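(* Let $X$ be a complex Banach space and let $\mathbf{T}=(T_1,\dots,T_n)$ be a commuting tuple of Ritt operators on $X$. Put $A_i=I_X-T_i$ for $1\le i\le n$ (these are sectorial operators). Then the following are equivalent. 1. There exist $\gamma_i\in(0,\frac{\pi}{2})$, $1\le i\le n$, such that for all $1\le k\le n$ and all $1\le i_1<\dots<i_k\le n$, the tuple $(T_{i_1},\dots,T_{i_k})$ admits a joint bounded $H^\infty(\mathcal{B}_{\gamma_{i_1}}\times\cdots\times\mathcal{B}_{\gamma_{i_k}})$ functional calculus. 2. There exist $\theta_i\in(0,\frac{\pi}{2})$, $1\le i\le n$, such that for all $1\le k\le n$ and all $1\le i_1<\dots<i_k\le n$, the tuple $(A_{i_1},\dots,A_{i_k})$ admits a joint bounded $H^\infty(\Sigma_{\theta_{i_1}}\times\cdots\times\Sigma_{\theta_{i_k}})$ functional calculus.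
   Context: Notation: $R(\lambda,T)=(\lambda I-T)^{-1}$ is the resolvent, $\sigma(T)$ the spectrum, $\|f\|_{\infty,K}=\sup_{K}|f|$, $D(a,r)$ the open disc of centre $a$ and radius $r$. Sectorial operators. For $\omega\in(0,\pi)$ let $\Sigma_\omega=\{z\in\mathbb{C}\setminus\{0\}:|\arg z|<\omega\}$, and let $\Gamma_\omega$ be its boundary, oriented counterclockwise. A densely defined closed operator $A$ on $X$ is sectorial of type $\omega\in(0,\pi)$ if $\sigma(A)\subseteq\overline{\Sigma_\omega}$ and for every $\nu\in(\omega,\pi)$ the set $\{zR(z,A):z\in\mathbb{C}\setminus\overline{\Sigma_\nu}\}$ is bounded. $H_0^\infty(\prod_{i=1}^m\Sigma_{\theta_i})$ is the set of bounded holomorphic $f$ on $\prod_{i=1}^m\Sigma_{\theta_i}$ for which there are constants $C,s>0$ (depending on $f$) with $|f(z_1,\dots,z_m)|\le C\prod_{i=1}^m\frac{|z_i|^s}{1+|z_i|^{2s}}$. For a tuple $\mathbf{A}=(A_1,\dots,A_m)$ with mutually commuting resolvents, $A_i$ sectorial of type $\omega_i$, $\omega_i<\nu_i<\theta_i<\pi$, and $f\in H_0^\infty(\prod_{i=1}^m\Sigma_{\theta_i})$, set $$f(\mathbf{A})=\Big(\frac{1}{2\pi i}\Big)^m\int_{\prod_{i}\Gamma_{\nu_i}}f(z_1,\dots,z_m)\prod_{i=1}^mR(z_i,A_i)\,dz_i ,$$ which converges absolutely and does not depend on the $\nu_i$. $\mathbf{A}$ admits a joint bounded $H^\infty(\prod_i\Sigma_{\theta_i})$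 functional calculus if there is $C>0$ with $\|f(\mathbf{A})\|\le C\|f\|_{\infty,\prod_i\Sigma_{\theta_i}}$ for all $f\in H_0^\infty(\prod_i\Sigma_{\theta_i})$. (This notion presupposes that each $A_i$ is sectorial of some type $\omega_i<\theta_i$.) Ritt operators. For $\gamma\in(0,\frac{\pi}{2})$ let $\mathcal{B}_\gamma$ (Stolz domain) be the interior of the convex hull of $1$ and $D(0,\sin\gamma)$, and $\Gamma_{\mathcal{B}_\gamma}$ its boundary, oriented counterclockwise. A bounded operator $T$ on $X$ is a Ritt operator of type $\alpha\in(0,\frac{\pi}{2})$ if $\sigma(T)\subseteq\overline{\mathcal{B}_\alpha}$ and for every $\beta\in(\alpha,\frac{\pi}{2})$ the set $\{(1-\lambda)R(\lambda,T):\lambda\in\mathbb{C}\setminus\overline{\mathcal{B}_\beta}\}$ is bounded; $T$ is a Ritt operator if it is so for some $\alpha$. $H_0^\infty(\prod_{i=1}^m\mathcal{B}_{\gamma_i})$ is the set of bounded holomorphic $\phi$ on $\prod_{i=1}^m\mathcal{B}_{\gamma_i}$ for which there are $c,s>0$ (depending on $\phi$) with $|\phi(\lambda_1,\dots,\lambda_m)|\le c\prod_{i=1}^m|1-\lambda_i|^s$. For a commuting tuple $\mathbf{T}=(T_1,\dots,T_m)$ with $T_i$ Ritt of type $\alpha_i$, $\alpha_i<\beta_i<\gamma_i<\frac{\pi}{2}$, and $\phi\in H_0^\infty(\prod_i\mathcal{B}_{\gamma_i})$, set $$\phi(\mathbf{T})=\Big(\frac{1}{2\pi i}\Big)^m\int_{\prod_{i}\Gamma_{\mathcal{B}_{\beta_i}}}\phi(\lambda_1,\dots,\lambda_m)\prod_{i=1}^mR(\lambda_i,T_i)\,d\lambda_i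 ,$$ which converges absolutely and does not depend on the $\beta_i$. $\mathbf{T}$ admits a joint bounded $H^\infty(\prod_i\mathcal{B}_{\gamma_i})$ functional calculus if there is $C>0$ with $\|\phi(\mathbf{T})\|\le C\|\phi\|_{\infty,\prod_i\mathcal{B}_{\gamma_i}}$ for all $\phi\in H_0^\infty(\prod_i\mathcal{B}_{\gamma_i})$. (This notion presupposes that each $T_i$ is Ritt of some type $\alpha_i<\gamma_i$.) *)

theory Defs
  imports "HOL-Complex_Analysis.Complex_Analysis"
begin

section \<open>Complex Banach spaces and their bounded operators\<close>

class complex_normed_vector = real_normed_vector +
  fixes scaleC :: "complex \<Rightarrow> 'a \<Rightarrow> 'a"  (infixr "*\<^sub>C" 75)
  assumes scaleC_add_right: "c *\<^sub>C (x + y) = c *\<^sub>C x + c *\<^sub>C y"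
    and scaleC_add_left: "(c + d) *\<^sub>C x = c *\<^sub>C x + d *\<^sub>C x"
    and scaleC_scaleC: "c *\<^sub>C d *\<^sub>C x = (c * d) *\<^sub>C x"
    and scaleC_of_real: "complex_of_real r *\<^sub>C x = r *\<^sub>R x"
    and norm_scaleC: "norm (c *\<^sub>C x) = cmod c * norm x"

class complex_banach = complex_normed_vector + banach

instantiation complex :: complex_banach
begin

definition scaleC_complex :: "complex \<Rightarrow> complex \<Rightarrow> complex" where
  "scaleC_complex c x = c * x"

instance
  by standard (auto simp: scaleC_complex_def algebra_simps norm_mult scaleR_conv_of_real)

end

lemma bounded_linear_scaleC: "bounded_linear (\<lambda>x::'a::complex_normed_vector. c *\<^sub>C x)"
proof (rule bounded_linear_intro[where K = "cmod c"])
  fix r :: real and x y :: 'a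
  show "c *\<^sub>C (x + y) = c *\<^sub>C x + c *\<^sub>C y" by (rule scaleC_add_right)
  show "c *\<^sub>C (r *\<^sub>R x) = r *\<^sub>R (c *\<^sub>C x)"
    by (metis mult.commute scaleC_of_real scaleC_scaleC)
  show "norm (c *\<^sub>C x) \<le> norm x * cmod c"
    by (simp add: norm_scaleC mult.commute)
qed

instantiation blinfun :: (real_normed_vector, complex_normed_vector) complex_normed_vector
begin

lift_definition scaleC_blinfun :: "complex \<Rightarrow> ('a \<Rightarrow>\<^sub>L 'b) \<Rightarrow> ('a \<Rightarrow>\<^sub>L 'b)"
  is "\<lambda>c T x. c *\<^sub>C T x"
  by (rule bounded_linear_compose[OF bounded_linear_scaleC])

instance
proof
  fix c d :: complex and r :: real and S T :: "'a \<Rightarrow>\<^sub>L 'b"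
  show "c *\<^sub>C (S + T) = c *\<^sub>C S + c *\<^sub>C T"
    by transfer (simp add: scaleC_add_right)
  show "(c + d) *\<^sub>C T = c *\<^sub>C T + d *\<^sub>C T"
    by transfer (simp add: scaleC_add_left)
  show assoc: "c *\<^sub>C d *\<^sub>C T = (c * d) *\<^sub>C T" for c d and T :: "'a \<Rightarrow>\<^sub>L 'b"
    by transfer (simp add: scaleC_scaleC)
  show real: "complex_of_real r *\<^sub>C T = r *\<^sub>R T" for r and T :: "'a \<Rightarrow>\<^sub>L 'b"
    by transfer (simp add: scaleC_of_real)
  have le: "norm (c *\<^sub>C T) \<le> cmod c * norm T" for c and T :: "'a \<Rightarrow>\<^sub>L 'b"
  proof (rule norm_blinfun_bound)
    show "norm (blinfun_apply (c *\<^sub>C T) x) \<le> cmod c * norm T * norm x" for x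
      by (simp add: scaleC_blinfun.rep_eq norm_scaleC mult.assoc mult_left_mono norm_blinfun)
  qed simp
  show "norm (c *\<^sub>C T) = cmod c * norm T"
  proof (cases "c = 0")
    case True
    then show ?thesis using le[of c T] by simp
  next
    case False
    have "norm T = norm (inverse c *\<^sub>C c *\<^sub>C T)"
      using False real[of 1 T] by (simp add: assoc)
    also have "\<dots> \<le> cmod (inverse c) * norm (c *\<^sub>C T)" by (rule le)
    finally have "cmod c * norm T \<le> norm (c *\<^sub>C T)"
      using False by (simp add: norm_divide inverse_eq_divide pos_le_divide_eq mult.commute)
    with le[of c T] show ?thesis by simp
  qed
qed

end

instance blinfun :: (real_normed_vector, complex_banach) complex_banach ..

text \<open>Elements of \<open>'a \<Rightarrow>\<^sub>L 'a\<close> are bounded and real-linear; this singles out the complex-linear ones.\<close>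

definition complex_linear :: "('a::complex_normed_vector \<Rightarrow>\<^sub>L 'a) \<Rightarrow> bool" where
  "complex_linear T \<longleftrightarrow> (\<forall>c x. blinfun_apply T (c *\<^sub>C x) = c *\<^sub>C blinfun_apply T x)"


section \<open>Closed operators, spectrum and resolvent\<close>

text \<open>A possibly unbounded operator is represented by its graph; its domain is \<^term>\<open>Domain A\<close>.\<close>

type_synonym 'a operator = "('a \<times> 'a) set"

definition graph_of :: "('a::complex_normed_vector \<Rightarrow>\<^sub>L 'a) \<Rightarrow> 'a operator" where
  "graph_of T = {(x, blinfun_apply T x) | x. True}"

definition linear_operator :: "'a::complex_normed_vector operator \<Rightarrow> bool" where
  "linear_operator A \<longleftrightarrow> single_valued A \<and> (0, 0) \<in> A \<and>
     (\<forall>x y x' y'. (x, y) \<in> A \<and> (x', y') \<in> A \<longrightarrow> (x + x', y + y') \<in> A) \<and>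
     (\<forall>c x y. (x, y) \<in> A \<longrightarrow> (c *\<^sub>C x, c *\<^sub>C y) \<in> A)"

definition closed_densely_defined :: "'a::complex_normed_vector operator \<Rightarrow> bool" where
  "closed_densely_defined A \<longleftrightarrow> linear_operator A \<and> closed A \<and> closure (Domain A) = UNIV"

text \<open>\<^term>\<open>B\<close> is the bounded inverse of \<open>z I - A\<close>: its graph is the converse of that of \<open>z I - A\<close>.\<close>

definition is_resolvent :: "complex \<Rightarrow> 'a::complex_normed_vector operator \<Rightarrow> ('a \<Rightarrow>\<^sub>L 'a) \<Rightarrow> bool" where
  "is_resolvent z A B \<longleftrightarrow> complex_linear B \<and> graph_of B = {(z *\<^sub>C x - y, x) | x y. (x, y) \<in> A}"

definition resolvent_set :: "'a::complex_normed_vector operator \<Rightarrow> complex set" where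
  "resolvent_set A = {z. \<exists>B. is_resolvent z A B}"

definition spectrum :: "'a::complex_normed_vector operator \<Rightarrow> complex set" where
  "spectrum A = - resolvent_set A"

definition resolvent :: "complex \<Rightarrow> 'a::complex_normed_vector operator \<Rightarrow> ('a \<Rightarrow>\<^sub>L 'a)" where
  "resolvent z A = (THE B. is_resolvent z A B)"

definition commuting_resolvents :: "'a::complex_normed_vector operator list \<Rightarrow> bool" where
  "commuting_resolvents As \<longleftrightarrow>
     (\<forall>A\<in>set As. \<forall>B\<in>set As. \<forall>z\<in>resolvent_set A. \<forall>w\<in>resolvent_set B.
        resolvent z A o\<^sub>L resolvent w B = resolvent w B o\<^sub>L resolvent z A)"


section \<open>Functions of several complex variables and iterated contour integrals\<close>

text \<open>Points of \<open>\<complex>\<^sup>m\<close> are lists of length \<open>m\<close>, and \<^term>\<open>listset [U\<^sub>1, U\<^sub>2]\<close> is a product of sets.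
  Holomorphy is complex (Frechet) differentiability at every point of \<^term>\<open>U\<close>.\<close>

definition multi_holomorphic_on :: "(complex list \<Rightarrow> complex) \<Rightarrow> complex list set \<Rightarrow> bool" where
  "multi_holomorphic_on f U \<longleftrightarrow>
     (\<forall>zs\<in>U. \<exists>c. \<forall>\<epsilon>>0. \<exists>\<delta>>0. \<forall>ws\<in>U. length ws = length zs \<longrightarrow>
        (\<forall>i<length zs. cmod (ws ! i - zs ! i) < \<delta>) \<longrightarrow>
        cmod (f ws - f zs - (\<Sum>i<length zs. c i * (ws ! i - zs ! i)))
          \<le> \<epsilon> * (\<Sum>i<length zs. cmod (ws ! i - zs ! i)))"

definition sup_norm :: "complex list set \<Rightarrow> (complex list \<Rightarrow> complex) \<Rightarrow> real" where
  "sup_norm U f = (SUP zs\<in>U. cmod (f zs))"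

text \<open>The analogue of \<^const>\<open>contour_integral\<close> for vector-valued integrands, over any parameter
  set \<^term>\<open>I\<close>.\<close>

definition path_integral ::
    "real set \<Rightarrow> (real \<Rightarrow> complex) \<Rightarrow> (complex \<Rightarrow> 'b::complex_normed_vector) \<Rightarrow> 'b" where
  "path_integral I g F = integral I (\<lambda>t. vector_derivative g (at t within I) *\<^sub>C F (g t))"

text \<open>The integral over a product of contours, as an iterated integral. The first argument lists the
  functionals of integration along the individual contours.\<close>

primrec iterated_integral ::
    "((complex \<Rightarrow> 'b) \<Rightarrow> 'b) list \<Rightarrow> (complex list \<Rightarrow> 'b) \<Rightarrow> 'b" where
  "iterated_integral [] F = F []"
| "iterated_integral (L # Ls) F = L (\<lambda>z. iterated_integral Ls (\<lambda>zs. F (z # zs)))"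

definition resolvent_product ::
    "complex list \<Rightarrow> 'a::complex_normed_vector operator list \<Rightarrow> ('a \<Rightarrow>\<^sub>L 'a)" where
  "resolvent_product zs As = foldr (o\<^sub>L) (map2 resolvent zs As) id_blinfun"


section \<open>Sectorial operators\<close>

definition sector :: "real \<Rightarrow> complex set" where
  "sector \<omega> = {z. z \<noteq> 0 \<and> \<bar>Arg z\<bar> < \<omega>}"

definition sectorial :: "real \<Rightarrow> 'a::complex_normed_vector operator \<Rightarrow> bool" where
  "sectorial \<omega> A \<longleftrightarrow> 0 < \<omega> \<and> \<omega> < pi \<and> closed_densely_defined A \<and>
     spectrum A \<subseteq> closure (sector \<omega>) \<and>
     (\<forall>\<nu>. \<omega> < \<nu> \<and> \<nu> < pi \<longrightarrow>
        bounded ((\<lambda>z. z *\<^sub>C resolvent z A) ` (- closure (sector \<nu>))))"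

text \<open>The boundary of the sector, with the sector on its left: inwards along the upper ray for
  \<^prop>\<open>t < 0\<close>, then outwards along the lower ray.\<close>

definition sector_boundary :: "real \<Rightarrow> real \<Rightarrow> complex" where
  "sector_boundary \<nu> t = (if t < 0 then of_real (- t) * cis \<nu> else of_real t * cis (- \<nu>))"

definition H0_sector :: "real list \<Rightarrow> (complex list \<Rightarrow> complex) set" where
  "H0_sector \<theta>s = {f. multi_holomorphic_on f (listset (map sector \<theta>s)) \<and>
     bounded (f ` listset (map sector \<theta>s)) \<and>
     (\<exists>C>0. \<exists>s>0. \<forall>zs\<in>listset (map sector \<theta>s).
        cmod (f zs) \<le> C * (\<Prod>z\<leftarrow>zs. cmod z powr s / (1 + cmod z powr (2 * s))))}"

definition sectorial_calculus ::
    "real list \<Rightarrow> 'a::complex_banach operator list \<Rightarrow> (complex list \<Rightarrow> complex) \<Rightarrow> ('a \<Rightarrow>\<^sub>L 'a)" where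
  "sectorial_calculus \<nu>s As f =
     (1 / (2 * of_real pi * \<i>)) ^ length As *\<^sub>C
       iterated_integral (map (\<lambda>\<nu>. path_integral UNIV (sector_boundary \<nu>)) \<nu>s)
         (\<lambda>zs. f zs *\<^sub>C resolvent_product zs As)"

text \<open>As \<open>f(A)\<close> does not depend on the angles \<open>\<nu>\<^sub>i\<close>, the bound is required for all admissible
  ones.\<close>

definition sectorial_joint_bounded_calculus ::
    "real list \<Rightarrow> 'a::complex_banach operator list \<Rightarrow> bool" where
  "sectorial_joint_bounded_calculus \<theta>s As \<longleftrightarrow>
     commuting_resolvents As \<and>
     list_all2 (\<lambda>\<theta> A. \<theta> < pi \<and> (\<exists>\<omega><\<theta>. sectorial \<omega> A)) \<theta>s As \<and>
     (\<exists>C>0. \<forall>f\<in>H0_sector \<theta>s. \<forall>\<nu>s.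
        list_all2 (<) \<nu>s \<theta>s \<and> list_all2 (\<lambda>\<nu> A. \<exists>\<omega><\<nu>. sectorial \<omega> A) \<nu>s As \<longrightarrow>
        norm (sectorial_calculus \<nu>s As f) \<le> C * sup_norm (listset (map sector \<theta>s)) f)"


section \<open>Ritt operators\<close>

definition stolz :: "real \<Rightarrow> complex set" where
  "stolz \<gamma> = interior (convex hull (insert 1 (ball 0 (sin \<gamma>))))"

definition ritt_type :: "real \<Rightarrow> ('a::complex_normed_vector \<Rightarrow>\<^sub>L 'a) \<Rightarrow> bool" where
  "ritt_type \<alpha> T \<longleftrightarrow> 0 < \<alpha> \<and> \<alpha> < pi / 2 \<and> complex_linear T \<and>
     spectrum (graph_of T) \<subseteq> closure (stolz \<alpha>) \<and>
     (\<forall>\<beta>. \<alpha> < \<beta> \<and> \<beta> < pi / 2 \<longrightarrow>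
        bounded ((\<lambda>z. (1 - z) *\<^sub>C resolvent z (graph_of T)) ` (- closure (stolz \<beta>))))"

definition ritt :: "('a::complex_normed_vector \<Rightarrow>\<^sub>L 'a) \<Rightarrow> bool" where
  "ritt T \<longleftrightarrow> (\<exists>\<alpha>. ritt_type \<alpha> T)"

text \<open>The tangents from \<open>1\<close> to the circle of radius \<open>sin \<beta>\<close> around \<open>0\<close> touch it at arguments
  \<open>\<plusminus>(\<pi>/2 - \<beta>)\<close>. The boundary runs from \<open>1\<close> along the upper tangent, around the circle
  through \<open>- sin \<beta>\<close>, and back to \<open>1\<close> along the lower tangent.\<close>

definition stolz_boundary :: "real \<Rightarrow> real \<Rightarrow> complex" where
  "stolz_boundary \<beta> =
     linepath 1 (of_real (sin \<beta>) * cis (pi / 2 - \<beta>)) +++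
     part_circlepath 0 (sin \<beta>) (pi / 2 - \<beta>) (3 * pi / 2 + \<beta>) +++
     linepath (of_real (sin \<beta>) * cis (- (pi / 2 - \<beta>))) 1"

definition H0_stolz :: "real list \<Rightarrow> (complex list \<Rightarrow> complex) set" where
  "H0_stolz \<gamma>s = {\<phi>. multi_holomorphic_on \<phi> (listset (map stolz \<gamma>s)) \<and>
     bounded (\<phi> ` listset (map stolz \<gamma>s)) \<and>
     (\<exists>c>0. \<exists>s>0. \<forall>zs\<in>listset (map stolz \<gamma>s).
        cmod (\<phi> zs) \<le> c * (\<Prod>z\<leftarrow>zs. cmod (1 - z) powr s))}"

definition ritt_calculus ::
    "real list \<Rightarrow> ('a::complex_banach \<Rightarrow>\<^sub>L 'a) list \<Rightarrow> (complex list \<Rightarrow> complex) \<Rightarrow> ('a \<Rightarrow>\<^sub>L 'a)" where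
  "ritt_calculus \<beta>s Ts \<phi> =
     (1 / (2 * of_real pi * \<i>)) ^ length Ts *\<^sub>C
       iterated_integral (map (\<lambda>\<beta>. path_integral {0..1} (stolz_boundary \<beta>)) \<beta>s)
         (\<lambda>zs. \<phi> zs *\<^sub>C resolvent_product zs (map graph_of Ts))"

definition commuting :: "('a::complex_normed_vector \<Rightarrow>\<^sub>L 'a) list \<Rightarrow> bool" where
  "commuting Ts \<longleftrightarrow> (\<forall>S\<in>set Ts. \<forall>T\<in>set Ts. S o\<^sub>L T = T o\<^sub>L S)"

definition ritt_joint_bounded_calculus ::
    "real list \<Rightarrow> ('a::complex_banach \<Rightarrow>\<^sub>L 'a) list \<Rightarrow> bool" where
  "ritt_joint_bounded_calculus \<gamma>s Ts \<longleftrightarrow>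
     commuting Ts \<and>
     list_all2 (\<lambda>\<gamma> T. \<gamma> < pi / 2 \<and> (\<exists>\<alpha><\<gamma>. ritt_type \<alpha> T)) \<gamma>s Ts \<and>
     (\<exists>C>0. \<forall>\<phi>\<in>H0_stolz \<gamma>s. \<forall>\<beta>s.
        list_all2 (<) \<beta>s \<gamma>s \<and> list_all2 (\<lambda>\<beta> T. \<exists>\<alpha><\<beta>. ritt_type \<alpha> T) \<beta>s Ts \<longrightarrow>
        norm (ritt_calculus \<beta>s Ts \<phi>) \<le> C * sup_norm (listset (map stolz \<gamma>s)) \<phi>)"

end

theory Submission imports Defs begin

text \<open>Put \<open>z = 1 - w\<close>; then \<open>A\<^sub>i = I - T\<^sub>i\<close>, and the Stolz domain becomes the bounded convex domain
	\<open>S\<close> swept out by the discs with centre \<open>v \<le> 1\<close> and radius \<open>v sin ga\<close>, contained in the sector of the same angle.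

	For \<open>f\<close> in the class of the sector, the contour integral of \<open>f R(z, A\<^sub>i)\<close> along the boundary of the sector equals
	that along the boundary of a Stolz domain, because \<open>A\<^sub>i\<close> is bounded with spectrum in \<open>S\<close>. Replacing the contours one
	variable at a time and restricting \<open>f\<close> to \<open>S\<close> gives (1) implies (2) with the same angles.

	Conversely let \<open>f\<close> be given on \<open>S\<close>. With \<open>ker u z = 1 / (u - z) - 1 / (u (1 + z))\<close>, which vanishes at \<open>0\<close> and at
	infinity, and \<open>Q(u)\<close> its value at \<open>A\<^sub>i\<close>, the integral of \<open>f R\<close> is that of \<open>f Q\<close> over a slightly larger Stolz
	boundary, which consists of two segments issuing from \<open>0\<close> and an arc away from \<open>0\<close>. On the segments, integrating
	\<open>f(u) ker u z\<close> yields a function of \<open>z\<close> in the class of the sector whose supremum is controlled by that of \<open>f\<close>, so this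
	part is a sectorial calculus in the variable; on the arc \<open>Q\<close> is bounded, and the variable disappears. Induction on
	the number of Stolz variables then bounds the calculus by the sectorial calculi of all subtuples.\<close>

section \<open>Scalars and composition of bounded operators\<close>

text \<open>The vertex 0 may belong to the spectrum of \<open>A\<close>, so no contour has room to
  spare: the resolvent is only O(1 / |z|) there, and integrals converge through the decay of f.
  Cauchy's theorem for the resolvent is therefore reached by moving the spectrum off the vertex,
  through (1 - q) rh + q A with q tending to 1. A single operator identity is extracted, that the
  integral of z R(z, A) is 2 pi i A; the rest follows from the resolvent identity. The term 1 / (u
  (1 + z)) of the kernel cancels the value 1 / u of the Cauchy kernel at z = 0, while its integral
  against f over the closed contour vanishes. So f is still reproduced, and the part over the
  segments falls into the class of the sector. The delicate point is the supremum bound for that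
  part, because the kernel behaves like 1 / u at the vertex and is not integrable there. For small z
  the integral is f(z) minus an integral over the arc; for the other z the singular term f(u) / u
  over the segments is minus its integral over the arc. Both are controlled by sup |f|.\<close>

lemma scaleC_one [simp]: "1 *\<^sub>C (x::'a::complex_normed_vector) = x" using scaleC_of_real[of 1 x] by simp

lemma scaleC_zero_left [simp]: "0 *\<^sub>C (x::'a::complex_normed_vector) = 0" using scaleC_of_real[of 0 x] by simp

lemma scaleC_zero_right [simp]: "c *\<^sub>C (0::'a::complex_normed_vector) = 0"
	using norm_scaleC[of c "0::'a"] by simp

lemma scaleC_minus_left: "(- c) *\<^sub>C (x::'a::complex_normed_vector) = - (c *\<^sub>C x)"
	using scaleC_add_left[of "-c" c x] by (simp add: eq_neg_iff_add_eq_0)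

lemma scaleC_minus_right: "c *\<^sub>C (- x::'a::complex_normed_vector) = - (c *\<^sub>C x)"
	using scaleC_add_right[of c "-x" x] by (simp add: eq_neg_iff_add_eq_0)

lemma scaleC_diff_left: "(c - d) *\<^sub>C (x::'a::complex_normed_vector) = c *\<^sub>C x - d *\<^sub>C x"
	using scaleC_add_left[of c "-d" x] by (simp add: scaleC_minus_left)

lemma scaleC_diff_right: "c *\<^sub>C (x - y::'a::complex_normed_vector) = c *\<^sub>C x - c *\<^sub>C y"
	using scaleC_add_right[of c x "-y"] by (simp add: scaleC_minus_right)

lemma bounded_bilinear_scaleC:
	"bounded_bilinear (scaleC :: complex => 'a::complex_normed_vector => 'a)"
proof
	show "(r *\<^sub>R c) *\<^sub>C x = r *\<^sub>R (c *\<^sub>C x)" for r c and x :: 'a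
		by (metis scaleC_of_real scaleC_scaleC scaleR_conv_of_real)
	show "c *\<^sub>C (r *\<^sub>R x) = r *\<^sub>R (c *\<^sub>C x)" for r c and x :: 'a
		by (metis mult.commute scaleC_of_real scaleC_scaleC)
	show "\<exists>K. \<forall>c (x::'a). norm (c *\<^sub>C x) \<le> norm c * norm x * K" by (rule exI[of _ 1]) (simp add: norm_scaleC)
qed (auto simp: scaleC_add_left scaleC_add_right)

lemmas tendsto_scaleC [tendsto_intros] =
	bounded_bilinear.tendsto[OF bounded_bilinear_scaleC]

lemmas continuous_on_scaleC [continuous_intros] =
	bounded_bilinear.continuous_on[OF bounded_bilinear_scaleC]

lemma scaleC_eq_mult [simp]: "(c::complex) *\<^sub>C (x::complex) = c * x" by (simp add: scaleC_complex_def)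

lemma complex_linear_id [simp]: "complex_linear id_blinfun" by (simp add: complex_linear_def)

lemma complex_linear_add: "complex_linear S ==> complex_linear T ==> complex_linear (S + T)"
	by (simp add: complex_linear_def blinfun.add_left scaleC_add_right)

lemma complex_linear_diff: "complex_linear S ==> complex_linear T ==> complex_linear (S - T)"
	by (simp add: complex_linear_def blinfun.diff_left scaleC_diff_right)

lemma complex_linear_minus: "complex_linear S ==> complex_linear (- S)"
	by (simp add: complex_linear_def blinfun.minus_left scaleC_minus_right)

lemma complex_linear_scaleC: "complex_linear S ==> complex_linear (c *\<^sub>C S)"
	by (simp add: complex_linear_def scaleC_blinfun.rep_eq scaleC_scaleC mult.commute)

lemma complex_linear_compose:
	"complex_linear S ==> complex_linear T ==> complex_linear (S o\<^sub>L T)" by (simp add: complex_linear_def)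

lemma scaleC_blinfun_apply [simp]: "blinfun_apply (c *\<^sub>C T) x = c *\<^sub>C blinfun_apply T x"
	by (simp add: scaleC_blinfun.rep_eq)

lemma compose_scaleC_left: "(c *\<^sub>C S) o\<^sub>L T = c *\<^sub>C (S o\<^sub>L T)" by (rule blinfun_eqI) simp

lemma compose_scaleC_right: "complex_linear S ==> S o\<^sub>L (c *\<^sub>C T) = c *\<^sub>C (S o\<^sub>L T)"
	by (rule blinfun_eqI) (simp add: complex_linear_def)

lemma compose_add_left: "(S + S') o\<^sub>L T = (S o\<^sub>L T) + (S' o\<^sub>L T)"
	by (rule blinfun_eqI) (simp add: blinfun.add_left)

lemma compose_add_right: "S o\<^sub>L (T + T') = (S o\<^sub>L T) + (S o\<^sub>L T')"
	by (rule blinfun_eqI) (simp add: blinfun.add_left blinfun.add_right)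

lemma compose_diff_left: "(S - S') o\<^sub>L T = (S o\<^sub>L T) - (S' o\<^sub>L T)"
	by (rule blinfun_eqI) (simp add: blinfun.diff_left)

lemma compose_diff_right: "S o\<^sub>L (T - T') = (S o\<^sub>L T) - (S o\<^sub>L T')"
	by (rule blinfun_eqI) (simp add: blinfun.diff_left blinfun.diff_right)

lemma compose_minus_left: "(- S) o\<^sub>L T = - (S o\<^sub>L T)" by (rule blinfun_eqI) (simp add: blinfun.minus_left)

lemma compose_minus_right: "S o\<^sub>L (- T) = - (S o\<^sub>L T)"
	by (rule blinfun_eqI) (simp add: blinfun.minus_left blinfun.minus_right)

lemma compose_id_left [simp]: "id_blinfun o\<^sub>L T = T" by (rule blinfun_eqI) simp

lemma compose_id_right [simp]: "T o\<^sub>L id_blinfun = T" by (rule blinfun_eqI) simp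

lemma compose_assoc: "(S o\<^sub>L T) o\<^sub>L U = S o\<^sub>L (T o\<^sub>L U)" by (rule blinfun_eqI) simp

lemma norm_id_blinfun_le: "norm (id_blinfun :: 'a::real_normed_vector \<Rightarrow>\<^sub>L 'a) \<le> 1"
	by (rule norm_blinfun_bound) auto

lemmas compose_blinfun_simps = compose_add_left compose_add_right compose_diff_left
	compose_diff_right compose_minus_left compose_minus_right compose_scaleC_left compose_assoc

lemma compose_bound: "norm S \<le> a ==> norm T \<le> b ==> norm (S o\<^sub>L T) \<le> a * b"
	by (rule order_trans[OF norm_blinfun_compose], intro mult_mono) (auto intro: order_trans[OF norm_ge_zero])

subsection \<open>Resolvents of bounded operators\<close>

text \<open>For an everywhere defined operator the equality of graphs splits into the two statements
  that \<open>B\<close> is a left and a right inverse of z I - S. In this algebraic form the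
  resolvent enters all later computations.\<close>

lemma is_resolvent_graph_of:
	"is_resolvent z (graph_of S) B \<longleftrightarrow> complex_linear B \<and>
		 B o\<^sub>L (z *\<^sub>C id_blinfun - S) = id_blinfun \<and> (z *\<^sub>C id_blinfun - S) o\<^sub>L B = id_blinfun"
		(is "?l \<longleftrightarrow> _ \<and> ?r1 \<and> ?r2")
proof -
	have *: "{(z *\<^sub>C x - y, x) | x y. (x, y) \<in> graph_of S} = {(z *\<^sub>C x - blinfun_apply S x, x) | x. True}"
		by (auto simp: graph_of_def)
	have "(graph_of B = {(z *\<^sub>C x - blinfun_apply S x, x) | x. True}) \<longleftrightarrow> ?r1 \<and> ?r2"
	proof
		assume eq: "graph_of B = {(z *\<^sub>C x - blinfun_apply S x, x) | x. True}"
		have "(z *\<^sub>C x - blinfun_apply S x, x) \<in> graph_of B" for x unfolding eq by blast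
		then have 1: "blinfun_apply B (z *\<^sub>C x - blinfun_apply S x) = x" for x by (auto simp: graph_of_def)
		have "(x, blinfun_apply B x) \<in> graph_of B" for x by (auto simp: graph_of_def)
		then have 2: "z *\<^sub>C (blinfun_apply B x) - blinfun_apply S (blinfun_apply B x) = x" for x
			unfolding eq by auto
		show "?r1 \<and> ?r2" using 1 2 by (auto intro!: blinfun_eqI simp: blinfun.diff_left)
	next
		assume r: "?r1 \<and> ?r2"
		have 1: "blinfun_apply B (z *\<^sub>C x - blinfun_apply S x) = x" for x
			using arg_cong[OF conjunct1[OF r], of "%T. blinfun_apply T x"] by (simp add: blinfun.diff_left)
		have 2: "z *\<^sub>C (blinfun_apply B x) - blinfun_apply S (blinfun_apply B x) = x" for x
			using arg_cong[OF conjunct2[OF r], of "%T. blinfun_apply T x"] by (simp add: blinfun.diff_left)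
		show "graph_of B = {(z *\<^sub>C x - blinfun_apply S x, x) | x. True}" using 1 2 by (force simp: graph_of_def)
	qed
	then show ?thesis unfolding is_resolvent_def * by blast
qed

lemma is_resolvent_unique:
	assumes "is_resolvent z (graph_of S) B" "is_resolvent z (graph_of S) B'"
	shows "B = B'"
	using assms unfolding is_resolvent_graph_of by (metis compose_assoc compose_id_left compose_id_right)

lemma resolvent_eqI: "is_resolvent z (graph_of S) B ==> resolvent z (graph_of S) = B"
	unfolding resolvent_def using is_resolvent_unique by blast

lemma is_resolvent_resolvent:
	"z \<in> resolvent_set (graph_of S) ==> is_resolvent z (graph_of S) (resolvent z (graph_of S))"
	using resolvent_eqI unfolding resolvent_set_def by fastforce

text \<open>Passing from (z, S) to (1 - z, I - S) changes only the sign of z I - S, hence that of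
  its inverse. This is the bridge between T and I - T.\<close>

lemma is_resolvent_reflect:
	"is_resolvent z (graph_of S) B \<longleftrightarrow> is_resolvent (1 - z) (graph_of (id_blinfun - S)) (- B)"
proof -
	let ?D = "z *\<^sub>C id_blinfun - S"
	have "(1 - z) *\<^sub>C id_blinfun - (id_blinfun - S) = - ?D" by (simp add: scaleC_diff_left)
	moreover have "(- B) o\<^sub>L (- ?D) = B o\<^sub>L ?D" "(- ?D) o\<^sub>L (- B) = ?D o\<^sub>L B"
		by (simp_all only: compose_minus_left compose_minus_right minus_minus)
	moreover have "complex_linear (- B) \<longleftrightarrow> complex_linear B"
		using complex_linear_minus[of B] complex_linear_minus[of "-B"] by auto
	ultimately show ?thesis unfolding is_resolvent_graph_of by metis
qed

lemma resolvent_set_reflect: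
	"z \<in> resolvent_set (graph_of S) \<longleftrightarrow> 1 - z \<in> resolvent_set (graph_of (id_blinfun - S))"
	unfolding resolvent_set_def mem_Collect_eq by (metis is_resolvent_reflect minus_minus)

lemma resolvent_reflect:
	assumes "1 - z \<in> resolvent_set (graph_of S)"
	shows "resolvent z (graph_of (id_blinfun - S)) = - resolvent (1 - z) (graph_of S)"
	using is_resolvent_resolvent[OF assms] by (intro resolvent_eqI) (simp add: is_resolvent_reflect[of "1 - z"])

lemma complex_linear_resolvent:
	"z \<in> resolvent_set (graph_of S) ==> complex_linear (resolvent z (graph_of S))"
	using is_resolvent_resolvent is_resolvent_graph_of by blast

lemma resolvent_compose:
	assumes "z \<in> resolvent_set (graph_of S)"
	shows "resolvent z (graph_of S) o\<^sub>L S = z *\<^sub>C resolvent z (graph_of S) - id_blinfun"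
	using is_resolvent_resolvent[OF assms] complex_linear_resolvent[OF assms]
	by (simp add: is_resolvent_graph_of compose_diff_right compose_scaleC_right algebra_simps)

lemma compose_resolvent:
	assumes "z \<in> resolvent_set (graph_of S)"
	shows "S o\<^sub>L resolvent z (graph_of S) = z *\<^sub>C resolvent z (graph_of S) - id_blinfun"
	using is_resolvent_resolvent[OF assms]
	by (simp add: is_resolvent_graph_of compose_diff_left compose_scaleC_left algebra_simps)

text \<open>The product R(z) S R(w) is evaluated twice, absorbing \<open>S\<close> into the right
  factor and into the left one.\<close>

lemma resolvent_identity:
	assumes z: "z \<in> resolvent_set (graph_of S)" and w: "w \<in> resolvent_set (graph_of S)"
	shows "resolvent z (graph_of S) - resolvent w (graph_of S)
			 = (w - z) *\<^sub>C (resolvent z (graph_of S) o\<^sub>L resolvent w (graph_of S))"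
proof -
	let ?R = "%z. resolvent z (graph_of S)"
	have "?R z o\<^sub>L (S o\<^sub>L ?R w) = w *\<^sub>C (?R z o\<^sub>L ?R w) - ?R z"
		by (simp add: compose_resolvent[OF w] compose_diff_right
				compose_scaleC_right[OF complex_linear_resolvent[OF z]])
	moreover have "(?R z o\<^sub>L S) o\<^sub>L ?R w = z *\<^sub>C (?R z o\<^sub>L ?R w) - ?R w"
		by (simp add: resolvent_compose[OF z] compose_diff_left compose_scaleC_left)
	ultimately have "w *\<^sub>C (?R z o\<^sub>L ?R w) - ?R z = z *\<^sub>C (?R z o\<^sub>L ?R w) - ?R w" by (simp add: compose_assoc)
	then show ?thesis by (simp add: scaleC_diff_left algebra_simps)
qed

lemma resolvent_commutes:
	assumes z: "z \<in> resolvent_set (graph_of S)" and SV: "S o\<^sub>L V = V o\<^sub>L S" and V: "complex_linear V"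
	shows "resolvent z (graph_of S) o\<^sub>L V = V o\<^sub>L resolvent z (graph_of S)"
proof -
	let ?R = "resolvent z (graph_of S)" and ?D = "z *\<^sub>C id_blinfun - S"
	have r: "?R o\<^sub>L ?D = id_blinfun" "?D o\<^sub>L ?R = id_blinfun"
		using is_resolvent_resolvent[OF z] by (simp_all add: is_resolvent_graph_of)
	have "V o\<^sub>L ?D = ?D o\<^sub>L V" by (simp add: compose_diff_left compose_diff_right compose_scaleC_left
				compose_scaleC_right[OF V] SV)
	then have "(?R o\<^sub>L V) o\<^sub>L (?D o\<^sub>L ?R) = (?R o\<^sub>L ?D) o\<^sub>L (V o\<^sub>L ?R)" by (metis compose_assoc)
	then show ?thesis by (simp only: r compose_id_left compose_id_right)
qed

lemma resolvents_commute:
	assumes "z \<in> resolvent_set (graph_of S)" "w \<in> resolvent_set (graph_of S')"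
		and "S o\<^sub>L S' = S' o\<^sub>L S" and "complex_linear S"
	shows "resolvent z (graph_of S) o\<^sub>L resolvent w (graph_of S')
			 = resolvent w (graph_of S') o\<^sub>L resolvent z (graph_of S)"
	using resolvent_commutes[OF assms(2), of S] assms complex_linear_resolvent[OF assms(2)]
	by (intro resolvent_commutes) auto

text \<open>By the resolvent identity the norm of R(z) - R(w) is |w - z| times that of a product
  which stays bounded as z tends to w. The bound M / |z| is of the sectorial kind, which is why 0 is
  kept out of \<open>V\<close>.\<close>

lemma continuous_on_resolvent:
	assumes "\<And>z. z \<in> V ==> z \<in> resolvent_set (graph_of S)" "0 \<notin> V"
		and "\<And>z. z \<in> V ==> norm (resolvent z (graph_of S)) \<le> M / cmod z"
	shows "continuous_on V (%z. resolvent z (graph_of S))" unfolding continuous_on_def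
proof
	let ?R = "%z. resolvent z (graph_of S)"
	fix w assume w: "w \<in> V"
	have "((%z. cmod (w - z) * (M / cmod z * (M / cmod w))) \<longlongrightarrow> cmod (w - w) * (M / cmod w * (M / cmod w))) (at w within V)"
		using w assms(2) by (intro tendsto_intros) auto
	then have lim: "((%z. cmod (w - z) * (M / cmod z * (M / cmod w))) \<longlongrightarrow> 0) (at w within V)" by simp
	have "\<forall>\<^sub>F z in at w within V. norm (?R z - ?R w) \<le> cmod (w - z) * (M / cmod z * (M / cmod w))"
		unfolding eventually_at_filter
	proof (rule eventually_mono[OF eventually_True], intro impI)
		fix z assume "z \<in> V"
		have "norm (?R z - ?R w) = cmod (w - z) * norm (?R z o\<^sub>L ?R w)"
			using resolvent_identity[OF assms(1)[OF \<open>z \<in> V\<close>] assms(1)[OF w]] by (simp add: norm_scaleC)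
		also have "... \<le> cmod (w - z) * (M / cmod z * (M / cmod w))"
			using assms(3) \<open>z \<in> V\<close> w by (intro mult_left_mono compose_bound) auto
		finally show "norm (?R z - ?R w) \<le> ..." .
	qed
	then show "(?R \<longlongrightarrow> ?R w) (at w within V)" by (rule LIM_zero_cancel[OF Lim_null_comparison[OF _ lim]])
qed

section \<open>Dominated integrals of continuous Banach-valued functions\<close>

lemma norm_diff_triangle3:
	fixes a b c d :: "'b::real_normed_vector"
	shows "norm (a - b) \<le> norm (a - c) + norm (c - d) + norm (b - d)"
	using dist_triangle[of a b c] dist_triangle[of c b d] by (simp add: dist_norm norm_minus_commute)

abbreviation (input) hk_content :: "real set => real" where
	"hk_content \<equiv> Henstock_Kurzweil_Integration.content"

text \<open>Riemann sums of \<open>v\<close> and \<open>w\<close> over the same fine division differ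
  by at most the Riemann sum of \<open>g\<close>, so the Cauchy criterion passes from
  \<open>w\<close> to \<open>v\<close>.\<close>

lemma integrable_on_cbox_approx:
	fixes v :: "real => 'b::banach"
	assumes approx: "\<And>e. e > 0 ==> \<exists>w g. w integrable_on cbox a b \<and> g integrable_on cbox a b \<and>
		 integral (cbox a b) g < e \<and> (\<forall>x\<in>cbox a b. norm (v x - w x) \<le> g x)"
	shows "v integrable_on cbox a b" unfolding integrable_Cauchy
proof (intro allI impI)
	fix e :: real assume "e > 0"
	\<comment> \<open>A fine Riemann sum of \<open>g\<close> stays below 2d, since its integral is
	  below d and the gauge error is below d. Two such errors and the error d for \<open>w\<close> add
	  up to 5d.\<close>
	define d where "d = e / 5"
	have "d > 0" using \<open>e > 0\<close> by (simp add: d_def)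
	obtain w g where wg: "w integrable_on cbox a b \<and> g integrable_on cbox a b \<and>
		 integral (cbox a b) g < d \<and> (\<forall>x\<in>cbox a b. norm (v x - w x) \<le> g x)" using approx[OF \<open>d > 0\<close>] by (elim exE)
	then have w: "w integrable_on cbox a b" and g: "g integrable_on cbox a b"
		and gd: "integral (cbox a b) g < d" and vw: "\<And>x. x \<in> cbox a b ==> norm (v x - w x) \<le> g x" by auto
	obtain ga1 where "gauge ga1 \<and> (\<forall>D. D tagged_division_of cbox a b \<and> ga1 fine D -->
			norm ((\<Sum>(x,K)\<in>D. hk_content K *\<^sub>R g x) - integral (cbox a b) g) < d)"
		using integrable_integral[OF g, unfolded has_integral, THEN spec, THEN mp, OF \<open>d > 0\<close>] by (elim exE)
	then have ga1: "gauge ga1" "\<And>D. D tagged_division_of cbox a b \<and> ga1 fine D ==>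
			norm ((\<Sum>(x,K)\<in>D. hk_content K *\<^sub>R g x) - integral (cbox a b) g) < d" by auto
	obtain ga2 where "gauge ga2 \<and> (\<forall>D1 D2. D1 tagged_division_of cbox a b \<and> ga2 fine D1 \<and>
			D2 tagged_division_of cbox a b \<and> ga2 fine D2 -->
			norm ((\<Sum>(x,K)\<in>D1. hk_content K *\<^sub>R w x) - (\<Sum>(x,K)\<in>D2. hk_content K *\<^sub>R w x)) < d)"
		using w[unfolded integrable_Cauchy, THEN spec, THEN mp, OF \<open>d > 0\<close>] by (elim exE)
	then have ga2: "gauge ga2" "\<And>D1 D2. D1 tagged_division_of cbox a b \<and> ga2 fine D1 \<and>
			D2 tagged_division_of cbox a b \<and> ga2 fine D2 ==>
			norm ((\<Sum>(x,K)\<in>D1. hk_content K *\<^sub>R w x) - (\<Sum>(x,K)\<in>D2. hk_content K *\<^sub>R w x)) < d" by auto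
	have close: "norm ((\<Sum>(x,K)\<in>D. hk_content K *\<^sub>R v x) - (\<Sum>(x,K)\<in>D. hk_content K *\<^sub>R w x)) \<le> 2 * d"
		if D: "D tagged_division_of cbox a b" "ga1 fine D" for D
	proof -
		have "(\<Sum>(x,K)\<in>D. hk_content K *\<^sub>R v x) - (\<Sum>(x,K)\<in>D. hk_content K *\<^sub>R w x)
				= (\<Sum>(x,K)\<in>D. hk_content K *\<^sub>R (v x - w x))"
			by (simp add: sum_subtractf[symmetric] case_prod_unfold scaleR_diff_right)
		also have "norm ... \<le> (\<Sum>(x,K)\<in>D. hk_content K *\<^sub>R g x)"
		proof (rule sum_norm_le, clarify)
			fix x K assume "(x, K) \<in> D"
			then have "x \<in> cbox a b" using D(1) by (meson tag_in_interval)
			then show "norm (hk_content K *\<^sub>R (v x - w x)) \<le> hk_content K *\<^sub>R g x"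
				using vw by (simp add: mult_left_mono)
		qed
		also have "... \<le> 2 * d" using ga1(2)[of D] D gd by (simp add: abs_if split: if_splits)
		finally show ?thesis .
	qed
	show "\<exists>ga. gauge ga \<and> (\<forall>D1 D2. D1 tagged_division_of cbox a b \<and> ga fine D1 \<and>
					D2 tagged_division_of cbox a b \<and> ga fine D2 -->
					norm ((\<Sum>(x,K)\<in>D1. hk_content K *\<^sub>R v x) - (\<Sum>(x,K)\<in>D2. hk_content K *\<^sub>R v x)) < e)"
	proof (intro exI[of _ "%x. ga1 x \<inter> ga2 x"] conjI allI impI)
		show "gauge (%x. ga1 x \<inter> ga2 x)" using ga1(1) ga2(1) by (rule gauge_Int)
		fix D1 D2
		assume D: "D1 tagged_division_of cbox a b \<and> (%x. ga1 x \<inter> ga2 x) fine D1 \<and>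
					D2 tagged_division_of cbox a b \<and> (%x. ga1 x \<inter> ga2 x) fine D2"
		let ?S = "%f D. (\<Sum>(x,K)\<in>D. hk_content K *\<^sub>R f x)"
		have 1: "norm (?S v D1 - ?S w D1) \<le> 2 * d" and 2: "norm (?S v D2 - ?S w D2) \<le> 2 * d"
			and 3: "norm (?S w D1 - ?S w D2) < d" using close D ga2(2) by (auto simp: fine_Int)
		show "norm (?S v D1 - ?S v D2) < e"
			using norm_diff_triangle3[of "?S v D1" "?S v D2" "?S w D1" "?S w D2"] 1 2 3 unfolding d_def by linarith
	qed
qed

text \<open>A continuous plateau: it is 1 where the distance to the complement of
  \<open>I \<inter> ball 0 n\<close> is at least 2/n, and 0 where it is at most 1/n. The shift by 1
  makes it vanish on an open set which together with \<open>I\<close> covers the line, so that a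
  product with the cutoff extends continuously by 0.\<close>

definition cutoff :: "real set => nat => real => real" where
	"cutoff I n t = max 0 (min 1 (real n * infdist t (- (I \<inter> ball 0 (real n))) - 1))"

lemma cutoff_bounds: "0 \<le> cutoff I n t" "cutoff I n t \<le> 1" by (simp_all add: cutoff_def)

lemma compl_Int_ball_nonempty: "- (I \<inter> ball 0 r) ~= {}" for I :: "real set"
proof -
	have "\<bar>r\<bar> \<notin> ball 0 r" by (simp add: dist_real_def)
	then show ?thesis by blast
qed

lemma continuous_on_cutoff: "continuous_on S (cutoff I n)" unfolding cutoff_def by (intro continuous_intros)

lemma cutoff_outside:
	assumes "t \<notin> I \<or> real n \<le> \<bar>t\<bar>"
	shows "cutoff I n t = 0"
proof -
	have "infdist t (- (I \<inter> ball 0 (real n))) = 0" by (rule infdist_zero) (use assms in auto)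
	then show ?thesis unfolding cutoff_def by simp
qed

definition cutoff_zone :: "real set => nat => real set" where
	"cutoff_zone I n = {t. real n * infdist t (- (I \<inter> ball 0 (real n))) < 1}"

lemma open_cutoff_zone: "open (cutoff_zone I n)"
	unfolding cutoff_zone_def by (intro open_Collect_less continuous_intros)

lemma cutoff_zone_eq_0: "t \<in> cutoff_zone I n ==> cutoff I n t = 0" by (simp add: cutoff_zone_def cutoff_def)

lemma cutoff_zone_cover: "I \<union> cutoff_zone I n = UNIV"
	using infdist_zero[of _ "- (I \<inter> ball 0 (real n))"] by (auto simp: cutoff_zone_def)

lemma cutoff_tendsto:
	assumes "open I" "t \<in> I"
	shows "(%n. cutoff I n t) \<longlonglongrightarrow> 1"
proof -
	obtain r where r: "r > 0" "ball t r \<subseteq> I" using assms open_contains_ball by blast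
	\<comment> \<open>The first condition puts the ball of radius r about t into
	  \<open>I \<inter> ball 0 n\<close>; the second makes n r - 1 at least 1.\<close>
	have "cutoff I n t = 1" if n: "real n \<ge> \<bar>t\<bar> + r" "real n \<ge> 2 / r" for n
	proof -
		have "infdist t (- (I \<inter> ball 0 (real n))) \<ge> r" unfolding infdist_notempty[OF compl_Int_ball_nonempty]
		proof (rule cINF_greatest[OF compl_Int_ball_nonempty])
			fix y assume y: "y \<in> - (I \<inter> ball 0 (real n))"
			show "r \<le> dist t y"
			proof (rule ccontr)
				assume "\<not> r \<le> dist t y"
				then have "y \<in> I" "\<bar>y\<bar> < real n" using r n by (auto simp: dist_real_def)
				then show False using y by (auto simp: dist_real_def)
			qed
		qed
		moreover have "real n > 0" using n(1) r(1) by linarith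
		ultimately have "real n * infdist t (- (I \<inter> ball 0 (real n))) \<ge> real n * r" by (intro mult_left_mono) auto
		moreover have "real n * r \<ge> 2" using n(2) r(1) by (simp add: field_simps)
		ultimately show ?thesis unfolding cutoff_def by simp
	qed
	moreover have "\<forall>\<^sub>F n in sequentially. real n \<ge> \<bar>t\<bar> + r \<and> real n \<ge> 2 / r"
		by (intro eventually_conj) (use filterlim_real_sequentially in \<open>auto simp: filterlim_at_top\<close>)
	ultimately have "\<forall>\<^sub>F n in sequentially. cutoff I n t = 1" by (auto elim: eventually_mono)
	then show ?thesis by (rule tendsto_eventually)
qed

lemma continuous_on_cutoff_scaleR:
	fixes u :: "real => 'b::real_normed_vector"
	assumes "open I" "continuous_on I u"
	shows "continuous_on S (%t. cutoff I n t *\<^sub>R u t)"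
proof -
	have "continuous_on (I \<union> cutoff_zone I n) (%t. cutoff I n t *\<^sub>R u t)"
	proof (rule continuous_on_open_Un[OF assms(1) open_cutoff_zone])
		show "continuous_on I (%t. cutoff I n t *\<^sub>R u t)" by (intro continuous_intros continuous_on_cutoff assms)
		show "continuous_on (cutoff_zone I n) (%t. cutoff I n t *\<^sub>R u t)"
			by (rule continuous_on_eq[of _ "%_. 0"]) (auto simp: cutoff_zone_eq_0)
	qed
	then show ?thesis unfolding cutoff_zone_cover using continuous_on_subset by blast
qed

lemma integral_eq_of_support:
	fixes f :: "real => 'b::banach"
	assumes "\<And>t. t \<notin> A ==> f t = 0" "\<And>t. t \<notin> B ==> f t = 0"
	shows "integral A f = integral B f" "f integrable_on B ==> f integrable_on A"
proof -
	have *: "(%x. if x \<in> A then f x else 0) = f" "(%x. if x \<in> B then f x else 0) = f" using assms by auto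
	show "integral A f = integral B f"
		using integral_restrict_UNIV[of A f] integral_restrict_UNIV[of B f] unfolding * by simp
	show "f integrable_on B ==> f integrable_on A"
		using integrable_restrict_UNIV[of A f] integrable_restrict_UNIV[of B f] unfolding * by simp
qed

text \<open>The integrand may be singular at the ends of \<open>I\<close>. It is approximated by its
  products with cutoffs, which are continuous with bounded support; the error is at most (1 -
  cutoff) m, whose integral tends to 0 by scalar dominated convergence.\<close>

lemma dominated_integrable:
	fixes u :: "real => 'b::banach"
	assumes I: "open I" and u: "continuous_on I u" and m: "m integrable_on I"
		and le: "\<And>t. t \<in> I ==> norm (u t) \<le> m t"
	shows "u integrable_on I"
proof (rule integrable_on_all_intervals_integrable_bound[OF integrable_on_cbox_approx le m])
	fix a b e :: real assume "e > 0"
	have m0: "0 \<le> m t" if "t \<in> I" for t using le[OF that] norm_ge_zero order_trans by blast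
	have mabs: "m absolutely_integrable_on I" using m m0 by (rule nonnegative_absolutely_integrable_1)
	define w where "w n t = cutoff I n t *\<^sub>R u t" for n t
	define g where "g n t = (1 - cutoff I n t) * m t" for n t
	have w: "w n integrable_on I" for n
	proof (rule integral_eq_of_support(2))
		show "w n integrable_on cbox (- real n) (real n)"
			unfolding w_def by (intro integrable_continuous continuous_on_cutoff_scaleR I u)
	qed (auto simp: w_def cutoff_outside)
	have g: "g n integrable_on I" for n
	proof -
		have "(%t. (1 - cutoff I n t) * m t) absolutely_integrable_on I"
		proof (rule absolutely_integrable_bounded_measurable_product_real[OF _ _ _ mabs])
			show "I \<in> sets lebesgue" using I by (simp add: borel_open)
			then show "(%t. 1 - cutoff I n t) \<in> borel_measurable (lebesgue_on I)"
				by (intro continuous_imp_measurable_on_sets_lebesgue continuous_intros continuous_on_cutoff)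
			show "bounded ((%t. 1 - cutoff I n t) ` I)" unfolding bounded_iff using cutoff_bounds[of I n]
				by (intro exI[of _ 1]) (auto simp: abs_le_iff intro: order_trans[of _ 1])
		qed
		then show ?thesis unfolding g_def absolutely_integrable_on_def by blast
	qed
	have "(%n. integral I (g n)) \<longlonglongrightarrow> integral I (%t. 0)"
	proof (rule dominated_convergence(2)[OF g m])
		show "norm (g n t) \<le> m t" if "t \<in> I" for n t using m0[OF that] cutoff_bounds[of I n t]
			by (simp add: g_def abs_mult mult_left_le_one_le)
		show "(%n. g n t) \<longlonglongrightarrow> 0" if "t \<in> I" for t
			unfolding g_def using cutoff_tendsto[OF I that] by (auto intro!: tendsto_eq_intros)
	qed
	then have "\<forall>\<^sub>F n in sequentially. integral I (g n) < e" using \<open>e > 0\<close> by (intro order_tendstoD(2)) auto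
	then obtain n where n: "integral I (g n) < e" by (auto simp: eventually_sequentially)
	let ?w = "%t. if t \<in> I then w n t else 0" and ?g = "%t. if t \<in> I then g n t else 0"
	have le: "norm ((if t \<in> I then u t else 0) - ?w t) \<le> ?g t" for t
	proof -
		have "u t - w n t = (1 - cutoff I n t) *\<^sub>R u t" by (simp add: w_def scaleR_diff_left)
		then show ?thesis using le[of t] cutoff_bounds[of I n t] by (simp add: g_def mult_left_mono)
	qed
	have gi: "?g integrable_on cbox a b" by (rule integrable_altD(1)[OF g])
	have "integral (cbox a b) ?g \<le> integral UNIV ?g"
		using order_trans[OF norm_ge_zero le] g gi by (intro integral_subset_le) (auto simp: integrable_restrict_UNIV)
	then have "integral (cbox a b) ?g < e" using n by (simp add: integral_restrict_UNIV)
	then show "\<exists>w g. w integrable_on cbox a b \<and> g integrable_on cbox a b \<and> integral (cbox a b) g < e \<and>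
			(\<forall>t\<in>cbox a b. norm ((if t \<in> I then u t else 0) - w t) \<le> g t)"
		using integrable_altD(1)[OF w] gi le by blast
qed

text \<open>The scalar theorem is applied to the norms of \<open>u n t - v t\<close>, which are
  dominated by twice the majorant.\<close>

lemma dominated_tendsto:
	fixes u :: "nat => real => 'b::banach"
	assumes I: "open I" and u: "\<And>n. continuous_on I (u n)" and v: "continuous_on I v"
		and m: "m integrable_on I" and le: "\<And>n t. t \<in> I ==> norm (u n t) \<le> m t"
		and lim: "\<And>t. t \<in> I ==> (%n. u n t) \<longlonglongrightarrow> v t"
	shows "(%n. integral I (u n)) \<longlonglongrightarrow> integral I v"
proof -
	have lev: "norm (v t) \<le> m t" if "t \<in> I" for t
		using Lim_bounded[OF tendsto_norm[OF lim[OF that]]] le[OF that] by blast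
	have iu: "u n integrable_on I" for n by (rule dominated_integrable[OF I u m le])
	have iv: "v integrable_on I" by (rule dominated_integrable[OF I v m lev])
	have m2: "(%t. 2 * m t) integrable_on I" using m by (rule integrable_on_mult_right)
	have le2: "norm (u n t - v t) \<le> 2 * m t" if "t \<in> I" for n t
		using norm_triangle_ineq4[of "u n t" "v t"] le[OF that, of n] lev[OF that] by linarith
	have id: "(%t. norm (u n t - v t)) integrable_on I" for n
		using le2 by (intro dominated_integrable[OF I _ m2] continuous_intros u v) auto
	have "(%n. integral I (%t. norm (u n t - v t))) \<longlonglongrightarrow> integral I (%t. 0)"
	proof (rule dominated_convergence(2)[OF id m2])
		show "norm (norm (u n t - v t)) \<le> 2 * m t" if "t \<in> I" for n t using le2[OF that] by simp
		show "(%n. norm (u n t - v t)) \<longlonglongrightarrow> 0" if "t \<in> I" for t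
			using tendsto_norm_zero[OF Lim_null[THEN iffD1, OF lim[OF that]]] .
	qed
	then have "(%n. integral I (%t. norm (u n t - v t))) \<longlonglongrightarrow> 0" by simp
	moreover have "norm (integral I (u n) - integral I v) \<le> integral I (%t. norm (u n t - v t))" for n
		unfolding integral_diff[OF iu iv, symmetric]
		by (intro integral_norm_bound_integral integrable_diff iu iv id) auto
	then have bound: "\<forall>\<^sub>F n in sequentially.
			norm (integral I (u n) - integral I v) \<le> integral I (%t. norm (u n t - v t))" by simp
	ultimately have "(%n. integral I (u n) - integral I v) \<longlonglongrightarrow> 0" by (rule Lim_null_comparison[rotated])
	then show ?thesis by (rule LIM_zero_cancel)
qed

text \<open>Multiplied by cutoffs in both variables the integrand is continuous on a square, where
  the order of integration can be exchanged; then n tends to infinity on both sides.\<close>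

lemma dominated_fubini:
	fixes U :: "real => real => 'b::banach"
	assumes I: "open I" and J: "open J" and U: "continuous_on (I \<times> J) (%(s, t). U s t)"
		and m: "m integrable_on I" "continuous_on I m" "\<And>s. s \<in> I ==> 0 \<le> m s"
		and k: "k integrable_on J" "continuous_on J k" "\<And>t. t \<in> J ==> 0 \<le> k t"
		and le: "\<And>s t. s \<in> I ==> t \<in> J ==> norm (U s t) \<le> m s * k t"
	shows "integral I (%s. integral J (U s)) = integral J (%t. integral I (%s. U s t))"
proof -
	\<comment> \<open>Stated for arbitrary sets and integrands because it is applied a second time with
	  the two variables exchanged.\<close>
	have half: "(%n. integral I (%s. integral J (%t. (cutoff I n s * cutoff J n t) *\<^sub>R U s t)))
			\<longlonglongrightarrow> integral I (%s. integral J (U s))"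
		if I: "open I" and J: "open J" and U: "continuous_on (I \<times> J) (%(s, t). U s t)"
		and m: "m integrable_on I" "continuous_on I m" "\<And>s. s \<in> I ==> 0 \<le> m s"
		and k: "k integrable_on J" "continuous_on J k" "\<And>t. t \<in> J ==> 0 \<le> k t"
		and le: "\<And>s t. s \<in> I ==> t \<in> J ==> norm (U s t) \<le> m s * k t"
		for I J m k and U :: "real => real => 'b"
	proof -
		have Ut: "continuous_on J (U s)" if "s \<in> I" for s
		proof -
			have "continuous_on J (%t. case (s, t) of (s, t) => U s t)"
			proof (rule continuous_on_compose2[OF U])
				show "continuous_on J (%t. (s, t))" by (intro continuous_intros)
			qed (use that in auto)
			then show ?thesis by simp
		qed
		have Us: "continuous_on I (%s. U s t)" if "t \<in> J" for t
		proof -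
			have "continuous_on I (%s. case (s, t) of (s, t) => U s t)"
			proof (rule continuous_on_compose2[OF U])
				show "continuous_on I (%s. (s, t))" by (intro continuous_intros)
			qed (use that in auto)
			then show ?thesis by simp
		qed
		have Jc: "continuous_on I (%s. integral J (%t. et t *\<^sub>R U s t))"
			if et: "continuous_on J et" "\<And>t. \<bar>et t\<bar> \<le> (1::real)" for et unfolding continuous_on_sequentially o_def
		proof (intro allI ballI impI, elim conjE)
			fix x s assume s: "s \<in> I" and x: "\<forall>n. x n \<in> I" "x \<longlonglongrightarrow> s"
			have "(%n. m (x n)) \<longlonglongrightarrow> m s" using m(2) s x unfolding continuous_on_sequentially o_def by blast
			then have "Bseq (%n. m (x n))" by (rule convergent_imp_Bseq[OF convergentI])
			then obtain K where K: "\<And>n. \<bar>m (x n)\<bar> \<le> K" unfolding Bseq_def by auto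
			show "(%n. integral J (%t. et t *\<^sub>R U (x n) t)) \<longlonglongrightarrow> integral J (%t. et t *\<^sub>R U s t)"
			proof (rule dominated_tendsto[OF J])
				show "(%t. K * k t) integrable_on J" using k(1) by (rule integrable_on_mult_right)
				show "continuous_on J (%t. et t *\<^sub>R U (x n) t)" for n using x by (intro continuous_intros et Ut) auto
				show "continuous_on J (%t. et t *\<^sub>R U s t)" using s by (intro continuous_intros et Ut) auto
				show "norm (et t *\<^sub>R U (x n) t) \<le> K * k t" if "t \<in> J" for n t
				proof -
					have "norm (et t *\<^sub>R U (x n) t) \<le> 1 * norm (U (x n) t)"
						unfolding norm_scaleR using et(2) by (intro mult_right_mono) auto
					also have "... \<le> m (x n) * k t" using le[of "x n" t] x that by simp
					also have "... \<le> K * k t" using K[of n] k(3)[OF that] by (intro mult_right_mono) auto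
					finally show ?thesis .
				qed
				show "(%n. et t *\<^sub>R U (x n) t) \<longlonglongrightarrow> et t *\<^sub>R U s t" if "t \<in> J" for t
					using Us[OF that] x s unfolding continuous_on_sequentially o_def by (intro tendsto_intros) auto
			qed
		qed
		have cut: "\<bar>cutoff A n t\<bar> \<le> 1" for A n t using cutoff_bounds[of A n t] by auto
		have int_le: "norm (integral J (%t. et t *\<^sub>R U s t)) \<le> m s * integral J k"
			if s: "s \<in> I" and et: "continuous_on J et" "\<And>t. \<bar>et t\<bar> \<le> (1::real)" for s et
		proof -
			have b: "norm (et t *\<^sub>R U s t) \<le> m s * k t" if "t \<in> J" for t
			proof -
				have "norm (et t *\<^sub>R U s t) \<le> 1 * norm (U s t)"
					unfolding norm_scaleR using et(2) by (intro mult_right_mono) auto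
				then show ?thesis using le[OF s that] by simp
			qed
			have i: "(%t. m s * k t) integrable_on J" using k(1) by (rule integrable_on_mult_right)
			have "norm (integral J (%t. et t *\<^sub>R U s t)) \<le> integral J (%t. m s * k t)"
				by (intro integral_norm_bound_integral dominated_integrable[OF J _ i] continuous_intros et Ut s b i)
			then show ?thesis by simp
		qed
		show ?thesis
		proof (rule dominated_tendsto[OF I])
			show "(%s. m s * integral J k) integrable_on I" using m(1) by (rule integrable_on_mult_left)
			have eq: "(%t. (cutoff I n s * cutoff J n t) *\<^sub>R U s t)
					= (%t. cutoff I n s *\<^sub>R (cutoff J n t *\<^sub>R U s t))" for n s by simp
			show "continuous_on I (%s. integral J (%t. (cutoff I n s * cutoff J n t) *\<^sub>R U s t))" for n
				unfolding eq integral_cmul by (intro continuous_intros continuous_on_cutoff Jc cut)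
			show "continuous_on I (%s. integral J (U s))" using Jc[of "%_. 1"] by simp
			show "norm (integral J (%t. (cutoff I n s * cutoff J n t) *\<^sub>R U s t)) \<le> m s * integral J k"
				if "s \<in> I" for n s
			proof -
				have "norm (integral J (%t. (cutoff I n s * cutoff J n t) *\<^sub>R U s t))
					 \<le> 1 * norm (integral J (%t. cutoff J n t *\<^sub>R U s t))"
					unfolding eq integral_cmul norm_scaleR using cut by (intro mult_right_mono) auto
				also have "... \<le> m s * integral J k"
					using int_le[OF that, of "cutoff J n"] cut continuous_on_cutoff by simp
				finally show ?thesis .
			qed
			show "(%n. integral J (%t. (cutoff I n s * cutoff J n t) *\<^sub>R U s t)) \<longlonglongrightarrow> integral J (U s)"
				if s: "s \<in> I" for s
			proof (rule dominated_tendsto[OF J])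
				show "(%t. m s * k t) integrable_on J" using k(1) by (rule integrable_on_mult_right)
				show "continuous_on J (%t. (cutoff I n s * cutoff J n t) *\<^sub>R U s t)" for n
					by (intro continuous_intros continuous_on_cutoff Ut s)
				show "norm ((cutoff I n s * cutoff J n t) *\<^sub>R U s t) \<le> m s * k t" if "t \<in> J" for n t
				proof -
					have "\<bar>cutoff I n s * cutoff J n t\<bar> \<le> 1"
						unfolding abs_mult using cut[of I n s] cut[of J n t] by (simp add: mult_le_one)
					then have "norm ((cutoff I n s * cutoff J n t) *\<^sub>R U s t) \<le> 1 * norm (U s t)"
						unfolding norm_scaleR by (intro mult_right_mono) auto
					then show ?thesis using le[OF s that] by simp
				qed
				show "(%n. (cutoff I n s * cutoff J n t) *\<^sub>R U s t) \<longlonglongrightarrow> U s t" if "t \<in> J" for t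
					using tendsto_scaleR[OF tendsto_mult[OF cutoff_tendsto[OF I s] cutoff_tendsto[OF J that]]
							tendsto_const[of "U s t"]] by simp
			qed (rule Ut[OF s])
		qed
	qed
	\<comment> \<open>The product with both cutoffs, read as 0 off the product of the two sets, is
	  continuous on the whole plane and supported in a square of half side n.\<close>
	have swap: "integral I (%s. integral J (%t. (cutoff I n s * cutoff J n t) *\<^sub>R U s t))
			= integral J (%t. integral I (%s. (cutoff J n t * cutoff I n s) *\<^sub>R U s t))" for n
	proof -
		let ?V = "%s t. (cutoff I n s * cutoff J n t) *\<^sub>R U s t"
		let ?B = "cbox (- real n) (real n)"
		let ?O = "I \<times> J \<union> (cutoff_zone I n \<times> UNIV \<union> UNIV \<times> cutoff_zone J n)"
		have cont: "continuous_on ?O (%(s, t). ?V s t)"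
		proof (intro continuous_on_open_Un open_Un open_Times I J open_cutoff_zone open_UNIV)
			have "continuous_on (I \<times> J) (%p. (cutoff I n (fst p) * cutoff J n (snd p)) *\<^sub>R (%(s, t). U s t) p)"
				by (intro continuous_intros U continuous_on_compose2[OF continuous_on_cutoff[of UNIV]]) auto
			then show "continuous_on (I \<times> J) (%(s, t). ?V s t)" by (simp add: case_prod_unfold)
		qed (rule continuous_on_eq[of _ "%_. 0"]; auto simp: cutoff_zone_eq_0)+
		have O: "?O = UNIV" using cutoff_zone_cover[of I n] cutoff_zone_cover[of J n] by auto
		have c: "continuous_on (cbox (- real n, - real n) (real n, real n)) (%(s, t). ?V s t)"
			by (rule continuous_on_subset[OF cont[unfolded O] subset_UNIV])
		have "integral I (%s. integral J (?V s)) = integral ?B (%s. integral J (?V s))"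
			by (rule integral_eq_of_support(1)) (auto simp: cutoff_outside)
		also have "integral ?B (%s. integral J (?V s)) = integral ?B (%s. integral ?B (?V s))"
			by (rule integral_cong, rule integral_eq_of_support(1)) (auto simp: cutoff_outside)
		also have "integral ?B (%s. integral ?B (?V s)) = integral ?B (%t. integral ?B (%s. ?V s t))"
			by (rule integral_swap_continuous[OF c])
		also have "integral ?B (%t. integral ?B (%s. ?V s t)) = integral ?B (%t. integral I (%s. ?V s t))"
			by (rule integral_cong, rule integral_eq_of_support(1)) (auto simp: cutoff_outside)
		also have "integral ?B (%t. integral I (%s. ?V s t)) = integral J (%t. integral I (%s. ?V s t))"
			by (rule integral_eq_of_support(1)) (auto simp: cutoff_outside)
		finally show ?thesis by (simp add: mult.commute)
	qed
	have U': "continuous_on (J \<times> I) (%(t, s). U s t)"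
	proof -
		have "continuous_on (J \<times> I) (%p. (%(s, t). U s t) (prod.swap p))"
			by (rule continuous_on_compose2[OF U continuous_on_swap]) auto
		then show ?thesis by (simp add: case_prod_unfold)
	qed
	have "(%n. integral I (%s. integral J (%t. (cutoff I n s * cutoff J n t) *\<^sub>R U s t)))
			\<longlonglongrightarrow> integral I (%s. integral J (U s))" by (rule half[OF I J U m k le])
	moreover have "(%n. integral I (%s. integral J (%t. (cutoff I n s * cutoff J n t) *\<^sub>R U s t)))
			\<longlonglongrightarrow> integral J (%t. integral I (%s. U s t))" unfolding swap
		by (rule half[OF J I U' k m]) (use le in \<open>simp_all add: mult.commute\<close>)
	ultimately show ?thesis by (rule LIMSEQ_unique)
qed

section \<open>Contours and iterated contour integrals\<close>

text \<open>A contour is a triple of an open parameter set, a density (the derivative of the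
	parametrization) and a parametrization.\<close>

type_synonym contour = "real set \<times> (real => complex) \<times> (real => complex)"

abbreviation params :: "contour => real set" where "params c \<equiv> fst c"
abbreviation dens :: "contour => real => complex" where "dens c \<equiv> fst (snd c)"
abbreviation pnt :: "contour => real => complex" where "pnt c \<equiv> snd (snd c)"

definition locus :: "contour => complex set" where "locus c = pnt c ` params c"

definition cint :: "contour => (complex => 'b::complex_banach) => 'b" where
	"cint c F = integral (params c) (%t. dens c t *\<^sub>C F (pnt c t))"

text \<open>The factor bounding functions in \<open>H0_sector\<close>, divided by |z|. It majorizes
  f(z) R(z, A), and for s > 0 it is integrable along rays both at 0 and at infinity.\<close>

definition wt :: "real => complex => real" where
	"wt s z = cmod z powr (s - 1) / (1 + cmod z powr (2 * s))"

text \<open>The locus may accumulate at 0 and at infinity, but has to leave out 0. Integrability of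
  all weights is what absolute convergence of the calculi requires, so that sector boundaries, Stolz
  boundaries and pieces of them are treated alike.\<close>

definition contour :: "contour => bool" where
	"contour c \<longleftrightarrow> open (params c) \<and> continuous_on (params c) (dens c) \<and> continuous_on (params c) (pnt c) \<and>
		 0 \<notin> locus c \<and> (\<forall>s>0. (%t. cmod (dens c t) * wt s (pnt c t)) integrable_on params c)"

definition mass :: "real => contour => real" where
	"mass s c = integral (params c) (%t. cmod (dens c t) * wt s (pnt c t))"

lemma wt_nonneg: "0 \<le> wt s z" by (simp add: wt_def)

lemma tendsto_wt: "(f \<longlongrightarrow> z) F ==> z ~= 0 ==> ((%x. wt s (f x)) \<longlongrightarrow> wt s z) F"
	unfolding wt_def by (intro tendsto_intros) (auto simp: add_nonneg_eq_0_iff)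

lemma continuous_on_wt: "continuous_on A f ==> 0 \<notin> f ` A ==> continuous_on A (%x. wt s (f x))"
	unfolding continuous_on_def by (auto intro: tendsto_wt)

lemma pnt_locus: "t \<in> params c ==> pnt c t \<in> locus c" by (simp add: locus_def)

lemma mass_nonneg: "0 \<le> mass s c"
	proof (cases "(%t. cmod (dens c t) * wt s (pnt c t)) integrable_on params c")
	case True
	then show ?thesis unfolding mass_def by (rule integral_nonneg) (simp add: wt_nonneg)
qed (simp add: mass_def not_integrable_integral)

definition integrand_on :: "real => real => contour => (complex => 'b::complex_banach) => bool" where
	"integrand_on s C c F \<longleftrightarrow> continuous_on (locus c) F \<and> (\<forall>z\<in>locus c. norm (F z) \<le> C * wt s z)"

lemma integrand_on_lift:
	assumes c: "contour c" and s: "s > 0" and F: "integrand_on s C c F"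
	shows "continuous_on (params c) (%t. dens c t *\<^sub>C F (pnt c t))"
		and "\<And>t. t \<in> params c ==> norm (dens c t *\<^sub>C F (pnt c t)) \<le> C * (cmod (dens c t) * wt s (pnt c t))"
		and "(%t. C * (cmod (dens c t) * wt s (pnt c t))) integrable_on params c"
		and "(%t. dens c t *\<^sub>C F (pnt c t)) integrable_on params c"
proof -
	show 1: "continuous_on (params c) (%t. dens c t *\<^sub>C F (pnt c t))"
	proof (intro continuous_on_scaleC)
		show "continuous_on (params c) (%t. F (pnt c t))" by (rule continuous_on_compose2[of "locus c" F])
				(use c F in \<open>auto simp: contour_def integrand_on_def locus_def\<close>)
	qed (use c in \<open>simp add: contour_def\<close>)
	show 2: "norm (dens c t *\<^sub>C F (pnt c t)) \<le> C * (cmod (dens c t) * wt s (pnt c t))"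
		if "t \<in> params c" for t
	proof -
		have "norm (F (pnt c t)) \<le> C * wt s (pnt c t)" using F pnt_locus[OF that] by (simp add: integrand_on_def)
		then show ?thesis unfolding norm_scaleC mult.left_commute[of C] by (intro mult_left_mono) auto
	qed
	show 3: "(%t. C * (cmod (dens c t) * wt s (pnt c t))) integrable_on params c"
		using c s by (intro integrable_on_mult_right) (simp add: contour_def)
	show "(%t. dens c t *\<^sub>C F (pnt c t)) integrable_on params c"
		using c by (intro dominated_integrable[OF _ 1 3 2]) (auto simp: contour_def)
qed

lemma norm_cint_le:
	assumes "contour c" "s > 0" "integrand_on s C c F"
	shows "norm (cint c F) \<le> C * mass s c"
proof -
	have "norm (cint c F) \<le> integral (params c) (%t. C * (cmod (dens c t) * wt s (pnt c t)))" unfolding cint_def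
		by (intro integral_norm_bound_integral integrand_on_lift[OF assms])
	then show ?thesis by (simp add: mass_def)
qed

lemma cint_cong: "(\<And>z. z \<in> locus c ==> F z = G z) ==> cint c F = cint c G"
	unfolding cint_def by (rule integral_cong) (simp add: pnt_locus)

lemma cint_add:
	assumes "contour c" "s > 0" "integrand_on s C c F" "integrand_on s D c G"
	shows "cint c (%z. F z + G z) = cint c F + cint c G" unfolding cint_def scaleC_add_right
	by (intro integral_add integrand_on_lift(4)[OF assms(1,2,3)] integrand_on_lift(4)[OF assms(1,2,4)])

lemma cint_linear:
	assumes "contour c" "s > 0" "integrand_on s C c F" and \<Phi>: "bounded_linear \<Phi>" "\<And>a x. \<Phi> (a *\<^sub>C x) = a *\<^sub>C \<Phi> x"
	shows "cint c (%z. \<Phi> (F z)) = \<Phi> (cint c F)" using integral_linear[OF integrand_on_lift(4)[OF assms(1-3)] \<Phi>(1)]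
	unfolding cint_def o_def \<Phi>(2) .

lemma integrand_on_linear:
	assumes "integrand_on s C c F" "bounded_linear \<Phi>"
	shows "integrand_on s (onorm \<Phi> * C) c (%z. \<Phi> (F z))" unfolding integrand_on_def
proof (intro conjI ballI)
	show "continuous_on (locus c) (%z. \<Phi> (F z))"
		using assms by (auto simp: integrand_on_def intro: bounded_linear.continuous_on)
	fix z assume "z \<in> locus c"
	then have "norm (F z) \<le> C * wt s z" using assms(1) by (simp add: integrand_on_def)
	then have "onorm \<Phi> * norm (F z) \<le> onorm \<Phi> * (C * wt s z)"
		using onorm_pos_le[OF assms(2)] by (intro mult_left_mono)
	then show "norm (\<Phi> (F z)) \<le> onorm \<Phi> * C * wt s z" using onorm[OF assms(2), of "F z"] by simp
qed

section \<open>Product sets of lists and coordinatewise convergence\<close>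

lemma in_listset_iff: "zs \<in> listset As \<longleftrightarrow> list_all2 (\<in>) zs As"
	by (induction As arbitrary: zs) (auto simp: set_Cons_def list_all2_Cons2)

lemma Cons_in_listset [simp]: "z # zs \<in> listset (A # As) \<longleftrightarrow> z \<in> A \<and> zs \<in> listset As"
	by (simp add: in_listset_iff del: listset.simps)

lemma append_in_listset: "xs \<in> listset As ==> ys \<in> listset Bs ==> xs @ ys \<in> listset (As @ Bs)"
	by (simp add: in_listset_iff list_all2_appendI)

lemma length_listset: "zs \<in> listset As ==> length zs = length As" by (simp add: in_listset_iff list_all2_lengthD)

lemma listset_ConsE:
	assumes "zs \<in> listset (A # As)"
	obtains z zs' where "zs = z # zs'" "z \<in> A" "zs' \<in> listset As" using assms by (auto simp: set_Cons_def)

lemma listset_appendE: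
	assumes "zs \<in> listset (As @ Bs)"
	obtains xs ys where "zs = xs @ ys" "xs \<in> listset As" "ys \<in> listset Bs"
	using assms by (auto simp: in_listset_iff list_all2_append2)

lemma listset_mono: "list_all2 (\<subseteq>) As Bs ==> listset As \<subseteq> listset Bs"
	by (induction rule: list_all2_induct) (auto simp: set_Cons_def)

declare listset.simps(2) [simp del]

definition list_lim :: "(nat => complex list) => complex list => bool" where
	"list_lim X zs \<longleftrightarrow> (\<forall>n. length (X n) = length zs) \<and> (\<forall>i<length zs. (%n. X n ! i) \<longlonglongrightarrow> zs ! i)"

lemma list_lim_const: "list_lim (%n. zs) zs" by (simp add: list_lim_def)

lemma list_lim_append: "list_lim X xs ==> list_lim Y ys ==> list_lim (%n. X n @ Y n) (xs @ ys)"
	by (auto simp: list_lim_def nth_append)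

lemma list_lim_Cons:
	assumes "x \<longlonglongrightarrow> z" "list_lim Y ys"
	shows "list_lim (%n. x n # Y n) (z # ys)"
proof -
	have "list_lim (%n. [x n]) [z]" using assms(1) by (simp add: list_lim_def)
	from list_lim_append[OF this assms(2)] show ?thesis by simp
qed

text \<open>Continuity in all coordinates jointly, expressed by sequences because it is produced and
  consumed by dominated convergence.\<close>

definition seqcont :: "complex list set => (complex list => 'b::topological_space) => bool" where
	"seqcont S F \<longleftrightarrow> (\<forall>X zs. (\<forall>n. X n \<in> S) --> zs \<in> S --> list_lim X zs --> (%n. F (X n)) \<longlonglongrightarrow> F zs)"

lemma seqcontD:
	"seqcont S F ==> (\<And>n. X n \<in> S) ==> zs \<in> S ==> list_lim X zs ==> (%n. F (X n)) \<longlonglongrightarrow> F zs" by (simp add: seqcont_def)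

lemma seqcont_imp_continuous_on:
	assumes "seqcont S F" "\<And>z. z \<in> A ==> xs @ z # ys \<in> S"
	shows "continuous_on A (%z. F (xs @ z # ys))" unfolding continuous_on_sequentially o_def
proof (intro allI ballI impI, elim conjE)
	fix x a assume "a \<in> A" "\<forall>n. x n \<in> A" "x \<longlonglongrightarrow> a"
	then show "(%n. F (xs @ x n # ys)) \<longlonglongrightarrow> F (xs @ a # ys)"
		by (intro seqcontD[OF assms(1)] assms(2) list_lim_append list_lim_Cons list_lim_const) auto
qed

section \<open>Dominated integrands in several variables and their iterated integrals\<close>

abbreviation wts :: "real => complex list => real" where
	"wts s zs \<equiv> prod_list (map (wt s) zs)"

abbreviation loci :: "contour list => complex list set" where
	"loci cs \<equiv> listset (map locus cs)"

abbreviation iter :: "contour list => (complex list => 'b::complex_banach) => 'b" where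
	"iter cs F \<equiv> iterated_integral (map cint cs) F"

definition integrand :: "real => real => contour list => (complex list => 'b::complex_banach) => bool" where
	"integrand s C cs F \<longleftrightarrow> seqcont (loci cs) F \<and> (\<forall>zs\<in>loci cs. norm (F zs) \<le> C * wts s zs)"

lemma tendsto_wts:
	assumes "list_lim X zs" "0 \<notin> set zs"
	shows "(%n. wts s (X n)) \<longlonglongrightarrow> wts s zs"
proof -
	have eq: "wts s xs = (\<Prod>i\<in>{0..<length xs}. wt s (xs ! i))" for xs by (simp add: prod.list_conv_set_nth)
	have l: "length (X n) = length zs" for n using assms(1) by (simp add: list_lim_def)
	show ?thesis unfolding eq l
	proof (intro tendsto_prod tendsto_wt)
		fix i assume "i \<in> {0..<length zs}"
		then show "(%n. X n ! i) \<longlonglongrightarrow> zs ! i" "zs ! i ~= 0" using assms nth_mem[of i zs] by (force simp: list_lim_def)+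
	qed
qed

lemma zero_notin_loci:
	assumes "\<forall>c\<in>set cs. contour c" "zs \<in> loci cs"
	shows "0 \<notin> set zs" using assms by (induction cs arbitrary: zs) (auto simp: contour_def elim!: listset_ConsE)

lemma integrand_on_slice:
	assumes "integrand s C (cs1 @ c # cs2) F" "xs \<in> loci cs1" "ys \<in> loci cs2"
	shows "integrand_on s (C * wts s xs * wts s ys) c (%z. F (xs @ z # ys))" unfolding integrand_on_def
proof (intro conjI ballI)
	have mem: "xs @ z # ys \<in> loci (cs1 @ c # cs2)" if "z \<in> locus c" for z
		using assms that by (simp add: append_in_listset)
	show "continuous_on (locus c) (%z. F (xs @ z # ys))"
		by (rule seqcont_imp_continuous_on[OF _ mem]) (use assms(1) in \<open>auto simp: integrand_def\<close>)
	show "norm (F (xs @ z # ys)) \<le> C * wts s xs * wts s ys * wt s z" if "z \<in> locus c" for z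
	proof -
		have "norm (F (xs @ z # ys)) \<le> C * wts s (xs @ z # ys)"
			using assms(1) mem[OF that] unfolding integrand_def by blast
		then show ?thesis by (simp add: mult_ac)
	qed
qed

text \<open>Integrating out one variable stays within the class: the weight of that variable turns
  into the constant \<open>mass s c\<close>, and continuity in the remaining variables is dominated
  convergence.\<close>

lemma integrand_cint_last:
	fixes F :: "complex list => 'b::complex_banach"
	assumes cs: "\<forall>c\<in>set cs. contour c" and c: "contour c" and s: "s > 0" and F: "integrand s C (cs @ [c]) F"
	shows "integrand s (C * mass s c) cs (%xs. cint c (%z. F (xs @ [z])))" unfolding integrand_def
proof (intro conjI ballI)
	have slice: "integrand_on s (C * wts s xs) c (%z. F (xs @ [z]))" if "xs \<in> loci cs" for xs
		using integrand_on_slice[of s C cs c "[]" F xs "[]"] F that by simp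
	show "norm (cint c (%z. F (xs @ [z]))) \<le> C * mass s c * wts s xs" if "xs \<in> loci cs" for xs
		using norm_cint_le[OF c s slice[OF that]] by (simp add: mult_ac)
	show "seqcont (loci cs) (%xs. cint c (%z. F (xs @ [z])))" unfolding seqcont_def
	proof (intro allI impI)
		fix X xs assume X: "\<forall>n. X n \<in> loci cs" and xs: "xs \<in> loci cs" and lim: "list_lim X xs"
		have "(%n. C * wts s (X n)) \<longlonglongrightarrow> C * wts s xs"
			by (intro tendsto_intros tendsto_wts[OF lim] zero_notin_loci[OF cs xs])
		\<comment> \<open>Boundedness of the weights along the convergent sequence gives one majorant
		  valid for all n.\<close>
		then have "Bseq (%n. C * wts s (X n))" by (rule convergent_imp_Bseq[OF convergentI])
		then obtain K where K: "\<And>n. \<bar>C * wts s (X n)\<bar> \<le> K" unfolding Bseq_def by auto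
		have le: "integrand_on s K c (%z. F (X n @ [z]))" for n unfolding integrand_on_def
		proof (intro conjI ballI)
			have sl: "integrand_on s (C * wts s (X n)) c (%z. F (X n @ [z]))" using X slice by blast
			then show "continuous_on (locus c) (%z. F (X n @ [z]))" by (simp add: integrand_on_def)
			fix z assume "z \<in> locus c"
			then have "norm (F (X n @ [z])) \<le> C * wts s (X n) * wt s z" using sl by (simp add: integrand_on_def)
			also have "... \<le> K * wt s z" using K[of n] by (intro mult_right_mono wt_nonneg) auto
			finally show "norm (F (X n @ [z])) \<le> K * wt s z" .
		qed
		show "(%n. cint c (%z. F (X n @ [z]))) \<longlonglongrightarrow> cint c (%z. F (xs @ [z]))" unfolding cint_def
		proof (rule dominated_tendsto)
			show "open (params c)" using c by (simp add: contour_def)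
			show "continuous_on (params c) (%t. dens c t *\<^sub>C F (X n @ [pnt c t]))" for n
				by (rule integrand_on_lift(1)[OF c s le])
			show "continuous_on (params c) (%t. dens c t *\<^sub>C F (xs @ [pnt c t]))"
				by (rule integrand_on_lift(1)[OF c s slice[OF xs]])
			show "(%t. K * (cmod (dens c t) * wt s (pnt c t))) integrable_on params c"
				by (rule integrand_on_lift(3)[OF c s le])
			show "norm (dens c t *\<^sub>C F (X n @ [pnt c t])) \<le> K * (cmod (dens c t) * wt s (pnt c t))"
				if "t \<in> params c" for n t by (rule integrand_on_lift(2)[OF c s le that])
			show "(%n. dens c t *\<^sub>C F (X n @ [pnt c t])) \<longlonglongrightarrow> dens c t *\<^sub>C F (xs @ [pnt c t])"
				if "t \<in> params c" for t
			proof (intro tendsto_intros seqcontD[of "loci (cs @ [c])"])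
				show "seqcont (loci (cs @ [c])) F" using F by (simp add: integrand_def)
				show "X n @ [pnt c t] \<in> loci (cs @ [c])" for n
					using X pnt_locus[OF that] by (simp add: append_in_listset)
				show "xs @ [pnt c t] \<in> loci (cs @ [c])" using xs pnt_locus[OF that] by (simp add: append_in_listset)
				show "list_lim (%n. X n @ [pnt c t]) (xs @ [pnt c t])" by (intro list_lim_append lim list_lim_const)
			qed
		qed
	qed
qed

abbreviation masses :: "real => contour list => real" where
	"masses s cs \<equiv> prod_list (map (mass s) cs)"

lemma integrand_iter:
	assumes "\<forall>c\<in>set (cs1 @ cs2). contour c" "s > 0" "integrand s C (cs1 @ cs2) F"
	shows "integrand s (C * masses s cs2) cs1 (%xs. iter cs2 (%ys. F (xs @ ys)))" using assms
proof (induction cs2 arbitrary: cs1)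
	case Nil
	then show ?case by simp
next
	case (Cons c cs2)
	have "integrand s (C * masses s cs2) (cs1 @ [c]) (%xs. iter cs2 (%ys. F (xs @ ys)))"
		by (rule Cons.IH) (use Cons.prems in auto)
	then have "integrand s (C * masses s cs2 * mass s c) cs1
			(%xs. cint c (%z. iter cs2 (%ys. F ((xs @ [z]) @ ys))))"
		by (intro integrand_cint_last[where F = "%xs. iter cs2 (%ys. F (xs @ ys))"]) (use Cons.prems in auto)
	then show ?case by (simp add: mult_ac)
qed

lemma iter_cong: "(\<And>zs. zs \<in> loci cs ==> F zs = G zs) ==> iter cs F = iter cs G"
proof (induction cs arbitrary: F G)
	case (Cons c cs)
	have "iter cs (%zs. F (z # zs)) = iter cs (%zs. G (z # zs))" if "z \<in> locus c" for z
		by (rule Cons.IH) (use that Cons.prems in auto)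
	then show ?case by (auto intro!: cint_cong)
qed auto

lemma iterated_integral_append:
	"iterated_integral (Ls1 @ Ls2) F = iterated_integral Ls1 (%xs. iterated_integral Ls2 (%ys. F (xs @ ys)))"
	by (induction Ls1 arbitrary: F) simp_all

lemma cint_swap:
	fixes F :: "complex list => 'b::complex_banach"
	assumes c: "contour c" and d: "contour d" and s: "s > 0" and F: "integrand s C [c, d] F"
	shows "cint c (%z. cint d (%w. F [z, w])) = cint d (%w. cint c (%z. F [z, w]))"
proof -
	let ?U = "%si ta. dens c si *\<^sub>C dens d ta *\<^sub>C F [pnt c si, pnt d ta]"
	have mem: "[z, w] \<in> loci [c, d]" if "z \<in> locus c" "w \<in> locus d" for z w using that by simp
	have on_d: "integrand_on s (C * wt s z) d (%w. F [z, w])" if "z \<in> locus c" for z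
		using integrand_on_slice[of s C "[c]" d "[]" F "[z]" "[]"] F that by simp
	have on_c: "integrand_on s (C * wt s w) c (%z. F [z, w])" if "w \<in> locus d" for w
		using integrand_on_slice[of s C "[]" c "[d]" F "[]" "[w]"] F that by simp
	have ne: "pnt c si ~= 0" "pnt d ta ~= 0" if "si \<in> params c" "ta \<in> params d" for si ta
		using c d that pnt_locus by (metis contour_def)+
	have swap: "integral (params c) (%si. integral (params d) (?U si)) =
			integral (params d) (%ta. integral (params c) (%si. ?U si ta))"
	proof (rule dominated_fubini)
		\<comment> \<open>The constant \<open>C\<close> of an integrand may have any sign, whereas the
		  majorants for Fubini have to be nonnegative; hence the absolute value.\<close>
		let ?m = "%si. \<bar>C\<bar> * (cmod (dens c si) * wt s (pnt c si))"
		let ?k = "%ta. cmod (dens d ta) * wt s (pnt d ta)"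
		show "open (params c)" "open (params d)" using c d by (auto simp: contour_def)
		show "?m integrable_on params c" using c s by (intro integrable_on_mult_right) (simp add: contour_def)
		show "?k integrable_on params d" using d s by (simp add: contour_def)
		show "continuous_on (params c) ?m" "continuous_on (params d) ?k"
			using c d by (intro continuous_intros continuous_on_wt; auto simp: contour_def locus_def)+
		show "0 \<le> ?m si" "0 \<le> ?k si" for si by (simp_all add: wt_nonneg)
		show "norm (?U si ta) \<le> ?m si * ?k ta" if "si \<in> params c" "ta \<in> params d" for si ta
		proof -
			have "norm (F [pnt c si, pnt d ta]) \<le> C * wt s (pnt c si) * wt s (pnt d ta)"
				using on_d[OF pnt_locus[OF that(1)]] pnt_locus[OF that(2)] by (simp add: integrand_on_def)
			also have "... \<le> \<bar>C\<bar> * wt s (pnt c si) * wt s (pnt d ta)" by (intro mult_right_mono wt_nonneg) auto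
			finally have "cmod (dens c si) * (cmod (dens d ta) * norm (F [pnt c si, pnt d ta]))
					\<le> cmod (dens c si) * (cmod (dens d ta) * (\<bar>C\<bar> * wt s (pnt c si) * wt s (pnt d ta)))"
				by (intro mult_left_mono) auto
			then show ?thesis by (simp add: norm_scaleC mult_ac)
		qed
		show "continuous_on (params c \<times> params d) (%(si, ta). ?U si ta)" unfolding continuous_on_sequentially o_def
		proof (intro allI ballI impI, elim conjE)
			fix p :: "nat => real \<times> real" and a
			assume a: "a \<in> params c \<times> params d" and p: "\<forall>n. p n \<in> params c \<times> params d" and lim: "p \<longlonglongrightarrow> a"
			have pc: "\<And>n. fst (p n) \<in> params c" and pd: "\<And>n. snd (p n) \<in> params d"
				using p by (auto simp: mem_Times_iff)
			have ac: "fst a \<in> params c" and ad: "snd a \<in> params d" using a by (auto simp: mem_Times_iff)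
			have l1: "(%n. fst (p n)) \<longlonglongrightarrow> fst a" and l2: "(%n. snd (p n)) \<longlonglongrightarrow> snd a"
				using lim by (auto intro: tendsto_fst tendsto_snd)
			have seq: "(%n. f (q n)) \<longlonglongrightarrow> f b" if "continuous_on A f" "\<And>n. q n \<in> A" "b \<in> A" "q \<longlonglongrightarrow> b"
				for A :: "real set" and f :: "real => complex" and q b
				using that unfolding continuous_on_sequentially o_def by blast
			have "(%n. ?U (fst (p n)) (snd (p n))) \<longlonglongrightarrow> ?U (fst a) (snd a)"
			proof (intro tendsto_scaleC)
				show "(%n. dens c (fst (p n))) \<longlonglongrightarrow> dens c (fst a)"
					using c by (intro seq[OF _ pc ac l1]) (simp add: contour_def)
				show "(%n. dens d (snd (p n))) \<longlonglongrightarrow> dens d (snd a)"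
					using d by (intro seq[OF _ pd ad l2]) (simp add: contour_def)
				have "(%n. pnt c (fst (p n))) \<longlonglongrightarrow> pnt c (fst a)"
					using c by (intro seq[OF _ pc ac l1]) (simp add: contour_def)
				moreover have "(%n. pnt d (snd (p n))) \<longlonglongrightarrow> pnt d (snd a)"
					using d by (intro seq[OF _ pd ad l2]) (simp add: contour_def)
				ultimately show "(%n. F [pnt c (fst (p n)), pnt d (snd (p n))]) \<longlonglongrightarrow> F [pnt c (fst a), pnt d (snd a)]"
					using F by (intro seqcontD[of "loci [c, d]"] mem pnt_locus pc pd ac ad
							list_lim_Cons list_lim_const) (auto simp: integrand_def)
			qed
			then show "(%n. case p n of (si, ta) => ?U si ta) \<longlonglongrightarrow> (case a of (si, ta) => ?U si ta)"
				by (simp add: case_prod_unfold)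
		qed
	qed
	have pull: "integral (params e) (%t. b *\<^sub>C (dens e t *\<^sub>C G (pnt e t))) = b *\<^sub>C cint e G"
		if "contour e" "integrand_on s K e G" for e b K and G :: "complex => 'b"
		using integral_linear[OF integrand_on_lift(4)[OF that(1) s that(2)] bounded_linear_scaleC[of b]]
		by (simp add: cint_def o_def)
	have "cint c (%z. cint d (%w. F [z, w])) = integral (params c) (%si. integral (params d) (?U si))"
		unfolding cint_def[of c] by (rule integral_cong) (simp add: pull[OF d on_d[OF pnt_locus]])
	also have "... = integral (params d) (%ta. integral (params c) (%si. ?U si ta))" by (rule swap)
	also have "... = integral (params d) (%ta. dens d ta *\<^sub>C cint c (%z. F [z, pnt d ta]))"
	proof (rule integral_cong)
		fix ta assume "ta \<in> params d"
		have "integral (params c) (%si. ?U si ta)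
				= integral (params c) (%si. dens d ta *\<^sub>C (dens c si *\<^sub>C F [pnt c si, pnt d ta]))"
			by (simp add: scaleC_scaleC mult.commute)
		also have "... = dens d ta *\<^sub>C cint c (%z. F [z, pnt d ta])"
			by (rule pull[OF c on_c[OF pnt_locus[OF \<open>ta \<in> params d\<close>]]])
		finally show "integral (params c) (%si. ?U si ta) = dens d ta *\<^sub>C cint c (%z. F [z, pnt d ta])" .
	qed
	finally show ?thesis unfolding cint_def[of d] .
qed

text \<open>The expression with \<open>take\<close> and \<open>drop\<close> inserts \<open>w\<close>
  at the position of \<open>c\<close>. Freezing a variable costs only its own weight.\<close>

lemma integrand_fix:
	assumes "\<forall>c\<in>set (cs1 @ c # cs2). contour c" "integrand s C (cs1 @ c # cs2) F" "w \<in> locus c"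
	shows "integrand s (C * wt s w) (cs1 @ cs2) (%zs. F (take (length cs1) zs @ w # drop (length cs1) zs))"
	unfolding integrand_def
proof (intro conjI ballI)
	let ?G = "%zs. take (length cs1) zs @ w # drop (length cs1) zs"
	have split: "\<exists>xs ys. zs = xs @ ys \<and> length xs = length cs1 \<and> ?G zs = xs @ w # ys \<and>
			?G zs \<in> loci (cs1 @ c # cs2)" if "zs \<in> loci (cs1 @ cs2)" for zs
	proof -
		have "zs \<in> listset (map locus cs1 @ map locus cs2)" using that by simp
		then obtain xs ys where xy: "zs = xs @ ys" "xs \<in> loci cs1" "ys \<in> loci cs2" by (rule listset_appendE)
		have "length xs = length cs1" using length_listset[OF xy(2)] by simp
		moreover have "xs @ w # ys \<in> listset (map locus cs1 @ locus c # map locus cs2)"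
			using xy assms(3) by (intro append_in_listset) auto
		ultimately show ?thesis using xy(1) by (intro exI[of _ xs] exI[of _ ys]) simp
	qed
	show "norm (F (?G zs)) \<le> C * wt s w * wts s zs" if zs: "zs \<in> loci (cs1 @ cs2)" for zs
	proof -
		obtain xs ys where xy: "zs = xs @ ys" "?G zs = xs @ w # ys" "?G zs \<in> loci (cs1 @ c # cs2)"
			using split[OF zs] by (elim exE conjE) (rule that)
		have "norm (F (?G zs)) \<le> C * wts s (?G zs)"
			by (rule assms(2)[unfolded integrand_def, THEN conjunct2, THEN bspec, OF xy(3)])
		also have "... = C * wt s w * wts s zs" using xy by (simp add: mult_ac)
		finally show ?thesis .
	qed
	show "seqcont (loci (cs1 @ cs2)) (%zs. F (?G zs))" unfolding seqcont_def
	proof (intro allI impI)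
		fix X zs assume X: "\<forall>n. X n \<in> loci (cs1 @ cs2)" "zs \<in> loci (cs1 @ cs2)" "list_lim X zs"
		have lim: "list_lim (%n. ?G (X n)) (?G zs)" using X(3) unfolding list_lim_def
			by (auto simp: nth_append min_def nth_Cons split: nat.splits)
		show "(%n. F (?G (X n))) \<longlonglongrightarrow> F (?G zs)"
			by (rule seqcontD[OF _ _ _ lim]) (use assms(2) X split in \<open>auto simp: integrand_def\<close>)
	qed
qed

lemma integrand_prefix:
	assumes "integrand s C (cs1 @ cs2) F" "xs \<in> loci cs1"
	shows "integrand s (C * wts s xs) cs2 (%ys. F (xs @ ys))" unfolding integrand_def
proof (intro conjI ballI)
	have mem: "xs @ ys \<in> loci (cs1 @ cs2)" if "ys \<in> loci cs2" for ys
		using that assms(2) by (simp add: append_in_listset)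
	show "norm (F (xs @ ys)) \<le> C * wts s xs * wts s ys" if "ys \<in> loci cs2" for ys
		using assms(1) mem[OF that] by (auto simp: integrand_def mult_ac)
	show "seqcont (loci cs2) (%ys. F (xs @ ys))" unfolding seqcont_def
		using assms(1) mem by (auto simp: integrand_def intro!: seqcontD[of "loci (cs1 @ cs2)" F]
				list_lim_append list_lim_const)
qed

text \<open>The outer integral is exchanged with the next one by the case of two variables, and then
  with the rest by induction, the second variable being frozen.\<close>

lemma cint_iter_swap:
	assumes "\<forall>d\<in>set (c # cs). contour d" "s > 0" "integrand s C (c # cs) F"
	shows "cint c (%z. iter cs (%zs. F (z # zs))) = iter cs (%zs. cint c (%z. F (z # zs)))" using assms
proof (induction cs arbitrary: F C)
	case Nil
	then show ?case by simp
next
	case (Cons d cs)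
	let ?H = "%xs. iter cs (%zs. F (xs @ zs))"
	have "integrand s (C * masses s cs) [c, d] ?H" by (rule integrand_iter) (use Cons.prems in auto)
	then have "cint c (%z. cint d (%w. ?H [z, w])) = cint d (%w. cint c (%z. ?H [z, w]))"
		using Cons.prems by (intro cint_swap[where F = ?H]) auto
	also have "... = cint d (%w. iter cs (%zs. cint c (%z. F (z # w # zs))))"
	proof (rule cint_cong)
		fix w assume w: "w \<in> locus d"
		let ?G = "%zs. F (take (length [c]) zs @ w # drop (length [c]) zs)"
		have "integrand s (C * wt s w) ([c] @ cs) ?G" by (rule integrand_fix) (use Cons.prems w in auto)
		then have "cint c (%z. iter cs (%zs. ?G (z # zs))) = iter cs (%zs. cint c (%z. ?G (z # zs)))"
			using Cons.prems by (intro Cons.IH) auto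
		then show "cint c (%z. ?H [z, w]) = iter cs (%zs. cint c (%z. F (z # w # zs)))" by simp
	qed
	finally show ?case by simp
qed

lemma iter_linear:
	assumes "\<forall>c\<in>set cs. contour c" "s > 0" "integrand s C cs F"
		and \<Phi>: "bounded_linear \<Phi>" "\<And>a x. \<Phi> (a *\<^sub>C x) = a *\<^sub>C \<Phi> x"
	shows "iter cs (%zs. \<Phi> (F zs)) = \<Phi> (iter cs F)" using assms(1,3)
proof (induction cs arbitrary: F C)
	case Nil
	then show ?case by simp
next
	case (Cons c cs)
	have "iter cs (%zs. \<Phi> (F (z # zs))) = \<Phi> (iter cs (%zs. F (z # zs)))" if "z \<in> locus c" for z by (rule Cons.IH)
			(use Cons.prems that integrand_prefix[of s C "[c]" cs F "[z]"] in auto)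
	then have "cint c (%z. iter cs (%zs. \<Phi> (F (z # zs)))) = cint c (%z. \<Phi> (iter cs (%zs. F (z # zs))))"
		by (rule cint_cong)
	also have "... = \<Phi> (cint c (%z. iter cs (%zs. F (z # zs))))"
	proof (rule cint_linear[OF _ assms(2) _ \<Phi>])
		have "integrand s (C * masses s cs) [c] (%xs. iter cs (%zs. F (xs @ zs)))"
			by (rule integrand_iter) (use Cons.prems assms(2) in auto)
		then have "integrand s (C * masses s cs) ([] @ c # []) (%xs. iter cs (%zs. F (xs @ zs)))" by simp
		from integrand_on_slice[OF this, of "[]" "[]"]
		show "integrand_on s (C * masses s cs) c (%z. iter cs (%zs. F (z # zs)))" by simp
	qed (use Cons.prems in auto)
	finally show ?case by simp
qed

lemma integrand_on_iter:
	assumes "\<forall>d\<in>set (c # cs). contour d" "s > 0" "integrand s C (c # cs) F"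
	shows "integrand_on s (C * masses s cs) c (%z. iter cs (%zs. F (z # zs)))"
proof -
	have "integrand s (C * masses s cs) ([] @ c # []) (%xs. iter cs (%zs. F (xs @ zs)))"
		using integrand_iter[of "[c]" cs s C F] assms by simp
	from integrand_on_slice[OF this, of "[]" "[]"] show ?thesis by simp
qed

lemma iter_add:
	assumes "\<forall>c\<in>set cs. contour c" "s > 0" "integrand s C cs F" "integrand s D cs G"
	shows "iter cs (%zs. F zs + G zs) = iter cs F + iter cs G" using assms(1,3,4)
proof (induction cs arbitrary: F G C D)
	case Nil
	then show ?case by simp
next
	case (Cons c cs)
	have "iter cs (%zs. F (z # zs) + G (z # zs)) = iter cs (%zs. F (z # zs)) + iter cs (%zs. G (z # zs))"
		if "z \<in> locus c" for z by (rule Cons.IH) (use Cons.prems that integrand_prefix[of s C "[c]" cs F "[z]"]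
				integrand_prefix[of s D "[c]" cs G "[z]"] in auto)
	then have "cint c (%z. iter cs (%zs. F (z # zs) + G (z # zs)))
			= cint c (%z. iter cs (%zs. F (z # zs)) + iter cs (%zs. G (z # zs)))" by (rule cint_cong)
	also have "... = cint c (%z. iter cs (%zs. F (z # zs))) + cint c (%z. iter cs (%zs. G (z # zs)))"
		using Cons.prems by (intro cint_add[OF _ assms(2) integrand_on_iter[OF _ assms(2) Cons.prems(2)]
					integrand_on_iter[OF _ assms(2) Cons.prems(3)]]) auto
	finally show ?case by simp
qed

text \<open>The integral to be replaced is moved to the innermost place, where all other variables
  are fixed and the one-variable equality applies, and is then moved back. The two integrands may
  have different decay exponents.\<close>

lemma iter_replace_at:
	assumes cs: "\<forall>d\<in>set (cs1 @ c # cs2). contour d" "contour c'" and s: "s > 0" "s' > 0"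
		and F: "integrand s C (cs1 @ c # cs2) F" and F': "integrand s' C' (cs1 @ c' # cs2) F'"
		and eq: "\<And>xs ys. xs \<in> loci cs1 ==> ys \<in> loci cs2 ==>
			cint c (%z. F (xs @ z # ys)) = cint c' (%z. F' (xs @ z # ys))"
	shows "iter (cs1 @ c # cs2) F = iter (cs1 @ c' # cs2) F'"
proof -
	have "cint c (%z. iter cs2 (%ys. F (xs @ z # ys))) = cint c' (%z. iter cs2 (%ys. F' (xs @ z # ys)))"
		if xs: "xs \<in> loci cs1" for xs
	proof -
		have "cint c (%z. iter cs2 (%ys. F (xs @ z # ys))) = iter cs2 (%ys. cint c (%z. F (xs @ z # ys)))"
			using cint_iter_swap[OF _ s(1) integrand_prefix[OF F xs]] cs by auto
		also have "... = iter cs2 (%ys. cint c' (%z. F' (xs @ z # ys)))" by (intro iter_cong eq xs)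
		also have "... = cint c' (%z. iter cs2 (%ys. F' (xs @ z # ys)))"
			using cint_iter_swap[OF _ s(2) integrand_prefix[OF F' xs]] cs by auto
		finally show ?thesis .
	qed
	then have "iter cs1 (%xs. cint c (%z. iter cs2 (%ys. F (xs @ z # ys))))
			= iter cs1 (%xs. cint c' (%z. iter cs2 (%ys. F' (xs @ z # ys))))" by (rule iter_cong)
	then show ?thesis by (simp add: iterated_integral_append)
qed

lemma integrand_subset:
	assumes "integrand s C cs F" "loci cs' \<subseteq> loci cs"
	shows "integrand s C cs' F" using assms unfolding integrand_def seqcont_def by blast

lemma iter_split_at:
	assumes cs: "\<forall>d\<in>set (cs1 @ c # cs2). contour d" "contour c1" "contour c2" and s: "s > 0"
		and F: "integrand s C (cs1 @ c # cs2) F" and sub: "locus c1 \<subseteq> locus c" "locus c2 \<subseteq> locus c"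
		and eq: "\<And>C (G :: complex => 'b). integrand_on s C c G ==> cint c G = cint c1 G + cint c2 G"
	shows "iter (cs1 @ c # cs2) (F :: complex list => 'b::complex_banach)
		= iter (cs1 @ c1 # cs2) F + iter (cs1 @ c2 # cs2) F"
proof -
	let ?H = "%c xs. cint c (%z. iter cs2 (%ys. F (xs @ z # ys)))"
	have adm: "integrand s (C * masses s (d # cs2)) cs1 (?H d)"
		if "contour d" "locus d \<subseteq> locus c" for d
	proof -
		have "loci (cs1 @ d # cs2) \<subseteq> loci (cs1 @ c # cs2)"
			using that by (intro listset_mono) (auto intro!: list_all2_appendI list.rel_refl)
		then have "integrand s C (cs1 @ d # cs2) F" by (rule integrand_subset[OF F])
		then have "integrand s (C * masses s (d # cs2)) cs1 (%xs. iter (d # cs2) (%ys. F (xs @ ys)))"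
			using cs s that by (intro integrand_iter) auto
		then show ?thesis by simp
	qed
	have "?H c xs = ?H c1 xs + ?H c2 xs" if xs: "xs \<in> loci cs1" for xs
		by (rule eq, rule integrand_on_iter[OF _ s integrand_prefix[OF F xs]]) (use cs in auto)
	then have "iter cs1 (?H c) = iter cs1 (%xs. ?H c1 xs + ?H c2 xs)" by (rule iter_cong)
	also have "... = iter cs1 (?H c1) + iter cs1 (?H c2)" using cs s sub by (intro iter_add[OF _ s adm adm]) auto
	finally show ?thesis by (simp add: iterated_integral_append)
qed

text \<open>Makes a middle variable the outermost one, for an estimate in which that variable acts
  as a parameter of the remaining calculus.\<close>

lemma iter_pull_front:
	assumes cs: "\<forall>d\<in>set (cs1 @ c # cs2). contour d" and s: "s > 0" and F: "integrand s C (cs1 @ c # cs2) F"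
	shows "iter (cs1 @ c # cs2) F = cint c (%z. iter cs1 (%xs. iter cs2 (%ys. F (xs @ z # ys))))"
proof -
	\<comment> \<open>The arguments are rotated, with the variable of \<open>c\<close> at the head, so
	  that the exchange of a leading integral with the rest can be used.\<close>
	let ?H = "%zs. iter cs2 (%ys. F (tl zs @ hd zs # ys))"
	have H: "integrand s (C * masses s cs2) (cs1 @ [c]) (%xs. iter cs2 (%ys. F (xs @ ys)))"
		using cs s F by (intro integrand_iter) auto
	have "integrand s (C * masses s cs2) (c # cs1) (%zs. iter cs2 (%ys. F ((tl zs @ [hd zs]) @ ys)))"
		unfolding integrand_def
	proof (intro conjI ballI)
		have mem: "tl zs @ [hd zs] \<in> loci (cs1 @ [c])" if "zs \<in> loci (c # cs1)" for zs
			using that by (auto elim!: listset_ConsE simp: append_in_listset)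
		show "norm (iter cs2 (%ys. F ((tl zs @ [hd zs]) @ ys))) \<le> C * masses s cs2 * wts s zs"
			if "zs \<in> loci (c # cs1)" for zs
		proof -
			have "norm (iter cs2 (%ys. F ((tl zs @ [hd zs]) @ ys))) \<le> C * masses s cs2 * wts s (tl zs @ [hd zs])"
				using H mem[OF that] unfolding integrand_def by blast
			also have "wts s (tl zs @ [hd zs]) = wts s zs" using that by (auto elim!: listset_ConsE)
			finally show ?thesis .
		qed
		show "seqcont (loci (c # cs1)) (%zs. iter cs2 (%ys. F ((tl zs @ [hd zs]) @ ys)))" unfolding seqcont_def
		proof (intro allI impI)
			fix X zs assume X: "\<forall>n. X n \<in> loci (c # cs1)" "zs \<in> loci (c # cs1)" "list_lim X zs"
			have "length (X n) = Suc (length cs1)" for n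
				using X(1) length_listset[of "X n" "map locus (c # cs1)"] by simp
			moreover have "length zs = Suc (length cs1)"
				using X(2) length_listset[of zs "map locus (c # cs1)"] by simp
			ultimately have ne: "X n ~= []" "zs ~= []" for n by (metis length_0_conv nat.distinct(1))+
			have tl: "list_lim (%n. tl (X n)) (tl zs)" using X(3) by (simp add: list_lim_def nth_tl)
			have "0 < length zs" using ne by simp
			then have hd: "list_lim (%n. [hd (X n)]) [hd zs]"
				using X(3) ne unfolding list_lim_def by (simp add: hd_conv_nth)
			show "(%n. iter cs2 (%ys. F ((tl (X n) @ [hd (X n)]) @ ys))) \<longlonglongrightarrow>
					iter cs2 (%ys. F ((tl zs @ [hd zs]) @ ys))"
			proof (rule seqcontD[where F = "%xs. iter cs2 (%ys. F (xs @ ys))"])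
				show "seqcont (loci (cs1 @ [c])) (%xs. iter cs2 (%ys. F (xs @ ys)))"
					using H by (simp add: integrand_def)
				show "tl (X n) @ [hd (X n)] \<in> loci (cs1 @ [c])" for n using X mem by blast
				show "tl zs @ [hd zs] \<in> loci (cs1 @ [c])" using X mem by blast
				show "list_lim (%n. tl (X n) @ [hd (X n)]) (tl zs @ [hd zs])" by (rule list_lim_append[OF tl hd])
			qed
		qed
	qed
	then have "integrand s (C * masses s cs2) (c # cs1) ?H" by simp
	then have "cint c (%z. iter cs1 (%zs. ?H (z # zs))) = iter cs1 (%zs. cint c (%z. ?H (z # zs)))"
		using cs s by (intro cint_iter_swap[where F = ?H]) auto
	then show ?thesis by (simp add: iterated_integral_append)
qed

section \<open>Holomorphic functions of several variables\<close>

text \<open>Holomorphy in each variable separately. This is the form to which the one-variable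
  theory applies; for bounded functions on products of open sets it agrees with
  \<open>multi_holomorphic_on\<close>.\<close>

definition sep_holo :: "(complex list => complex) => complex set list => bool" where
	"sep_holo f Ds \<longleftrightarrow> (\<forall>As D Bs xs ys. Ds = As @ D # Bs --> xs \<in> listset As --> ys \<in> listset Bs -->
		 (%z. f (xs @ z # ys)) holomorphic_on D)"

lemma sep_holo_slice:
	"sep_holo f (As @ D # Bs) ==> xs \<in> listset As ==> ys \<in> listset Bs ==> (%z. f (xs @ z # ys)) holomorphic_on D"
	by (simp add: sep_holo_def)

lemma sep_holo_Cons_tail:
	assumes "sep_holo f (D # Ds)" "z \<in> D"
	shows "sep_holo (%zs. f (z # zs)) Ds" unfolding sep_holo_def
proof (intro allI impI)
	fix As E Bs xs ys
	assume "Ds = As @ E # Bs" "xs \<in> listset As" "ys \<in> listset Bs"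
	then show "(%w. f (z # xs @ w # ys)) holomorphic_on E"
		using sep_holo_slice[of f "D # As" E Bs "z # xs" ys] assms by simp
qed

text \<open>Cauchy's estimates on discs of radius R/4 centred in the half disc bound the first
  derivative by 4B/R and the second by 2B/(R/4)^2 = 32B/R^2.\<close>

lemma lipschitz_of_bounded_holomorphic:
	assumes f: "f holomorphic_on ball z R" and B: "\<And>w. w \<in> ball z R ==> cmod (f w) \<le> B"
		and R: "R > 0" and w: "w \<in> cball z (R / 2)" "w' \<in> cball z (R / 2)"
	shows "cmod (f w - f w') \<le> 4 * B / R * cmod (w - w')"
		and "cmod (f w - f z - deriv f z * (w - z)) \<le> 32 * B / R\<^sup>2 * (cmod (w - z))\<^sup>2"
proof -
	have sub: "cball \<xi> (R / 4) \<subseteq> ball z R" if "\<xi> \<in> cball z (R / 2)" for \<xi>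
	proof
		fix x assume "x \<in> cball \<xi> (R / 4)"
		then show "x \<in> ball z R" using that R dist_triangle[of z x \<xi>] by simp
	qed
	have est: "cmod ((deriv ^^ n) f \<xi>) \<le> fact n * B / (R / 4) ^ n" if "\<xi> \<in> cball z (R / 2)" for n \<xi>
	proof (rule Cauchy_inequality)
		show "f holomorphic_on ball \<xi> (R / 4)" by (rule holomorphic_on_subset[OF f]) (use sub[OF that] in force)
		show "continuous_on (cball \<xi> (R / 4)) f"
			by (rule continuous_on_subset[OF holomorphic_on_imp_continuous_on[OF f] sub[OF that]])
		show "0 < R / 4" using R by simp
		show "cmod (f x) \<le> B" if "cmod (\<xi> - x) = R / 4" for x
			using B sub[OF \<open>\<xi> \<in> cball z (R / 2)\<close>] that by (auto simp: dist_norm)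
	qed
	have der: "((deriv ^^ n) f has_field_derivative (deriv ^^ Suc n) f \<xi>) (at \<xi> within cball z (R / 2))"
		if "\<xi> \<in> cball z (R / 2)" for n \<xi>
	proof -
		have "(deriv ^^ n) f holomorphic_on ball z R" by (rule holomorphic_higher_deriv[OF f open_ball])
		moreover have "\<xi> \<in> ball z R" using that R by simp
		ultimately show ?thesis using holomorphic_derivI[of "(deriv ^^ n) f" "ball z R" \<xi>]
			by (simp add: has_field_derivative_at_within)
	qed
	show "cmod (f w - f w') \<le> 4 * B / R * cmod (w - w')"
	proof (rule field_differentiable_bound[OF convex_cball _ _ w])
		show "(f has_field_derivative deriv f \<xi>) (at \<xi> within cball z (R / 2))"
			if "\<xi> \<in> cball z (R / 2)" for \<xi> using der[OF that, of 0] by simp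
		show "cmod (deriv f \<xi>) \<le> 4 * B / R" if "\<xi> \<in> cball z (R / 2)" for \<xi>
			using est[OF that, of 1] by (simp add: mult.commute)
	qed
	have "cmod ((deriv ^^ 0) f w - (\<Sum>i\<le>1. (deriv ^^ i) f z * (w - z) ^ i / fact i))
			\<le> 32 * B / R\<^sup>2 * cmod (w - z) ^ Suc 1 / fact 1"
	proof (rule complex_Taylor[OF convex_cball])
		show "cmod ((deriv ^^ Suc 1) f \<xi>) \<le> 32 * B / R\<^sup>2" if "\<xi> \<in> cball z (R / 2)" for \<xi>
			using est[OF that, of "Suc 1"] by (simp add: power2_eq_square field_simps)
		show "((deriv ^^ i) f has_field_derivative (deriv ^^ Suc i) f x) (at x within cball z (R / 2))"
			if "x \<in> cball z (R / 2)" "i \<le> 1" for i x using der that by blast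
	qed (use R w in auto)
	then show "cmod (f w - f z - deriv f z * (w - z)) \<le> 32 * B / R\<^sup>2 * (cmod (w - z))\<^sup>2"
		by (simp add: power2_eq_square algebra_simps)
qed

section \<open>Osgood's lemma: from separate to joint holomorphy\<close>

definition ldist :: "complex list => complex list => real" where
	"ldist ws zs = (\<Sum>i<length zs. cmod (ws ! i - zs ! i))"

lemma ldist_simps [simp]:
	"ldist [] [] = 0" "ldist (w # ws) (z # zs) = cmod (w - z) + ldist ws zs"
	unfolding ldist_def by (simp_all add: sum.lessThan_Suc_shift del: sum.lessThan_Suc)

lemma ldist_nonneg: "0 \<le> ldist ws zs" by (simp add: ldist_def sum_nonneg)

abbreviation poly_inside :: "real => complex list => complex set list => bool" where
	"poly_inside R zs Ds \<equiv> list_all2 (%z D. ball z R \<subseteq> D) zs Ds"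

abbreviation poly_near :: "real => complex list => complex list => bool" where
	"poly_near r ws zs \<equiv> list_all2 (%w z. cmod (w - z) \<le> r) ws zs"

lemma poly_inside_near:
	assumes "poly_inside R zs Ds" "poly_near (R / 2) ws zs" "R > 0"
	shows "ws \<in> listset Ds"
proof -
	have "list_all2 (\<in>) ws Ds" using assms(2,1) by (rule list_all2_trans[rotated])
			(use assms(3) in \<open>auto simp: subset_iff dist_norm norm_minus_commute\<close>)
	then show ?thesis by (simp add: in_listset_iff)
qed

lemma poly_near_refl: "r \<ge> 0 ==> poly_near r zs zs" by (simp add: list_all2_same)

text \<open>The coordinates are changed one at a time, each change being estimated by the
  one-variable Lipschitz bound.\<close>

lemma lipschitz_of_sep_holo:
	assumes "R > 0" "poly_inside R zs Ds" "poly_near (R / 2) ws zs"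
		and "sep_holo f Ds" "\<And>xs. xs \<in> listset Ds ==> cmod (f xs) \<le> B"
	shows "cmod (f ws - f zs) \<le> 4 * B / R * ldist ws zs" using assms(2-)
proof (induction Ds arbitrary: f zs ws rule: list.induct)
	case Nil
	have "zs = []" using list_all2_lengthD[OF Nil.prems(1)] by simp
	moreover have "ws = []" using list_all2_lengthD[OF Nil.prems(2)] \<open>zs = []\<close> by simp
	ultimately show ?case by simp
next
	case (Cons D Ds)
	obtain z zs' where zs: "zs = z # zs'" "ball z R \<subseteq> D" "poly_inside R zs' Ds"
		using Cons.prems(1) by (auto simp: list_all2_Cons2)
	obtain w ws' where ws: "ws = w # ws'" "cmod (w - z) \<le> R / 2" "poly_near (R / 2) ws' zs'"
		using Cons.prems(2) zs by (auto simp: list_all2_Cons2)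
	have z: "z \<in> D" using zs(2) assms(1) by auto
	have ws': "ws' \<in> listset Ds" by (rule poly_inside_near[OF zs(3) ws(3) assms(1)])
	have "cmod (f (z # ws') - f (z # zs')) \<le> 4 * B / R * ldist ws' zs'"
		by (rule Cons.IH[OF zs(3) ws(3) sep_holo_Cons_tail[OF Cons.prems(3) z]]) (use Cons.prems(4) z in simp)
	moreover have "cmod (f (w # ws') - f (z # ws')) \<le> 4 * B / R * cmod (w - z)"
	proof (rule lipschitz_of_bounded_holomorphic(1))
		have "(%x. f (x # ws')) holomorphic_on D"
			using sep_holo_slice[of f "[]" D Ds "[]" ws'] Cons.prems(3) ws' by simp
		then show "(%x. f (x # ws')) holomorphic_on ball z R" by (rule holomorphic_on_subset[OF _ zs(2)])
		show "cmod (f (x # ws')) \<le> B" if "x \<in> ball z R" for x using Cons.prems(4) zs(2) ws' that by auto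
		show "w \<in> cball z (R / 2)" using ws(2) by (simp add: dist_norm norm_minus_commute)
	qed (use assms(1) in auto)
	moreover have "cmod (f (w # ws') - f (z # zs'))
			\<le> cmod (f (w # ws') - f (z # ws')) + cmod (f (z # ws') - f (z # zs'))"
		using norm_triangle_ineq[of "f (w # ws') - f (z # ws')" "f (z # ws') - f (z # zs')"] by simp
	ultimately show ?case using zs(1) ws(1) by (simp add: distrib_left)
qed

text \<open>Osgood's lemma: the linear part is assembled one variable at a time; passing from
	\<open>\<partial>\<^sub>1 f (z, ws)\<close> to \<open>\<partial>\<^sub>1 f (z, zs)\<close> costs a Lipschitz constant, by Cauchy's estimate.\<close>

lemma quadratic_approx_of_sep_holo:
	assumes "R > 0" "poly_inside R zs Ds" and "sep_holo f Ds" "\<And>xs. xs \<in> listset Ds ==> cmod (f xs) \<le> B"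
	shows "\<exists>c K. 0 \<le> K \<and> (\<forall>ws. poly_near (R / 2) ws zs -->
		 cmod (f ws - f zs - (\<Sum>i<length zs. c i * (ws ! i - zs ! i))) \<le> K * (ldist ws zs)\<^sup>2)" using assms(2-)
proof (induction Ds arbitrary: f zs rule: list.induct)
	case Nil
	have "zs = []" using list_all2_lengthD[OF Nil.prems(1)] by simp
	then show ?case by (intro exI[of _ "%_. 0"] exI[of _ 0]) (simp add: list_all2_Nil2)
next
	case (Cons D Ds)
	note R = assms(1)
	obtain z zs' where zs: "zs = z # zs'" "ball z R \<subseteq> D" "poly_inside R zs' Ds"
		using Cons.prems(1) by (auto simp: list_all2_Cons2)
	have z: "z \<in> D" using zs(2) R by auto
	have bound: "cmod (f (x # ys)) \<le> B" if "x \<in> D" "ys \<in> listset Ds" for x ys using Cons.prems(3) that by simp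
	have zs': "zs' \<in> listset Ds" by (rule poly_inside_near[OF zs(3) poly_near_refl R]) (use R in simp)
	have B: "B \<ge> 0" using bound[OF z zs'] norm_ge_zero order_trans by blast
	have holo: "(%x. f (x # ys)) holomorphic_on ball z R" if "ys \<in> listset Ds" for ys
		using sep_holo_slice[of f "[]" D Ds "[]" ys] Cons.prems(2) that
		by (auto intro: holomorphic_on_subset[OF _ zs(2)])
	obtain c K where K: "0 \<le> K" and c: "\<And>ws'. poly_near (R / 2) ws' zs' ==>
		 cmod (f (z # ws') - f (z # zs') - (\<Sum>i<length zs'. c i * (ws' ! i - zs' ! i))) \<le> K * (ldist ws' zs')\<^sup>2"
		using Cons.IH[OF zs(3) sep_holo_Cons_tail[OF Cons.prems(2) z]] bound[OF z] by blast
	define d where "d ys = deriv (%x. f (x # ys)) z" for ys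
	define c' where "c' = case_nat (d zs') c"
	\<comment> \<open>The summands bound the remainder in the tail variables, the Taylor remainder in
	  the first variable, and the mixed term. In the latter, Cauchy's estimate on radius R/2 turns the
	  Lipschitz constant 4B/R into 8B/R^2.\<close>
	define K' where "K' = K + 32 * B / R\<^sup>2 + 8 * B / R\<^sup>2"
	have "cmod (f ws - f zs - (\<Sum>i<length zs. c' i * (ws ! i - zs ! i))) \<le> K' * (ldist ws zs)\<^sup>2"
		if near: "poly_near (R / 2) ws zs" for ws
	proof -
		obtain w ws' where ws: "ws = w # ws'" "cmod (w - z) \<le> R / 2" "poly_near (R / 2) ws' zs'"
			using near zs by (auto simp: list_all2_Cons2)
		have ws': "ws' \<in> listset Ds" by (rule poly_inside_near[OF zs(3) ws(3) R])
		define a b where "a = cmod (w - z)" and "b = ldist ws' zs'"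
		have ab: "0 \<le> a" "0 \<le> b" by (simp_all add: a_def b_def ldist_nonneg)
		have 1: "cmod (f (w # ws') - f (z # ws') - d ws' * (w - z)) \<le> 32 * B / R\<^sup>2 * a\<^sup>2" unfolding a_def d_def
		proof (rule lipschitz_of_bounded_holomorphic(2)[OF holo[OF ws'] _ R])
			show "cmod (f (x # ws')) \<le> B" if "x \<in> ball z R" for x using bound zs(2) ws' that by auto
			show "w \<in> cball z (R / 2)" using ws(2) by (simp add: dist_norm norm_minus_commute)
			then show "w \<in> cball z (R / 2)" .
		qed
		have lip: "cmod (f (x # ws') - f (x # zs')) \<le> 4 * B / R * b" if "x \<in> ball z R" for x
		proof -
			have x: "x \<in> D" using that zs(2) by blast
			show ?thesis unfolding b_def
				by (rule lipschitz_of_sep_holo[OF R zs(3) ws(3) sep_holo_Cons_tail[OF Cons.prems(2) x]])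
					(use bound[OF x] in simp)
		qed
		have dd: "d ws' - d zs' = deriv (%x. f (x # ws') - f (x # zs')) z" unfolding d_def
			using holo[OF ws'] holo[OF zs'] R
			by (intro deriv_diff[symmetric]) (auto intro: holomorphic_on_imp_differentiable_at[of _ "ball z R"])
		have "cmod ((deriv ^^ 1) (%x. f (x # ws') - f (x # zs')) z) \<le> fact 1 * (4 * B / R * b) / (R / 2) ^ 1"
		proof (rule Cauchy_inequality)
			have h: "(%x. f (x # ws') - f (x # zs')) holomorphic_on ball z R"
				by (intro holomorphic_on_diff holo ws' zs')
			show "(%x. f (x # ws') - f (x # zs')) holomorphic_on ball z (R / 2)"
				by (rule holomorphic_on_subset[OF h]) (use R in force)
			show "continuous_on (cball z (R / 2)) (%x. f (x # ws') - f (x # zs'))"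
				by (rule continuous_on_subset[OF holomorphic_on_imp_continuous_on[OF h]]) (use R in force)
			show "0 < R / 2" using R by simp
			show "cmod (f (x # ws') - f (x # zs')) \<le> 4 * B / R * b" if "cmod (z - x) = R / 2" for x
				by (rule lip) (use that R in \<open>simp add: dist_norm\<close>)
		qed
		then have "cmod (d ws' - d zs') \<le> 8 * B / R\<^sup>2 * b" unfolding dd by (simp add: power2_eq_square field_simps)
		then have 2: "cmod ((d ws' - d zs') * (w - z)) \<le> 8 * B / R\<^sup>2 * (b * a)"
			unfolding norm_mult a_def mult.assoc[symmetric] by (rule mult_right_mono) simp
		have 3: "cmod (f (z # ws') - f (z # zs') - (\<Sum>i<length zs'. c i * (ws' ! i - zs' ! i))) \<le> K * b\<^sup>2"
			unfolding b_def by (rule c[OF ws(3)])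
		have split: "f ws - f zs - (\<Sum>i<length zs. c' i * (ws ! i - zs ! i))
			 = (f (w # ws') - f (z # ws') - d ws' * (w - z)) + (d ws' - d zs') * (w - z)
			 + (f (z # ws') - f (z # zs') - (\<Sum>i<length zs'. c i * (ws' ! i - zs' ! i)))" unfolding zs(1) ws(1) c'_def
			by (simp add: sum.lessThan_Suc_shift algebra_simps del: sum.lessThan_Suc)
		have "cmod (f ws - f zs - (\<Sum>i<length zs. c' i * (ws ! i - zs ! i)))
			 \<le> 32 * B / R\<^sup>2 * a\<^sup>2 + 8 * B / R\<^sup>2 * (b * a) + K * b\<^sup>2"
			unfolding split using 1 2 3 by (meson add_mono norm_triangle_le)
		also have "... \<le> 32 * B / R\<^sup>2 * (a + b)\<^sup>2 + 8 * B / R\<^sup>2 * (a + b)\<^sup>2 + K * (a + b)\<^sup>2"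
		proof (intro add_mono mult_left_mono)
			show "a\<^sup>2 \<le> (a + b)\<^sup>2" "b\<^sup>2 \<le> (a + b)\<^sup>2" using ab by (auto intro!: power_mono)
			have "b * a \<le> (a + b) * (a + b)" using ab by (intro mult_mono) auto
			then show "b * a \<le> (a + b)\<^sup>2" by (simp add: power2_eq_square)
		qed (use B K in auto)
		also have "... = K' * (ldist ws zs)\<^sup>2" unfolding zs(1) ws(1) K'_def a_def b_def by (simp add: algebra_simps)
		finally show ?thesis .
	qed
	moreover have "0 \<le> K'" unfolding K'_def using K B by simp
	ultimately show ?case by blast
qed

lemma poly_inside_exists:
	assumes "\<forall>D\<in>set Ds. open D" "zs \<in> listset Ds"
	shows "\<exists>R>0. poly_inside R zs Ds" using assms
proof (induction Ds arbitrary: zs)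
	case Nil
	then show ?case by (auto intro: exI[of _ 1])
next
	case (Cons D Ds)
	obtain z zs' where zs: "zs = z # zs'" "z \<in> D" "zs' \<in> listset Ds" using Cons.prems(2) by (rule listset_ConsE)
	obtain R where R: "R > 0" "poly_inside R zs' Ds" using Cons.IH[OF _ zs(3)] Cons.prems(1) by auto
	obtain r where r: "r > 0" "ball z r \<subseteq> D" using Cons.prems(1) zs(2) open_contains_ball[of D] by auto
	have "poly_inside (min r R) zs' Ds" using R(2) by (rule list_all2_mono) (auto simp: subset_iff)
	moreover have "ball z (min r R) \<subseteq> D" using r(2) by (auto simp: subset_iff)
	ultimately show ?case using zs(1) r(1) R(1) by (intro exI[of _ "min r R"]) simp
qed

text \<open>A remainder quadratic in the distance is below any given multiple of the distance once
  the points are close.\<close>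

lemma multi_holomorphic_of_sep_holo:
	assumes op: "\<forall>D\<in>set Ds. open D" and f: "sep_holo f Ds" and B: "\<And>xs. xs \<in> listset Ds ==> cmod (f xs) \<le> B"
	shows "multi_holomorphic_on f (listset Ds)" unfolding multi_holomorphic_on_def
proof
	fix zs assume "zs \<in> listset Ds"
	then obtain R where R: "R > 0" "poly_inside R zs Ds" using poly_inside_exists[OF op] by blast
	obtain c K where K: "0 \<le> K" and c: "\<And>ws. poly_near (R / 2) ws zs ==>
		 cmod (f ws - f zs - (\<Sum>i<length zs. c i * (ws ! i - zs ! i))) \<le> K * (ldist ws zs)\<^sup>2"
		using quadratic_approx_of_sep_holo[OF R f B] by blast
	show "\<exists>c. \<forall>ep>0. \<exists>de>0. \<forall>ws\<in>listset Ds. length ws = length zs --> (\<forall>i<length zs. cmod (ws ! i - zs ! i) < de) -->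
				cmod (f ws - f zs - (\<Sum>i<length zs. c i * (ws ! i - zs ! i)))
					\<le> ep * (\<Sum>i<length zs. cmod (ws ! i - zs ! i))"
	proof (intro exI[of _ c] allI impI)
		fix ep :: real assume ep: "ep > 0"
		define n where "n = real (length zs)"
		\<comment> \<open>With n coordinates each closer than \<open>de\<close> the distance is at most n
		  de, and K n de is at most ep; the 1 keeps the denominator positive. The bound R/2 keeps the
		  points in the polydisc of the quadratic estimate.\<close>
		define de where "de = min (R / 2) (ep / (K * n + 1))"
		have pos: "K * n + 1 > 0" using K by (simp add: n_def add_nonneg_pos)
		have de: "de > 0" "de \<le> R / 2" "de \<le> ep / (K * n + 1)" unfolding de_def using R ep pos by (simp_all only: min.cobounded1 min.cobounded2 min_less_iff_conj) simp_all
		have "K * n * de \<le> K * n * (ep / (K * n + 1))" using de(3) K by (intro mult_left_mono) (auto simp: n_def)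
		also have "... \<le> ep" using pos ep by (simp add: field_simps)
		finally have Kn: "K * n * de \<le> ep" .
		show "\<exists>de>0. \<forall>ws\<in>listset Ds. length ws = length zs --> (\<forall>i<length zs. cmod (ws ! i - zs ! i) < de) -->
				cmod (f ws - f zs - (\<Sum>i<length zs. c i * (ws ! i - zs ! i)))
					\<le> ep * (\<Sum>i<length zs. cmod (ws ! i - zs ! i))"
		proof (intro exI[of _ de] conjI ballI impI de(1))
			fix ws assume len: "length ws = length zs" and close: "\<forall>i<length zs. cmod (ws ! i - zs ! i) < de"
			have near: "poly_near (R / 2) ws zs"
				unfolding list_all2_conv_all_nth using len close de(2) by (auto intro: order_trans less_imp_le)
			have "ldist ws zs \<le> n * de" unfolding ldist_def n_def
				using sum_bounded_above[of "{..<length zs}" "%i. cmod (ws ! i - zs ! i)" de] close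
				by (auto intro: less_imp_le)
			then have "K * ldist ws zs \<le> ep"
				using Kn K mult_left_mono[of "ldist ws zs" "n * de" K] by (simp add: mult.assoc)
			then have "K * (ldist ws zs)\<^sup>2 \<le> ep * ldist ws zs"
				unfolding power2_eq_square mult.assoc[symmetric] by (rule mult_right_mono[OF _ ldist_nonneg])
			then show "cmod (f ws - f zs - (\<Sum>i<length zs. c i * (ws ! i - zs ! i)))
					\<le> ep * (\<Sum>i<length zs. cmod (ws ! i - zs ! i))"
				using c[OF near] unfolding ldist_def by (rule order_trans[rotated])
		qed
	qed
qed

text \<open>The lists differ in a single place. \<open>G\<close> is general because the sum is
  needed both for the linear part and for the moduli.\<close>

lemma sum_nth_one_coordinate:
	fixes G :: "nat => complex => 'a::comm_monoid_add"
	assumes "\<And>i. G i 0 = 0"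
	shows "(\<Sum>i<length (xs @ z # ys). G i ((xs @ w # ys) ! i - (xs @ z # ys) ! i)) = G (length xs) (w - z)"
proof -
	have "(\<Sum>i<length (xs @ z # ys). G i ((xs @ w # ys) ! i - (xs @ z # ys) ! i))
			= (\<Sum>i<length (xs @ z # ys). if i = length xs then G (length xs) (w - z) else 0)"
		by (rule sum.cong) (auto simp: nth_append nth_Cons assms split: nat.splits)
	then show ?thesis by simp
qed

lemma sep_holo_of_multi_holomorphic:
	assumes "multi_holomorphic_on f (listset Ds)"
	shows "sep_holo f Ds" unfolding sep_holo_def
proof (intro allI impI)
	fix As D Bs xs ys
	assume Ds: "Ds = As @ D # Bs" and xs: "xs \<in> listset As" and ys: "ys \<in> listset Bs"
	have mem: "xs @ z # ys \<in> listset Ds" if "z \<in> D" for z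
		unfolding Ds using xs ys that by (intro append_in_listset) auto
	show "(%z. f (xs @ z # ys)) holomorphic_on D" unfolding holomorphic_on_def field_differentiable_def
	proof
		fix z assume z: "z \<in> D"
		let ?zs = "xs @ z # ys"
		obtain c where c: "\<forall>ep>0. \<exists>de>0. \<forall>ws\<in>listset Ds. length ws = length ?zs -->
				(\<forall>i<length ?zs. cmod (ws ! i - ?zs ! i) < de) -->
				cmod (f ws - f ?zs - (\<Sum>i<length ?zs. c i * (ws ! i - ?zs ! i)))
					\<le> ep * (\<Sum>i<length ?zs. cmod (ws ! i - ?zs ! i))"
			using assms mem[OF z] unfolding multi_holomorphic_on_def by blast
		have "((%z. f (xs @ z # ys)) has_field_derivative c (length xs)) (at z within D)"
			unfolding has_field_derivative_def has_derivative_within_alt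
		proof (intro conjI allI impI bounded_linear_mult_right)
			fix e :: real assume "e > 0"
			then obtain de where de: "de > 0" "\<And>ws. ws \<in> listset Ds ==> length ws = length ?zs ==>
				(\<forall>i<length ?zs. cmod (ws ! i - ?zs ! i) < de) ==>
				cmod (f ws - f ?zs - (\<Sum>i<length ?zs. c i * (ws ! i - ?zs ! i)))
					\<le> e * (\<Sum>i<length ?zs. cmod (ws ! i - ?zs ! i))" using c by meson
			show "\<exists>d>0. \<forall>w\<in>D. norm (w - z) < d -->
					norm (f (xs @ w # ys) - f ?zs - c (length xs) * (w - z)) \<le> e * norm (w - z)"
			proof (intro exI[of _ de] conjI ballI impI de(1))
				fix w assume w: "w \<in> D" "norm (w - z) < de"
				have "\<forall>i<length ?zs. cmod ((xs @ w # ys) ! i - ?zs ! i) < de"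
					using w(2) de(1) by (auto simp: nth_append nth_Cons split: nat.splits)
				note near = de(2)[OF mem[OF w(1)] _ this]
				have 1: "(\<Sum>i<length ?zs. c i * ((xs @ w # ys) ! i - ?zs ! i)) = c (length xs) * (w - z)"
					by (rule sum_nth_one_coordinate) simp
				have 2: "(\<Sum>i<length ?zs. cmod ((xs @ w # ys) ! i - ?zs ! i)) = cmod (w - z)"
					by (rule sum_nth_one_coordinate[where G = "%_. cmod"]) simp
				show "norm (f (xs @ w # ys) - f ?zs - c (length xs) * (w - z)) \<le> e * norm (w - z)"
					using near unfolding 1 2 by simp
			qed
		qed
		then show "\<exists>f'. ((%z. f (xs @ z # ys)) has_field_derivative f') (at z within D)" by blast
	qed
qed

lemma seqcont_of_sep_holo:
	assumes op: "\<forall>D\<in>set Ds. open D" and f: "sep_holo f Ds" and B: "\<And>xs. xs \<in> listset Ds ==> cmod (f xs) \<le> B"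
	shows "seqcont (listset Ds) f" unfolding seqcont_def
proof (intro allI impI)
	fix X zs assume X: "\<forall>n. X n \<in> listset Ds" and zs: "zs \<in> listset Ds" and lim: "list_lim X zs"
	obtain R where R: "R > 0" "poly_inside R zs Ds" using poly_inside_exists[OF op zs] by blast
	have "\<forall>\<^sub>F n in sequentially. \<forall>i\<in>{..<length zs}. cmod (X n ! i - zs ! i) < R / 2"
	proof (intro eventually_ball_finite ballI finite_lessThan)
		fix i assume "i \<in> {..<length zs}"
		then have "(%n. X n ! i) \<longlonglongrightarrow> zs ! i" using lim by (simp add: list_lim_def)
		from tendstoD[OF this, of "R / 2"] show "\<forall>\<^sub>F n in sequentially. cmod (X n ! i - zs ! i) < R / 2"
			using R(1) by (simp add: dist_norm)
	qed
	then have "\<forall>\<^sub>F n in sequentially. norm (f (X n) - f zs) \<le> 4 * B / R * ldist (X n) zs"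
	proof (rule eventually_mono)
		fix n assume "\<forall>i\<in>{..<length zs}. cmod (X n ! i - zs ! i) < R / 2"
		then have "poly_near (R / 2) (X n) zs"
			using lim by (auto simp: list_all2_conv_all_nth list_lim_def intro: less_imp_le)
		from lipschitz_of_sep_holo[OF R this f B]
		show "norm (f (X n) - f zs) \<le> 4 * B / R * ldist (X n) zs" .
	qed
	moreover have "(%n. 4 * B / R * ldist (X n) zs) \<longlonglongrightarrow> 0"
	proof -
		have "(%n. ldist (X n) zs) \<longlonglongrightarrow> (\<Sum>i<length zs. cmod (zs ! i - zs ! i))"
			unfolding ldist_def using lim by (intro tendsto_intros) (auto simp: list_lim_def)
		then show ?thesis by (intro tendsto_mult_right_zero) simp
	qed
	ultimately have "(%n. f (X n) - f zs) \<longlonglongrightarrow> 0" by (rule Lim_null_comparison)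
	then show "(%n. f (X n)) \<longlonglongrightarrow> f zs" by (rule LIM_zero_cancel)
qed

text \<open>Differentiation under the integral sign. The bound \<open>C\<close> is uniform in the
  parameter, so Cauchy's estimate on a disc inside \<open>U\<close> dominates the difference
  quotients.\<close>

lemma holomorphic_on_cint:
	assumes c: "contour c" and s: "s > 0" and U: "open U"
		and holo: "\<And>mu. mu \<in> locus c ==> (%z. u z mu) holomorphic_on U" and adm: "\<And>z. z \<in> U ==> integrand_on s C c (u z)"
	shows "(%z. cint c (u z)) holomorphic_on U" unfolding holomorphic_on_def
proof
	fix z assume z: "z \<in> U"
	obtain R where R: "R > 0" "ball z R \<subseteq> U" using U z open_contains_ball by blast
	define S where "S = ball z (R / 2)"
	have S: "open S" "z \<in> S" "S \<subseteq> U" using R unfolding S_def by (auto simp: subset_iff)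
	let ?q = "%w t. dens c t * ((u w (pnt c t) - u z (pnt c t)) / (w - z))"
	let ?d = "%t. dens c t * deriv (%w. u w (pnt c t)) z"
	let ?h = "%t. 4 / R * (C * (cmod (dens c t) * wt s (pnt c t)))"
	have int: "(%t. dens c t * u w (pnt c t)) integrable_on params c" if "w \<in> U" for w
		using integrand_on_lift(4)[OF c s adm[OF that]] by simp
	have q_eq: "?q w = (%t. (dens c t * u w (pnt c t) - dens c t * u z (pnt c t)) / (w - z))" for w
		by (rule ext) (simp add: algebra_simps)
	have q_int: "?q w integrable_on params c" if "w \<in> U" for w
		unfolding q_eq by (intro integrable_on_divide integrable_diff int that z)
	have h_int: "?h integrable_on params c"
		by (rule integrable_on_mult_right[OF integrand_on_lift(3)[OF c s adm[OF z]]])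
	have le: "norm (?q w t) \<le> ?h t" if w: "w \<in> S" "w ~= z" and t: "t \<in> params c" for w t
	proof -
		let ?mu = "pnt c t"
		have mu: "?mu \<in> locus c" using pnt_locus[OF t] .
		have "cmod (u w ?mu - u z ?mu) \<le> 4 * (C * wt s ?mu) / R * cmod (w - z)"
		proof (rule lipschitz_of_bounded_holomorphic(1))
			show "(%w. u w ?mu) holomorphic_on ball z R" by (rule holomorphic_on_subset[OF holo[OF mu] R(2)])
			show "cmod (u x ?mu) \<le> C * wt s ?mu" if "x \<in> ball z R" for x
				using adm[of x] R(2) mu that by (auto simp: integrand_on_def)
		qed (use R w in \<open>auto simp: S_def\<close>)
		then have "cmod ((u w ?mu - u z ?mu) / (w - z)) \<le> 4 * (C * wt s ?mu) / R"
			using w(2) by (simp add: norm_divide pos_divide_le_eq)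
		then have "cmod (dens c t) * cmod ((u w ?mu - u z ?mu) / (w - z))
				\<le> cmod (dens c t) * (4 * (C * wt s ?mu) / R)" by (intro mult_left_mono) auto
		then have "norm (?q w t) \<le> cmod (dens c t) * (4 * (C * wt s ?mu) / R)" by (simp only: norm_mult)
		also have "... = ?h t" by simp
		finally show ?thesis .
	qed
	have "((%w. (cint c (u w) - cint c (u z)) / (w - z)) \<longlongrightarrow> integral (params c) ?d) (at z within S)"
		unfolding tendsto_at_iff_sequentially o_def
	proof (intro allI impI)
		fix X assume X: "\<forall>i. X i \<in> S - {z}" "X \<longlonglongrightarrow> z"
		have "(%k. integral (params c) (?q (X k))) \<longlonglongrightarrow> integral (params c) ?d"
		proof (rule dominated_convergence(2)[OF _ h_int])
			show "?q (X k) integrable_on params c" for k using X S by (intro q_int) auto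
			show "norm (?q (X k) t) \<le> ?h t" if "t \<in> params c" for k t using X that by (intro le) auto
			show "(%k. ?q (X k) t) \<longlonglongrightarrow> ?d t" if t: "t \<in> params c" for t
			proof (intro tendsto_intros)
				have "((%w. u w (pnt c t)) has_field_derivative deriv (%w. u w (pnt c t)) z) (at z)"
					by (rule holomorphic_derivI[OF holo[OF pnt_locus[OF t]] U z])
				then have "((%w. (u w (pnt c t) - u z (pnt c t)) / (w - z)) \<longlongrightarrow> deriv (%w. u w (pnt c t)) z) (at z)"
					by (simp add: has_field_derivative_iff)
				then show "(%k. (u (X k) (pnt c t) - u z (pnt c t)) / (X k - z)) \<longlonglongrightarrow> deriv (%w. u w (pnt c t)) z"
					unfolding tendsto_at_iff_sequentially o_def using X by blast
			qed
		qed
		moreover have "integral (params c) (?q (X k)) = (cint c (u (X k)) - cint c (u z)) / (X k - z)" for k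
		proof -
			have "X k \<in> U" using X S by auto
			then show ?thesis
				unfolding q_eq cint_def scaleC_eq_mult integral_divide by (simp add: integral_diff int z)
		qed
		ultimately show "(%k. (cint c (u (X k)) - cint c (u z)) / (X k - z)) \<longlonglongrightarrow> integral (params c) ?d"
			by (simp only:)
	qed
	then have "((%z. cint c (u z)) has_field_derivative integral (params c) ?d) (at z)"
		unfolding has_field_derivative_iff using at_within_open[OF S(2,1)] by simp
	then show "(%z. cint c (u z)) field_differentiable at z within U"
		using field_differentiable_at_within field_differentiable_def by blast
qed

section \<open>Stolz domains and their boundaries\<close>

text \<open>In the coordinate \<open>z = 1 - w\<close> the Stolz domain of angle \<open>ga\<close> is the union of the discs
	with centre \<open>v \<in> (0, 1]\<close> and radius \<open>v sin ga\<close>, and the sector is the union of all such discs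
	with \<open>v > 0\<close>.\<close>

definition sto :: "real => real => complex set" where
	"sto s rh = {z. \<exists>v. 0 < v \<and> v \<le> rh \<and> cmod (z - of_real v) < v * s}"

text \<open>Closed discs, but with v > 0: for s < 1 the vertex 0 stays excluded. The boundary
  contours lie in this set.\<close>

definition stc :: "real => real => complex set" where
	"stc s rh = {z. \<exists>v. 0 < v \<and> v \<le> rh \<and> cmod (z - of_real v) \<le> v * s}"

lemma stoI: "0 < v ==> v \<le> rh ==> cmod (z - of_real v) < v * s ==> z \<in> sto s rh" by (auto simp: sto_def)

lemma stcI: "0 < v ==> v \<le> rh ==> cmod (z - of_real v) \<le> v * s ==> z \<in> stc s rh" by (auto simp: stc_def)

lemma sto_subset_stc: "sto s rh \<subseteq> stc s rh" by (auto simp: sto_def stc_def intro: less_imp_le)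

lemma stc_subset_sto:
	assumes "s < s'" "rh \<le> rh'" shows "stc s rh \<subseteq> sto s' rh'"
proof
	fix z assume "z \<in> stc s rh"
	then obtain v where v: "0 < v" "v \<le> rh" "cmod (z - of_real v) \<le> v * s" by (auto simp: stc_def)
	moreover have "v * s < v * s'" using v(1) assms by simp
	ultimately show "z \<in> sto s' rh'" using assms by (intro stoI[of v]; linarith)
qed

lemma sto_mono:
	assumes "s \<le> s'" "rh \<le> rh'" shows "sto s rh \<subseteq> sto s' rh'"
proof
	fix z assume "z \<in> sto s rh"
	then obtain v where v: "0 < v" "v \<le> rh" "cmod (z - of_real v) < v * s" by (auto simp: sto_def)
	moreover have "v * s \<le> v * s'" using v(1) assms by simp
	ultimately show "z \<in> sto s' rh'" using assms by (intro stoI[of v]; linarith)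
qed

lemma open_sto: "open (sto s rh)"
proof -
	have "sto s rh = (\<Union>v\<in>{0<..rh}. ball (of_real v) (v * s))" by (auto simp: sto_def dist_norm norm_minus_commute)
	then show ?thesis by auto
qed

lemma convex_comb_norm:
	fixes a b u v :: real
	assumes "0 \<le> a" "0 \<le> b" "cmod (z - of_real v) \<le> p" "cmod (w - of_real u) \<le> q"
	shows "cmod (of_real a * z + of_real b * w - of_real (a * v + b * u)) \<le> a * p + b * q"
proof -
	have "of_real a * z + of_real b * w - of_real (a * v + b * u)
			= of_real a * (z - of_real v) + of_real b * (w - of_real u)" by (simp add: algebra_simps)
	also have "cmod ... \<le> a * cmod (z - of_real v) + b * cmod (w - of_real u)"
		using norm_triangle_ineq[of "of_real a * (z - of_real v)" "of_real b * (w - of_real u)"] assms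
		by (simp add: norm_mult)
	also have "... \<le> a * p + b * q" using assms by (intro add_mono mult_left_mono)
	finally show ?thesis .
qed

text \<open>The radius v s is proportional to the centre v, so a convex combination of points of two
  discs lies in the disc at the combined centre. Strictness survives because the two coefficients
  are not both 0.\<close>

lemma convex_sto: "convex (sto s rh)" unfolding convex_def
proof (intro ballI allI impI)
	fix z w and a b :: real
	assume z: "z \<in> sto s rh" and w: "w \<in> sto s rh" and ab: "0 \<le> a" "0 \<le> b" "a + b = 1"
	obtain v where v: "0 < v" "v \<le> rh" "cmod (z - of_real v) < v * s" using z by (auto simp: sto_def)
	obtain u where u: "0 < u" "u \<le> rh" "cmod (w - of_real u) < u * s" using w by (auto simp: sto_def)
	show "a *\<^sub>R z + b *\<^sub>R w \<in> sto s rh"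
	proof (rule stoI)
		show "0 < a * v + b * u"
		proof (cases "a = 0")
			case False
			then show ?thesis using ab v u by (intro add_pos_nonneg) auto
		qed (use ab u in simp)
		have "a * v + b * u \<le> a * rh + b * rh" using ab v u by (intro add_mono mult_left_mono) auto
		then show "a * v + b * u \<le> rh" using ab by (metis distrib_right mult_1)
		have "cmod (a *\<^sub>R z + b *\<^sub>R w - of_real (a * v + b * u)) \<le> a * cmod (z - of_real v) + b * cmod (w - of_real u)"
			using convex_comb_norm[OF ab(1,2) order_refl order_refl, where z = z and v = v and w = w and u = u] by (simp add: scaleR_conv_of_real)
		also have "... < a * (v * s) + b * (u * s)"
		proof (cases "a = 0")
			case True then show ?thesis using ab u by simp
		next
			case False
			then have "a * cmod (z - of_real v) < a * (v * s)" using ab v by simp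
			moreover have "b * cmod (w - of_real u) \<le> b * (u * s)" using ab u by (intro mult_left_mono) auto
			ultimately show ?thesis by linarith
		qed
		finally show "cmod (a *\<^sub>R z + b *\<^sub>R w - of_real (a * v + b * u)) < (a * v + b * u) * s"
			by (simp add: algebra_simps)
	qed
qed

lemma stc_bounds:
	assumes "z \<in> stc s rh" "s < 1"
	shows "0 < Re z" "z ~= 0" "cmod z \<le> 2 * rh"
proof -
	obtain v where v: "0 < v" "v \<le> rh" "cmod (z - of_real v) \<le> v * s" using assms by (auto simp: stc_def)
	have vs: "v * s < v" using v assms by simp
	have "\<bar>Re (z - of_real v)\<bar> \<le> v * s" using abs_Re_le_cmod[of "z - of_real v"] v(3) by linarith
	then show "0 < Re z" using vs by simp
	then show "z ~= 0" by auto
	have "cmod z \<le> cmod (z - of_real v) + cmod (of_real v)" using norm_triangle_sub[of z "of_real v"] by simp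
	moreover have "cmod (of_real v) = v" using v(1) by simp
	ultimately show "cmod z \<le> 2 * rh" using v vs by linarith
qed

lemma of_real_in_sto: "0 < x ==> x \<le> rh ==> 0 < s ==> complex_of_real x \<in> sto s rh" by (rule stoI[of x]) auto

text \<open>\<open>z\<close> lies in a disc of radius v s about some v, and \<open>mu\<close> lies
  outside the disc of radius v s' about the same v. The gap v (s' - s) is comparable to |z|, because
  |z| is at most 2v.\<close>

lemma stc_separated:
	assumes z: "z \<in> stc s rh" and mu: "mu \<notin> sto s' rh" and s: "s < s'" "s < 1"
	shows "(s' - s) / 2 * cmod z \<le> cmod (mu - z)"
proof -
	obtain v where v: "0 < v" "v \<le> rh" "cmod (z - of_real v) \<le> v * s" using z by (auto simp: stc_def)
	have "cmod (mu - of_real v) \<ge> v * s'" using mu v stoI[of v rh mu s'] by force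
	moreover have "cmod (mu - of_real v) \<le> cmod (mu - z) + cmod (z - of_real v)"
		using norm_triangle_ineq[of "mu - z" "z - of_real v"] by simp
	ultimately have *: "v * (s' - s) \<le> cmod (mu - z)" using v(3) by (simp add: algebra_simps)
	have "cmod z \<le> cmod (z - of_real v) + cmod (of_real v)" using norm_triangle_sub[of z "of_real v"] by simp
	moreover have "v * s \<le> v" "cmod (of_real v) = v" using v s by simp_all
	ultimately have "cmod z \<le> 2 * v" using v by linarith
	then have "(s' - s) / 2 * cmod z \<le> (s' - s) / 2 * (2 * v)" using s by (intro mult_left_mono) auto
	also have "(s' - s) / 2 * (2 * v) = v * (s' - s)" by simp
	finally show ?thesis using * by linarith
qed

lemma sector_iff:
	assumes "0 < ga" "ga \<le> pi"
	shows "z \<in> sector ga \<longleftrightarrow> cos ga * cmod z < Re z"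
proof (cases "z = 0")
	case False
	have Re: "Re z = cmod z * cos \<bar>Arg z\<bar>" using False Re_rcis[of "cmod z" "Arg z"] rcis_cmod_Arg[of z] by simp
	have "\<bar>Arg z\<bar> \<le> pi" using Arg_bounded[of z] by auto
	then have "\<bar>Arg z\<bar> < ga \<longleftrightarrow> cos ga < cos \<bar>Arg z\<bar>" using assms cos_mono_less_eq[of ga "\<bar>Arg z\<bar>"] by auto
	then show ?thesis using False unfolding Re sector_def by (simp add: mult.commute[of "cos ga"])
qed (simp add: sector_def)

text \<open>The inequality is squared and (sin ga)^2 replaced by 1 - (cos ga)^2. In this form the
  extremal disc for given z can be read off.\<close>

lemma disc_condition:
	assumes "0 < ga" "ga < pi / 2" "0 < v"
	shows "cmod (z - of_real v) < v * sin ga \<longleftrightarrow> (cmod z)\<^sup>2 + (v * cos ga)\<^sup>2 < 2 * v * Re z"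
proof -
	have s: "0 < sin ga" using assms by (simp add: sin_gt_zero_02 sin_gt_zero)
	have "cmod (z - of_real v) < v * sin ga \<longleftrightarrow> (cmod (z - of_real v))\<^sup>2 < (v * sin ga)\<^sup>2"
		using s assms by (intro iffI power_strict_mono) (auto intro: power2_less_imp_less)
	also have "(cmod (z - of_real v))\<^sup>2 = (cmod z)\<^sup>2 - 2 * v * Re z + v\<^sup>2"
		unfolding cmod_power2 by (simp add: power2_eq_square algebra_simps)
	also have "(v * sin ga)\<^sup>2 = v\<^sup>2 - (v * cos ga)\<^sup>2" by (simp add: power_mult_distrib sin_squared_eq algebra_simps)
	finally show ?thesis by auto
qed

text \<open>The disc about v touches the boundary rays of the sector at modulus v cos ga, which
  suggests v = |z| / cos ga for a given z. The converse inclusion is (|z| - v cos ga)^2 \<ge> 0. The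
  second claim is the requirement that this v be at most rh.\<close>

lemma sector_eq_Union_sto:
	assumes "0 < ga" "ga < pi / 2"
	shows "z \<in> sector ga \<longleftrightarrow> (\<exists>v>0. cmod (z - of_real v) < v * sin ga)"
		and "z \<in> sector ga ==> cmod z \<le> rh * cos ga ==> z \<in> sto (sin ga) rh"
proof -
	have c: "0 < cos ga" using assms by (intro cos_gt_zero) auto
	have *: "cmod (z - of_real (cmod z / cos ga)) < cmod z / cos ga * sin ga \<and> cmod z / cos ga > 0"
		if "z \<in> sector ga"
	proof -
		have z: "cos ga * cmod z < Re z" using that sector_iff[of ga z] assms pi_gt_zero by (simp del: pi_gt_zero)
		then have "z ~= 0" by auto
		then have pos: "cmod z / cos ga > 0" using c by simp
		have "(cmod z)\<^sup>2 + (cmod z / cos ga * cos ga)\<^sup>2 = 2 * (cmod z * cmod z)"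
			using c by (simp add: power2_eq_square)
		also have "... < 2 * (cmod z / cos ga * Re z)" using z c \<open>z ~= 0\<close> by (simp add: field_simps)
		finally show ?thesis using disc_condition[OF assms pos, of z] pos by simp
	qed
	show "z \<in> sector ga \<longleftrightarrow> (\<exists>v>0. cmod (z - of_real v) < v * sin ga)"
	proof
		assume "\<exists>v>0. cmod (z - of_real v) < v * sin ga"
		then obtain v where v: "v > 0" "(cmod z)\<^sup>2 + (v * cos ga)\<^sup>2 < 2 * v * Re z"
			using disc_condition[OF assms] by blast
		have "0 \<le> (cmod z - v * cos ga)\<^sup>2" by simp
		then have "2 * v * (cos ga * cmod z) < 2 * v * Re z" using v(2) by (simp add: power2_diff algebra_simps)
		then have "cos ga * cmod z < Re z" using v(1) by simp
		then show "z \<in> sector ga" using sector_iff[of ga z] assms by simp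
	qed (use * in blast)
	assume "z \<in> sector ga" "cmod z \<le> rh * cos ga"
	then show "z \<in> sto (sin ga) rh" using * c by (intro stoI[of "cmod z / cos ga"]) (auto simp: field_simps)
qed

lemma sto_subset_sector: "0 < ga ==> ga < pi / 2 ==> sto (sin ga) rh \<subseteq> sector ga"
	using sector_eq_Union_sto(1) by (auto simp: sto_def)

lemma open_sector:
	assumes "0 < ga" "ga \<le> pi" shows "open (sector ga)"
proof -
	have "sector ga = {z. cos ga * cmod z < Re z}" using sector_iff[OF assms] by auto
	then show ?thesis by (simp add: open_Collect_less continuous_intros)
qed

lemma closure_sector_subset:
	assumes "0 < om" "om < nu" "nu \<le> pi" "z \<in> closure (sector om)" "z ~= 0"
	shows "z \<in> sector nu"
proof -
	have "closed {z. cos om * cmod z \<le> Re z}" by (intro closed_Collect_le continuous_intros)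
	moreover have "sector om \<subseteq> {z. cos om * cmod z \<le> Re z}" using sector_iff[of om] assms by force
	ultimately have "cos om * cmod z \<le> Re z" using assms(4) closure_minimal by blast
	moreover have "cos nu < cos om" using assms by (intro cos_monotone_0_pi) auto
	then have "cos nu * cmod z < cos om * cmod z" using assms(5) by simp
	ultimately show ?thesis using sector_iff[of nu z] assms by linarith
qed

lemma sector_mono: "om \<le> nu ==> sector om \<subseteq> sector nu" by (auto simp: sector_def)

text \<open>A point of the hull is w = (1 - v) + v b with |b| < sin ga, so 1 - w has distance v |b|
  from v. The interior drops only w = 1: points slightly beyond it would correspond to points of
  negative real part.\<close>

lemma stolz_iff:
	assumes "0 < ga" "ga < pi / 2"
	shows "w \<in> stolz ga \<longleftrightarrow> 1 - w \<in> sto (sin ga) 1"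
proof -
	let ?s = "sin ga" and ?H = "convex hull (insert 1 (ball 0 (sin ga))) :: complex set"
	have s: "0 < ?s" using assms by (intro sin_gt_zero) auto
	have s1: "?s < 1" using sin_monotone_2pi[of ga "pi/2"] assms by simp
	have H: "w \<in> ?H \<longleftrightarrow> w = 1 \<or> 1 - w \<in> sto ?s 1" for w
	proof -
		have hull: "?H = {z. \<exists>u\<ge>0. \<exists>v\<ge>0. \<exists>b. b \<in> ball 0 ?s \<and> u + v = 1 \<and> z = u *\<^sub>R 1 + v *\<^sub>R b}"
		proof -
			have b: "convex hull ball 0 ?s = ball (0::complex) ?s" by (rule convex_hull_eq[THEN iffD2]) simp
			have "ball (0::complex) ?s ~= {}" using s by simp
			from convex_hull_insert[OF this, of 1] show ?thesis unfolding b by blast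
		qed
		show ?thesis
		proof
			assume "w \<in> ?H"
			then obtain u v b where uvb: "u \<ge> 0" "v \<ge> 0" "cmod b < ?s" "u + v = 1" "w = u *\<^sub>R 1 + v *\<^sub>R b"
				unfolding hull by (auto simp: dist_norm)
			show "w = 1 \<or> 1 - w \<in> sto ?s 1"
			proof (cases "v = 0")
				case False
				have u: "u = 1 - v" using uvb(4) by simp
				have "1 - w - of_real v = - (of_real v * b)" unfolding uvb(5) u by (simp add: scaleR_conv_of_real)
				then have "cmod (1 - w - of_real v) = v * cmod b" using uvb(2) by (simp add: norm_mult)
				also have "... < v * ?s" using uvb False by simp
				finally have "1 - w \<in> sto ?s 1" using uvb False u by (intro stoI[of v]) auto
				then show ?thesis ..
			qed (use uvb in simp)
		next
			assume "w = 1 \<or> 1 - w \<in> sto ?s 1"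
			then show "w \<in> ?H"
			proof
				assume "1 - w \<in> sto ?s 1"
				then obtain v where v: "0 < v" "v \<le> 1" "cmod (1 - w - of_real v) < v * ?s" by (auto simp: sto_def)
				define b where "b = (w - 1 + of_real v) / of_real v"
				have bn: "cmod b = cmod (1 - w - of_real v) / v"
				proof -
					have "w - 1 + of_real v = - (1 - w - of_real v)" by simp
					then show ?thesis unfolding b_def norm_divide using v(1) by (simp only: norm_minus_cancel) simp
				qed
				have "cmod b < ?s" unfolding bn using v by (simp only: pos_divide_less_eq mult.commute)
				then have "b \<in> ball 0 ?s" by (simp add: dist_norm)
				moreover have "w = (1 - v) *\<^sub>R 1 + v *\<^sub>R b"
					unfolding b_def using v(1) by (simp add: scaleR_conv_of_real)
				ultimately show ?thesis unfolding hull using v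
					by (intro CollectI exI[of _ "1 - v"] conjI exI[of _ v] exI[of _ b]) auto
			qed (auto intro: hull_inc)
		qed
	qed
	have open_img: "open {w. 1 - w \<in> sto ?s 1}"
		using continuous_open_preimage[of UNIV "%w. 1 - w" "sto ?s 1"] open_sto
		by (auto simp: vimage_def continuous_intros)
	show ?thesis
	proof
		assume w: "w \<in> stolz ga"
		then have "w \<in> ?H" unfolding stolz_def using interior_subset by blast
		moreover have "w ~= 1"
		proof
			assume "w = 1"
			then obtain e where e: "e > 0" "ball 1 e \<subseteq> ?H" using w unfolding stolz_def mem_interior by blast
			have "1 + of_real (e / 2) \<in> ball (1::complex) e" using e(1) by (simp add: dist_norm)
			then have "1 + of_real (e / 2) \<in> ?H" using e(2) by blast
			then have "- of_real (e / 2) \<in> stc ?s 1" using H e(1) sto_subset_stc by auto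
			from stc_bounds(1)[OF this s1] show False using e(1) by simp
		qed
		ultimately show "1 - w \<in> sto ?s 1" using H by blast
	next
		assume "1 - w \<in> sto ?s 1"
		then show "w \<in> stolz ga" unfolding stolz_def using interior_maximal[OF _ open_img, of ?H] H by blast
	qed
qed

text \<open>The closed family of discs, with v = 0 included, is a continuous image of a compact set
  and therefore closed. The parameter v = 0 yields only the vertex w = 1.\<close>

lemma closure_stolz_subset:
	assumes "0 < ga" "ga < pi / 2" "w \<in> closure (stolz ga)" "w ~= 1"
	shows "1 - w \<in> stc (sin ga) 1"
proof -
	let ?C = "(%(v, d). 1 - of_real v * (1 + of_real (sin ga) * d)) ` ({0..1} \<times> cball (0::complex) 1)"
	have s: "0 < sin ga" using assms by (intro sin_gt_zero) auto
	have "compact ?C" by (intro compact_continuous_image compact_Times compact_cball compact_Icc)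
			(auto simp: case_prod_unfold intro!: continuous_intros)
	then have "closed ?C" by (rule compact_imp_closed)
	moreover have "stolz ga \<subseteq> ?C"
	proof
		fix w assume "w \<in> stolz ga"
		then obtain v where v: "0 < v" "v \<le> 1" "cmod (1 - w - of_real v) < v * sin ga"
			using stolz_iff[OF assms(1,2)] by (auto simp: sto_def)
		let ?d = "(1 - w - of_real v) / of_real (v * sin ga)"
		have "cmod ?d \<le> 1" using v s by (simp add: norm_divide norm_mult)
		moreover have "w = 1 - of_real v * (1 + of_real (sin ga) * ?d)" using v s by (simp add: field_simps)
		ultimately show "w \<in> ?C" using v by (intro image_eqI[of _ _ "(v, ?d)"]) auto
	qed
	ultimately have "w \<in> ?C" using assms(3) closure_minimal by blast
	then obtain v d where vd: "0 \<le> v" "v \<le> 1" "cmod d \<le> 1"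
		"w = 1 - of_real v * (1 + of_real (sin ga) * d)" by (auto simp: dist_norm)
	have "v ~= 0" using vd(4) assms(4) by auto
	have "1 - w - of_real v = of_real (v * sin ga) * d" unfolding vd(4) by (simp add: algebra_simps)
	then have "cmod (1 - w - of_real v) = v * sin ga * cmod d" using vd(1) s by (simp add: norm_mult)
	also have "... \<le> v * sin ga * 1" using vd s by (intro mult_left_mono) auto
	finally show ?thesis using vd \<open>v ~= 0\<close> by (intro stcI[of v]) auto
qed

subsection \<open>Parametrization of the boundary\<close>

definition bpath :: "real => real => complex" where
	"bpath be t = 1 - stolz_boundary be t"

text \<open>The three smooth pieces of the boundary path. The break points 1/2 and 3/4 come from the
  nesting of \<open>+++\<close>; at the end points 0 and 1 the path is at the vertex.\<close>

definition bdom :: "real set" where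
	"bdom = {0<..<1/2} \<union> {1/2<..<3/4} \<union> {3/4<..<1}"

text \<open>The argument on the circular arc, affine from pi/2 - be at t = 1/2 to 3 pi/2 + be at t =
  3/4.\<close>

definition bangle :: "real => real => real" where
	"bangle be t = (pi / 2 - be) + (4 * t - 2) * (pi + 2 * be)"

definition bderiv :: "real => real => complex" where
	"bderiv be t = (if t < 1/2 then of_real (2 * cos be) * cis (- be)
		 else if t < 3/4 then - (of_real (sin be * (4 * (pi + 2 * be))) * \<i> * cis (bangle be t))
		 else - (of_real (4 * cos be) * cis be))"

lemma one_minus_tangent_point:
	"1 - of_real (sin be) * cis (pi / 2 - be) = of_real (cos be) * cis (- be)"
	"1 - of_real (sin be) * cis (- (pi / 2 - be)) = of_real (cos be) * cis be" using sin_cos_squared_add[of be]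
	by (auto simp: complex_eq_iff cos_diff sin_diff power2_eq_square algebra_simps)

text \<open>In the coordinate 1 - w the path leaves 0 along the ray of argument -be, follows the arc
  about 1, and returns along the ray of argument be. The last segment occupies only a quarter of the
  parameter interval and is run through at twice the speed of the first.\<close>

lemma bpath_eq:
	"t \<le> 1/2 ==> bpath be t = of_real (2 * t * cos be) * cis (- be)"
	"1/2 < t ==> t \<le> 3/4 ==> bpath be t = 1 - of_real (sin be) * cis (bangle be t)"
	"3/4 < t ==> bpath be t = of_real (4 * (1 - t) * cos be) * cis be"
proof -
	assume t: "t \<le> 1/2"
	have "bpath be t = of_real (2 * t) * (1 - of_real (sin be) * cis (pi / 2 - be))"
		using t by (simp add: bpath_def stolz_boundary_def joinpaths_def linepath_def scaleR_conv_of_real algebra_simps)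
	then show "bpath be t = of_real (2 * t * cos be) * cis (- be)" unfolding one_minus_tangent_point by simp
next
	assume "1/2 < t" "t \<le> 3/4"
	moreover have "linepath (pi / 2 - be) (3 * pi / 2 + be) (2 * (2 * t - 1)) = bangle be t"
		by (simp add: linepath_def bangle_def field_simps)
	ultimately show "bpath be t = 1 - of_real (sin be) * cis (bangle be t)"
		by (simp add: bpath_def stolz_boundary_def joinpaths_def part_circlepath_def cis_conv_exp)
next
	assume t: "3/4 < t"
	have "bpath be t = of_real (4 * (1 - t)) * (1 - of_real (sin be) * cis (- (pi / 2 - be)))"
		using t by (simp add: bpath_def stolz_boundary_def joinpaths_def linepath_def scaleR_conv_of_real algebra_simps)
	then show "bpath be t = of_real (4 * (1 - t) * cos be) * cis be" unfolding one_minus_tangent_point by simp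
qed

lemma open_bdom: "open bdom" unfolding bdom_def by (intro open_Un open_greaterThanLessThan)

lemma bdom_subset: "bdom \<subseteq> {0<..<1}" unfolding bdom_def by auto

lemma bpath_has_derivative:
	assumes "t \<in> bdom"
	shows "(bpath be has_vector_derivative bderiv be t) (at t)"
proof -
	consider "t \<in> {0<..<1/2}" | "t \<in> {1/2<..<3/4}" | "t \<in> {3/4<..<1}" using assms unfolding bdom_def by auto
	then show ?thesis
	proof cases
		case 1
		have "((%t. of_real (2 * t * cos be) * cis (- be)) has_vector_derivative bderiv be t) (at t)"
			unfolding of_real_mult bderiv_def using 1 by (auto intro!: derivative_eq_intros simp: scaleR_conv_of_real)
		then show ?thesis by (rule has_vector_derivative_transform_within_open[OF _ _ 1]) (auto simp: bpath_eq(1))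
	next
		case 2
		have "((%t. exp (\<i> * of_real (bangle be t))) has_vector_derivative
				of_real (4 * (pi + 2 * be)) * \<i> * cis (bangle be t)) (at t)"
			unfolding bangle_def has_vector_derivative_complex_iff
			by (auto intro!: derivative_eq_intros simp: Re_exp Im_exp)
		then have "((%t. 1 - of_real (sin be) * exp (\<i> * of_real (bangle be t))) has_vector_derivative bderiv be t) (at t)"
			using 2 by (auto intro!: derivative_eq_intros simp: bderiv_def)
		then show ?thesis by (rule has_vector_derivative_transform_within_open[OF _ _ 2])
				(auto simp: bpath_eq(2) cis_conv_exp)
	next
		case 3
		have "((%t. of_real (4 * (1 - t) * cos be) * cis be) has_vector_derivative bderiv be t) (at t)"
			unfolding of_real_mult of_real_diff bderiv_def using 3
			by (auto intro!: derivative_eq_intros simp: scaleR_conv_of_real)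
		then show ?thesis by (rule has_vector_derivative_transform_within_open[OF _ _ 3]) (auto simp: bpath_eq(3))
	qed
qed

lemma continuous_on_bderiv: "continuous_on bdom (bderiv be)"
proof -
	have c: "continuous_on {1/2<..<3/4} (%t. - (of_real (sin be * (4 * (pi + 2 * be))) * \<i> * cis (bangle be t)))"
		unfolding bangle_def cis_conv_exp by (intro continuous_intros)
	have "continuous_on {0<..<1/2} (bderiv be) \<longleftrightarrow> continuous_on {0<..<1/2::real} (%t. of_real (2 * cos be) * cis (- be))"
		by (rule continuous_on_cong) (auto simp: bderiv_def)
	moreover have "continuous_on {3/4<..<1} (bderiv be) \<longleftrightarrow> continuous_on {3/4<..<1::real} (%t. - (of_real (4 * cos be) * cis be))"
		by (rule continuous_on_cong) (auto simp: bderiv_def)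
	moreover have "continuous_on {1/2<..<3/4} (bderiv be) \<longleftrightarrow> continuous_on {1/2<..<3/4}
			(%t. - (of_real (sin be * (4 * (pi + 2 * be))) * \<i> * cis (bangle be t)))"
		by (rule continuous_on_cong) (auto simp: bderiv_def)
	ultimately show ?thesis unfolding bdom_def using c by (simp add: continuous_on_open_Un open_Un)
qed

text \<open>On the arc the speed is 4 sin be (pi + 2 be), which is at most 4 (4 + 4) because pi <
  4.\<close>

lemma norm_bderiv_le:
	assumes "0 < be" "be < pi / 2" shows "cmod (bderiv be t) \<le> 32"
proof -
	have c: "0 \<le> sin be" "0 \<le> cos be" "pi < 4" using assms pi_less_4 by (auto intro!: sin_ge_zero cos_ge_zero)
	have "sin be * (4 * (pi + 2 * be)) \<le> 1 * (4 * (4 + 4))" using c assms by (intro mult_mono) auto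
	moreover have "0 \<le> sin be * (4 * (pi + 2 * be))" using c assms by simp
	ultimately have "\<bar>sin be * (4 * (pi + 2 * be))\<bar> \<le> 32" by simp
	moreover have "\<bar>2 * cos be\<bar> \<le> 32" "\<bar>4 * cos be\<bar> \<le> 32" using c cos_le_one[of be] by linarith+
	moreover have n: "cmod (of_real x * cis ph) = \<bar>x\<bar>" "cmod (of_real x * \<i> * cis ph) = \<bar>x\<bar>" for x ph
		by (simp_all add: norm_mult)
	ultimately show ?thesis
		unfolding bderiv_def if_distrib[of cmod] norm_minus_cancel n by (cases "t < 1/2"; cases "t < 3/4"; simp only: if_True if_False)
qed

lemma stolz_boundary_path:
	"valid_path (stolz_boundary be)" "pathstart (stolz_boundary be) = 1" "pathfinish (stolz_boundary be) = 1"
proof -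
	have "exp (\<i> * of_real (3 * pi / 2 + be)) = cis (3 * pi / 2 + be)" by (simp add: cis_conv_exp)
	also have "... = cis (- (pi / 2 - be) + 2 * pi)" by (simp add: field_simps)
	also have "... = cis (- (pi / 2 - be))" unfolding cis_mult[symmetric] by simp
	finally have e: "exp (\<i> * of_real (3 * pi / 2 + be)) = cis (- (pi / 2 - be))" .
	have e': "exp (\<i> * of_real (pi / 2 - be)) = cis (pi / 2 - be)" by (simp add: cis_conv_exp)
	show "valid_path (stolz_boundary be)"
		unfolding stolz_boundary_def by (intro valid_path_join) (simp_all only: e e' valid_path_linepath
				valid_path_part_circlepath pathstart_join pathfinish_linepath pathstart_linepath
				pathstart_part_circlepath pathfinish_part_circlepath add_0 )
	show "pathstart (stolz_boundary be) = 1" "pathfinish (stolz_boundary be) = 1"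
		unfolding stolz_boundary_def by simp_all
qed

lemma bpath_0 [simp]: "bpath be 0 = 0" and bpath_1 [simp]: "bpath be 1 = 0"
	using stolz_boundary_path(2,3)[of be] by (simp_all add: bpath_def pathstart_def pathfinish_def)

lemma continuous_on_bpath: "continuous_on {0..1} (bpath be)"
	using valid_path_imp_path[OF stolz_boundary_path(1)] unfolding bpath_def path_def by (intro continuous_intros)

lemma bpath_in_stc:
	assumes "0 < be" "be < pi / 2" "t \<in> {0<..<1}"
	shows "bpath be t \<in> stc (sin be) 1"
proof -
	have s: "0 < sin be" using assms by (intro sin_gt_zero) auto
	\<comment> \<open>The points of modulus v cos be on the two rays are the tangent points of the
	  circle of radius v sin be about v.\<close>
	have r: "cmod (of_real (v * cos be) * cis ph - of_real v) = v * sin be"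
		if "v > 0" "ph = be \<or> ph = - be" for v ph
	proof -
		have "(cmod (of_real (v * cos be) * cis ph - of_real v))\<^sup>2 = v\<^sup>2 * (((cos be)\<^sup>2 - 1)\<^sup>2 + (cos be * sin be)\<^sup>2)"
			unfolding cmod_power2 using that(2) by (auto simp: power2_eq_square algebra_simps)
		also have "(cos be)\<^sup>2 - 1 = - (sin be)\<^sup>2" by (simp add: cos_squared_eq)
		also have "(- (sin be)\<^sup>2)\<^sup>2 + (cos be * sin be)\<^sup>2 = (sin be)\<^sup>2 * ((sin be)\<^sup>2 + (cos be)\<^sup>2)" by algebra
		finally have "(cmod (of_real (v * cos be) * cis ph - of_real v))\<^sup>2 = (v * sin be)\<^sup>2"
			by (simp add: power_mult_distrib)
		then show ?thesis by (rule power2_eq_imp_eq) (use that s in auto)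
	qed
	consider "t \<le> 1/2" | "1/2 < t" "t \<le> 3/4" | "3/4 < t" by linarith
	then show ?thesis
	proof cases
		case 1
		then show ?thesis using assms(3) r[of "2 * t" "-be"] by (intro stcI[of "2 * t"]) (auto simp: bpath_eq(1))
	next
		case 2
		then show ?thesis using s by (intro stcI[of 1]) (auto simp: bpath_eq(2) norm_mult)
	next
		case 3
		then show ?thesis using assms(3) r[of "4 * (1 - t)" "be"]
			by (intro stcI[of "4 * (1 - t)"]) (auto simp: bpath_eq(3))
	qed
qed

text \<open>On the rays the inequality of the open sector fails. On the arc the distance to every
  admissible centre v is computed directly; the decisive fact is that cos of the angle is at most
  sin be there.\<close>

lemma bpath_notin_sto:
	assumes be: "0 < be" "be < pi / 2" and t: "t \<in> {0..1}"
	shows "bpath be t \<notin> sto (sin be) 1"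
proof
	assume in_sto: "bpath be t \<in> sto (sin be) 1"
	have c: "cos be > 0" and s: "sin be > 0" using be by (auto intro!: sin_gt_zero cos_gt_zero)
	have sec: "cos be * cmod (bpath be t) < Re (bpath be t)"
		using in_sto sto_subset_sector[OF be, of 1] sector_iff[of be "bpath be t"] be by auto
	consider "t \<le> 1/2" | "1/2 < t" "t \<le> 3/4" | "3/4 < t" by linarith
	then show False
	proof cases
		case 1
		then have "cmod (bpath be t) = 2 * t * cos be"
			unfolding bpath_eq(1)[OF 1] norm_mult norm_of_real norm_cis using t c by (simp add: abs_mult)
		then show False using sec t c bpath_eq(1)[OF 1, of be] by simp
	next
		case 3
		have "cmod (bpath be t) = 4 * (1 - t) * cos be"
			unfolding bpath_eq(3)[OF 3] norm_mult norm_of_real norm_cis abs_mult using t c by simp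
		then show False using sec t c unfolding bpath_eq(3)[OF 3, of be] by (simp add: mult.commute)
	next
		case 2
		define ph where "ph = bangle be t"
		have "pi / 2 - be \<le> ph" using 2 be by (auto simp: ph_def bangle_def intro!: mult_nonneg_nonneg)
		moreover have "(4 * t - 2) * (pi + 2 * be) \<le> 1 * (pi + 2 * be)" using 2 be by (intro mult_right_mono) auto
		then have "ph \<le> 3 * pi / 2 + be" by (simp add: ph_def bangle_def)
		ultimately have "\<bar>ph - pi\<bar> \<le> pi / 2 + be" by (auto simp: abs_le_iff)
		then have "cos (pi / 2 + be) \<le> cos \<bar>ph - pi\<bar>" using be by (intro cos_monotone_0_pi_le) auto
		then have "- sin be \<le> - cos ph" by (simp add: cos_add cos_diff)
		then have cos: "cos ph \<le> sin be" by simp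
		have z: "bpath be t = 1 - of_real (sin be) * cis ph" using 2 by (simp add: bpath_eq(2) ph_def)
		obtain v where v: "0 < v" "v \<le> 1" "cmod (bpath be t - of_real v) < v * sin be"
			using in_sto by (auto simp: sto_def)
		\<comment> \<open>The right-hand side exceeds the left-hand side by (1 - v)^2 (cos be)^2.\<close>
		have "(v * sin be)\<^sup>2 \<le> (1 - v)\<^sup>2 + (sin be)\<^sup>2 - 2 * (1 - v) * (sin be * sin be)"
		proof -
			have "0 \<le> (1 - v)\<^sup>2 * (cos be)\<^sup>2" by simp
			also have "... = (1 - v)\<^sup>2 * (1 - (sin be)\<^sup>2)" by (simp add: cos_squared_eq)
			finally show ?thesis by (simp add: power2_eq_square algebra_simps)
		qed
		also have "... \<le> (1 - v)\<^sup>2 + (sin be)\<^sup>2 - 2 * (1 - v) * (sin be * cos ph)"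
			using v s cos by (intro diff_left_mono mult_left_mono) auto
		also have "... = (cmod (bpath be t - of_real v))\<^sup>2"
		proof -
			have "(cmod (bpath be t - of_real v))\<^sup>2 = (1 - v - sin be * cos ph)\<^sup>2 + (sin be * sin ph)\<^sup>2"
				unfolding z by (simp add: cmod_power2 algebra_simps)
			also have "... = (1 - v)\<^sup>2 - 2 * (1 - v) * (sin be * cos ph) + (sin be)\<^sup>2 * ((sin ph)\<^sup>2 + (cos ph)\<^sup>2)" by algebra
			finally show ?thesis by simp
		qed
		also have "... < (v * sin be)\<^sup>2" using v(3) by (intro power_strict_mono) auto
		finally show False by simp
	qed
qed

text \<open>The path leaves the vertex at least linearly in the parameter, so negative powers of its
  modulus are as integrable as powers of t and 1 - t.\<close>

lemma norm_bpath_ge: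
	assumes be: "0 < be" "be < pi / 2" and t: "t \<in> {0..1}"
	shows "min (2 * cos be) (1 - sin be) * min t (1 - t) \<le> cmod (bpath be t)"
proof -
	let ?m = "min (2 * cos be) (1 - sin be)"
	have c: "cos be > 0" and s: "sin be > 0" using be by (auto intro!: sin_gt_zero cos_gt_zero)
	have m: "0 \<le> ?m" using c by simp
	consider "t \<le> 1/2" | "1/2 < t" "t \<le> 3/4" | "3/4 < t" by linarith
	then show ?thesis
	proof cases
		case 1
		have "?m * min t (1 - t) \<le> (2 * cos be) * t" using m t c by (intro mult_mono) auto
		then show ?thesis using 1 t c by (simp add: bpath_eq(1) norm_mult abs_mult mult_ac)
	next
		case 2
		have "?m * min t (1 - t) \<le> (1 - sin be) * 1" using m t by (intro mult_mono) auto
		also have "... \<le> cmod (bpath be t)" using norm_triangle_ineq2[of 1 "of_real (sin be) * cis (bangle be t)"] 2 s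
			by (simp add: bpath_eq(2) norm_mult)
		finally show ?thesis .
	next
		case 3
		have "?m * min t (1 - t) \<le> (2 * cos be) * (1 - t)" using m t c by (intro mult_mono) auto
		also have "... \<le> 4 * (1 - t) * cos be" using t c by simp
		also have "... = cmod (bpath be t)"
			unfolding bpath_eq(3)[OF 3] norm_mult norm_of_real norm_cis abs_mult using t c by simp
		finally show ?thesis .
	qed
qed

subsection \<open>The scaled Stolz contour\<close>

definition bcont :: "real => real => contour" where
	"bcont be rh = (bdom, %t. of_real rh * bderiv be t, %t. of_real rh * bpath be t)"

lemma bcont_simps [simp]:
	"params (bcont be rh) = bdom" "dens (bcont be rh) = (%t. of_real rh * bderiv be t)"
	"pnt (bcont be rh) = (%t. of_real rh * bpath be t)" by (simp_all add: bcont_def)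

lemma scale_stc: "0 < rh ==> z \<in> stc s 1 ==> of_real rh * z \<in> stc s rh"
proof -
	assume rh: "0 < rh" and "z \<in> stc s 1"
	then obtain v where v: "0 < v" "v \<le> 1" "cmod (z - of_real v) \<le> v * s" by (auto simp: stc_def)
	have "of_real rh * z - of_real (rh * v) = of_real rh * (z - of_real v)" by (simp add: algebra_simps)
	then have "cmod (of_real rh * z - of_real (rh * v)) = rh * cmod (z - of_real v)"
		using rh by (simp only: norm_mult norm_of_real abs_of_pos)
	also have "... \<le> rh * (v * s)" using v rh by (intro mult_left_mono) auto
	finally show ?thesis using v rh by (intro stcI[of "rh * v"]) (auto simp: mult.assoc)
qed

lemma scale_sto:
	assumes "0 < a" "z \<in> sto s rh" shows "of_real a * z \<in> sto s (a * rh)"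
proof -
	obtain v where v: "0 < v" "v \<le> rh" "cmod (z - of_real v) < v * s" using assms by (auto simp: sto_def)
	have "of_real a * z - of_real (a * v) = of_real a * (z - of_real v)" by (simp add: algebra_simps)
	then have "cmod (of_real a * z - of_real (a * v)) = a * cmod (z - of_real v)"
		using assms(1) by (simp only: norm_mult norm_of_real abs_of_pos)
	also have "... < a * (v * s)" using v assms(1) by (intro mult_strict_left_mono) auto
	finally show ?thesis using v assms(1) by (intro stoI[of "a * v"]) (auto simp: mult.assoc)
qed

lemma scale_sto_iff: "0 < rh ==> of_real rh * z \<in> sto s rh \<longleftrightarrow> z \<in> sto s 1"
	using scale_sto[of rh z s 1] scale_sto[of "inverse rh" "of_real rh * z" s rh]
	by (auto simp: mult.assoc[symmetric] simp flip: of_real_mult)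

lemma locus_bcont:
	assumes "0 < be" "be < pi / 2" "0 < rh" "z \<in> locus (bcont be rh)"
	shows "z \<in> stc (sin be) rh" "z \<notin> sto (sin be) rh" "z ~= 0" "cmod z \<le> 2 * rh"
proof -
	obtain t where t: "t \<in> bdom" "z = of_real rh * bpath be t" using assms(4) by (auto simp: locus_def)
	have t': "t \<in> {0<..<1}" using t bdom_subset by auto
	show 1: "z \<in> stc (sin be) rh" unfolding t(2) by (rule scale_stc[OF assms(3) bpath_in_stc[OF assms(1,2) t']])
	show "z \<notin> sto (sin be) rh"
		unfolding t(2) scale_sto_iff[OF assms(3)] by (rule bpath_notin_sto[OF assms(1,2)]) (use t' in auto)
	have "sin be < 1" using sin_monotone_2pi[of be "pi/2"] assms by simp
	from stc_bounds[OF 1 this] show "z ~= 0" "cmod z \<le> 2 * rh" by auto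
qed

lemma bdom_negligible: "negligible {x \<in> {0..1} - bdom. f x ~= 0}" "negligible {x \<in> bdom - {0..1}. f x ~= 0}"
proof -
	have "{x \<in> {0..1} - bdom. f x ~= 0} \<subseteq> {0, 1/2, 3/4, 1}" by (auto simp: bdom_def)
	then show "negligible {x \<in> {0..1} - bdom. f x ~= 0}"
		by (rule negligible_subset[rotated]) (simp add: negligible_finite)
	have "{x \<in> bdom - {0..1}. f x ~= 0} = {}" by (auto simp: bdom_def)
	then show "negligible {x \<in> bdom - {0..1}. f x ~= 0}" by (simp only: negligible_empty)
qed

lemma has_integral_bdom:
	fixes f :: "real => 'b::banach"
	shows "(f has_integral i) {0..1} \<longleftrightarrow> (f has_integral i) bdom"
	by (rule has_integral_spike_set_eq[OF bdom_negligible])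

lemma integrable_bpath_powr:
	assumes be: "0 < be" "be < pi / 2" and si: "0 < si" "si \<le> 1"
	shows "(%t. cmod (bderiv be t) * cmod (bpath be t) powr (si - 1)) integrable_on bdom"
proof -
	define m where "m = min (2 * cos be) (1 - sin be)"
	have "sin be < 1" using sin_monotone_2pi[of be "pi/2"] be by simp
	moreover have "0 < cos be" using be by (intro cos_gt_zero) auto
	ultimately have m: "0 < m" by (simp add: m_def)
	have "((%t. t powr (si - 1)) integrable_on {0..1::real})"
		using integrable_on_powr_from_0[of "si - 1" 1] si by simp
	moreover from this have "((%t. (1 - t) powr (si - 1)) integrable_on {0..1::real})"
		using has_integral_affinity_iff[of "-1" "%t. t powr (si - 1)" _ 1 "0::real" 1]
			integrable_affinity[of "%t. t powr (si - 1)" 0 1 "-1" 1] by simp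
	ultimately have "(%t. 32 * (m powr (si - 1) * (t powr (si - 1) + (1 - t) powr (si - 1)))) integrable_on {0..1::real}"
		by (intro integrable_on_mult_right integrable_add)
	then have h: "(%t. 32 * (m powr (si - 1) * (t powr (si - 1) + (1 - t) powr (si - 1)))) integrable_on bdom"
		unfolding integrable_on_def has_integral_bdom .
	show ?thesis
	proof (rule dominated_integrable[OF open_bdom _ h])
		have nz: "bpath be t ~= 0" if "t \<in> bdom" for t
		proof -
			have "t \<in> {0<..<1}" using that bdom_subset by auto
			then show ?thesis using stc_bounds(2)[OF bpath_in_stc[OF be] \<open>sin be < 1\<close>] by blast
		qed
		have c: "continuous_on bdom (bpath be)"
			by (rule continuous_on_subset[OF continuous_on_bpath]) (use bdom_subset in auto)
		show "continuous_on bdom (%t. cmod (bderiv be t) * cmod (bpath be t) powr (si - 1))"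
			using nz by (intro continuous_intros continuous_on_bderiv c) auto
		fix t assume "t \<in> bdom"
		then have t: "0 < t" "t < 1" using bdom_subset by auto
		have mm: "m * min t (1 - t) \<le> cmod (bpath be t)"
			unfolding m_def by (rule norm_bpath_ge[OF be]) (use t in auto)
		have "cmod (bpath be t) powr (si - 1) \<le> (m * min t (1 - t)) powr (si - 1)"
			using mm m t si by (intro powr_mono2') auto
		also have "... = m powr (si - 1) * min t (1 - t) powr (si - 1)" using m t by (simp add: powr_mult)
		also have "... \<le> m powr (si - 1) * (t powr (si - 1) + (1 - t) powr (si - 1))"
			by (intro mult_left_mono) (auto simp: min_def)
		finally have "cmod (bderiv be t) * cmod (bpath be t) powr (si - 1)
			 \<le> 32 * (m powr (si - 1) * (t powr (si - 1) + (1 - t) powr (si - 1)))"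
			by (intro mult_mono norm_bderiv_le[OF be]) auto
		then show "norm (cmod (bderiv be t) * cmod (bpath be t) powr (si - 1))
			 \<le> 32 * (m powr (si - 1) * (t powr (si - 1) + (1 - t) powr (si - 1)))" by simp
	qed
qed

lemma wt_le_powr: "wt s z \<le> cmod z powr (s - 1)"
	unfolding wt_def by (simp add: divide_le_eq mult_le_cancel_left1 add_pos_nonneg)

text \<open>On a bounded set the denominator of the weight is bounded, so weight and power are
  comparable; the denominator matters only at infinity.\<close>

lemma powr_le_wt:
	assumes "cmod z \<le> K" "s > 0"
	shows "cmod z powr (s - 1) \<le> (1 + K powr (2 * s)) * wt s z"
proof -
	have "0 < 1 + cmod z powr (2 * s)" by (simp add: add_pos_nonneg)
	then have "cmod z powr (s - 1) = (1 + cmod z powr (2 * s)) * wt s z" by (simp add: wt_def)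
	also have "... \<le> (1 + K powr (2 * s)) * wt s z"
		using assms by (intro mult_right_mono wt_nonneg add_left_mono powr_mono2) auto
	finally show ?thesis .
qed

text \<open>With a = |z|^s' and b = |z|^s the claim amounts to (a - b)(1 - a b) \<ge> 0, and both
  factors change sign together at |z| = 1.\<close>

lemma wt_antimono:
	assumes "0 < s'" "s' \<le> s" shows "wt s z \<le> wt s' z"
proof (cases "z = 0")
	case False
	define x a b where "x = cmod z" and "a = x powr s'" and "b = x powr s"
	have x: "0 < x" using False by (simp add: x_def)
	then have ab: "0 < a" "0 < b" by (simp_all add: a_def b_def)
	have e: "wt r z = x powr r / (1 + (x powr r)\<^sup>2) / x" for r
		using x by (simp add: wt_def x_def powr_diff powr_add power2_eq_square flip: powr_add)
	have "0 \<le> (a - b) * (1 - a * b)"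
	proof (cases "x \<le> 1")
		case True
		then have "b \<le> a" "a \<le> 1" "b \<le> 1" using x assms by (auto simp: a_def b_def powr_mono' powr_le1)
		then show ?thesis using ab by (intro mult_nonneg_nonneg) (auto intro: mult_le_one)
	next
		case False
		then have "a \<le> b" "1 \<le> a" "1 \<le> b" using assms by (auto simp: a_def b_def powr_mono ge_one_powr_ge_zero)
		moreover from this have "1 * 1 \<le> a * b" by (intro mult_mono) auto
		ultimately show ?thesis by (intro mult_nonpos_nonpos) auto
	qed
	then have "b * (1 + a\<^sup>2) \<le> a * (1 + b\<^sup>2)" by (simp add: power2_eq_square algebra_simps)
	then have "b / (1 + b\<^sup>2) \<le> a / (1 + a\<^sup>2)"
		by (simp add: divide_le_eq pos_le_divide_eq add_pos_nonneg mult.commute field_simps)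
	then show ?thesis unfolding e a_def[symmetric] b_def[symmetric] using x by (intro divide_right_mono) auto
qed (simp add: wt_def)

lemma contour_bcont:
	assumes be: "0 < be" "be < pi / 2" and rh: "0 < rh"
	shows "contour (bcont be rh)"
proof -
	have c: "continuous_on bdom (bpath be)"
		by (rule continuous_on_subset[OF continuous_on_bpath]) (use bdom_subset in auto)
	have z: "0 \<notin> locus (bcont be rh)" using locus_bcont(3)[OF be rh] by blast
	then have z': "rh * bpath be t ~= 0" if "t \<in> bdom" for t using that pnt_locus[of t "bcont be rh"] by auto
	have "(%t. cmod (of_real rh * bderiv be t) * wt s (of_real rh * bpath be t)) integrable_on bdom"
		if s: "s > 0" for s
	proof (rule dominated_integrable[OF open_bdom])
		\<comment> \<open>The integrability result for powers asks for an exponent si - 1 that is not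
		  positive; the weight only grows when s is lowered.\<close>
		define si where "si = min s 1"
		have si: "0 < si" "si \<le> 1" "si \<le> s" using s by (auto simp: si_def)
		show "continuous_on bdom (%t. cmod (of_real rh * bderiv be t) * wt s (of_real rh * bpath be t))"
			using z' by (intro continuous_intros continuous_on_bderiv continuous_on_wt c) auto
		show "(%t. rh powr si * (cmod (bderiv be t) * cmod (bpath be t) powr (si - 1))) integrable_on bdom"
			by (intro integrable_on_mult_right integrable_bpath_powr be si)
		fix t assume "t \<in> bdom"
		have "wt s (of_real rh * bpath be t) \<le> cmod (of_real rh * bpath be t) powr (si - 1)"
			using wt_antimono[OF si(1,3)] wt_le_powr order_trans by blast
		also have "... = rh powr (si - 1) * cmod (bpath be t) powr (si - 1)" using rh by (simp add: norm_mult powr_mult)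
		finally have "rh * cmod (bderiv be t) * wt s (of_real rh * bpath be t)
			 \<le> rh * cmod (bderiv be t) * (rh powr (si - 1) * cmod (bpath be t) powr (si - 1))"
			using rh by (intro mult_left_mono) auto
		also have "... = rh powr si * (cmod (bderiv be t) * cmod (bpath be t) powr (si - 1))"
			using rh by (simp add: powr_diff)
		finally show "norm (cmod (of_real rh * bderiv be t) * wt s (of_real rh * bpath be t))
			\<le> rh powr si * (cmod (bderiv be t) * cmod (bpath be t) powr (si - 1))"
			using rh by (simp add: norm_mult wt_nonneg)
	qed
	then show ?thesis unfolding contour_def using z
		by (auto intro!: open_bdom continuous_intros continuous_on_bderiv c)
qed

lemma integrand_on_bcontI:
	assumes be: "0 < be" "be < pi / 2" and rh: "0 < rh" and si: "0 < si" and F: "continuous_on (locus (bcont be rh)) F"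
		and le: "\<And>z. z \<in> locus (bcont be rh) ==> norm (F z) \<le> C * cmod z powr (si - 1)" and C: "0 \<le> C"
	shows "integrand_on si (C * (1 + (2 * rh) powr (2 * si))) (bcont be rh) F" unfolding integrand_on_def
proof (intro conjI ballI F)
	fix z assume z: "z \<in> locus (bcont be rh)"
	have "norm (F z) \<le> C * cmod z powr (si - 1)" by (rule le[OF z])
	also have "... \<le> C * ((1 + (2 * rh) powr (2 * si)) * wt si z)"
		by (intro mult_left_mono powr_le_wt locus_bcont(4)[OF be rh z] si C)
	finally show "norm (F z) \<le> C * (1 + (2 * rh) powr (2 * si)) * wt si z" by (simp add: mult.assoc)
qed

lemma integrand_on_bcont_bounded:
	assumes be: "0 < be" "be < pi / 2" and rh: "0 < rh" and F: "continuous_on (locus (bcont be rh)) F"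
		and le: "\<And>z. z \<in> locus (bcont be rh) ==> norm (F z) \<le> C" and C: "0 \<le> C"
	shows "integrand_on 1 (C * (1 + (2 * rh) powr 2)) (bcont be rh) F"
	using integrand_on_bcontI[OF be rh zero_less_one F _ C] le locus_bcont(3)[OF be rh] by simp

section \<open>Cauchy's theorem and Cauchy's formula along a Stolz contour\<close>

lemma has_integral_bdom_FTC:
	fixes P :: "real => 'b::banach"
	assumes "continuous_on {0..1} P" "\<And>t. t \<in> bdom ==> (P has_vector_derivative P' t) (at t)"
	shows "(P' has_integral (P 1 - P 0)) bdom"
proof -
	have "(P' has_integral (P 1 - P 0)) {0..1}"
	proof (rule fundamental_theorem_of_calculus_interior_strong[of "{1/2, 3/4}"])
		show "(P has_vector_derivative P' t) (at t)" if "t \<in> {0<..<1} - {1/2, 3/4}" for t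
			by (rule assms(2)) (use that in \<open>auto simp: bdom_def\<close>)
	qed (use assms(1) in auto)
	then show ?thesis unfolding has_integral_bdom .
qed

text \<open>Covers all affine images that occur: the dilated boundary (a = 0), the boundary shrunk
  towards an inner point, and, with a = 1 and b = -1, the original boundary of the Stolz
  domain.\<close>

lemma affine_bpath:
	fixes a b :: complex and be :: real
	defines "p \<equiv> %t. a + b * bpath be t"
	shows "valid_path p" "pathstart p = a" "pathfinish p = a"
		and "(f has_contour_integral i) p ==> ((%t. b * bderiv be t * f (p t)) has_integral i) bdom"
proof -
	have "valid_path ((%z. a + b * (1 - z)) \<circ> stolz_boundary be)"
	proof (rule valid_path_compose[OF stolz_boundary_path(1)])
		have d: "((%z. a + b * (1 - z)) has_field_derivative - b) (at z)" for z
			by (auto intro!: derivative_eq_intros)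
		then show "(%z. a + b * (1 - z)) field_differentiable at z" for z
			unfolding field_differentiable_def by blast
		have "deriv (%z. a + b * (1 - z)) = (%z. - b)" using DERIV_imp_deriv[OF d] by auto
		then show "continuous_on (path_image (stolz_boundary be)) (deriv (%z. a + b * (1 - z)))" by simp
	qed
	then show "valid_path p" by (simp add: p_def bpath_def o_def)
	show "pathstart p = a" "pathfinish p = a" by (simp_all add: p_def pathstart_def pathfinish_def)
	assume "(f has_contour_integral i) p"
	then have "((%t. f (p t) * vector_derivative p (at t within {0..1})) has_integral i) bdom"
		unfolding has_contour_integral_def has_integral_bdom .
	moreover have "f (p t) * vector_derivative p (at t within {0..1}) = b * bderiv be t * f (p t)"
		if "t \<in> bdom" for t
	proof -
		have t: "t \<in> {0<..<1}" using that bdom_subset by auto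
		have "(p has_vector_derivative b * bderiv be t) (at t)"
			unfolding p_def by (auto intro!: derivative_eq_intros bpath_has_derivative that)
		then have "(p has_vector_derivative b * bderiv be t) (at t within {0..1})"
			by (rule has_vector_derivative_at_within)
		then have "vector_derivative p (at t within {0..1}) = b * bderiv be t"
			using t by (intro vector_derivative_within_cbox[of 0 1, unfolded box_real]) auto
		then show ?thesis by simp
	qed
	ultimately show "((%t. b * bderiv be t * f (p t)) has_integral i) bdom" by (rule has_integral_eq[rotated])
qed

lemma norm_real_add_ge: "0 \<le> a ==> 0 \<le> Re w ==> cmod w \<le> cmod (of_real a + w)"
proof -
	assume "0 \<le> a" "0 \<le> Re w"
	then have "(Re w)\<^sup>2 \<le> (a + Re w)\<^sup>2" by (intro power_mono) auto
	then have "(cmod w)\<^sup>2 \<le> (cmod (of_real a + w))\<^sup>2" unfolding cmod_power2 by simp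
	then show ?thesis by (rule power2_le_imp_le) simp
qed

text \<open>Cauchy's theorem for an integrand that may blow up at the vertex: shrink the contour
	towards \<open>rh\<close>, where everything is regular, and pass to the limit.\<close>

lemma cint_bcont_eq_0:
	assumes be: "0 < be" "be < pi / 2" and rh: "0 < rh" and s': "sin be < s'"
		and u: "u holomorphic_on sto s' rh" and si: "0 < si" "si \<le> 1" and C: "0 \<le> C"
		and le: "\<And>z. z \<in> stc (sin be) rh ==> cmod (u z) \<le> C * cmod z powr (si - 1)"
	shows "cint (bcont be rh) u = 0"
proof -
	have s: "0 < sin be" "sin be < 1" using be sin_monotone_2pi[of be "pi/2"] by (auto intro: sin_gt_zero)
	\<comment> \<open>The factors tend to 1 but never drop below 1/2, which yields the majorant with rh
	  / 2.\<close>
	define r where "r n = 1 - 1 / (real n + 2)" for n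
	have r: "1/2 \<le> r n" "r n < 1" for n by (auto simp: r_def field_simps)
	have r_lim: "r \<longlonglongrightarrow> 1" unfolding r_def by real_asymp
	define p where "p n t = of_real ((1 - r n) * rh) + of_real (r n * rh) * bpath be t" for n t
	have b: "bpath be t = 0 \<or> bpath be t \<in> stc (sin be) 1" if "t \<in> {0..1}" for t
	proof (cases "t = 0 \<or> t = 1")
		case False then show ?thesis using that bpath_in_stc[OF be, of t] by auto
	qed auto
	have p_stc: "p n t \<in> stc (sin be) rh" if t: "t \<in> {0..1}" for n t
	proof -
		obtain v where v: "0 \<le> v" "v \<le> 1" "cmod (bpath be t - of_real v) \<le> v * sin be"
			using b[OF t] s by (auto simp: stc_def intro: that[of 0] less_imp_le)
		have "p n t - of_real ((1 - r n) * rh + r n * rh * v) = of_real (r n * rh) * (bpath be t - of_real v)"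
			by (simp add: p_def algebra_simps)
		then have "cmod (p n t - of_real ((1 - r n) * rh + r n * rh * v)) = r n * rh * cmod (bpath be t - of_real v)"
			using r[of n] rh by (simp only: norm_mult norm_of_real) simp
		also have "... \<le> r n * rh * (v * sin be)" using r[of n] rh v by (intro mult_left_mono) auto
		also have "... \<le> ((1 - r n) * rh + r n * rh * v) * sin be" using r[of n] rh s v by (simp add: distrib_right)
		finally show ?thesis
		proof (rule stcI[rotated 2])
			show "0 < (1 - r n) * rh + r n * rh * v" using r[of n] rh v by (intro add_pos_nonneg) auto
			have "r n * rh * v \<le> r n * rh * 1" using r[of n] rh v by (intro mult_left_mono) auto
			then show "(1 - r n) * rh + r n * rh * v \<le> rh" by (simp add: algebra_simps)
		qed
	qed
	have sub: "stc (sin be) rh \<subseteq> sto s' rh" by (rule stc_subset_sto[OF s' order_refl])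
	have u_cont: "continuous_on (sto s' rh) u" by (rule holomorphic_on_imp_continuous_on[OF u])
	have c_b: "continuous_on bdom (bpath be)"
		by (rule continuous_on_subset[OF continuous_on_bpath]) (use bdom_subset in auto)
	have bd: "t \<in> {0..1}" "t \<in> {0<..<1}" if "t \<in> bdom" for t using that bdom_subset by auto
	let ?F = "%n t. of_real rh * bderiv be t * u (p n t)"
	have zero: "integral bdom (?F n) = 0" for n
	proof -
		have "(u has_contour_integral 0) (p n)"
		proof (rule Cauchy_theorem_convex_simple[OF u convex_sto])
			show "valid_path (p n)" "pathfinish (p n) = pathstart (p n)"
				unfolding p_def by (simp_all only: affine_bpath)
			show "path_image (p n) \<subseteq> sto s' rh" using p_stc sub by (auto simp: path_image_def)
		qed
		then have "((%t. of_real (r n * rh) * bderiv be t * u (p n t)) has_integral 0) bdom"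
			unfolding p_def by (rule affine_bpath(4))
		from has_integral_mult_right[OF this, of "of_real (1 / r n)"]
		have "(?F n has_integral 0) bdom" using r[of n] by (simp add: mult.assoc)
		then show ?thesis by (rule integral_unique)
	qed
	have "(%n. integral bdom (?F n)) \<longlonglongrightarrow> integral bdom (%t. of_real rh * bderiv be t * u (of_real rh * bpath be t))"
	proof (rule dominated_tendsto[OF open_bdom])
		show "continuous_on bdom (?F n)" for n using p_stc sub bd unfolding p_def
			by (intro continuous_intros continuous_on_bderiv c_b continuous_on_compose2[OF u_cont]) blast
		show "continuous_on bdom (%t. of_real rh * bderiv be t * u (of_real rh * bpath be t))"
			using sub scale_stc[OF rh bpath_in_stc[OF be]] bd
			by (intro continuous_intros continuous_on_bderiv c_b continuous_on_compose2[OF u_cont]) blast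
		show "(%t. rh * C * (rh / 2) powr (si - 1) * (cmod (bderiv be t) * cmod (bpath be t) powr (si - 1))) integrable_on bdom"
			by (intro integrable_on_mult_right integrable_bpath_powr be si)
		fix t assume t: "t \<in> bdom"
		have bs: "bpath be t \<in> stc (sin be) 1" by (rule bpath_in_stc[OF be bd(2)[OF t]])
		note bb = stc_bounds[OF bs s(2)]
		show "norm (?F n t) \<le> rh * C * (rh / 2) powr (si - 1) * (cmod (bderiv be t) * cmod (bpath be t) powr (si - 1))" for n
		proof -
			\<comment> \<open>The shift away from the vertex is by a nonnegative real number, and in the
			  right half plane this does not decrease the modulus; so the shrunken contours share one
			  majorant at the vertex.\<close>
			have "rh / 2 * cmod (bpath be t) \<le> r n * rh * cmod (bpath be t)"
				using r[of n] rh by (intro mult_right_mono) auto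
			also have "... = cmod (of_real (r n * rh) * bpath be t)"
				using r[of n] rh by (simp only: norm_mult norm_of_real) simp
			also have "... \<le> cmod (p n t)" unfolding p_def using r[of n] rh bb(1) by (intro norm_real_add_ge) auto
			finally have "cmod (p n t) powr (si - 1) \<le> (rh / 2 * cmod (bpath be t)) powr (si - 1)"
				using si rh bb(2) by (intro powr_mono2') auto
			also have "... = (rh / 2) powr (si - 1) * cmod (bpath be t) powr (si - 1)" using rh by (subst powr_mult) auto
			finally have "C * cmod (p n t) powr (si - 1) \<le> C * ((rh / 2) powr (si - 1) * cmod (bpath be t) powr (si - 1))"
				using C by (intro mult_left_mono)
			then have "cmod (u (p n t)) \<le> C * ((rh / 2) powr (si - 1) * cmod (bpath be t) powr (si - 1))"
				using le[OF p_stc[OF bd(1)[OF t], of n]] by linarith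
			then have "rh * cmod (bderiv be t) * cmod (u (p n t))
				 \<le> rh * cmod (bderiv be t) * (C * ((rh / 2) powr (si - 1) * cmod (bpath be t) powr (si - 1)))"
				using rh by (intro mult_left_mono) auto
			also have "... = rh * C * (rh / 2) powr (si - 1) * (cmod (bderiv be t) * cmod (bpath be t) powr (si - 1))"
				by (simp only: mult_ac)
			finally show ?thesis using rh by (simp add: norm_mult)
		qed
		show "(%n. ?F n t) \<longlonglongrightarrow> of_real rh * bderiv be t * u (of_real rh * bpath be t)"
		proof (intro tendsto_intros)
			have mem: "of_real rh * bpath be t \<in> sto s' rh" using scale_stc[OF rh bs] sub by blast
			then have "isCont u (of_real rh * bpath be t)" using u_cont open_sto continuous_on_eq_continuous_at by blast
			moreover have "(%n. p n t) \<longlonglongrightarrow> of_real ((1 - 1) * rh) + of_real (1 * rh) * bpath be t"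
				unfolding p_def by (intro tendsto_intros r_lim)
			then have "(%n. p n t) \<longlonglongrightarrow> of_real rh * bpath be t" by simp
			ultimately show "(%n. u (p n t)) \<longlonglongrightarrow> u (of_real rh * bpath be t)" by (rule isCont_tendsto_compose)
		qed
	qed
	then have "integral bdom (%t. of_real rh * bderiv be t * u (of_real rh * bpath be t)) = 0"
		unfolding zero using LIMSEQ_unique tendsto_const by blast
	then show ?thesis by (simp add: cint_def)
qed

text \<open>The integral of 1/w along the boundary: the segments lie in the right half plane and
  contribute differences of \<open>Ln\<close>, the arc contributes i (pi + 2 be). The imaginary
  parts add up to 2 pi.\<close>

lemma has_integral_stolz_log:
	assumes be: "0 < be" "be < pi / 2"
	shows "((%t. bderiv be t / (bpath be t - 1)) has_integral (2 * pi * \<i>)) bdom"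
proof -
	have s: "0 < sin be" using be by (auto intro: sin_gt_zero)
	define p where "p = of_real (sin be) * cis (pi / 2 - be)"
	define q where "q = of_real (sin be) * cis (- (pi / 2 - be))"
	have Re: "Re p > 0" "Re q > 0" using s be by (simp_all add: p_def q_def cos_diff)
	have lnr: "Ln (of_real (sin be) * cis ph) = of_real (ln (sin be)) + \<i> * of_real ph"
		if "\<bar>ph\<bar> < pi" for ph
	proof -
		have "of_real (sin be) * cis ph = exp (of_real (ln (sin be)) + \<i> * of_real ph)"
			using s by (simp add: exp_add cis_conv_exp exp_of_real)
		moreover have "Ln (exp (of_real (ln (sin be)) + \<i> * of_real ph)) = of_real (ln (sin be)) + \<i> * of_real ph"
			using that by (intro Ln_exp) auto
		ultimately show ?thesis by (simp only:)
	qed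
	have Lp: "Ln p = of_real (ln (sin be)) + \<i> * of_real (pi / 2 - be)"
		unfolding p_def by (rule lnr) (use be in auto)
	have Lq: "Ln q = of_real (ln (sin be)) + \<i> * of_real (- (pi / 2 - be))"
		unfolding q_def by (rule lnr) (use be in auto)
	have seg: "((%z. 1 / z) has_contour_integral (Ln b - Ln a)) (linepath a b)"
		if "Re a > 0" "Re b > 0" for a b
	proof -
		have "((%z. 1 / z) has_contour_integral (Ln (pathfinish (linepath a b)) - Ln (pathstart (linepath a b)))) (linepath a b)"
		proof (rule contour_integral_primitive[of "{z. Re z > 0}"])
			show "(Ln has_field_derivative 1 / z) (at z within {z. Re z > 0})" if "z \<in> {z. Re z > 0}" for z
				using that by (auto intro!: derivative_eq_intros simp: complex_nonpos_Reals_iff field_simps)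
			show "path_image (linepath a b) \<subseteq> {z. Re z > 0}"
				using that by (simp add: closed_segment_subset convex_halfspace_Re_gt)
		qed simp
		then show ?thesis by simp
	qed
	have arc: "((%z. 1 / z) has_contour_integral (of_real (pi + 2 * be) * \<i>))
			(part_circlepath 0 (sin be) (pi / 2 - be) (3 * pi / 2 + be))"
	proof -
		have lt: "pi / 2 - be < 3 * pi / 2 + be" using be by simp
		have "((%t. \<i>) has_integral ((3 * pi / 2 + be - (pi / 2 - be)) *\<^sub>R \<i>)) {pi / 2 - be..3 * pi / 2 + be}"
			using has_integral_const_real[of \<i> "pi / 2 - be" "3 * pi / 2 + be"] lt by simp
		moreover have "(3 * pi / 2 + be - (pi / 2 - be)) *\<^sub>R \<i> = of_real (pi + 2 * be) * \<i>"
			by (simp add: scaleR_conv_of_real complex_eq_iff)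
		moreover have "(%t. \<i>) = (%t. 1 / (0 + of_real (sin be) * cis t) * of_real (sin be) * \<i> * cis t)"
			using s by (auto simp: fun_eq_iff)
		ultimately have "((%t. 1 / (0 + of_real (sin be) * cis t) * of_real (sin be) * \<i> * cis t) has_integral (of_real (pi + 2 * be) * \<i>))
				{pi / 2 - be..3 * pi / 2 + be}" by (simp only:)
		then show ?thesis by (simp only: has_contour_integral_part_circlepath_iff[OF lt])
	qed
	have "((%z. 1 / z) has_contour_integral ((Ln p - Ln 1) + (of_real (pi + 2 * be) * \<i> + (Ln 1 - Ln q)))) (stolz_boundary be)"
		unfolding stolz_boundary_def p_def[symmetric] q_def[symmetric]
		by (intro has_contour_integral_join seg arc Re valid_path_join valid_path_linepath
				valid_path_part_circlepath)
			(use valid_path_join stolz_boundary_path in \<open>auto simp: q_def cis_conv_exp field_simps exp_eq intro: exI[of _ 1]\<close>)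
	moreover have "(Ln p - Ln 1) + (of_real (pi + 2 * be) * \<i> + (Ln 1 - Ln q)) = 2 * pi * \<i>"
		unfolding Lp Lq by (simp add: algebra_simps)
	ultimately have "((%z. 1 / z) has_contour_integral (2 * pi * \<i>)) (%t. 1 + (- 1) * bpath be t)"
		by (simp add: bpath_def)
	from affine_bpath(4)[OF this]
	have "((%t. (- 1) * bderiv be t * (1 / (1 + (- 1) * bpath be t))) has_integral (2 * pi * \<i>)) bdom" .
	moreover have "(%t. (- 1) * bderiv be t * (1 / (1 + (- 1) * bpath be t))) = (%t. bderiv be t / (bpath be t - 1))"
		by (rule ext) (simp add: minus_divide_right)
	ultimately show ?thesis by simp
qed

text \<open>The winding number is constant on the convex domain, so the pole may be moved to rh;
  after division by rh the integral is the logarithmic one.\<close>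

lemma cint_bcont_inverse:
	assumes be: "0 < be" "be < pi / 2" and rh: "0 < rh" and z0: "z0 \<in> sto (sin be) rh"
	shows "cint (bcont be rh) (%z. 1 / (z - z0)) = 2 * pi * \<i>"
proof -
	have s: "0 < sin be" using be by (auto intro: sin_gt_zero)
	define p where "p t = 0 + of_real rh * bpath be t" for t
	have p: "valid_path p" "pathfinish p = pathstart p" unfolding p_def by (simp_all only: affine_bpath)
	have im: "path_image p \<inter> sto (sin be) rh = {}"
		using bpath_notin_sto[OF be] scale_sto_iff[OF rh] by (auto simp: path_image_def p_def)
	have eq: "cint (bcont be rh) (%z. 1 / (z - w)) = 2 * pi * \<i> * winding_number p w"
		if w: "w \<in> sto (sin be) rh" for w
	proof -
		have wp: "w \<notin> path_image p" using im w by blast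
		have "(%z. 1 / (z - w)) contour_integrable_on p" by (rule contour_integrable_inversediff[OF p(1) wp])
		then have "((%z. 1 / (z - w)) has_contour_integral contour_integral p (%z. 1 / (z - w))) p"
			by (rule has_contour_integral_integral)
		then have "((%t. of_real rh * bderiv be t * (1 / (p t - w))) has_integral contour_integral p (%z. 1 / (z - w))) bdom"
			unfolding p_def by (rule affine_bpath(4))
		then have "cint (bcont be rh) (%z. 1 / (z - w)) = contour_integral p (%z. 1 / (z - w))"
			by (simp add: cint_def p_def integral_unique)
		then show ?thesis using winding_number_valid_path[OF p(1) wp] by simp
	qed
	have rhmem: "of_real rh \<in> sto (sin be) rh" by (rule of_real_in_sto) (use rh s in auto)
	have "winding_number p constant_on sto (sin be) rh"
		using im by (intro winding_number_constant valid_path_imp_path p convex_connected convex_sto) auto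
	then have "winding_number p z0 = winding_number p (of_real rh)"
		using z0 rhmem unfolding constant_on_def by metis
	then have "cint (bcont be rh) (%z. 1 / (z - z0)) = cint (bcont be rh) (%z. 1 / (z - of_real rh))"
		using eq[OF z0] eq[OF rhmem] by simp
	also have "... = integral bdom (%t. bderiv be t / (bpath be t - 1))" unfolding cint_def
	proof (simp, rule integral_cong)
		fix t
		have "of_real rh * bpath be t - of_real rh = of_real rh * (bpath be t - 1)" by (simp add: algebra_simps)
		then show "of_real rh * bderiv be t / (of_real rh * bpath be t - of_real rh) = bderiv be t / (bpath be t - 1)"
			using rh by simp
	qed
	also have "... = 2 * pi * \<i>" by (rule integral_unique[OF has_integral_stolz_log[OF be]])
	finally show ?thesis .
qed

text \<open>The difference quotient of \<open>u\<close> at \<open>z0\<close> is holomorphic and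
  satisfies a bound of the same kind, hence integrates to 0; what remains is u(z0) times the
  integral of 1 / (z - z0).\<close>

lemma cint_bcont_cauchy:
	assumes be: "0 < be" "be < pi / 2" and rh: "0 < rh" and s': "sin be < s'"
		and u: "u holomorphic_on sto s' rh" and si: "0 < si" "si \<le> 1" and C: "0 \<le> C"
		and le: "\<And>z. z \<in> stc (sin be) rh ==> cmod (u z) \<le> C * cmod z powr (si - 1)" and z0: "z0 \<in> sto (sin be) rh"
	shows "cint (bcont be rh) (%z. u z / (z - z0)) = 2 * pi * \<i> * u z0"
proof -
	let ?c = "bcont be rh"
	have s: "0 < sin be" "sin be < 1" using be sin_monotone_2pi[of be "pi/2"] by (auto intro: sin_gt_zero)
	have sub: "stc (sin be) rh \<subseteq> sto s' rh" by (rule stc_subset_sto[OF s' order_refl])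
	have z0': "z0 \<in> sto s' rh" using z0 sto_subset_stc sub by blast
	define g where "g z = (if z = z0 then deriv u z0 else (u z - u z0) / (z - z0))" for z
	have g: "g holomorphic_on sto s' rh"
		unfolding g_def by (rule pole_lemma[OF u]) (simp add: interior_open open_sto z0')
	obtain de0 where de0: "de0 > 0" "cball z0 de0 \<subseteq> sto s' rh" using z0' open_sto open_contains_cball by blast
	obtain de1 where de1: "de1 > 0" "ball z0 de1 \<subseteq> sto (sin be) rh" using z0 open_sto open_contains_ball by blast
	have "compact (g ` cball z0 de0)" by (intro compact_continuous_image compact_cball
				continuous_on_subset[OF holomorphic_on_imp_continuous_on[OF g] de0(2)])
	then obtain K where K: "\<And>z. z \<in> cball z0 de0 ==> cmod (g z) \<le> K"
		using compact_imp_bounded bounded_iff by (metis imageI)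
	have K0: "0 \<le> K" using order_trans[OF norm_ge_zero K[of z0]] de0(1) by simp
	\<comment> \<open>As |z| is at most 2 rh and the exponent is not positive, \<open>e\<close> bounds
	  |z| powr (si - 1) from below. Dividing by it turns constants into multiples of that
	  power.\<close>
	define e where "e = (2 * rh) powr (si - 1)"
	have e: "0 < e" using rh by (simp add: e_def)
	define C' where "C' = K / e + (C + cmod (u z0) / e) / de0"
	have C'0: "0 \<le> C'" unfolding C'_def using K0 e C de0(1) by simp
	have g_le: "cmod (g z) \<le> C' * cmod z powr (si - 1)" if z: "z \<in> stc (sin be) rh" for z
	proof -
		have ez: "e \<le> cmod z powr (si - 1)" unfolding e_def using stc_bounds[OF z s(2)] si by (intro powr_mono2') auto
		have scale: "x \<le> x / e * cmod z powr (si - 1)" if "0 \<le> x" for x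
		proof -
			have "x / e * e \<le> x / e * cmod z powr (si - 1)" using ez that e by (intro mult_left_mono) auto
			then show ?thesis using e by simp
		qed
		have nonneg: "0 \<le> K / e * cmod z powr (si - 1)" "0 \<le> (C + cmod (u z0) / e) / de0 * cmod z powr (si - 1)"
			using K0 e C de0(1) by simp_all
		show ?thesis
		proof (cases "z \<in> cball z0 de0")
			case True
			then have "cmod (g z) \<le> K / e * cmod z powr (si - 1)" using K scale[OF K0] order_trans by blast
			then show ?thesis using nonneg by (simp add: C'_def distrib_right)
		next
			case False
			then have far: "de0 < cmod (z - z0)" by (simp add: dist_norm norm_minus_commute)
			then have "z ~= z0" using de0(1) by auto
			then have "cmod (g z) = cmod (u z - u z0) / cmod (z - z0)" by (simp add: g_def norm_divide)
			also have "... \<le> cmod (u z - u z0) / de0" using far de0(1) less_trans[OF de0(1) far]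
				by (intro divide_left_mono mult_pos_pos) (auto intro: less_imp_le)
			also have "... \<le> (C * cmod z powr (si - 1) + cmod (u z0) / e * cmod z powr (si - 1)) / de0"
				using norm_triangle_ineq4[of "u z" "u z0"] le[OF z] scale[of "cmod (u z0)"] de0(1)
				by (intro divide_right_mono) auto
			also have "... = (C + cmod (u z0) / e) / de0 * cmod z powr (si - 1)" by (simp add: distrib_right)
			finally show ?thesis using nonneg by (simp add: C'_def distrib_right)
		qed
	qed
	have zero: "cint ?c g = 0" by (rule cint_bcont_eq_0[OF be rh s' g si C'0 g_le])
	have c: "contour ?c" by (rule contour_bcont[OF be rh])
	have lsub: "locus ?c \<subseteq> sto s' rh" using locus_bcont(1)[OF be rh] sub by blast
	have g_adm: "integrand_on si (C' * (1 + (2 * rh) powr (2 * si))) ?c g"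
		by (intro integrand_on_bcontI[OF be rh si(1)] continuous_on_subset[OF holomorphic_on_imp_continuous_on[OF g] lsub]
				g_le locus_bcont(1)[OF be rh] C'0)
	have far: "de1 \<le> cmod (z - z0)" if "z \<in> locus ?c" for z
		using locus_bcont(2)[OF be rh that] de1(2) by (force simp: dist_norm norm_minus_commute)
	then have nz: "z ~= z0" if "z \<in> locus ?c" for z using that de1(1) by fastforce
	have i_le: "cmod (1 / (z - z0)) \<le> 1 / de1 / e * cmod z powr (si - 1)" if "z \<in> locus ?c" for z
	proof -
		have "e \<le> cmod z powr (si - 1)" unfolding e_def using locus_bcont[OF be rh that] si by (intro powr_mono2') auto
		then have "1 / de1 / e * e \<le> 1 / de1 / e * cmod z powr (si - 1)" using de1(1) e by (intro mult_left_mono) auto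
		moreover have "cmod (1 / (z - z0)) \<le> 1 / de1" using far[OF that] de1(1) by (simp add: norm_divide frac_le)
		ultimately show ?thesis using e by simp
	qed
	have i_adm: "integrand_on si (1 / de1 / e * (1 + (2 * rh) powr (2 * si))) ?c (%z. 1 / (z - z0))"
		using nz i_le de1(1) e by (intro integrand_on_bcontI[OF be rh si(1)] continuous_intros) auto
	have m: "bounded_linear (%x::complex. u z0 * x)" by (rule bounded_linear_mult_right)
	have m': "u z0 * (a *\<^sub>C x) = a *\<^sub>C (u z0 * x)" for a x by simp
	have "cint ?c (%z. u z / (z - z0)) = cint ?c (%z. g z + u z0 * (1 / (z - z0)))"
		by (rule cint_cong) (auto dest!: nz simp: g_def diff_divide_distrib)
	also have "... = cint ?c g + cint ?c (%z. u z0 * (1 / (z - z0)))"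
		by (rule cint_add[OF c si(1) g_adm integrand_on_linear[OF i_adm m]])
	also have "cint ?c (%z. u z0 * (1 / (z - z0))) = u z0 * cint ?c (%z. 1 / (z - z0))"
		by (rule cint_linear[OF c si(1) i_adm m m'])
	also have "cint ?c (%z. 1 / (z - z0)) = 2 * pi * \<i>" by (rule cint_bcont_inverse[OF be rh z0])
	finally show ?thesis by (simp add: zero)
qed

section \<open>Contour integrals of the resolvent\<close>

abbreviation res :: "('a::complex_normed_vector \<Rightarrow>\<^sub>L 'a) => complex => ('a \<Rightarrow>\<^sub>L 'a)" where
	"res A z \<equiv> resolvent z (graph_of A)"

text \<open>The resolvent estimate outside a Stolz domain of size rh, with only the vertex excepted.
  The Ritt condition gives it for rh = 1, the sectorial condition for all large rh with one
  constant.\<close>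

definition reg :: "('a::complex_normed_vector \<Rightarrow>\<^sub>L 'a) => real => real => real => bool" where
	"reg A s rh M \<longleftrightarrow> (\<forall>z. z \<notin> sto s rh --> z ~= 0 -->
		 z \<in> resolvent_set (graph_of A) \<and> norm (res A z) \<le> M / cmod z)"

lemma regD:
	assumes "reg A s rh M" "z \<notin> sto s rh" "z ~= 0"
	shows "z \<in> resolvent_set (graph_of A)" "norm (res A z) \<le> M / cmod z" using assms by (auto simp: reg_def)

lemma minus_one_notin_sto: "s < 1 ==> - 1 \<notin> sto s rh"
	using stc_bounds(1)[of "-1" s rh] sto_subset_stc[of s rh] by auto

lemma reg_nonneg: "reg A s rh M ==> s < 1 ==> 0 \<le> M"
	using order_trans[OF norm_ge_zero regD(2)[of A s rh M "-1"]] minus_one_notin_sto[of s rh] by simp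

lemma reg_continuous_on:
	assumes "reg A s rh M" "V \<inter> sto s rh = {}" "0 \<notin> V"
	shows "continuous_on V (res A)"
	by (rule continuous_on_resolvent[where M = M]) (use regD[OF assms(1)] assms in blast)+

lemma bounded_linear_compose_left: "bounded_linear (%T. S o\<^sub>L T)"
	by (rule bounded_bilinear.bounded_linear_right[OF bounded_bilinear_blinfun_compose])

lemma bounded_linear_compose_right: "bounded_linear (%T. T o\<^sub>L S)"
	by (rule bounded_bilinear.bounded_linear_left[OF bounded_bilinear_blinfun_compose])

lemma bounded_linear_scaleC_left: "bounded_linear (%c. c *\<^sub>C x)"
	by (rule bounded_bilinear.bounded_linear_left[OF bounded_bilinear_scaleC])

lemmas continuous_on_compose_blinfun [continuous_intros] =
	bounded_bilinear.continuous_on[OF bounded_bilinear_blinfun_compose]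

lemmas tendsto_compose_blinfun [tendsto_intros] =
	bounded_bilinear.tendsto[OF bounded_bilinear_blinfun_compose]

text \<open>The identity X - X' = X (Y' - Y) X' for inverses X of Y and X' of Y'. It serves for
  variation of the spectral point as well as for variation of the operator.\<close>

lemma inverse_diff:
	fixes dil dil' dinv dinv' :: "'a::real_normed_vector \<Rightarrow>\<^sub>L 'a"
	assumes "dil o\<^sub>L dinv = id_blinfun" "dinv' o\<^sub>L dil' = id_blinfun"
	shows "dil - dil' = dil o\<^sub>L ((dinv' - dinv) o\<^sub>L dil')"
proof -
	have "dil o\<^sub>L ((dinv' - dinv) o\<^sub>L dil') = (dil o\<^sub>L (dinv' o\<^sub>L dil')) - ((dil o\<^sub>L dinv) o\<^sub>L dil')"
		by (simp add: compose_diff_left compose_diff_right compose_assoc)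
	then show ?thesis by (simp add: assms)
qed

lemma cint_scaleC_left:
	fixes f :: "complex => complex" and x :: "'b::complex_banach"
	assumes "contour c" "s > 0" "integrand_on s C c f"
	shows "cint c (%z. f z *\<^sub>C x) = cint c f *\<^sub>C x"
	by (rule cint_linear[OF assms bounded_linear_scaleC_left]) (simp add: scaleC_scaleC)

lemma cint_scaleC:
	fixes F :: "complex => 'b::complex_banach"
	assumes "contour c" "s > 0" "integrand_on s C c F"
	shows "cint c (%z. a *\<^sub>C F z) = a *\<^sub>C cint c F"
	by (rule cint_linear[OF assms bounded_linear_scaleC]) (simp add: scaleC_scaleC mult.commute)

lemma cint_compose_left:
	assumes "contour c" "s > 0" "integrand_on s C c F" "complex_linear S"
	shows "cint c (%z. S o\<^sub>L F z) = S o\<^sub>L cint c F"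
	by (rule cint_linear[OF assms(1-3) bounded_linear_compose_left]) (rule compose_scaleC_right[OF assms(4)])

lemma cint_compose_right:
	assumes "contour c" "s > 0" "integrand_on s C c F"
	shows "cint c (%z. F z o\<^sub>L S) = cint c F o\<^sub>L S"
	by (rule cint_linear[OF assms bounded_linear_compose_right]) (rule compose_scaleC_left)

section \<open>A homotopy argument for the contour integral of the resolvent\<close>

lemma has_derivative_zero_of_quadratic:
	fixes N :: "real => 'b::real_normed_vector"
	assumes "\<And>x y. x \<in> S ==> y \<in> S ==> norm (N y - N x) \<le> K * (y - x)\<^sup>2" "x \<in> S"
	shows "(N has_derivative (%h. 0)) (at x within S)" unfolding has_derivative_within_alt
proof (intro conjI allI impI)
	fix e :: real assume e: "e > 0"
	show "\<exists>d>0. \<forall>y\<in>S. norm (y - x) < d --> norm (N y - N x - 0) \<le> e * norm (y - x)"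
	proof (intro exI[of _ "e / (\<bar>K\<bar> + 1)"] conjI ballI impI)
		fix y assume y: "y \<in> S" "norm (y - x) < e / (\<bar>K\<bar> + 1)"
		have "\<bar>K\<bar> * \<bar>y - x\<bar> \<le> (\<bar>K\<bar> + 1) * (e / (\<bar>K\<bar> + 1))" using y(2) by (intro mult_mono) auto
		then have "\<bar>K\<bar> * \<bar>y - x\<bar> \<le> e" by simp
		then have "\<bar>K\<bar> * \<bar>y - x\<bar> * \<bar>y - x\<bar> \<le> e * \<bar>y - x\<bar>" by (intro mult_right_mono) auto
		moreover have "K * (y - x)\<^sup>2 \<le> \<bar>K\<bar> * (y - x)\<^sup>2" by (intro mult_right_mono) auto
		moreover have "\<bar>K\<bar> * (y - x)\<^sup>2 = \<bar>K\<bar> * \<bar>y - x\<bar> * \<bar>y - x\<bar>" by (simp add: power2_eq_square)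
		ultimately show "norm (N y - N x - 0) \<le> e * norm (y - x)" using assms(1)[OF assms(2) y(1)] by simp
	qed (use e in auto)
qed (rule bounded_linear_zero)

context
	fixes A :: "'a::complex_banach \<Rightarrow>\<^sub>L 'a" and be rh M :: real
	assumes A: "complex_linear A" and be: "0 < be" "be < pi / 2" and rh: "0 < rh" and reg: "reg A (sin be) rh M"
begin

text \<open>Moving the spectrum of \<open>A\<close> along the homotopy \<open>(1 - q) rh + q A\<close>, \<open>0 \<le> q < 1\<close>, away from
	the vertex makes the contour integral of the resolvent independent of \<open>q\<close>.\<close>

definition dil :: "real => complex => ('a \<Rightarrow>\<^sub>L 'a)" where
	"dil q z = (if q = 0 then (1 / (z - of_real rh)) *\<^sub>C id_blinfun
		 else (1 / of_real q) *\<^sub>C res A ((z - of_real ((1 - q) * rh)) / of_real q))"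

definition dinv :: "real => complex => ('a \<Rightarrow>\<^sub>L 'a)" where
	"dinv q z = (z - of_real ((1 - q) * rh)) *\<^sub>C id_blinfun - of_real q *\<^sub>C A"

text \<open>Unlike \<open>locus\<close> this contains the vertex. For q < 1 the homotopy has moved
  the spectrum away, and \<open>dil q\<close> is defined and continuous on the whole closed
  curve.\<close>

definition bimage :: "complex set" where
	"bimage = (%t. of_real rh * bpath be t) ` {0..1}"

lemma s_pos: "0 < sin be" and s_less: "sin be < 1"
	using be sin_monotone_2pi[of be "pi/2"] by (auto intro: sin_gt_zero)

lemma M_nonneg: "0 \<le> M" by (rule reg_nonneg[OF reg s_less])

lemma bimage_notin: "z \<in> bimage ==> z \<notin> sto (sin be) rh"
	unfolding bimage_def using bpath_notin_sto[OF be] scale_sto_iff[OF rh] by auto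

lemma locus_bimage: "locus (bcont be rh) \<subseteq> bimage" unfolding bimage_def locus_def using bdom_subset by force

lemma dist_ge:
	assumes "z \<in> bimage" "0 \<le> q" "q < 1"
	shows "(1 - q) * rh * sin be \<le> cmod (z - of_real ((1 - q) * rh))"
proof (rule ccontr)
	assume "\<not> ?thesis"
	then have "z \<in> sto (sin be) rh"
		using assms rh by (intro stoI[of "(1 - q) * rh"]) (auto simp: mult_le_cancel_right1)
	then show False using bimage_notin[OF assms(1)] by blast
qed

text \<open>\<open>z\<close> is the convex combination (1 - q) rh + q w. If \<open>w\<close>
  belonged to the convex domain, which contains rh, then so would \<open>z\<close>.\<close>

lemma shifted_regular:
	assumes "z \<in> bimage" "0 < q" "q < 1 \<or> z ~= 0" "q \<le> 1"
	defines "w \<equiv> (z - of_real ((1 - q) * rh)) / of_real q"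
	shows "w \<notin> sto (sin be) rh" "w ~= 0"
proof -
	have z: "z = of_real (1 - q) * of_real rh + of_real q * w" using assms(2) by (simp add: w_def)
	have rhmem: "of_real rh \<in> sto (sin be) rh" by (rule of_real_in_sto) (use rh s_pos in auto)
	show "w \<notin> sto (sin be) rh"
	proof
		assume "w \<in> sto (sin be) rh"
		then have "(1 - q) *\<^sub>R of_real rh + q *\<^sub>R w \<in> sto (sin be) rh"
			using convex_sto rhmem assms(2,4) unfolding convex_def by (metis add.commute diff_add_cancel diff_ge_0_iff_ge less_imp_le)
		then show False using bimage_notin[OF assms(1)] z by (simp add: scaleR_conv_of_real)
	qed
	show "w ~= 0"
	proof
		assume "w = 0"
		then have "z = of_real ((1 - q) * rh)" using z by simp
		moreover from this assms(3,4) have "q < 1" by auto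
		ultimately have "z \<in> sto (sin be) rh"
			using rh s_pos assms(2) of_real_in_sto[of "(1 - q) * rh" rh "sin be"] by (simp add: mult_le_cancel_right1)
		then show False using bimage_notin[OF assms(1)] by blast
	qed
qed

lemma dil_inverse:
	assumes "z \<in> bimage" "0 \<le> q" "q < 1"
	shows "dil q z o\<^sub>L dinv q z = id_blinfun" "dinv q z o\<^sub>L dil q z = id_blinfun" "complex_linear (dil q z)"
		"dil q z o\<^sub>L A = A o\<^sub>L dil q z"
proof -
	have "(dil q z o\<^sub>L dinv q z = id_blinfun \<and> dinv q z o\<^sub>L dil q z = id_blinfun) \<and> complex_linear (dil q z) \<and> dil q z o\<^sub>L A = A o\<^sub>L dil q z"
	proof (cases "q = 0")
		case True
		have "cmod (z - of_real rh) > 0" using dist_ge[OF assms(1), of 0] rh s_pos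
			by (metis diff_zero less_le_trans mult_1 mult_pos_pos order_refl zero_less_one)
		then have "z - of_real rh ~= 0" by auto
		then show ?thesis
			using True by (simp add: dil_def dinv_def compose_scaleC_left compose_scaleC_right complex_linear_scaleC scaleC_scaleC A)
	next
		case False
		then have q: "0 < q" using assms(2) by simp
		let ?w = "(z - of_real ((1 - q) * rh)) / of_real q"
		have r: "?w \<in> resolvent_set (graph_of A)"
			using regD(1)[OF reg shifted_regular[OF assms(1) q]] assms(3) by simp
		have lin: "complex_linear (res A ?w)" by (rule complex_linear_resolvent[OF r])
		have dinv: "dinv q z = of_real q *\<^sub>C (?w *\<^sub>C id_blinfun - A)"
			using q unfolding dinv_def by (simp add: scaleC_diff_right scaleC_scaleC)
		have Gq: "dil q z = (1 / of_real q) *\<^sub>C res A ?w" using False by (simp add: dil_def)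
		have inv: "res A ?w o\<^sub>L (?w *\<^sub>C id_blinfun - A) = id_blinfun" "(?w *\<^sub>C id_blinfun - A) o\<^sub>L res A ?w = id_blinfun"
			using is_resolvent_resolvent[OF r] unfolding is_resolvent_graph_of by auto
		have linX: "complex_linear (?w *\<^sub>C id_blinfun - A)"
			by (intro complex_linear_diff complex_linear_scaleC complex_linear_id A)
		show ?thesis
			unfolding dinv Gq compose_scaleC_left compose_scaleC_right[OF lin] compose_scaleC_right[OF linX]
				compose_scaleC_right[OF A] inv resolvent_commutes[OF r refl A]
			using q lin by (simp add: scaleC_scaleC complex_linear_scaleC)
	qed
	then show "dil q z o\<^sub>L dinv q z = id_blinfun" "dinv q z o\<^sub>L dil q z = id_blinfun" "complex_linear (dil q z)"
		"dil q z o\<^sub>L A = A o\<^sub>L dil q z" by auto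
qed

text \<open>The resolvent estimate at the shifted point combined with the distance to (1 - q) rh.
  The summand 1 in M + 1 serves q = 0, where \<open>dil\<close> is a scalar multiple of the
  identity.\<close>

lemma norm_dil_le:
	assumes "z \<in> bimage" "0 \<le> q" "q \<le> q0" "q0 < 1"
	shows "norm (dil q z) \<le> (M + 1) / ((1 - q0) * rh * sin be)"
proof -
	have q: "q < 1" using assms by simp
	have d: "(1 - q0) * rh * sin be \<le> cmod (z - of_real ((1 - q) * rh))" using dist_ge[OF assms(1,2) q] assms rh s_pos
		by (meson diff_left_mono less_imp_le mult_right_mono order_trans)
	have d0: "0 < (1 - q0) * rh * sin be" using assms rh s_pos by simp
	have "norm (dil q z) \<le> (M + 1) / cmod (z - of_real ((1 - q) * rh))"
	proof (cases "q = 0")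
		case True
		have "norm (dil q z) = 1 / cmod (z - of_real rh) * norm (id_blinfun :: 'a \<Rightarrow>\<^sub>L 'a)"
			using True by (simp add: dil_def norm_scaleC norm_divide)
		also have "... \<le> 1 / cmod (z - of_real rh) * (M + 1)"
			using M_nonneg norm_id_blinfun_le[where 'a = 'a] by (intro mult_left_mono) auto
		finally show ?thesis using True by simp
	next
		case False
		then have q': "0 < q" using assms(2) by simp
		let ?w = "(z - of_real ((1 - q) * rh)) / of_real q"
		have "norm (dil q z) = 1 / q * norm (res A ?w)" using False q' by (simp add: dil_def norm_scaleC norm_divide)
		also have "... \<le> 1 / q * (M / cmod ?w)"
			using regD(2)[OF reg shifted_regular[OF assms(1) q']] q q' by (intro mult_left_mono) auto
		also have "... = M / cmod (z - of_real ((1 - q) * rh))" using q' by (simp add: norm_divide)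
		also have "... \<le> (M + 1) / cmod (z - of_real ((1 - q) * rh))" by (intro divide_right_mono) auto
		finally show ?thesis .
	qed
	also have "... \<le> (M + 1) / ((1 - q0) * rh * sin be)"
		by (rule frac_le[OF _ order_refl d0 d]) (use M_nonneg in simp)
	finally show ?thesis .
qed

lemma dil_diff:
	assumes "z \<in> bimage" "z' \<in> bimage" "0 \<le> q" "q < 1" "0 \<le> q'" "q' < 1"
	shows "dil q z - dil q z' = (z' - z) *\<^sub>C (dil q z o\<^sub>L dil q z')"
		and "dil q z - dil q' z = of_real (q' - q) *\<^sub>C (dil q z o\<^sub>L ((of_real rh *\<^sub>C id_blinfun - A) o\<^sub>L dil q' z))"
proof -
	have "dinv q z' - dinv q z = (z' - z) *\<^sub>C id_blinfun" by (simp add: dinv_def scaleC_diff_left)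
	then show "dil q z - dil q z' = (z' - z) *\<^sub>C (dil q z o\<^sub>L dil q z')"
		using inverse_diff[OF dil_inverse(1)[OF assms(1,3,4)] dil_inverse(2)[OF assms(2,3,4)]]
		by (simp add: compose_scaleC_left compose_scaleC_right[OF dil_inverse(3)[OF assms(1,3,4)]])
	have "dinv q' z - dinv q z = of_real (q' - q) *\<^sub>C (of_real rh *\<^sub>C id_blinfun - A)"
	proof -
		have "dinv q' z - dinv q z = ((z - of_real ((1 - q') * rh)) - (z - of_real ((1 - q) * rh))) *\<^sub>C id_blinfun
				- (of_real q' - of_real q) *\<^sub>C A" by (simp add: dinv_def scaleC_diff_left)
		also have "(z - of_real ((1 - q') * rh)) - (z - of_real ((1 - q) * rh)) = of_real (q' - q) * of_real rh"
			by (simp add: algebra_simps)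
		finally show ?thesis by (simp add: scaleC_diff_right scaleC_scaleC)
	qed
	then show "dil q z - dil q' z = of_real (q' - q) *\<^sub>C (dil q z o\<^sub>L ((of_real rh *\<^sub>C id_blinfun - A) o\<^sub>L dil q' z))"
		using inverse_diff[OF dil_inverse(1)[OF assms(1,3,4)] dil_inverse(2)[OF assms(1,5,6)]]
		by (simp add: compose_scaleC_left compose_scaleC_right[OF dil_inverse(3)[OF assms(1,3,4)]])
qed

lemma dil_has_derivative:
	assumes z: "z \<in> bimage" and q: "0 \<le> q" "q < 1"
	shows "(dil q has_derivative (%h. - (h *\<^sub>C (dil q z o\<^sub>L dil q z)))) (at z within bimage)"
	unfolding has_derivative_within_alt
proof (intro conjI allI impI)
	show "bounded_linear (%h. - (h *\<^sub>C (dil q z o\<^sub>L dil q z)))"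
		by (intro bounded_linear_minus bounded_linear_scaleC_left)
	define K where "K = (M + 1) / ((1 - q) * rh * sin be)"
	have K: "norm (dil q y) \<le> K" if "y \<in> bimage" for y
		unfolding K_def by (rule norm_dil_le[OF that q(1) order_refl q(2)])
	have K0: "0 \<le> K" using K[OF z] norm_ge_zero order_trans by blast
	fix e :: real assume e: "e > 0"
	show "\<exists>d>0. \<forall>y\<in>bimage. norm (y - z) < d -->
		 norm (dil q y - dil q z - - ((y - z) *\<^sub>C (dil q z o\<^sub>L dil q z))) \<le> e * norm (y - z)"
	proof (intro exI[of _ "e / (K * (K * K) + 1)"] conjI ballI impI)
		have pos: "0 < K * (K * K) + 1" using K0 by (simp add: add_nonneg_pos)
		then show "0 < e / (K * (K * K) + 1)" using e by simp
		fix y assume y: "y \<in> bimage" "norm (y - z) < e / (K * (K * K) + 1)"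
		have "dil q y - dil q z - - ((y - z) *\<^sub>C (dil q z o\<^sub>L dil q z)) = (z - y) *\<^sub>C ((dil q y - dil q z) o\<^sub>L dil q z)"
			unfolding compose_diff_left scaleC_diff_right
			using dil_diff(1)[OF y(1) z q q] by (simp add: scaleC_diff_left algebra_simps)
		also have "... = (z - y) *\<^sub>C ((z - y) *\<^sub>C ((dil q y o\<^sub>L dil q z) o\<^sub>L dil q z))"
			unfolding dil_diff(1)[OF y(1) z q q] compose_scaleC_left ..
		also have "norm ... = cmod (y - z) * (cmod (y - z) * norm ((dil q y o\<^sub>L dil q z) o\<^sub>L dil q z))"
			by (simp add: norm_scaleC norm_minus_commute)
		also have "... \<le> cmod (y - z) * (e / (K * (K * K) + 1) * (K * K * K))"
			using y K z K0 e pos by (intro mult_left_mono mult_mono compose_bound) (auto intro: less_imp_le)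
		also have "... = e * (K * (K * K) / (K * (K * K) + 1)) * norm (y - z)" by (simp add: mult_ac)
		also have "... \<le> e * 1 * norm (y - z)" using pos K0 e by (intro mult_right_mono mult_left_mono) auto
		finally show "norm (dil q y - dil q z - - ((y - z) *\<^sub>C (dil q z o\<^sub>L dil q z))) \<le> e * norm (y - z)" by simp
	qed
qed

lemma continuous_on_dil: "0 \<le> q ==> q < 1 ==> continuous_on bimage (dil q)"
	unfolding continuous_on_eq_continuous_within using has_derivative_continuous[OF dil_has_derivative] by blast

text \<open>The square of \<open>dil q\<close> has the primitive -\<open>dil q\<close>, which is
  continuous along the closed curve including the vertex, and the curve starts and ends
  there.\<close>

lemma cint_dil_sq:
	assumes q: "0 \<le> q" "q < 1"
	shows "cint (bcont be rh) (%z. dil q z o\<^sub>L dil q z) = 0"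
proof -
	define p where "p t = of_real rh * bpath be t" for t
	have pI: "p ` {0..1} = bimage" by (simp add: bimage_def p_def)
	have "((%t. - ((of_real rh * bderiv be t) *\<^sub>C (dil q (p t) o\<^sub>L dil q (p t)))) has_integral (dil q (p 1) - dil q (p 0))) bdom"
	proof (rule has_integral_bdom_FTC)
		have "continuous_on {0..1} p" unfolding p_def by (intro continuous_intros continuous_on_bpath)
		then show "continuous_on {0..1} (%t. dil q (p t))"
			by (rule continuous_on_compose2[OF continuous_on_dil[OF q]]) (simp add: pI)
		fix t assume t: "t \<in> bdom"
		then have ti: "t \<in> {0<..<1}" using bdom_subset by auto
		have "(p has_vector_derivative of_real rh * bderiv be t) (at t)"
			unfolding p_def by (auto intro!: derivative_eq_intros bpath_has_derivative t)
		then have "(p has_vector_derivative of_real rh * bderiv be t) (at t within {0..1})"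
			by (rule has_vector_derivative_at_within)
		then have "(p has_derivative (%x. x *\<^sub>R (of_real rh * bderiv be t))) (at t within {0..1})"
			by (simp add: has_vector_derivative_def)
		moreover have "(dil q has_derivative (%h. - (h *\<^sub>C (dil q (p t) o\<^sub>L dil q (p t))))) (at (p t) within p ` {0..1})"
			unfolding pI by (rule dil_has_derivative[OF _ q]) (use ti pI in force)
		ultimately have "((%t. dil q (p t)) has_derivative
				(%x. - ((x *\<^sub>R (of_real rh * bderiv be t)) *\<^sub>C (dil q (p t) o\<^sub>L dil q (p t))))) (at t within {0..1})"
			by (rule has_derivative_in_compose)
		then have "((%t. dil q (p t)) has_vector_derivative
				- ((of_real rh * bderiv be t) *\<^sub>C (dil q (p t) o\<^sub>L dil q (p t)))) (at t within {0..1})"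
			unfolding has_vector_derivative_def bounded_bilinear.scaleR_left[OF bounded_bilinear_scaleC] scaleR_minus_right .
		then show "((%t. dil q (p t)) has_vector_derivative
				- ((of_real rh * bderiv be t) *\<^sub>C (dil q (p t) o\<^sub>L dil q (p t)))) (at t)"
			using ti at_within_Icc_at[of 0 t 1] by simp
	qed
	from integral_unique[OF this]
	have "integral bdom (%t. - ((of_real rh * bderiv be t) *\<^sub>C (dil q (p t) o\<^sub>L dil q (p t)))) = 0"
		by (simp add: p_def)
	then show ?thesis unfolding integral_neg by (simp add: cint_def p_def)
qed

lemma cint_const: "cint (bcont be rh) (%z. x :: 'b::complex_banach) = 0"
proof -
	have "cint (bcont be rh) (%z. 1 :: complex) = 0" by (rule cint_bcont_eq_0[OF be rh s_less, where si = 1 and C = 1])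
			(use stc_bounds(2)[OF _ s_less] in auto)
	moreover have "integrand_on 1 (1 * (1 + (2 * rh) powr 2)) (bcont be rh) (%z. 1 :: complex)"
		by (intro integrand_on_bcont_bounded[OF be rh]) auto
	note cint_scaleC_left[OF contour_bcont[OF be rh] zero_less_one this, of x]
	ultimately show ?thesis by simp
qed

text \<open>The derivative of the integral in q is A - rh composed with the integral of the square
  of \<open>dil q\<close>, which vanishes. So the integral does not depend on q, and at q = 0 it is
  the scalar integral of 1 / (z - rh).\<close>

lemma cint_dil:
	assumes q0: "0 \<le> q0" "q0 < 1"
	shows "cint (bcont be rh) (dil q0) = (2 * pi * \<i>) *\<^sub>C id_blinfun"
proof -
	let ?c = "bcont be rh" and ?m = "1 + (2 * rh) powr 2"
	have c: "contour ?c" by (rule contour_bcont[OF be rh])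
	define K where "K = (M + 1) / ((1 - q0) * rh * sin be)"
	have K: "norm (dil q z) \<le> K" if "z \<in> bimage" "q \<in> {0..q0}" for q z
		unfolding K_def by (rule norm_dil_le) (use that q0 in auto)
	have K0: "0 \<le> K" unfolding K_def using M_nonneg q0 rh s_pos by simp
	let ?B = "of_real rh *\<^sub>C id_blinfun - A"
	define b where "b = norm ?B"
	have B: "complex_linear ?B" by (intro complex_linear_diff complex_linear_scaleC complex_linear_id A)
	have q1: "0 \<le> q" "q < 1" if "q \<in> {0..q0}" for q using that q0 by auto
	have cG: "continuous_on (locus ?c) (dil q)" if "q \<in> {0..q0}" for q
		by (rule continuous_on_subset[OF continuous_on_dil[OF q1[OF that]] locus_bimage])
	have adm: "integrand_on 1 (K * ?m) ?c (dil q)" if "q \<in> {0..q0}" for q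
		using K[OF _ that] locus_bimage by (intro integrand_on_bcont_bounded[OF be rh cG[OF that] _ K0]) blast
	\<comment> \<open>Inserting the first-order identity for \<open>dil\<close> into itself splits the
	  increment into a linear term, whose integral is 0, and the term \<open>E\<close> with a factor
	  (q' - q)^2. A function with quadratic increments is constant.\<close>
	have quad: "norm (cint ?c (dil q) - cint ?c (dil q')) \<le> K * b * (K * b * K) * ?m * mass 1 ?c * (q - q')\<^sup>2"
		if q: "q \<in> {0..q0}" and q': "q' \<in> {0..q0}" for q q'
	proof -
		define E where "E z = dil q z o\<^sub>L (?B o\<^sub>L (dil q' z o\<^sub>L (?B o\<^sub>L dil q' z)))" for z
		have E_le: "norm (E z) \<le> K * b * (K * b * K)" if "z \<in> locus ?c" for z
		proof -
			have z: "z \<in> bimage" using that locus_bimage by blast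
			have "norm (E z) \<le> K * (b * (K * (b * K)))"
				unfolding E_def b_def by (intro compose_bound K z q q' order_refl)
			then show ?thesis by (simp add: mult_ac)
		qed
		have E_adm: "integrand_on 1 (K * b * (K * b * K) * ?m) ?c E"
			by (rule integrand_on_bcont_bounded[OF be rh _ E_le])
				(auto simp: E_def b_def K0 intro!: continuous_intros cG q q' mult_nonneg_nonneg)
		have S_adm: "integrand_on 1 (K * K * ?m) ?c (%z. dil q' z o\<^sub>L dil q' z)"
		proof (rule integrand_on_bcont_bounded[OF be rh])
			show "norm (dil q' z o\<^sub>L dil q' z) \<le> K * K" if "z \<in> locus ?c" for z
				using that locus_bimage by (intro compose_bound K q') auto
		qed (auto simp: K0 intro!: continuous_intros cG q')
		have BS_adm: "integrand_on 1 (onorm (%T::'a \<Rightarrow>\<^sub>L 'a. ?B o\<^sub>L T) * (K * K * ?m)) ?c (%z. ?B o\<^sub>L (dil q' z o\<^sub>L dil q' z))"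
			by (rule integrand_on_linear[OF S_adm bounded_linear_compose_left])
		have eq: "dil q z = dil q' z + (of_real (q' - q) *\<^sub>C (?B o\<^sub>L (dil q' z o\<^sub>L dil q' z)) + of_real ((q' - q)\<^sup>2) *\<^sub>C E z)"
			if "z \<in> locus ?c" for z
		proof -
			have z: "z \<in> bimage" using that locus_bimage by blast
			note d = dil_diff(2)[OF z z q1[OF q] q1[OF q']]
			have comm: "dil q' z o\<^sub>L ?B = ?B o\<^sub>L dil q' z" using dil_inverse(3,4)[OF z q1[OF q']]
				by (simp add: compose_diff_left compose_diff_right compose_scaleC_left compose_scaleC_right)
			have "dil q z o\<^sub>L (?B o\<^sub>L dil q' z) = (dil q' z o\<^sub>L (?B o\<^sub>L dil q' z)) + ((dil q z - dil q' z) o\<^sub>L (?B o\<^sub>L dil q' z))"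
				by (simp only: compose_diff_left[of "dil q z"]) simp
			also have "(dil q z - dil q' z) o\<^sub>L (?B o\<^sub>L dil q' z) = of_real (q' - q) *\<^sub>C E z"
				unfolding d compose_scaleC_left E_def by (simp only: compose_assoc)
			also have "dil q' z o\<^sub>L (?B o\<^sub>L dil q' z) = ?B o\<^sub>L (dil q' z o\<^sub>L dil q' z)"
				by (simp only: compose_assoc[symmetric] comm)
			finally have "dil q z - dil q' z = of_real (q' - q) *\<^sub>C (?B o\<^sub>L (dil q' z o\<^sub>L dil q' z)) + of_real ((q' - q)\<^sup>2) *\<^sub>C E z"
				using d by (simp add: scaleC_add_right scaleC_scaleC power2_eq_square)
			then show ?thesis by (simp add: algebra_simps)
		qed
		have s1: "integrand_on 1 (onorm (%T::'a \<Rightarrow>\<^sub>L 'a. of_real (q' - q) *\<^sub>C T) * (onorm (%T::'a \<Rightarrow>\<^sub>L 'a. ?B o\<^sub>L T) * (K * K * ?m))) ?c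
				(%z. of_real (q' - q) *\<^sub>C (?B o\<^sub>L (dil q' z o\<^sub>L dil q' z)))"
			by (rule integrand_on_linear[OF BS_adm bounded_linear_scaleC])
		have s2: "integrand_on 1 (onorm (%T::'a \<Rightarrow>\<^sub>L 'a. of_real ((q' - q)\<^sup>2) *\<^sub>C T) * (K * b * (K * b * K) * ?m)) ?c
				(%z. of_real ((q' - q)\<^sup>2) *\<^sub>C E z)" by (rule integrand_on_linear[OF E_adm bounded_linear_scaleC])
		have s12: "integrand_on 1 (onorm (%T::'a \<Rightarrow>\<^sub>L 'a. of_real (q' - q) *\<^sub>C T) * (onorm (%T::'a \<Rightarrow>\<^sub>L 'a. ?B o\<^sub>L T) * (K * K * ?m))
				+ onorm (%T::'a \<Rightarrow>\<^sub>L 'a. of_real ((q' - q)\<^sup>2) *\<^sub>C T) * (K * b * (K * b * K) * ?m)) ?c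
				(%z. of_real (q' - q) *\<^sub>C (?B o\<^sub>L (dil q' z o\<^sub>L dil q' z)) + of_real ((q' - q)\<^sup>2) *\<^sub>C E z)"
			unfolding integrand_on_def
		proof (intro conjI ballI continuous_on_add)
			fix z assume z: "z \<in> locus ?c"
			show "norm (of_real (q' - q) *\<^sub>C (?B o\<^sub>L (dil q' z o\<^sub>L dil q' z)) + of_real ((q' - q)\<^sup>2) *\<^sub>C E z)
				\<le> (onorm (%T::'a \<Rightarrow>\<^sub>L 'a. of_real (q' - q) *\<^sub>C T) * (onorm (%T::'a \<Rightarrow>\<^sub>L 'a. ?B o\<^sub>L T) * (K * K * ?m))
					+ onorm (%T::'a \<Rightarrow>\<^sub>L 'a. of_real ((q' - q)\<^sup>2) *\<^sub>C T) * (K * b * (K * b * K) * ?m)) * wt 1 z"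
				unfolding distrib_right using s1 s2 z unfolding integrand_on_def
				by (intro order_trans[OF norm_triangle_ineq] add_mono) auto
		qed (use s1 s2 in \<open>auto simp: integrand_on_def\<close>)
		have "cint ?c (dil q) = cint ?c (%z. dil q' z + (of_real (q' - q) *\<^sub>C (?B o\<^sub>L (dil q' z o\<^sub>L dil q' z)) + of_real ((q' - q)\<^sup>2) *\<^sub>C E z))"
			by (rule cint_cong) (rule eq)
		also have "... = cint ?c (dil q') + (of_real (q' - q) *\<^sub>C (?B o\<^sub>L cint ?c (%z. dil q' z o\<^sub>L dil q' z)) + of_real ((q' - q)\<^sup>2) *\<^sub>C cint ?c E)"
			by (simp only: cint_add[OF c zero_less_one adm[OF q'] s12] cint_add[OF c zero_less_one s1 s2]
					cint_scaleC[OF c zero_less_one BS_adm] cint_scaleC[OF c zero_less_one E_adm]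
					cint_compose_left[OF c zero_less_one S_adm B])
		also have "cint ?c (%z. dil q' z o\<^sub>L dil q' z) = 0" by (rule cint_dil_sq[OF q1[OF q']])
		finally have "cint ?c (dil q) - cint ?c (dil q') = of_real ((q' - q)\<^sup>2) *\<^sub>C cint ?c E"
			by (simp add: bounded_bilinear.zero_right[OF bounded_bilinear_blinfun_compose])
		then have "norm (cint ?c (dil q) - cint ?c (dil q')) = (q' - q)\<^sup>2 * norm (cint ?c E)"
			by (simp only: norm_scaleC norm_of_real abs_power2)
		also have "... \<le> (q' - q)\<^sup>2 * (K * b * (K * b * K) * ?m * mass 1 ?c)"
			by (intro mult_left_mono norm_cint_le[OF c zero_less_one E_adm]) simp
		finally show ?thesis by (simp add: power2_commute[of q q'] mult_ac)
	qed
	have "(%q. cint ?c (dil q)) constant_on {0..q0}"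
	proof -
		have "((%q. cint ?c (dil q)) has_derivative (%h. 0)) (at q within {0..q0})" if "q \<in> {0..q0}" for q
			by (rule has_derivative_zero_of_quadratic[OF quad that])
		from has_derivative_zero_constant[OF convex_real_interval(5) this]
		show ?thesis unfolding constant_on_def by blast
	qed
	then have "cint ?c (dil q0) = cint ?c (dil 0)"
		unfolding constant_on_def using q0(1) by (metis atLeastAtMost_iff order_refl)
	also have "... = cint ?c (%z. (1 / (z - of_real rh)) *\<^sub>C id_blinfun)" by (rule cint_cong) (simp add: dil_def)
	also have "... = cint ?c (%z. 1 / (z - of_real rh)) *\<^sub>C id_blinfun"
	proof (rule cint_scaleC_left[OF c zero_less_one])
		have ge: "rh * sin be \<le> cmod (z - of_real rh)" if "z \<in> locus ?c" for z
			using dist_ge[of z 0] that locus_bimage by auto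
		have pos: "0 < rh * sin be" using rh s_pos by simp
		have "z - of_real rh ~= 0" if "z \<in> locus ?c" for z using ge[OF that] pos by auto
		then show "integrand_on 1 (1 / (rh * sin be) * ?m) ?c (%z. 1 / (z - of_real rh))"
			using ge pos by (intro integrand_on_bcont_bounded[OF be rh] continuous_intros)
				(auto simp: norm_divide frac_le)
	qed
	also have "cint ?c (%z. 1 / (z - of_real rh)) = 2 * pi * \<i>"
		by (rule cint_bcont_inverse[OF be rh of_real_in_sto]) (use rh s_pos in auto)
	finally show ?thesis by simp
qed

text \<open>The factor z compensates the growth M / |z| at the vertex. For q < 1 the corresponding
  integrand is I + q A \<open>dil q\<close>, with integral 2 pi i q A; then q tends to 1.\<close>

lemma cint_resolvent: "cint (bcont be rh) (%z. z *\<^sub>C res A z) = (2 * pi * \<i>) *\<^sub>C A"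
proof -
	let ?c = "bcont be rh"
	have c: "contour ?c" by (rule contour_bcont[OF be rh])
	define q where "q n = 1 - 1 / (real n + 2)" for n
	have q: "0 < q n" "q n < 1" for n by (auto simp: q_def field_simps)
	have q_lim: "q \<longlonglongrightarrow> 1" unfolding q_def by real_asymp
	define H where "H n z = (z - of_real ((1 - q n) * rh)) *\<^sub>C dil (q n) z" for n z
	have G_adm: "\<exists>K. integrand_on 1 K ?c (dil (q n))" for n
	proof -
		let ?K = "(M + 1) / ((1 - q n) * rh * sin be)"
		have "0 \<le> ?K" using M_nonneg q[of n] rh s_pos by simp
		then have "integrand_on 1 (?K * (1 + (2 * rh) powr 2)) ?c (dil (q n))"
			using norm_dil_le[of _ "q n" "q n"] q[of n] locus_bimage
			by (intro integrand_on_bcont_bounded[OF be rh] continuous_on_subset[OF continuous_on_dil locus_bimage])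
				(auto intro: less_imp_le)
		then show ?thesis by blast
	qed
	have int: "cint ?c (H n) = of_real (q n) *\<^sub>C (A o\<^sub>L ((2 * pi * \<i>) *\<^sub>C id_blinfun))" for n
	proof -
		obtain K where K: "integrand_on 1 K ?c (dil (q n))" using G_adm by blast
		have AG: "integrand_on 1 (onorm (%T::'a \<Rightarrow>\<^sub>L 'a. A o\<^sub>L T) * K) ?c (%z. A o\<^sub>L dil (q n) z)"
			by (rule integrand_on_linear[OF K bounded_linear_compose_left])
		have qAG: "integrand_on 1 (onorm (%T::'a \<Rightarrow>\<^sub>L 'a. of_real (q n) *\<^sub>C T) * (onorm (%T::'a \<Rightarrow>\<^sub>L 'a. A o\<^sub>L T) * K)) ?c
				(%z. of_real (q n) *\<^sub>C (A o\<^sub>L dil (q n) z))" by (rule integrand_on_linear[OF AG bounded_linear_scaleC])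
		have one: "integrand_on 1 (1 * (1 + (2 * rh) powr 2)) ?c (%z. id_blinfun :: 'a \<Rightarrow>\<^sub>L 'a)"
			by (rule integrand_on_bcont_bounded[OF be rh]) (auto intro: norm_id_blinfun_le)
		have "H n z = id_blinfun + of_real (q n) *\<^sub>C (A o\<^sub>L dil (q n) z)" if "z \<in> locus ?c" for z
		proof -
			have "dinv (q n) z o\<^sub>L dil (q n) z = id_blinfun"
				using that locus_bimage q[of n] by (intro dil_inverse(2)) (auto intro: less_imp_le)
			then show ?thesis by (simp add: dinv_def H_def compose_diff_left compose_scaleC_left algebra_simps)
		qed
		then have "cint ?c (H n) = cint ?c (%z. id_blinfun + of_real (q n) *\<^sub>C (A o\<^sub>L dil (q n) z))"
			by (rule cint_cong)
		also have "... = cint ?c (%z. id_blinfun) + of_real (q n) *\<^sub>C (A o\<^sub>L cint ?c (dil (q n)))"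
			by (simp only: cint_add[OF c zero_less_one one qAG] cint_scaleC[OF c zero_less_one AG]
					cint_compose_left[OF c zero_less_one K A])
		finally show ?thesis using q[of n] by (simp add: cint_const cint_dil less_imp_le)
	qed
	have c_b: "continuous_on bdom (%t. of_real rh * bpath be t)"
		by (intro continuous_intros continuous_on_subset[OF continuous_on_bpath]) (use bdom_subset in auto)
	have loc: "of_real rh * bpath be t \<in> locus ?c" if "t \<in> bdom" for t using pnt_locus[of t ?c] that by simp
	have res_cont: "continuous_on (- sto (sin be) rh - {0}) (res A)" by (rule reg_continuous_on[OF reg]) auto
	have l_out: "locus ?c \<subseteq> - sto (sin be) rh - {0}" using locus_bcont[OF be rh] by blast
	have "(%n. cint ?c (H n)) \<longlonglongrightarrow> cint ?c (%z. z *\<^sub>C res A z)" unfolding cint_def bcont_simps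
	proof (rule dominated_tendsto[OF open_bdom])
		have "continuous_on (locus ?c) (H n)" for n unfolding H_def using q[of n]
			by (intro continuous_intros continuous_on_subset[OF continuous_on_dil locus_bimage]) auto
		then show "continuous_on bdom (%t. (of_real rh * bderiv be t) *\<^sub>C H n (of_real rh * bpath be t))" for n
			using loc by (intro continuous_intros continuous_on_bderiv continuous_on_compose2[OF _ c_b]) auto
		have "continuous_on (locus ?c) (%z. z *\<^sub>C res A z)"
			by (intro continuous_intros continuous_on_subset[OF res_cont l_out])
		then have "continuous_on bdom (%t. (%z. z *\<^sub>C res A z) (of_real rh * bpath be t))"
			by (rule continuous_on_compose2[OF _ c_b]) (use loc in auto)
		then show "continuous_on bdom (%t. (of_real rh * bderiv be t) *\<^sub>C ((of_real rh * bpath be t) *\<^sub>C res A (of_real rh * bpath be t)))"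
			by (intro continuous_on_scaleC[of _ "%t. of_real rh * bderiv be t"] continuous_on_mult
					continuous_on_const continuous_on_bderiv) simp
		show "(%t. rh * M * (cmod (bderiv be t) * cmod (bpath be t) powr (1 - 1))) integrable_on bdom"
			by (intro integrable_on_mult_right integrable_bpath_powr be) auto
		fix t assume t: "t \<in> bdom"
		define z where "z = of_real rh * bpath be t"
		have zl: "z \<in> locus ?c" unfolding z_def by (rule loc[OF t])
		have z: "z \<in> bimage" "z ~= 0" using zl locus_bimage l_out by auto
		define w where "w n = (z - of_real ((1 - q n) * rh)) / of_real (q n)" for n
		have w: "w n \<in> - sto (sin be) rh - {0}" for n
			using shifted_regular[OF z(1) q(1)[of n]] q[of n] unfolding w_def by auto
		\<comment> \<open>In this form the operators are bounded by M uniformly in n, which supplies the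
		  majorant for the passage to the limit.\<close>
		have Hw: "H n z = w n *\<^sub>C res A (w n)" for n using q[of n] by (simp add: H_def dil_def w_def scaleC_scaleC)
		show "norm ((of_real rh * bderiv be t) *\<^sub>C H n (of_real rh * bpath be t))
				\<le> rh * M * (cmod (bderiv be t) * cmod (bpath be t) powr (1 - 1))" for n
		proof -
			have "norm (H n z) \<le> M"
				unfolding Hw norm_scaleC using regD(2)[OF reg, of "w n"] w[of n] by (simp add: field_simps)
			then have "rh * cmod (bderiv be t) * norm (H n z) \<le> rh * cmod (bderiv be t) * M"
				using rh by (intro mult_left_mono) auto
			moreover have "bpath be t ~= 0" using z(2) by (auto simp: z_def)
			ultimately show ?thesis unfolding z_def[symmetric] norm_scaleC using rh by (simp add: norm_mult mult_ac)
		qed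
		show "(%n. (of_real rh * bderiv be t) *\<^sub>C H n (of_real rh * bpath be t)) \<longlonglongrightarrow>
				(of_real rh * bderiv be t) *\<^sub>C ((of_real rh * bpath be t) *\<^sub>C res A (of_real rh * bpath be t))"
			unfolding z_def[symmetric] Hw
		proof (intro tendsto_scaleC tendsto_const)
			have "w \<longlonglongrightarrow> (z - of_real ((1 - 1) * rh)) / of_real 1" unfolding w_def by (intro tendsto_intros q_lim) auto
			then show wl: "w \<longlonglongrightarrow> z" by simp
			show "(%n. res A (w n)) \<longlonglongrightarrow> res A z"
				by (rule continuous_on_tendsto_compose[OF res_cont wl]) (use w zl l_out in auto)
		qed
	qed
	moreover have "(%n. of_real (q n) *\<^sub>C (A o\<^sub>L ((2 * pi * \<i>) *\<^sub>C id_blinfun))) \<longlonglongrightarrow>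
			of_real 1 *\<^sub>C (A o\<^sub>L ((2 * pi * \<i>) *\<^sub>C id_blinfun))" by (intro tendsto_intros q_lim)
	ultimately have "cint ?c (%z. z *\<^sub>C res A z) = of_real 1 *\<^sub>C (A o\<^sub>L ((2 * pi * \<i>) *\<^sub>C id_blinfun))"
		unfolding int using LIMSEQ_unique by blast
	then show ?thesis by (simp add: compose_scaleC_right[OF A])
qed

end

subsection \<open>A Cauchy kernel vanishing at the vertex and at infinity\<close>

text \<open>As a function of z it factors as z (1 + mu) / ((1 + z) mu (mu - z)), see
  \<open>ker_eq\<close>. The auxiliary pole -1 lies outside all sectors of angle below pi /
  2.\<close>

definition ker :: "complex => complex => complex" where
	"ker mu z = 1 / (mu - z) - 1 / (mu * (1 + z))"

text \<open>The value of \<open>ker mu\<close> at the operator \<open>A\<close>.\<close>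

definition qop :: "('a::complex_normed_vector \<Rightarrow>\<^sub>L 'a) => complex => ('a \<Rightarrow>\<^sub>L 'a)" where
	"qop A mu = res A mu + (1 / mu) *\<^sub>C res A (- 1)"

lemma ker_eq:
	assumes "mu ~= z" "z ~= - 1" "mu ~= 0"
	shows "ker mu z = z / (1 + z) * ((1 + mu) / mu / (mu - z))"
proof -
	have "mu - z ~= 0" "1 + z ~= 0" using assms by (auto simp: add_eq_0_iff)
	then have "ker mu z = (mu * (1 + z) - (mu - z)) / ((mu - z) * (mu * (1 + z)))"
		using assms(3) unfolding ker_def by (simp add: diff_frac_eq)
	also have "mu * (1 + z) - (mu - z) = z * (1 + mu)" by (simp add: algebra_simps)
	finally show ?thesis by (simp add: mult_ac)
qed

lemma norm_one_plus_ge: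
	assumes "0 \<le> Re z" shows "1 \<le> cmod (1 + z)" "cmod z \<le> cmod (1 + z)"
proof -
	show "1 \<le> cmod (1 + z)" using abs_Re_le_cmod[of "1 + z"] assms by simp
	show "cmod z \<le> cmod (1 + z)" using norm_real_add_ge[of 1 z] assms by simp
qed

text \<open>The distance is comparable to both moduli. From d |z| \<le> |mu - z| with d = (s' - s) /
  2 the triangle inequality gives the bound by |mu| with d / (1 + d), which is the constant
  \<open>ka\<close>.\<close>

lemma separated:
	assumes z: "z \<in> stc s rh" and mu: "mu \<notin> sto s' rh" and s: "s < s'" "s < 1"
	defines "ka \<equiv> (s' - s) / (2 + (s' - s))"
	shows "0 < ka" "ka * cmod z \<le> cmod (mu - z)" "ka * cmod mu \<le> cmod (mu - z)"
proof -
	define d where "d = (s' - s) / 2"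
	have d: "0 < d" and ka: "ka = d / (1 + d)" using s by (auto simp: d_def ka_def field_simps)
	show "0 < ka" using d by (simp add: ka)
	have dz: "d * cmod z \<le> cmod (mu - z)" unfolding d_def by (rule stc_separated[OF z mu s])
	have "ka \<le> d" using d by (simp add: ka field_simps)
	then have "ka * cmod z \<le> d * cmod z" by (intro mult_right_mono) auto
	then show "ka * cmod z \<le> cmod (mu - z)" using dz by linarith
	have "cmod mu \<le> cmod (mu - z) + cmod z" using norm_triangle_sub[of mu z] by simp
	then have "d * cmod mu \<le> d * cmod (mu - z) + d * cmod z" using d by (simp flip: distrib_left)
	also have "... \<le> (1 + d) * cmod (mu - z)" using dz by (simp add: algebra_simps)
	finally show "ka * cmod mu \<le> cmod (mu - z)" using d by (simp add: ka field_simps)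
qed

text \<open>|mu - z| is at least \<open>ka\<close> times the larger of |mu| and |z|, hence at least
  \<open>ka\<close> |mu|^ta |z|^(1 - ta). The free exponent \<open>ta\<close> trades decay in z
  against the singularity in mu.\<close>

lemma norm_ker_le:
	assumes ka: "0 < ka" "ka * cmod z \<le> cmod (mu - z)" "ka * cmod mu \<le> cmod (mu - z)"
		and "0 \<le> Re z" "z ~= 0" "mu ~= 0" and ta: "0 \<le> ta" "ta \<le> 1"
	shows "cmod (ker mu z) \<le> (1 + cmod mu) / ka * (cmod mu powr (- ta - 1) * (cmod z powr ta / cmod (1 + z)))"
proof -
	define x y where "x = cmod mu" and "y = cmod z"
	have xy: "0 < x" "0 < y" using assms by (auto simp: x_def y_def)
	let ?m = "max x y"
	have "x powr ta * y powr (1 - ta) \<le> ?m powr ta * ?m powr (1 - ta)" using xy ta by (intro mult_mono powr_mono2) auto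
	also have "... = ?m" using xy by (simp flip: powr_add)
	finally have "ka * (x powr ta * y powr (1 - ta)) \<le> ka * ?m" using ka(1) by simp
	also have "... \<le> cmod (mu - z)" using ka(2,3) by (simp add: max_def x_def y_def)
	finally have sep: "ka * (x powr ta * y powr (1 - ta)) \<le> cmod (mu - z)" .
	have pos: "0 < ka * (x powr ta * y powr (1 - ta))" using ka(1) xy by simp
	then have "cmod (mu - z) > 0" using sep by linarith
	then have ne: "mu ~= z" by auto
	have one: "1 \<le> cmod (1 + z)" using norm_one_plus_ge assms by blast
	have z1: "z ~= - 1" using assms(4) by auto
	have "cmod (ker mu z) = y / cmod (1 + z) * (cmod (1 + mu) / x / cmod (mu - z))"
		unfolding ker_eq[OF ne z1 assms(6)] x_def y_def by (simp add: norm_mult norm_divide)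
	also have "... \<le> y / cmod (1 + z) * ((1 + x) / x / (ka * (x powr ta * y powr (1 - ta))))"
		using sep pos xy one norm_triangle_ineq[of 1 mu]
		by (intro mult_left_mono frac_le divide_right_mono divide_nonneg_nonneg) (auto simp: x_def)
	also have "... = (1 + x) / ka * (x powr (- ta - 1) * (y powr ta / cmod (1 + z)))"
	proof -
		have gen: "y / c * ((1 + x) / x / (ka * (a * (y / b)))) = (1 + x) / ka * (1 / (a * x) * (b / c))"
			if "c > 0" "a > 0" "b > 0" for a b c :: real using that xy ka(1) by (simp add: field_simps)
		have "y powr (1 - ta) = y / y powr ta" "x powr (- ta - 1) = 1 / (x powr ta * x)"
			using xy by (simp_all add: powr_diff powr_minus field_simps)
		moreover have "0 < cmod (1 + z)" using one by linarith
		ultimately show ?thesis using gen[of "cmod (1 + z)" "x powr ta" "y powr ta"] xy by simp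
	qed
	finally show ?thesis unfolding x_def y_def .
qed

lemma norm_qop_le:
	assumes "reg A s rh M" "s < 1" "mu \<notin> sto s rh" "mu ~= 0"
	shows "norm (qop A mu) \<le> 2 * M / cmod mu"
proof -
	have "norm (res A mu) \<le> M / cmod mu" by (rule regD(2)[OF assms(1,3,4)])
	moreover have "norm (res A (- 1)) \<le> M" using regD(2)[OF assms(1) minus_one_notin_sto[OF assms(2)]] by simp
	then have "norm ((1 / mu) *\<^sub>C res A (- 1)) \<le> M / cmod mu"
		unfolding norm_scaleC by (simp add: norm_divide divide_right_mono)
	ultimately show ?thesis
		unfolding qop_def using norm_triangle_ineq[of "res A mu" "(1 / mu) *\<^sub>C res A (- 1)"] by simp
qed

lemma continuous_on_qop:
	assumes "reg A s rh M" "V \<inter> sto s rh = {}" "0 \<notin> V"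
	shows "continuous_on V (qop A)" unfolding qop_def
	by (intro continuous_on_add continuous_on_scaleC continuous_on_const continuous_on_divide
			continuous_on_id reg_continuous_on[OF assms]) (use assms in auto)

text \<open>The operator form of the factorization of the kernel: R(-1) is minus the inverse of I +
  A, which accounts for the sign. The factor \<open>A\<close> in front matches the integral of z
  R(z, A).\<close>

lemma compose_qop:
	assumes A: "complex_linear A" and r: "mu \<in> resolvent_set (graph_of A)" "- 1 \<in> resolvent_set (graph_of A)"
		and ne: "mu ~= 0"
	shows "A o\<^sub>L (- ((1 + mu) / mu) *\<^sub>C (res A mu o\<^sub>L res A (- 1))) = qop A mu"
proof -
	let ?R = "res A" and ?Q = "- ((1 + mu) / mu) *\<^sub>C (res A mu o\<^sub>L res A (- 1))"
	have m1: "?R mu - ?R (- 1) = (- 1 - mu) *\<^sub>C (?R mu o\<^sub>L ?R (- 1))" by (rule resolvent_identity[OF r])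
	show "A o\<^sub>L ?Q = qop A mu"
	proof -
		have "A o\<^sub>L ?Q = - ((1 + mu) / mu) *\<^sub>C ((A o\<^sub>L ?R mu) o\<^sub>L ?R (- 1))"
			by (simp add: compose_scaleC_right[OF A] compose_assoc)
		also have "(A o\<^sub>L ?R mu) o\<^sub>L ?R (- 1) = mu *\<^sub>C (?R mu o\<^sub>L ?R (- 1)) - ?R (- 1)"
			by (simp add: compose_resolvent[OF r(1)] compose_diff_left compose_scaleC_left)
		also have "- ((1 + mu) / mu) *\<^sub>C (mu *\<^sub>C (?R mu o\<^sub>L ?R (- 1)) - ?R (- 1))
				= (- 1 - mu) *\<^sub>C (?R mu o\<^sub>L ?R (- 1)) + (1 / mu + 1) *\<^sub>C ?R (- 1)"
		proof -
			have "- ((1 + mu) / mu) * mu = - 1 - mu" "- ((1 + mu) / mu) = - (1 / mu + 1)"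
				using ne by (simp, simp add: add_divide_distrib)
			then show ?thesis unfolding scaleC_diff_right scaleC_scaleC
				by (simp only: scaleC_minus_left diff_minus_eq_add)
		qed
		also have "... = qop A mu" unfolding m1[symmetric] by (simp add: qop_def scaleC_add_left)
		finally show ?thesis .
	qed
qed

text \<open>Two applications of the resolvent identity separate the spectral variable: scalar
  functions of z times fixed operators, plus z R(z) - I composed with a fixed operator.\<close>

lemma ker_resolvent:
	assumes A: "complex_linear A" and r: "z \<in> resolvent_set (graph_of A)"
		"mu \<in> resolvent_set (graph_of A)" "- 1 \<in> resolvent_set (graph_of A)" and ne: "mu ~= z" "z ~= - 1" "mu ~= 0"
	shows "ker mu z *\<^sub>C res A z = (1 / (mu - z)) *\<^sub>C res A mu - (1 / (mu * (1 + z))) *\<^sub>C res A (- 1)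
			+ ((z *\<^sub>C res A z - id_blinfun) o\<^sub>L (- ((1 + mu) / mu) *\<^sub>C (res A mu o\<^sub>L res A (- 1))))"
proof -
	let ?R = "res A" and ?Q = "- ((1 + mu) / mu) *\<^sub>C (res A mu o\<^sub>L res A (- 1))"
	have d: "mu - z ~= 0" "1 + z ~= 0" using ne by (auto simp: add_eq_0_iff)
	note AQ = compose_qop[OF A r(2,3) ne(3)]
	have e1: "(1 / (mu - z)) *\<^sub>C ?R z = (1 / (mu - z)) *\<^sub>C ?R mu + (?R z o\<^sub>L ?R mu)"
	proof -
		have "(1 / (mu - z)) *\<^sub>C (?R z - ?R mu) = ?R z o\<^sub>L ?R mu"
			unfolding resolvent_identity[OF r(1,2)] using d by (simp add: scaleC_scaleC)
		then show ?thesis by (simp add: scaleC_diff_right algebra_simps)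
	qed
	have e2: "(1 / (mu * (1 + z))) *\<^sub>C ?R z = (1 / (mu * (1 + z))) *\<^sub>C ?R (- 1) - (1 / mu) *\<^sub>C (?R z o\<^sub>L ?R (- 1))"
	proof -
		have "(1 / (mu * (1 + z))) *\<^sub>C (?R z - ?R (- 1)) = ((1 / (mu * (1 + z))) * (- 1 - z)) *\<^sub>C (?R z o\<^sub>L ?R (- 1))"
			unfolding resolvent_identity[OF r(1,3)] by (simp add: scaleC_scaleC)
		also have "(1 / (mu * (1 + z))) * (- 1 - z) = - (1 / mu)"
		proof -
			have "1 / (mu * b) * (- b) = - (1 / mu)" if "b ~= 0" for b using that by simp
			moreover have "- 1 - z = - (1 + z)" by simp
			ultimately show ?thesis using d(2) by (simp only:) 
		qed
		finally show ?thesis by (simp add: scaleC_diff_right scaleC_minus_left algebra_simps)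
	qed
	have "(?R z o\<^sub>L A) o\<^sub>L ?Q = ?R z o\<^sub>L qop A mu" by (simp only: compose_assoc AQ)
	also have "... = (?R z o\<^sub>L ?R mu) + (1 / mu) *\<^sub>C (?R z o\<^sub>L ?R (- 1))"
		unfolding qop_def compose_add_right compose_scaleC_right[OF complex_linear_resolvent[OF r(1)]] ..
	finally have e3: "(z *\<^sub>C ?R z - id_blinfun) o\<^sub>L ?Q = (?R z o\<^sub>L ?R mu) + (1 / mu) *\<^sub>C (?R z o\<^sub>L ?R (- 1))"
		unfolding resolvent_compose[OF r(1)] .
	show "ker mu z *\<^sub>C ?R z = (1 / (mu - z)) *\<^sub>C ?R mu - (1 / (mu * (1 + z))) *\<^sub>C ?R (- 1)
			+ ((z *\<^sub>C ?R z - id_blinfun) o\<^sub>L ?Q)" unfolding e3 ker_def scaleC_diff_left e1 e2 by simp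
qed

lemma integrand_on_add:
	assumes "integrand_on s C c F" "integrand_on s D c H"
	shows "integrand_on s (C + D) c (%z. F z + H z)" unfolding integrand_on_def
proof (intro conjI ballI continuous_on_add)
	fix z assume z: "z \<in> locus c"
	show "norm (F z + H z) \<le> (C + D) * wt s z" unfolding distrib_right using assms z unfolding integrand_on_def
		by (intro order_trans[OF norm_triangle_ineq] add_mono) auto
qed (use assms in \<open>auto simp: integrand_on_def\<close>)

lemma sin_less_one: "0 < be ==> be < pi / 2 ==> sin be < 1" using sin_monotone_2pi[of be "pi/2"] by simp

text \<open>The scalar terms of the decomposition have their poles \<open>mu\<close> and -1 outside
  the domain and integrate to 0. The last term gives 2 pi i A composed with the fixed operator, and
  that is 2 pi i times \<open>qop\<close>.\<close>

lemma cint_ker_resolvent: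
	fixes A :: "'a::complex_banach \<Rightarrow>\<^sub>L 'a"
	assumes A: "complex_linear A" and be: "0 < be" "be < pi / 2" and rh: "0 < rh"
		and reg: "reg A (sin be) rh M" and s': "sin be < s'" "s' \<le> 1" and mu: "mu \<notin> sto s' rh" "mu ~= 0"
	shows "cint (bcont be rh) (%z. ker mu z *\<^sub>C res A z) = (2 * pi * \<i>) *\<^sub>C qop A mu"
proof -
	let ?c = "bcont be rh" and ?R = "res A" and ?m = "1 + (2 * rh) powr 2"
	let ?Q = "- ((1 + mu) / mu) *\<^sub>C (?R mu o\<^sub>L ?R (- 1))"
	have s1: "sin be < 1" by (rule sin_less_one[OF be])
	have c: "contour ?c" by (rule contour_bcont[OF be rh])
	have mu': "mu \<notin> sto (sin be) rh" using mu(1) sto_mono[of "sin be" s' rh rh] s'(1) by auto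
	have rmu: "mu \<in> resolvent_set (graph_of A)" by (rule regD(1)[OF reg mu' mu(2)])
	have r1: "- 1 \<in> resolvent_set (graph_of A)" by (rule regD(1)[OF reg minus_one_notin_sto[OF s1]]) simp
	have M: "0 \<le> M" by (rule reg_nonneg[OF reg s1])
	define ka where "ka = (s' - sin be) / (2 + (s' - sin be))"
	have ka: "0 < ka" and far: "\<And>z. z \<in> stc (sin be) rh ==> ka * cmod mu \<le> cmod (mu - z)"
		using separated[OF _ mu(1) s'(1) s1] s'(1) by (auto simp: ka_def)
	have pos: "0 < ka * cmod mu" using ka mu(2) by simp
	have le1: "cmod (1 / (mu - z)) \<le> 1 / (ka * cmod mu)" if "z \<in> stc (sin be) rh" for z
		using frac_le[OF _ order_refl pos far[OF that], of 1] by (simp add: norm_divide)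
	have le2: "cmod (- 1 / (mu * (1 + z))) \<le> 1 / cmod mu" if "z \<in> stc (sin be) rh" for z
	proof -
		have "1 \<le> cmod (1 + z)" using norm_one_plus_ge(1)[of z] stc_bounds(1)[OF that s1] by simp
		then have "cmod mu * 1 \<le> cmod mu * cmod (1 + z)" by (intro mult_left_mono) auto
		then show ?thesis using frac_le[of 1 1 "cmod mu" "cmod mu * cmod (1 + z)"] mu(2)
			by (simp add: norm_divide norm_mult)
	qed
	have ne: "mu ~= z" "z ~= - 1" if "z \<in> stc (sin be) rh" for z
		using far[OF that] pos stc_bounds(1)[OF that s1] by auto
	have ne': "mu ~= z" "1 + z ~= 0" if "z \<in> sto s' rh" for z using that mu(1) minus_one_notin_sto[of "s'" rh] s'
		by (auto simp: add_eq_0_iff sto_def) (smt (verit, best) Re_complex_of_real abs_Re_le_cmod minus_complex.sel(1) mult_left_le one_complex.sel(1) uminus_complex.sel(1))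
	have h1: "(%z. 1 / (mu - z)) holomorphic_on sto s' rh" using ne' by (intro holomorphic_intros) auto
	have h2: "(%z. - 1 / (mu * (1 + z))) holomorphic_on sto s' rh" using ne' mu(2) by (intro holomorphic_intros) auto
	have one: "cmod z powr (1 - 1) = 1" if "z \<in> stc (sin be) rh" for z using stc_bounds(2)[OF that s1] by simp
	have i1: "cint ?c (%z. 1 / (mu - z)) = 0"
		by (rule cint_bcont_eq_0[OF be rh s'(1) h1, where si = 1 and C = "1 / (ka * cmod mu)"]) (use le1 one pos in auto)
	have i2: "cint ?c (%z. - 1 / (mu * (1 + z))) = 0"
		by (rule cint_bcont_eq_0[OF be rh s'(1) h2, where si = 1 and C = "1 / cmod mu"]) (use le2 one in auto)
	have lsub: "locus ?c \<subseteq> stc (sin be) rh" using locus_bcont(1)[OF be rh] by blast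
	have lsub': "locus ?c \<subseteq> sto s' rh" using lsub stc_subset_sto[OF s'(1) order_refl] by blast
	have a1: "integrand_on 1 (1 / (ka * cmod mu) * ?m) ?c (%z. 1 / (mu - z))"
		using lsub le1 pos by (intro integrand_on_bcont_bounded[OF be rh]
				continuous_on_subset[OF holomorphic_on_imp_continuous_on[OF h1] lsub']) auto
	have a2: "integrand_on 1 (1 / cmod mu * ?m) ?c (%z. - 1 / (mu * (1 + z)))"
		using lsub le2 by (intro integrand_on_bcont_bounded[OF be rh]
				continuous_on_subset[OF holomorphic_on_imp_continuous_on[OF h2] lsub']) auto
	have a3: "integrand_on 1 (M * ?m) ?c (%z. z *\<^sub>C ?R z)"
	proof (rule integrand_on_bcont_bounded[OF be rh])
		show "continuous_on (locus ?c) (%z. z *\<^sub>C ?R z)"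
			using locus_bcont[OF be rh] by (intro continuous_intros reg_continuous_on[OF reg]) blast+
		show "norm (z *\<^sub>C ?R z) \<le> M" if "z \<in> locus ?c" for z
			using regD(2)[OF reg, of z] locus_bcont[OF be rh that] by (simp add: norm_scaleC field_simps)
	qed (rule M)
	have a4: "integrand_on 1 (1 * ?m) ?c (%z. - id_blinfun :: 'a \<Rightarrow>\<^sub>L 'a)"
		using norm_id_blinfun_le[where 'a = 'a] by (intro integrand_on_bcont_bounded[OF be rh]) auto
	have i34: "cint ?c (%z. z *\<^sub>C ?R z + (- id_blinfun)) = (2 * pi * \<i>) *\<^sub>C A"
		using cint_add[OF c zero_less_one a3 a4] cint_resolvent[OF A be rh reg]
			cint_const[OF A be rh reg, of "- id_blinfun :: 'a \<Rightarrow>\<^sub>L 'a"] by simp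
	have a34: "integrand_on 1 (M * ?m + 1 * ?m) ?c (%z. z *\<^sub>C ?R z + (- id_blinfun))"
		by (rule integrand_on_add[OF a3 a4])
	note b1 = integrand_on_linear[OF a1 bounded_linear_scaleC_left[of "?R mu"]]
		and b2 = integrand_on_linear[OF a2 bounded_linear_scaleC_left[of "?R (- 1)"]]
		and b3 = integrand_on_linear[OF a34 bounded_linear_compose_right[of ?Q]]
	have "cint ?c (%z. ker mu z *\<^sub>C ?R z) = cint ?c (%z. (1 / (mu - z)) *\<^sub>C ?R mu
			+ ((- 1 / (mu * (1 + z))) *\<^sub>C ?R (- 1) + ((z *\<^sub>C ?R z + (- id_blinfun)) o\<^sub>L ?Q)))"
	proof (rule cint_cong)
		fix z assume z: "z \<in> locus ?c"
		have "z \<in> resolvent_set (graph_of A)" using regD(1)[OF reg] locus_bcont[OF be rh z] by blast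
		from ker_resolvent(1)[OF A this rmu r1 ne[OF subsetD[OF lsub z]] mu(2)]
		show "ker mu z *\<^sub>C ?R z = (1 / (mu - z)) *\<^sub>C ?R mu
			+ ((- 1 / (mu * (1 + z))) *\<^sub>C ?R (- 1) + ((z *\<^sub>C ?R z + (- id_blinfun)) o\<^sub>L ?Q))"
			by (simp add: scaleC_minus_left)
	qed
	also have "... = cint ?c (%z. (1 / (mu - z)) *\<^sub>C ?R mu) + (cint ?c (%z. (- 1 / (mu * (1 + z))) *\<^sub>C ?R (- 1))
			+ cint ?c (%z. (z *\<^sub>C ?R z + (- id_blinfun)) o\<^sub>L ?Q))"
		by (simp only: cint_add[OF c zero_less_one b1 integrand_on_add[OF b2 b3]] cint_add[OF c zero_less_one b2 b3])
	also have "... = ((2 * pi * \<i>) *\<^sub>C A) o\<^sub>L ?Q"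
		by (simp only: cint_scaleC_left[OF c zero_less_one a1] cint_scaleC_left[OF c zero_less_one a2]
				cint_compose_right[OF c zero_less_one a34] i1 i2 i34 scaleC_zero_left add_0)
	also have "... = (2 * pi * \<i>) *\<^sub>C qop A mu" unfolding compose_scaleC_left compose_qop[OF A rmu r1 mu(2)] ..
	finally show ?thesis .
qed

text \<open>Fubini: evaluating at \<open>A\<close> the function z -> integral of f(mu) ker(mu, z)
  amounts to evaluating the kernel at \<open>A\<close> under the integral. The contour
  \<open>d\<close> is general because this is used for the full Stolz boundary and for the two
  segments alone.\<close>

lemma cint_exchange:
	fixes A :: "'a::complex_banach \<Rightarrow>\<^sub>L 'a"
	assumes A: "complex_linear A" and be: "0 < be" "be < pi / 2" and rh: "0 < rh"
		and reg: "reg A (sin be) rh M" and s': "sin be < s'" "s' \<le> 1"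
		and d: "contour d" "locus d \<inter> sto s' rh = {}" "\<And>mu. mu \<in> locus d ==> cmod mu \<le> L"
		and f: "continuous_on (locus d) f" "\<And>mu. mu \<in> locus d ==> cmod (f mu) \<le> C * cmod mu powr si"
		and si: "0 < si" "si \<le> 1" and C: "0 \<le> C"
	shows "cint (bcont be rh) (%z. cint d (%mu. f mu * ker mu z) *\<^sub>C res A z)
			= (2 * pi * \<i>) *\<^sub>C cint d (%mu. f mu *\<^sub>C qop A mu)"
proof -
	let ?c = "bcont be rh"
	have s1: "sin be < 1" by (rule sin_less_one[OF be])
	have c: "contour ?c" by (rule contour_bcont[OF be rh])
	have M: "0 \<le> M" by (rule reg_nonneg[OF reg s1])
	have muout: "mu \<notin> sto s' rh" "mu \<notin> sto (sin be) rh" "mu ~= 0" if "mu \<in> locus d" for mu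
		using that d(1,2) sto_mono[of "sin be" s' rh rh] s'(1) by (auto simp: contour_def)
	have L: "0 \<le> L" if "mu \<in> locus d" for mu using d(3)[OF that] norm_ge_zero order_trans by blast
	define ka where "ka = (s' - sin be) / (2 + (s' - sin be))"
	have ka: "0 < ka" using s'(1) by (simp add: ka_def)
	have sep: "ka * cmod z \<le> cmod (mu - z)" "ka * cmod mu \<le> cmod (mu - z)"
		if "z \<in> stc (sin be) rh" "mu \<in> locus d" for z mu
		using separated[OF that(1) muout(1)[OF that(2)] s'(1) s1] by (auto simp: ka_def)
	\<comment> \<open>The available power |mu|^si is shared out evenly: after the kernel estimate and
	  the resolvent bound, mu and z both carry the integrable exponent ta - 1.\<close>
	define ta where "ta = si / 2"
	have ta: "0 < ta" "ta \<le> 1" "si - ta = ta" using si by (auto simp: ta_def)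
	define K1 where "K1 = C * ((1 + \<bar>L\<bar>) / ka)"
	have K1: "0 \<le> K1" using C ka by (simp add: K1_def)
	have fk_le: "cmod (f mu * ker mu z) \<le> K1 * (cmod z powr ta * cmod mu powr (ta - 1))"
		if z: "z \<in> locus ?c" and mu: "mu \<in> locus d" for z mu
	proof -
		have zs: "z \<in> stc (sin be) rh" by (rule locus_bcont(1)[OF be rh z])
		note zb = stc_bounds[OF zs s1]
		have "cmod (ker mu z) \<le> (1 + cmod mu) / ka * (cmod mu powr (- ta - 1) * (cmod z powr ta / cmod (1 + z)))"
			using norm_ker_le[OF ka sep[OF zs mu], of ta] zb muout[OF mu] ta by simp
		also have "... \<le> (1 + \<bar>L\<bar>) / ka * (cmod mu powr (- ta - 1) * (cmod z powr ta / 1))"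
			using d(3)[OF mu] norm_one_plus_ge(1)[of z] zb(1) ka
			by (intro mult_mono divide_right_mono frac_le order_refl) auto
		finally have "cmod (f mu) * cmod (ker mu z)
				\<le> (C * cmod mu powr si) * ((1 + \<bar>L\<bar>) / ka * (cmod mu powr (- ta - 1) * (cmod z powr ta / 1)))"
			using f(2)[OF mu] C by (intro mult_mono) auto
		also have "... = K1 * (cmod z powr ta * (cmod mu powr si * cmod mu powr (- ta - 1)))" by (simp add: K1_def mult_ac)
		also have "cmod mu powr si * cmod mu powr (- ta - 1) = cmod mu powr (ta - 1)" using ta(3) by (simp flip: powr_add)
		finally show ?thesis by (simp add: norm_mult)
	qed
	have wt_d: "cmod mu powr (ta - 1) \<le> (1 + \<bar>L\<bar> powr (2 * ta)) * wt ta mu" if "mu \<in> locus d" for mu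
		by (rule powr_le_wt[OF _ ta(1)]) (use d(3)[OF that] in simp)
	have wt_c: "cmod z powr (ta - 1) \<le> (1 + (2 * rh) powr (2 * ta)) * wt ta z" if "z \<in> locus ?c" for z
		by (rule powr_le_wt[OF locus_bcont(4)[OF be rh that] ta(1)])
	have ne: "mu - z ~= 0" "mu * (1 + z) ~= 0" if z: "z \<in> locus ?c" and mu: "mu \<in> locus d" for z mu
	proof -
		have zs: "z \<in> stc (sin be) rh" by (rule locus_bcont(1)[OF be rh z])
		have "0 < ka * cmod mu" using ka muout(3)[OF mu] by simp
		then show "mu - z ~= 0" using sep(2)[OF zs mu] by auto
		have "1 + z ~= 0" using norm_one_plus_ge(1)[of z] stc_bounds(1)[OF zs s1] by auto
		then show "mu * (1 + z) ~= 0" using muout(3)[OF mu] by simp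
	qed
	have res_c: "continuous_on (locus ?c) (res A)"
		by (rule reg_continuous_on[OF reg]) (use locus_bcont[OF be rh] in blast)+
	have res_le: "norm (res A z) \<le> M / cmod z" if "z \<in> locus ?c" for z
		using regD(2)[OF reg] locus_bcont[OF be rh that] by blast
	define F where "F zs = (f (zs ! 1) * ker (zs ! 1) (zs ! 0)) *\<^sub>C res A (zs ! 0)" for zs
	have F: "F [z, mu] = (f mu * ker mu z) *\<^sub>C res A z" for z mu by (simp add: F_def)
	define K where "K = K1 * M * (1 + (2 * rh) powr (2 * ta)) * (1 + \<bar>L\<bar> powr (2 * ta))"
	have integrand: "integrand ta K [?c, d] F" unfolding integrand_def
	proof (intro conjI ballI)
		fix zs assume "zs \<in> loci [?c, d]"
		then obtain z mu where zs: "zs = [z, mu]" "z \<in> locus ?c" "mu \<in> locus d" by (auto elim!: listset_ConsE)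
		have "norm (F zs) \<le> (K1 * (cmod z powr ta * cmod mu powr (ta - 1))) * (M / cmod z)"
			unfolding zs(1) F norm_scaleC using fk_le[OF zs(2,3)] res_le[OF zs(2)] K1 by (intro mult_mono) auto
		also have "... = K1 * M * (cmod z powr (ta - 1) * cmod mu powr (ta - 1))"
			using locus_bcont(3)[OF be rh zs(2)] by (simp add: powr_diff mult_ac)
		also have "... \<le> K1 * M * (((1 + (2 * rh) powr (2 * ta)) * wt ta z) * ((1 + \<bar>L\<bar> powr (2 * ta)) * wt ta mu))"
			using wt_c[OF zs(2)] wt_d[OF zs(3)] K1 M by (intro mult_left_mono mult_mono) (auto simp: wt_nonneg)
		also have "... = K * wts ta zs" by (simp add: zs K_def mult_ac)
		finally show "norm (F zs) \<le> K * wts ta zs" .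
	next
		show "seqcont (loci [?c, d]) F" unfolding seqcont_def
		proof (intro allI impI)
			fix X zs assume X: "\<forall>n. X n \<in> loci [?c, d]" and zs: "zs \<in> loci [?c, d]" and lim: "list_lim X zs"
			have mem: "ys ! 0 \<in> locus ?c" "ys ! 1 \<in> locus d" "length ys = 2" if "ys \<in> loci [?c, d]" for ys
				using that by (auto elim!: listset_ConsE)
			note z = mem[OF zs]
			have l0: "(%n. X n ! 0) \<longlonglongrightarrow> zs ! 0" and l1: "(%n. X n ! 1) \<longlonglongrightarrow> zs ! 1"
				using lim z(3) by (auto simp: list_lim_def)
			have "(%n. f (X n ! 1)) \<longlonglongrightarrow> f (zs ! 1)"
				by (rule continuous_on_tendsto_compose[OF f(1) l1 z(2)]) (use X mem in auto)
			moreover have "(%n. res A (X n ! 0)) \<longlonglongrightarrow> res A (zs ! 0)"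
				by (rule continuous_on_tendsto_compose[OF res_c l0 z(1)]) (use X mem in auto)
			ultimately show "(%n. F (X n)) \<longlonglongrightarrow> F zs"
				unfolding F_def ker_def by (intro tendsto_intros l0 l1 ne[OF z(1,2)])
		qed
	qed
	have on_d: "integrand_on ta (K1 * cmod z powr ta * (1 + \<bar>L\<bar> powr (2 * ta))) d (%mu. f mu * ker mu z)"
		if z: "z \<in> locus ?c" for z unfolding integrand_on_def
	proof (intro conjI ballI)
		show "continuous_on (locus d) (%mu. f mu * ker mu z)"
			unfolding ker_def using ne[OF z] by (intro continuous_intros f(1)) auto
		fix mu assume mu: "mu \<in> locus d"
		have "cmod (f mu * ker mu z) \<le> K1 * cmod z powr ta * cmod mu powr (ta - 1)"
			using fk_le[OF z mu] by (simp add: mult.assoc)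
		also have "... \<le> K1 * cmod z powr ta * ((1 + \<bar>L\<bar> powr (2 * ta)) * wt ta mu)"
			using wt_d[OF mu] K1 by (intro mult_left_mono) auto
		finally show "cmod (f mu * ker mu z) \<le> K1 * cmod z powr ta * (1 + \<bar>L\<bar> powr (2 * ta)) * wt ta mu"
			by (simp add: mult.assoc)
	qed
	have left: "cint ?c (%z. cint d (%mu. F [z, mu])) = cint ?c (%z. cint d (%mu. f mu * ker mu z) *\<^sub>C res A z)"
		unfolding F by (rule cint_cong) (rule cint_scaleC_left[OF d(1) ta(1) on_d])
	have ker_adm: "integrand_on 1 (((1 + \<bar>L\<bar>) / ka * cmod mu powr (- 1 - 1)) * M * (1 + (2 * rh) powr 2)) ?c
			(%z. ker mu z *\<^sub>C res A z)"
		if mu: "mu \<in> locus d" for mu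
	proof (rule integrand_on_bcont_bounded[OF be rh])
		show "continuous_on (locus ?c) (%z. ker mu z *\<^sub>C res A z)"
			unfolding ker_def using ne[OF _ mu] by (intro continuous_intros res_c) auto
		show "0 \<le> ((1 + \<bar>L\<bar>) / ka * cmod mu powr (- 1 - 1)) * M" using ka M by simp
		fix z assume z: "z \<in> locus ?c"
		have zs: "z \<in> stc (sin be) rh" by (rule locus_bcont(1)[OF be rh z])
		note zb = stc_bounds[OF zs s1]
		have "cmod (ker mu z) \<le> (1 + cmod mu) / ka * (cmod mu powr (- 1 - 1) * (cmod z powr 1 / cmod (1 + z)))"
			using norm_ker_le[OF ka sep[OF zs mu], of 1] zb muout[OF mu] by simp
		also have "... \<le> (1 + \<bar>L\<bar>) / ka * (cmod mu powr (- 1 - 1) * (cmod z powr 1 / 1))"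
			using d(3)[OF mu] norm_one_plus_ge(1)[of z] zb(1) ka
			by (intro mult_mono divide_right_mono frac_le order_refl) auto
		finally have "cmod (ker mu z) * norm (res A z)
			\<le> ((1 + \<bar>L\<bar>) / ka * (cmod mu powr (- 1 - 1) * (cmod z powr 1 / 1))) * (M / cmod z)"
			using res_le[OF z] ka by (intro mult_mono) auto
		also have "... = ((1 + \<bar>L\<bar>) / ka * cmod mu powr (- 1 - 1)) * M" using zb(2) by simp
		finally show "norm (ker mu z *\<^sub>C res A z) \<le> ((1 + \<bar>L\<bar>) / ka * cmod mu powr (- 1 - 1)) * M"
			by (simp add: norm_scaleC)
	qed
	have q_adm: "integrand_on si (C * (2 * M) * (1 + \<bar>L\<bar> powr (2 * si))) d (%mu. f mu *\<^sub>C qop A mu)"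
		unfolding integrand_on_def
	proof (intro conjI ballI)
		show "continuous_on (locus d) (%mu. f mu *\<^sub>C qop A mu)"
			by (intro continuous_on_scaleC f(1) continuous_on_qop[OF reg]) (use muout in blast)+
		fix mu assume mu: "mu \<in> locus d"
		have "norm (f mu *\<^sub>C qop A mu) \<le> (C * cmod mu powr si) * (2 * M / cmod mu)"
			unfolding norm_scaleC using f(2)[OF mu] norm_qop_le[OF reg s1 muout(2,3)[OF mu]] C by (intro mult_mono) auto
		also have "... = C * (2 * M) * cmod mu powr (si - 1)" using muout(3)[OF mu] by (simp add: powr_diff)
		also have "... \<le> C * (2 * M) * ((1 + \<bar>L\<bar> powr (2 * si)) * wt si mu)"
			using C M d(3)[OF mu] by (intro mult_left_mono powr_le_wt si) auto
		finally show "norm (f mu *\<^sub>C qop A mu) \<le> C * (2 * M) * (1 + \<bar>L\<bar> powr (2 * si)) * wt si mu"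
			by (simp add: mult.assoc)
	qed
	have "cint d (%mu. cint ?c (%z. F [z, mu])) = cint d (%mu. (2 * pi * \<i>) *\<^sub>C (f mu *\<^sub>C qop A mu))"
	proof (rule cint_cong)
		fix mu assume mu: "mu \<in> locus d"
		have "cint ?c (%z. F [z, mu]) = cint ?c (%z. f mu *\<^sub>C (ker mu z *\<^sub>C res A z))" by (simp add: F scaleC_scaleC)
		also have "... = f mu *\<^sub>C cint ?c (%z. ker mu z *\<^sub>C res A z)"
			by (rule cint_scaleC[OF c zero_less_one ker_adm[OF mu]])
		also have "cint ?c (%z. ker mu z *\<^sub>C res A z) = (2 * pi * \<i>) *\<^sub>C qop A mu"
			by (rule cint_ker_resolvent[OF A be rh reg s' muout(1,3)[OF mu]])
		finally show "cint ?c (%z. F [z, mu]) = (2 * pi * \<i>) *\<^sub>C (f mu *\<^sub>C qop A mu)"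
			by (simp add: scaleC_scaleC mult.commute)
	qed
	also have "... = (2 * pi * \<i>) *\<^sub>C cint d (%mu. f mu *\<^sub>C qop A mu)" by (rule cint_scaleC[OF d(1) si(1) q_adm])
	finally show ?thesis unfolding left[symmetric] cint_swap[OF c d(1) ta(1) integrand] .
qed

text \<open>By the factorization of the kernel the integrand is z / (1 + z) times u(mu) / (mu - z)
  with u(mu) = f(mu) (1 + mu) / mu. Cauchy's formula returns u(z), and the factors cancel to
  f(z).\<close>

lemma cint_ker_reproduces:
	assumes be: "0 < be" "be < pi / 2" and rh: "0 < rh" and s': "sin be < s'" "s' < 1"
		and f: "f holomorphic_on sto s' rh" and si: "0 < si" "si \<le> 1" and C: "0 \<le> C"
		and le: "\<And>z. z \<in> stc (sin be) rh ==> cmod (f z) \<le> C * cmod z powr si" and z: "z \<in> sto (sin be) rh"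
	shows "cint (bcont be rh) (%mu. f mu * ker mu z) = 2 * pi * \<i> * f z"
proof -
	let ?d = "bcont be rh"
	have s1: "sin be < 1" by (rule sin_less_one[OF be])
	define u where "u mu = f mu * (1 + mu) / mu" for mu
	have nz: "mu ~= 0" "0 < Re mu" "cmod mu \<le> 2 * rh" if "mu \<in> sto s' rh" for mu
		using stc_bounds[of mu s' rh] sto_subset_stc that s' by auto
	have u: "u holomorphic_on sto s' rh" unfolding u_def using nz by (intro holomorphic_intros f) auto
	have sub: "stc (sin be) rh \<subseteq> sto s' rh" by (rule stc_subset_sto[OF s'(1) order_refl])
	have u_le: "cmod (u mu) \<le> C * (1 + 2 * rh) * cmod mu powr (si - 1)" if mu: "mu \<in> stc (sin be) rh" for mu
	proof -
		have "cmod (1 + mu) \<le> 1 + 2 * rh" using norm_triangle_ineq[of 1 mu] nz(3) mu sub by fastforce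
		then have "cmod (f mu) * cmod (1 + mu) \<le> (C * cmod mu powr si) * (1 + 2 * rh)"
			using le[OF mu] C by (intro mult_mono) auto
		then have "cmod (f mu) * cmod (1 + mu) / cmod mu \<le> (C * cmod mu powr si) * (1 + 2 * rh) / cmod mu"
			by (intro divide_right_mono) auto
		also have "... = C * (1 + 2 * rh) * cmod mu powr (si - 1)" using nz(1) mu sub by (auto simp: powr_diff)
		finally show ?thesis by (simp add: u_def norm_mult norm_divide)
	qed
	have C': "0 \<le> C * (1 + 2 * rh)" using C rh by simp
	have cf: "cint ?d (%mu. u mu / (mu - z)) = 2 * pi * \<i> * u z"
		by (rule cint_bcont_cauchy[OF be rh s'(1) u si C' u_le z])
	obtain e where e: "e > 0" "ball z e \<subseteq> sto (sin be) rh" using z open_sto open_contains_ball by blast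
	have far: "e \<le> cmod (mu - z)" if "mu \<in> locus ?d" for mu
		using locus_bcont(2)[OF be rh that] e(2) by (force simp: dist_norm norm_minus_commute)
	have lsub: "locus ?d \<subseteq> sto s' rh" using locus_bcont(1)[OF be rh] sub by blast
	have ne: "mu - z ~= 0" if "mu \<in> locus ?d" for mu using far[OF that] e(1) by auto
	have adm: "integrand_on si (C * (1 + 2 * rh) / e * (1 + (2 * rh) powr (2 * si))) ?d (%mu. u mu / (mu - z))"
	proof (rule integrand_on_bcontI[OF be rh si(1)])
		show "continuous_on (locus ?d) (%mu. u mu / (mu - z))" using ne by (intro continuous_intros
					continuous_on_subset[OF holomorphic_on_imp_continuous_on[OF u] lsub]) auto
		show "0 \<le> C * (1 + 2 * rh) / e" using C' e(1) by simp
		fix mu assume mu: "mu \<in> locus ?d"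
		have "cmod (u mu / (mu - z)) \<le> (C * (1 + 2 * rh) * cmod mu powr (si - 1)) / e"
			unfolding norm_divide using far[OF mu] e(1) C' by (intro frac_le u_le locus_bcont(1)[OF be rh mu]) auto
		then show "cmod (u mu / (mu - z)) \<le> C * (1 + 2 * rh) / e * cmod mu powr (si - 1)" by simp
	qed
	have zR: "0 < Re z" "z ~= 0" using stc_bounds[of z "sin be" rh] sto_subset_stc z s1 by auto
	have "cint ?d (%mu. f mu * ker mu z) = cint ?d (%mu. (z / (1 + z)) *\<^sub>C (u mu / (mu - z)))"
	proof (rule cint_cong)
		fix mu assume mu: "mu \<in> locus ?d"
		have "ker mu z = z / (1 + z) * ((1 + mu) / mu / (mu - z))"
			by (rule ker_eq) (use ne[OF mu] zR locus_bcont(3)[OF be rh mu] in auto)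
		then show "f mu * ker mu z = (z / (1 + z)) *\<^sub>C (u mu / (mu - z))" by (simp add: u_def)
	qed
	also have "... = (z / (1 + z)) *\<^sub>C (2 * pi * \<i> * u z)"
		unfolding cf[symmetric] by (rule cint_scaleC[OF contour_bcont[OF be rh] si(1) adm])
	also have "... = 2 * pi * \<i> * f z"
	proof -
		have "1 + z ~= 0" using zR(1) by (auto simp: complex_eq_iff)
		then show ?thesis using zR(2) by (simp add: u_def)
	qed
	finally show ?thesis .
qed

text \<open>The values f(z) on the inner contour are written as kernel integrals over the outer one,
  and the integrations are exchanged. The right-hand side does not involve \<open>be\<close> and
  \<open>rh\<close>, which is the source of all independence of the contour.\<close>

lemma cint_contour_change:
	fixes A :: "'a::complex_banach \<Rightarrow>\<^sub>L 'a"
	assumes A: "complex_linear A" and be: "0 < be" "be < be'" "be' < pi / 2" and rh: "0 < rh" "rh \<le> rh'"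
		and reg: "reg A (sin be) rh M" and s': "sin be' < s'" "s' < 1"
		and f: "f holomorphic_on sto s' rh'" and si: "0 < si" "si \<le> 1" and C: "0 \<le> C"
		and le: "\<And>z. z \<in> stc (sin be') rh' ==> cmod (f z) \<le> C * cmod z powr si"
	shows "cint (bcont be rh) (%z. f z *\<^sub>C res A z) = cint (bcont be' rh') (%mu. f mu *\<^sub>C qop A mu)"
proof -
	let ?c = "bcont be rh" and ?d = "bcont be' rh'"
	have be': "0 < be'" "be < pi / 2" and rh': "0 < rh'" using be rh by auto
	have ss: "sin be < sin be'" using be by (intro sin_monotone_2pi) auto
	have s1: "sin be < 1" "sin be' < 1" using sin_less_one be be' by auto
	have sub: "stc (sin be) rh \<subseteq> sto (sin be') rh'" by (rule stc_subset_sto[OF ss rh(2)])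
	have sub': "stc (sin be') rh' \<subseteq> sto s' rh'" by (rule stc_subset_sto[OF s'(1) order_refl])
	have f_cont: "continuous_on (sto s' rh') f" by (rule holomorphic_on_imp_continuous_on[OF f])
	have lc: "locus ?c \<subseteq> sto s' rh'" using locus_bcont(1)[OF be(1) be'(2) rh(1)] sub sub' sto_subset_stc by blast
	have ld: "locus ?d \<subseteq> sto s' rh'" using locus_bcont(1)[OF be'(1) be(3) rh'] sub' by blast
	have M: "0 \<le> M" by (rule reg_nonneg[OF reg s1(1)])
	have "(2 * pi * \<i>) *\<^sub>C cint ?d (%mu. f mu *\<^sub>C qop A mu) = cint ?c (%z. cint ?d (%mu. f mu * ker mu z) *\<^sub>C res A z)"
	proof (rule cint_exchange[OF A be(1) be'(2) rh(1) reg ss, symmetric])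
		show "contour ?d" by (rule contour_bcont[OF be'(1) be(3) rh'])
		show "locus ?d \<inter> sto (sin be') rh = {}"
			using locus_bcont(2)[OF be'(1) be(3) rh'] sto_mono[OF order_refl rh(2), of "sin be'"] by blast
		show "cmod mu \<le> 2 * rh'" if "mu \<in> locus ?d" for mu by (rule locus_bcont(4)[OF be'(1) be(3) rh' that])
		show "continuous_on (locus ?d) f" by (rule continuous_on_subset[OF f_cont ld])
		show "cmod (f mu) \<le> C * cmod mu powr si" if "mu \<in> locus ?d" for mu
			by (rule le[OF locus_bcont(1)[OF be'(1) be(3) rh' that]])
	qed (use s1 si C in auto)
	also have "... = cint ?c (%z. (2 * pi * \<i>) *\<^sub>C (f z *\<^sub>C res A z))"
	proof (rule cint_cong)
		fix z assume "z \<in> locus ?c"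
		then have z: "z \<in> sto (sin be') rh'" using locus_bcont(1)[OF be(1) be'(2) rh(1)] sub by blast
		have "cint ?d (%mu. f mu * ker mu z) = 2 * pi * \<i> * f z"
			by (rule cint_ker_reproduces[OF be'(1) be(3) rh' s' f si C le z])
		then show "cint ?d (%mu. f mu * ker mu z) *\<^sub>C res A z = (2 * pi * \<i>) *\<^sub>C (f z *\<^sub>C res A z)"
			by (simp only: scaleC_scaleC)
	qed
	also have "... = (2 * pi * \<i>) *\<^sub>C cint ?c (%z. f z *\<^sub>C res A z)"
	proof (rule cint_scaleC[OF contour_bcont[OF be(1) be'(2) rh(1)] si(1)])
		show "integrand_on si (C * M * (1 + (2 * rh) powr (2 * si))) ?c (%z. f z *\<^sub>C res A z)"
		proof (rule integrand_on_bcontI[OF be(1) be'(2) rh(1) si(1)])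
			show "continuous_on (locus ?c) (%z. f z *\<^sub>C res A z)"
				by (intro continuous_on_scaleC continuous_on_subset[OF f_cont lc] reg_continuous_on[OF reg])
					(use locus_bcont[OF be(1) be'(2) rh(1)] in blast)+
			show "0 \<le> C * M" using C M by simp
			fix z assume z: "z \<in> locus ?c"
			note lz = locus_bcont[OF be(1) be'(2) rh(1) z]
			have "z \<in> stc (sin be') rh'" using lz(1) sub sto_subset_stc by blast
			then have "cmod (f z) * norm (res A z) \<le> (C * cmod z powr si) * (M / cmod z)"
				using le regD(2)[OF reg lz(2,3)] C by (intro mult_mono) auto
			also have "... = C * M * cmod z powr (si - 1)" using lz(3) by (simp add: powr_diff)
			finally show "norm (f z *\<^sub>C res A z) \<le> C * M * cmod z powr (si - 1)" by (simp add: norm_scaleC)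
		qed
	qed
	finally have "(1 / (2 * pi * \<i>)) *\<^sub>C (2 * pi * \<i>) *\<^sub>C cint ?d (%mu. f mu *\<^sub>C qop A mu)
			= (1 / (2 * pi * \<i>)) *\<^sub>C (2 * pi * \<i>) *\<^sub>C cint ?c (%z. f z *\<^sub>C res A z)" by simp
	then show ?thesis unfolding scaleC_scaleC by simp
qed

section \<open>The boundary of a sector as a limit of Stolz contours\<close>

definition scont :: "real => contour" where
	"scont nu = (- {0}, %t. if t < 0 then - cis nu else cis (- nu), sector_boundary nu)"

lemma scont_simps [simp]:
	"params (scont nu) = - {0}" "dens (scont nu) = (%t. if t < 0 then - cis nu else cis (- nu))"
	"pnt (scont nu) = sector_boundary nu" by (simp_all add: scont_def)

lemma norm_sector_boundary: "cmod (sector_boundary nu t) = \<bar>t\<bar>"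
proof -
	have "cmod (of_real x * cis ph) = \<bar>x\<bar>" for x ph by (simp add: norm_mult)
	then show ?thesis by (simp only: sector_boundary_def if_distrib[of cmod] abs_minus_cancel if_cancel)
qed

lemma continuous_on_nonzero:
	fixes h :: "real => 'b::topological_space"
	assumes "\<And>t. t < 0 ==> h t = f t" "\<And>t. t > 0 ==> h t = g t" and "continuous_on {..<0} f" "continuous_on {0<..} g"
	shows "continuous_on (- {0}) h"
proof -
	have e: "- {0::real} = {..<0} \<union> {0<..}" by auto
	have "continuous_on {..<0} h \<longleftrightarrow> continuous_on {..<0} f" by (rule continuous_on_cong) (auto simp: assms)
	moreover have "continuous_on {0<..} h \<longleftrightarrow> continuous_on {0<..} g"
		by (rule continuous_on_cong) (auto simp: assms)
	ultimately show ?thesis unfolding e using assms(3,4) by (intro continuous_on_open_Un) auto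
qed

lemma path_integral_sector_boundary:
	fixes F :: "complex => 'b::complex_banach"
	shows "path_integral UNIV (sector_boundary nu) F = cint (scont nu) F"
proof -
	have d: "vector_derivative (sector_boundary nu) (at t within UNIV) = dens (scont nu) t" if "t ~= 0" for t
	proof -
		have "(sector_boundary nu has_vector_derivative dens (scont nu) t) (at t)"
		proof (cases "t < 0")
			case True
			have "((%t. of_real (- t) * cis nu) has_vector_derivative - cis nu) (at t)"
				by (auto intro!: derivative_eq_intros)
			then have "(sector_boundary nu has_vector_derivative - cis nu) (at t)"
				by (rule has_vector_derivative_transform_within_open[of _ _ _ "{..<0}"])
					(use True in \<open>auto simp: sector_boundary_def\<close>)
			then show ?thesis using True by simp
		next
			case False
			have "((%t. of_real t * cis (- nu)) has_vector_derivative cis (- nu)) (at t)"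
				by (auto intro!: derivative_eq_intros)
			then have "(sector_boundary nu has_vector_derivative cis (- nu)) (at t)"
				by (rule has_vector_derivative_transform_within_open[of _ _ _ "{0<..}"])
					(use False that in \<open>auto simp: sector_boundary_def\<close>)
			then show ?thesis using False by simp
		qed
		then show ?thesis by (rule vector_derivative_at)
	qed
	have "path_integral UNIV (sector_boundary nu) F
			= integral (- {0}) (%t. vector_derivative (sector_boundary nu) (at t within UNIV) *\<^sub>C F (sector_boundary nu t))"
		unfolding path_integral_def by (rule integral_spike_set[symmetric]; rule negligible_subset[of "{0}"]) auto
	also have "... = cint (scont nu) F"
		unfolding cint_def scont_simps(1,3) by (rule integral_cong) (simp add: d del: scont_simps)
	finally show ?thesis .
qed

text \<open>The weight has the bounded antiderivative sgn(t) arctan(|t|^s) / s, continuous at 0, so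
  its integrals over growing intervals stay bounded and monotone convergence applies.\<close>

lemma integrable_wt_line:
	assumes s: "0 < s"
	shows "(%t. wt s (of_real t)) integrable_on UNIV"
proof -
	define P where "P t = sgn t * (arctan (\<bar>t\<bar> powr s) / s)" for t :: real
	let ?h = "%t::real. wt s (of_real t)"
	have h: "?h t = \<bar>t\<bar> powr (s - 1) / (1 + \<bar>t\<bar> powr (2 * s))" for t by (simp add: wt_def)
	have P': "(P has_vector_derivative ?h t) (at t)" if t: "t ~= 0" for t
	proof -
		have e: "x powr (s * 2) = (x powr s)\<^sup>2" if "0 < x" for x :: real
			using that by (simp add: power2_eq_square mult.commute[of s 2] flip: powr_add)
		show ?thesis
		proof (cases "t > 0")
			case True
			have "((%t. arctan (t powr s) / s) has_real_derivative ?h t) (at t)" unfolding h using True s e[OF True]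
				by (auto intro!: derivative_eq_intros simp: divide_simps mult.commute)
			then have "((%t. arctan (t powr s) / s) has_vector_derivative ?h t) (at t)"
				by (simp add: has_real_derivative_iff_has_vector_derivative)
			then show ?thesis by (rule has_vector_derivative_transform_within_open[of _ _ _ "{0<..}"])
					(use True in \<open>auto simp: P_def\<close>)
		next
			case False
			then have t: "t < 0" using that by simp
			have "((%t. - (arctan ((- t) powr s) / s)) has_real_derivative ?h t) (at t)"
				unfolding h using t s e[of "-t"] by (auto intro!: derivative_eq_intros simp: divide_simps mult.commute)
			then have "((%t. - (arctan ((- t) powr s) / s)) has_vector_derivative ?h t) (at t)"
				by (simp add: has_real_derivative_iff_has_vector_derivative)
			then show ?thesis by (rule has_vector_derivative_transform_within_open[of _ _ _ "{..<0}"])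
					(use t in \<open>auto simp: P_def\<close>)
		qed
	qed
	have P0: "isCont P 0"
	proof -
		have "((%t. \<bar>arctan (\<bar>t\<bar> powr s) / s\<bar>) \<longlongrightarrow> \<bar>arctan (\<bar>0::real\<bar> powr s) / s\<bar>) (at 0)"
			using s by (intro tendsto_intros tendsto_powr') (auto simp: eventually_at_filter)
		then have "((%t. \<bar>arctan (\<bar>t\<bar> powr s) / s\<bar>) \<longlongrightarrow> 0) (at 0)" using s by simp
		moreover have "\<forall>\<^sub>F t in at 0. norm (P t) \<le> \<bar>arctan (\<bar>t\<bar> powr s) / s\<bar>"
			by (rule always_eventually) (auto simp: P_def abs_mult sgn_if)
		ultimately have "(P \<longlongrightarrow> 0) (at 0)" by (rule Lim_null_comparison[rotated])
		then show ?thesis by (simp add: isCont_def P_def)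
	qed
	have cP: "isCont P t" for t using P' has_vector_derivative_continuous P0 by (cases "t = 0") blast+
	have int: "(?h has_integral (P k - P (- k))) {- k..k}" if "0 \<le> k" for k
	proof (rule fundamental_theorem_of_calculus_interior_strong[of "{0}"])
		show "continuous_on {- k..k} P" using cP by (simp add: continuous_at_imp_continuous_on)
		show "(P has_vector_derivative ?h t) (at t)" if "t \<in> {- k<..<k} - {0}" for t using that by (intro P') auto
	qed (use that in auto)
	let ?f = "%k t. if t \<in> {- real k..real k} then ?h t else 0"
	have fi: "(?f k has_integral (P (real k) - P (- real k))) UNIV" for k
		using int[of "real k"] unfolding has_integral_restrict_UNIV by simp
	have "?h integrable_on UNIV \<and> (%k. integral UNIV (?f k)) \<longlonglongrightarrow> integral UNIV ?h"
	proof (rule monotone_convergence_increasing)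
		show "?f k integrable_on UNIV" for k using fi by blast
		show "?f k t \<le> ?f (Suc k) t" for k t by (simp add: wt_nonneg)
		show "(%k. ?f k t) \<longlonglongrightarrow> ?h t" for t
		proof (rule tendsto_eventually)
			obtain N :: nat where N: "\<bar>t\<bar> \<le> real N" using real_arch_simple by blast
			show "\<forall>\<^sub>F k in sequentially. ?f k t = ?h t"
				using eventually_ge_at_top[of N] by eventually_elim (use N in auto)
		qed
		have "\<bar>P t\<bar> \<le> pi / s" for t
		proof -
			have "\<bar>arctan (\<bar>t\<bar> powr s)\<bar> \<le> pi" using arctan_bounded[of "\<bar>t\<bar> powr s"] by auto
			then have "\<bar>arctan (\<bar>t\<bar> powr s)\<bar> / s \<le> pi / s" using s by (intro divide_right_mono) auto
			moreover have "\<bar>P t\<bar> \<le> \<bar>arctan (\<bar>t\<bar> powr s)\<bar> / s" using s by (simp add: P_def abs_mult abs_sgn_eq)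
			ultimately show ?thesis by linarith
		qed
		then have "\<bar>P (real k) - P (- real k)\<bar> \<le> 2 * (pi / s)" for k
			using abs_triangle_ineq4[of "P (real k)" "P (- real k)"] by (smt (verit))
		then show "bounded (range (%k. integral UNIV (?f k)))" unfolding bounded_iff integral_unique[OF fi] by auto
	qed
	then show ?thesis by blast
qed

lemma contour_scont: "contour (scont nu)"
proof -
	have nz: "sector_boundary nu t ~= 0" if "t ~= 0" for t using norm_sector_boundary[of nu t] that by auto
	have "(%t. cmod (dens (scont nu) t) * wt s (sector_boundary nu t)) integrable_on - {0}" if "s > 0" for s
	proof -
		have "(%t. cmod (dens (scont nu) t) * wt s (sector_boundary nu t)) = (%t. wt s (of_real t))"
			by (rule ext) (simp add: wt_def norm_sector_boundary)
		moreover have "(%t. wt s (of_real t)) integrable_on - {0}"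
			by (rule integrable_spike_set[OF integrable_wt_line[OF that]]; rule negligible_subset[of "{0}"]) auto
		ultimately show ?thesis by simp
	qed
	moreover have "continuous_on (- {0}) (dens (scont nu))"
		by (rule continuous_on_nonzero[of _ "%_. - cis nu" "%_. cis (- nu)"]) auto
	moreover have "continuous_on (- {0}) (sector_boundary nu)"
		by (rule continuous_on_nonzero[of _ "%t. of_real (- t) * cis nu" "%t. of_real t * cis (- nu)"])
			(auto simp: sector_boundary_def intro!: continuous_intros)
	moreover have "0 \<notin> locus (scont nu)" unfolding locus_def using nz by force
	ultimately show ?thesis unfolding contour_def by (auto simp: open_Compl)
qed

lemma locus_scont:
	assumes "z \<in> locus (scont nu)" "0 < nu" "nu < pi / 2"
	shows "Re z = cos nu * cmod z" "z ~= 0" "z \<notin> sto (sin nu) rh" "nu < th ==> th < pi / 2 ==> z \<in> sector th"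
proof -
	obtain t where t: "t ~= 0" "z = sector_boundary nu t" using assms(1) by (auto simp: locus_def)
	show nz: "z ~= 0" using norm_sector_boundary[of nu t] t by auto
	show Re: "Re z = cos nu * cmod z" unfolding t(2) norm_sector_boundary by (simp add: sector_boundary_def)
	show "z \<notin> sto (sin nu) rh" using sto_subset_sector[OF assms(2,3)] sector_iff[of nu z] assms Re by auto
	assume th: "nu < th" "th < pi / 2"
	then have "cos th < cos nu" using assms by (intro cos_monotone_0_pi) auto
	then have "cos th * cmod z < cos nu * cmod z" using nz by simp
	then show "z \<in> sector th" using sector_iff[of th z] Re assms th by simp
qed

text \<open>The straight pieces of the Stolz contour are exactly the part |t| \<le> rh cos nu of the
  sector boundary. On the arc the speed is of order rh and the integrand of order rh^(-s - 1), so
  its contribution tends to 0 like rh^(-s).\<close>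

lemma bcont_tendsto_scont:
	fixes F :: "complex => 'b::complex_banach"
	assumes nu: "0 < nu" "nu < pi / 2" and s: "0 < s" and K: "0 \<le> K" and F: "integrand_on s K (scont nu) F"
		and rh0: "0 < rh0" and Fb: "\<And>rh. rh \<ge> rh0 ==> integrand_on s K (bcont nu rh) F"
	shows "((%rh. cint (bcont nu rh) F) \<longlongrightarrow> cint (scont nu) F) at_top"
proof -
	define u where "u t = dens (scont nu) t *\<^sub>C F (sector_boundary nu t)" for t
	have c: "0 < cos nu" and sn: "sin nu < 1" using nu sin_less_one by (auto intro: cos_gt_zero)
	have "u integrable_on - {0}" using integrand_on_lift(4)[OF contour_scont s F] unfolding u_def by simp
	then have "(u has_integral integral (- {0}) u) (- {0})" by (rule integrable_integral)
	moreover have "(u has_integral y) UNIV \<longleftrightarrow> (u has_integral y) (- {0})" for y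
		by (rule has_integral_spike_set_eq; rule negligible_subset[of "{0}"]) auto
	moreover have "cint (scont nu) F = integral (- {0}) u" by (simp add: cint_def u_def[abs_def])
	ultimately have uU: "(u has_integral cint (scont nu) F) UNIV" by simp
	then have ui: "u integrable_on {a..b}" for a b using integrable_on_subinterval[of u UNIV a b] by blast
	have split: "cint (bcont nu rh) F = integral {- (rh * cos nu)..rh * cos nu} u +
			integral {1/2..3/4} (%t. (of_real rh * bderiv nu t) *\<^sub>C F (of_real rh * bpath nu t))"
		if rh: "rh \<ge> rh0" for rh
	proof -
		have rhp: "0 < rh" using rh rh0 by simp
		let ?v = "%t. (of_real rh * bderiv nu t) *\<^sub>C F (of_real rh * bpath nu t)"
		\<comment> \<open>The modulus at which the rays meet the arc. The substitutions t -> 2 b t on the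
		  first piece and t -> 4 b t - 4 b on the last one produce the arc length parameter of the sector
		  boundary.\<close>
		define b where b_def: "b = rh * cos nu"
		have b: "0 < b" using rhp c by (simp add: b_def)
		have "?v integrable_on bdom" using integrand_on_lift(4)[OF contour_bcont[OF nu rhp] s Fb[OF rh]] by simp
		then have v01: "?v integrable_on {0..1}" unfolding integrable_on_def has_integral_bdom .
		then have vi: "?v integrable_on {a..b}" if "0 \<le> a" "b \<le> 1" for a b
			by (rule integrable_on_subinterval) (use that in auto)
		have "cint (bcont nu rh) F = integral {0..1} ?v" unfolding cint_def bcont_simps
			using v01 has_integral_bdom integrable_integral integral_unique by metis
		also have "... = integral {0..1/2} ?v + (integral {1/2..3/4} ?v + integral {3/4..1} ?v)"
			using Henstock_Kurzweil_Integration.integral_combine[of 0 "1/2" 1 ?v] vi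
				Henstock_Kurzweil_Integration.integral_combine[of "1/2" "3/4" 1 ?v] by simp
		also have "integral {0..1/2} ?v = integral {0..b} u"
		proof -
			have "((%t. u ((2 * b) *\<^sub>R t + 0)) has_integral (1 / \<bar>2 * b\<bar> ^ DIM(real)) *\<^sub>R integral {0..b} u)
				 ((%x. (1 / (2 * b)) *\<^sub>R x + - ((1 / (2 * b)) *\<^sub>R 0)) ` cbox 0 b)"
				using b ui by (intro has_integral_affinity) (auto simp: integrable_integral)
			moreover have "(%x. (1 / (2 * b)) *\<^sub>R x + - ((1 / (2 * b)) *\<^sub>R 0)) ` cbox 0 b = {0..1/2}"
				using b c rhp image_affinity_cbox[of "1 / (2 * b)" "0::real" 0 b] by simp
			ultimately have "((%t. u (2 * b * t)) has_integral (1 / (2 * b)) *\<^sub>R integral {0..b} u) {0..1/2}"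
				using b by simp
			then have "((%t. (2 * b) *\<^sub>R u (2 * b * t)) has_integral (2 * b) *\<^sub>R (1 / (2 * b)) *\<^sub>R integral {0..b} u) {0..1/2}"
				by (rule has_integral_cmul)
			then have 1: "((%t. (2 * b) *\<^sub>R u (2 * b * t)) has_integral integral {0..b} u) {0..1/2}"
				using b c rhp by simp
			have "(?v has_integral integral {0..b} u) {0..1/2}"
			proof (rule has_integral_spike_finite[OF _ _ 1, of "{0, 1/2}"])
				show "?v t = (2 * b) *\<^sub>R u (2 * b * t)" if t: "t \<in> {0..1/2} - {0, 1/2}" for t
				proof -
					have pos: "\<not> 2 * b * t < 0" using t b by (simp add: not_less)
					then have "sector_boundary nu (2 * b * t) = of_real (2 * b * t) * cis (- nu)"
						by (simp only: sector_boundary_def if_False)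
					then have "of_real rh * bpath nu t = sector_boundary nu (2 * b * t)"
						using t by (simp add: bpath_eq(1) b_def)
					moreover have "dens (scont nu) (2 * b * t) = cis (- nu)" using pos by (simp only: scont_simps if_False)
					then have "of_real rh * bderiv nu t = of_real (2 * b) * dens (scont nu) (2 * b * t)"
						using t by (simp add: bderiv_def b_def del: scont_simps)
					ultimately show ?thesis unfolding u_def scaleC_of_real[symmetric] scaleC_scaleC by (simp only:)
				qed
			qed simp
			then show ?thesis by (rule integral_unique)
		qed
		also have "integral {3/4..1} ?v = integral {- b..0} u"
		proof -
			let ?m = "4 * b"
			have "((%t. u (?m *\<^sub>R t + - ?m)) has_integral (1 / \<bar>?m\<bar> ^ DIM(real)) *\<^sub>R integral {- b..0} u)
				 ((%x. (1 / ?m) *\<^sub>R x + - ((1 / ?m) *\<^sub>R (- ?m))) ` cbox (- b) 0)"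
				using b ui by (intro has_integral_affinity) (auto simp: integrable_integral)
			moreover have "(%x. (1 / ?m) *\<^sub>R x + - ((1 / ?m) *\<^sub>R (- ?m))) ` cbox (- b) 0 = {3/4..1}"
				using b c rhp image_affinity_cbox[of "1 / ?m" "1::real" "- b" 0] by simp
			ultimately have "((%t. u (?m * t - ?m)) has_integral (1 / ?m) *\<^sub>R integral {- b..0} u) {3/4..1}"
				using b by simp
			then have "((%t. ?m *\<^sub>R u (?m * t - ?m)) has_integral ?m *\<^sub>R (1 / ?m) *\<^sub>R integral {- b..0} u) {3/4..1}"
				by (rule has_integral_cmul)
			then have 1: "((%t. ?m *\<^sub>R u (?m * t - ?m)) has_integral integral {- b..0} u) {3/4..1}"
				using b c rhp by simp
			have "(?v has_integral integral {- b..0} u) {3/4..1}"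
			proof (rule has_integral_spike_finite[OF _ _ 1, of "{3/4, 1}"])
				show "?v t = ?m *\<^sub>R u (?m * t - ?m)" if t: "t \<in> {3/4..1} - {3/4, 1}" for t
				proof -
					have neg: "?m * t - ?m < 0" using t b by (simp add: algebra_simps)
					have "of_real rh * bpath nu t = sector_boundary nu (?m * t - ?m)"
						using t neg unfolding b_def by (simp add: bpath_eq(3) sector_boundary_def algebra_simps)
					moreover have "of_real rh * bderiv nu t = of_real ?m * dens (scont nu) (?m * t - ?m)"
						using t neg unfolding b_def by (simp add: bderiv_def)
					ultimately show ?thesis unfolding u_def scaleC_of_real[symmetric] scaleC_scaleC by (simp only:)
				qed
			qed simp
			then show ?thesis by (rule integral_unique)
		qed
		finally show ?thesis unfolding b_def[symmetric]
			using Henstock_Kurzweil_Integration.integral_combine[of "- b" 0 b u] b ui by (simp add: algebra_simps)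
	qed
	have lim1: "((%rh. integral {- (rh * cos nu)..rh * cos nu} u) \<longlongrightarrow> cint (scont nu) F) at_top"
	proof (rule tendstoI)
		fix e :: real assume "e > 0"
		with uU have "\<exists>B>0. \<forall>a b. ball 0 B \<subseteq> cbox a b -->
				norm (integral (cbox a b) (%x. if x \<in> UNIV then u x else 0) - cint (scont nu) F) < e"
			by (simp only: has_integral_alt')
		then obtain B where B: "B > 0" "\<And>a b. ball 0 B \<subseteq> cbox a b ==>
				norm (integral (cbox a b) u - cint (scont nu) F) < e" by (elim exE) auto
		have "\<forall>\<^sub>F rh in at_top. rh \<ge> B / cos nu" by (rule eventually_ge_at_top)
		then show "\<forall>\<^sub>F rh in at_top. dist (integral {- (rh * cos nu)..rh * cos nu} u) (cint (scont nu) F) < e"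
		proof eventually_elim
			case (elim rh)
			then have "B \<le> rh * cos nu" using c by (simp add: field_simps)
			then have "ball 0 B \<subseteq> cbox (- (rh * cos nu)) (rh * cos nu)" by (auto simp: dist_real_def)
			from B(2)[OF this] show ?case by (simp add: dist_norm)
		qed
	qed
	have lim2: "((%rh. integral {1/2..3/4} (%t. (of_real rh * bderiv nu t) *\<^sub>C F (of_real rh * bpath nu t))) \<longlongrightarrow> 0) at_top"
	proof (rule Lim_null_comparison)
		define k where "k = 1 - sin nu"
		have k: "0 < k" using sn by (simp add: k_def)
		show "((%rh. 32 * K * k powr (- s - 1) * rh powr (- s) * (1 / 4)) \<longlongrightarrow> 0) at_top"
			using s by (intro tendsto_mult_left_zero tendsto_mult_right_zero tendsto_neg_powr filterlim_ident) auto
		show "\<forall>\<^sub>F rh in at_top. norm (integral {1/2..3/4} (%t. (of_real rh * bderiv nu t) *\<^sub>C F (of_real rh * bpath nu t)))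
				\<le> 32 * K * k powr (- s - 1) * rh powr (- s) * (1 / 4)" using eventually_ge_at_top[of rh0]
		proof eventually_elim
			case (elim rh)
			then have rhp: "0 < rh" using rh0 by simp
			let ?v = "%t. (of_real rh * bderiv nu t) *\<^sub>C F (of_real rh * bpath nu t)"
			let ?C = "32 * K * k powr (- s - 1) * rh powr (- s)"
			have "?v integrable_on bdom" using integrand_on_lift(4)[OF contour_bcont[OF nu rhp] s Fb[OF elim]] by simp
			then have "?v integrable_on {0..1}" unfolding integrable_on_def has_integral_bdom .
			then have vi: "?v integrable_on {1/2..3/4}" by (rule integrable_on_subinterval) auto
			have le: "norm (?v t) \<le> ?C" if t: "t \<in> {1/2<..<3/4}" for t
			proof -
				let ?z = "of_real rh * bpath nu t"
				have "t \<in> bdom" using t by (auto simp: bdom_def)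
				then have "?z \<in> locus (bcont nu rh)" using pnt_locus[of t "bcont nu rh"] by simp
				then have F1: "norm (F ?z) \<le> K * wt s ?z" using Fb[OF elim] by (simp add: integrand_on_def)
				have "k \<le> cmod (bpath nu t)"
					using norm_triangle_ineq2[of 1 "of_real (sin nu) * cis (bangle nu t)"] t nu sin_ge_zero[of nu]
					by (simp add: bpath_eq(2) norm_mult k_def)
				then have kz: "rh * k \<le> cmod ?z" using rhp by (simp add: norm_mult)
				have zp: "0 < rh * k" using rhp k by simp
				have "wt s ?z \<le> cmod ?z powr (s - 1) / (cmod ?z powr (2 * s))"
					unfolding wt_def using kz zp by (intro divide_left_mono mult_pos_pos add_pos_nonneg) auto
				also have "... = cmod ?z powr (- s - 1)" using kz zp by (simp flip: powr_diff)
				also have "... \<le> (rh * k) powr (- s - 1)" using kz zp s by (intro powr_mono2') auto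
				finally have "norm (F ?z) \<le> K * (rh * k) powr (- s - 1)" using F1 K mult_left_mono order_trans by blast
				moreover have "cmod (of_real rh * bderiv nu t) \<le> rh * 32"
					using norm_bderiv_le[OF nu, of t] rhp by (simp add: norm_mult)
				ultimately have "norm (?v t) \<le> (rh * 32) * (K * (rh * k) powr (- s - 1))"
					unfolding norm_scaleC using rhp by (intro mult_mono) auto
				also have "... = ?C"
				proof -
					have "(rh * k) powr (- s - 1) = rh powr (- s - 1) * k powr (- s - 1)"
						using rhp k by (simp add: powr_mult)
					moreover have "rh powr (- s) = rh * rh powr (- s - 1)" using rhp by (simp add: powr_diff)
					ultimately show ?thesis by (simp add: mult_ac)
				qed
				finally show ?thesis .
			qed
			have "integral {1/2..3/4} ?v = integral {1/2<..<3/4} ?v" by (rule integral_open_interval_real)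
			also have "norm ... \<le> integral {1/2<..<3/4::real} (%t. ?C)"
			proof (rule integral_norm_bound_integral)
				show "?v integrable_on {1/2<..<3/4}" using vi by (simp add: integrable_on_open_interval_real)
				show "(%t. ?C) integrable_on {1/2<..<3/4::real}"
					by (simp add: integrable_on_open_interval_real integrable_on_const)
			qed (use le in auto)
			also have "... = ?C * (1 / 4)" by (simp flip: integral_open_interval_real)
			finally show ?case .
		qed
	qed
	have "((%rh. integral {- (rh * cos nu)..rh * cos nu} u +
			integral {1/2..3/4} (%t. (of_real rh * bderiv nu t) *\<^sub>C F (of_real rh * bpath nu t))) \<longlongrightarrow> cint (scont nu) F + 0) at_top"
		by (rule tendsto_add[OF lim1 lim2])
	moreover have "\<forall>\<^sub>F rh in at_top. integral {- (rh * cos nu)..rh * cos nu} u +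
			integral {1/2..3/4} (%t. (of_real rh * bderiv nu t) *\<^sub>C F (of_real rh * bpath nu t)) = cint (bcont nu rh) F"
		using eventually_ge_at_top[of rh0] by eventually_elim (simp only: split)
	ultimately have "((%rh. cint (bcont nu rh) F) \<longlongrightarrow> cint (scont nu) F + 0) at_top" by (rule Lim_transform_eventually)
	then show ?thesis by simp
qed

section \<open>Independence of the contour for functions with the decay of the class\<close>

abbreviation W :: "real => complex => real" where
	"W s z \<equiv> cmod z * wt s z"

lemma W_nonneg: "0 \<le> W s z" by (simp add: wt_nonneg)

lemma W_eq: "W s z = cmod z powr s / (1 + cmod z powr (2 * s))"
	by (cases "z = 0") (simp_all add: wt_def powr_diff)

lemma W_le_powr: "W s z \<le> cmod z powr s"
proof -
	have "W s z \<le> cmod z * cmod z powr (s - 1)" by (intro mult_left_mono wt_le_powr) simp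
	also have "... = cmod z powr s" by (cases "z = 0") (simp_all add: powr_diff)
	finally show ?thesis .
qed

lemma W_antimono: "0 < s' ==> s' \<le> s ==> W s z \<le> W s' z" by (intro mult_left_mono wt_antimono) auto

lemma W_le_1: "W s z \<le> 1"
proof -
	have "x \<le> 1 + x * x" for x :: real using sum_squares_ge_zero[of "x - 1" "0"] zero_le_square[of "x"]
		by (smt (verit) mult_le_cancel_right1 mult_nonneg_nonneg)
	then have "cmod z powr s \<le> 1 + cmod z powr s * cmod z powr s" .
	also have "cmod z powr s * cmod z powr s = cmod z powr (2 * s)" by (simp flip: powr_add)
	finally show ?thesis unfolding W_eq by (simp add: divide_le_eq add_pos_nonneg)
qed

lemma bcont_locus_sector:
	assumes "0 < be" "be < th" "th < pi / 2" "0 < rh" "rh \<le> rh'"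
	shows "locus (bcont be rh) \<subseteq> sto (sin th) rh'"
	using locus_bcont(1)[of be rh] stc_subset_sto[of "sin be" "sin th" rh rh'] sin_monotone_2pi[of be th] assms by auto

text \<open>Both integrals equal the same integral of \<open>qop\<close> over a Stolz contour of an
  angle between the larger of the two and \<open>th\<close>.\<close>

lemma bcont_independent:
	fixes A :: "'a::complex_banach \<Rightarrow>\<^sub>L 'a"
	assumes A: "complex_linear A" and be: "0 < be1" "be1 < th" "0 < be2" "be2 < th" "th < pi / 2"
		and rh: "0 < rh1" "rh1 \<le> rh" "0 < rh2" "rh2 \<le> rh" and reg: "reg A (sin be1) rh1 M1" "reg A (sin be2) rh2 M2"
		and f: "f holomorphic_on sto (sin th) rh" and si: "0 < si" "si \<le> 1" and C: "0 \<le> C"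
		and le: "\<And>z. z \<in> sto (sin th) rh ==> cmod (f z) \<le> C * cmod z powr si"
	shows "cint (bcont be1 rh1) (%z. f z *\<^sub>C res A z) = cint (bcont be2 rh2) (%z. f z *\<^sub>C res A z)"
proof -
	obtain be' where be': "max be1 be2 < be'" "be' < th" using dense[of "max be1 be2" th] be by auto
	have sn: "sin be' < sin th" using be be' by (intro sin_monotone_2pi) auto
	have s1: "sin th < 1" using be by (intro sin_less_one) auto
	have le': "cmod (f z) \<le> C * cmod z powr si" if "z \<in> stc (sin be') rh" for z
		using stc_subset_sto[OF sn order_refl] that le by auto
	have "cint (bcont be1 rh1) (%z. f z *\<^sub>C res A z) = cint (bcont be' rh) (%mu. f mu *\<^sub>C qop A mu)"
		by (rule cint_contour_change[OF A _ _ _ _ _ reg(1) sn s1 f si C le']) (use be be' rh in auto)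
	moreover have "cint (bcont be2 rh2) (%z. f z *\<^sub>C res A z) = cint (bcont be' rh) (%mu. f mu *\<^sub>C qop A mu)"
		by (rule cint_contour_change[OF A _ _ _ _ _ reg(2) sn s1 f si C le']) (use be be' rh in auto)
	ultimately show ?thesis by simp
qed

text \<open>Resolvents and the operators \<open>qop\<close> obey the same bound M / |z| on their
  contours. The calculus over products is built on this common property, so that both kinds of
  kernel may occur in one product.\<close>

definition kern :: "real => contour => (complex => ('a::complex_banach \<Rightarrow>\<^sub>L 'a)) => bool" where
	"kern M c K \<longleftrightarrow> contour c \<and> 0 \<le> M \<and> continuous_on (locus c) K \<and>
		 (\<forall>z\<in>locus c. complex_linear (K z) \<and> norm (K z) \<le> M / cmod z)"

lemma integrand_on_kern:
	assumes K: "kern M c K" and f: "continuous_on (locus c) f" "\<And>z. z \<in> locus c ==> cmod (f z) \<le> C * W s z"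
	shows "integrand_on s (C * M) c (%z. f z *\<^sub>C K z)"
proof -
	have "norm (f z *\<^sub>C K z) \<le> C * M * wt s z" if z: "z \<in> locus c" for z
	proof -
		have nz: "z ~= 0" using K z by (auto simp: kern_def contour_def)
		have "norm (f z *\<^sub>C K z) \<le> (C * W s z) * (M / cmod z)"
			unfolding norm_scaleC using K f(2)[OF z] z order_trans[OF norm_ge_zero f(2)[OF z]]
			by (intro mult_mono) (auto simp: kern_def)
		then show ?thesis using nz by (simp add: field_simps)
	qed
	then show ?thesis using K f(1) unfolding integrand_on_def kern_def by (auto intro!: continuous_intros)
qed

lemma kern_res:
	assumes "contour c" "reg A s rh M" "s < 1" "locus c \<inter> sto s rh = {}"
	shows "kern M c (res A)"
proof -
	have "0 \<notin> locus c" using assms(1) by (simp add: contour_def)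
	moreover have "z \<in> resolvent_set (graph_of A) \<and> norm (res A z) \<le> M / cmod z" if "z \<in> locus c" for z
		using regD[OF assms(2), of z] that assms(4) calculation by auto
	ultimately show ?thesis
		using assms reg_nonneg[OF assms(2,3)] reg_continuous_on[OF assms(2,4)] complex_linear_resolvent
		unfolding kern_def by blast
qed

lemma kern_qop:
	assumes "contour c" "reg A s rh M" "s < 1" "locus c \<inter> sto s rh = {}"
	shows "kern (2 * M) c (qop A)"
proof -
	have nz: "0 \<notin> locus c" using assms(1) by (simp add: contour_def)
	have r1: "- 1 \<in> resolvent_set (graph_of A)"
		using regD(1)[OF assms(2) minus_one_notin_sto[OF assms(3)]] by simp
	have "complex_linear (qop A z) \<and> norm (qop A z) \<le> 2 * M / cmod z" if z: "z \<in> locus c" for z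
	proof -
		have z': "z \<notin> sto s rh" "z ~= 0" using z assms(4) nz by auto
		have "complex_linear (qop A z)" unfolding qop_def
			by (intro complex_linear_add complex_linear_scaleC complex_linear_resolvent r1 regD(1)[OF assms(2) z'])
		then show ?thesis using norm_qop_le[OF assms(2,3) z'] by simp
	qed
	then show ?thesis
		using assms reg_nonneg[OF assms(2,3)] continuous_on_qop[OF assms(2,4) nz] unfolding kern_def by simp
qed

lemma kern_bcont_res:
	assumes "0 < be" "be < pi / 2" "0 < rh" "reg A (sin be) rh M"
	shows "kern M (bcont be rh) (res A)" using assms sin_less_one locus_bcont(2)[OF assms(1-3)]
	by (intro kern_res[OF contour_bcont assms(4)]) auto

lemma kern_scont_res:
	assumes "0 < nu" "nu < pi / 2" "reg A (sin nu) rh M"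
	shows "kern M (scont nu) (res A)" using assms sin_less_one locus_scont(3)[OF _ assms(1,2)]
	by (intro kern_res[OF contour_scont assms(3)]) auto

text \<open>The integrals over the Stolz contours of angle \<open>nu\<close> do not change with
  their size and converge to the integral over the sector boundary.\<close>

lemma cint_scont:
	fixes A :: "'a::complex_banach \<Rightarrow>\<^sub>L 'a"
	assumes A: "complex_linear A" and nu: "0 < nu" "nu < th" "th < pi / 2"
		and rh0: "0 < rh0" and reg: "\<And>rh. rh \<ge> rh0 ==> reg A (sin nu) rh M"
		and be: "0 < be" "be < th" "0 < rh" "reg A (sin be) rh M'"
		and f: "f holomorphic_on sector th" and s: "0 < s" and C: "0 \<le> C"
		and le: "\<And>z. z \<in> sector th ==> cmod (f z) \<le> C * W s z"
	shows "cint (scont nu) (%z. f z *\<^sub>C res A z) = cint (bcont be rh) (%z. f z *\<^sub>C res A z)"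
proof -
	let ?F = "%z. f z *\<^sub>C res A z"
	have nu2: "nu < pi / 2" using nu by simp
	have M: "0 \<le> M" using reg_nonneg[OF reg[OF order_refl]] sin_less_one nu nu2 by blast
	have le1: "cmod (f z) \<le> C * cmod z powr min s 1" if "z \<in> sector th" for z
	proof -
		have "W s z \<le> W (min s 1) z" using s by (intro W_antimono) auto
		also have "... \<le> cmod z powr min s 1" by (rule W_le_powr)
		finally have "C * W s z \<le> C * cmod z powr min s 1" using C by (rule mult_left_mono)
		then show ?thesis using le[OF that] by linarith
	qed
	have sub: "sto (sin th) rh' \<subseteq> sector th" for rh' using nu by (intro sto_subset_sector) auto
	have const: "cint (bcont nu rh') ?F = cint (bcont be rh) ?F" if rh': "rh' \<ge> rh0" for rh'
	proof (rule bcont_independent[OF A _ _ _ _ _ _ _ _ _ reg[OF rh'] be(4), of th "max rh' rh" f "min s 1" C])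
		show "f holomorphic_on sto (sin th) (max rh' rh)" by (rule holomorphic_on_subset[OF f sub])
	qed (use nu be s C rh0 rh' le1 sub in auto)
	have cf: "continuous_on V f" if "V \<subseteq> sector th" for V
		using holomorphic_on_imp_continuous_on[OF f] continuous_on_subset that by blast
	have "((%rh. cint (bcont nu rh) ?F) \<longlongrightarrow> cint (scont nu) ?F) at_top"
	proof (rule bcont_tendsto_scont[OF nu(1) nu2 s _ _ rh0])
		show "0 \<le> C * M" using C M by simp
		have l: "locus (scont nu) \<subseteq> sector th" using locus_scont(4)[OF _ nu(1) nu2 nu(2,3)] by auto
		show "integrand_on s (C * M) (scont nu) ?F"
			by (rule integrand_on_kern[OF kern_scont_res[OF nu(1) nu2 reg[OF order_refl]] cf[OF l] le]) (use l in auto)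
		fix rh' assume rh': "rh' \<ge> rh0"
		then have p: "0 < rh'" using rh0 by simp
		have l: "locus (bcont nu rh') \<subseteq> sector th" using bcont_locus_sector[OF nu p order_refl] sub by blast
		show "integrand_on s (C * M) (bcont nu rh') ?F"
			by (rule integrand_on_kern[OF kern_bcont_res[OF nu(1) nu2 p reg[OF rh']] cf[OF l] le]) (use l in auto)
	qed
	moreover have "\<forall>\<^sub>F rh' in at_top. cint (bcont nu rh') ?F = cint (bcont be rh) ?F"
		using eventually_ge_at_top[of rh0] by eventually_elim (rule const)
	ultimately have "((%rh'. cint (bcont be rh) ?F) \<longlongrightarrow> cint (scont nu) ?F) (at_top :: real filter)"
		by (rule Lim_transform_eventually)
	then show ?thesis by (simp add: tendsto_const_iff)
qed

section \<open>Ritt operators and sectorial operators\<close>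

lemma bounded_image_norm:
	assumes "bounded (f ` V)"
	shows "\<exists>B\<ge>0. \<forall>z\<in>V. norm (f z) \<le> B"
proof -
	obtain B where "\<forall>x\<in>f ` V. norm x \<le> B" using assms bounded_iff by blast
	then show ?thesis by (intro exI[of _ "max 0 B"]) (auto intro: max.coboundedI2)
qed

text \<open>The Ritt bound is taken at an angle \<open>be0\<close> strictly between
  \<open>al\<close> and \<open>be\<close>, since the closure of its Stolz domain, apart from the
  vertex, lies inside the open domain of angle \<open>be\<close>.\<close>

lemma reg_of_ritt:
	assumes T: "ritt_type al T" and be: "al < be" "be < pi / 2"
	shows "\<exists>M. reg (id_blinfun - T) (sin be) 1 M"
proof -
	obtain be0 where be0: "al < be0" "be0 < be" using dense be(1) by blast
	have al: "0 < al" "al < pi / 2" using T by (auto simp: ritt_type_def)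
	have "bounded ((%z. (1 - z) *\<^sub>C resolvent z (graph_of T)) ` (- closure (stolz be0)))"
		using T be0 be by (auto simp: ritt_type_def)
	then obtain B where B: "0 \<le> B"
			"\<And>z. z \<in> - closure (stolz be0) ==> norm ((1 - z) *\<^sub>C resolvent z (graph_of T)) \<le> B"
		using bounded_image_norm by blast
	have out: "1 - z \<notin> closure (stolz de)" if "z \<notin> sto (sin be) 1" "z ~= 0" "0 < de" "de < be" for z de
	proof
		assume "1 - z \<in> closure (stolz de)"
		then have "z \<in> stc (sin de) 1" using closure_stolz_subset[of de "1 - z"] that be by simp
		moreover have "sin de < sin be" using that be by (intro sin_monotone_2pi) auto
		ultimately show False using stc_subset_sto that(1) by blast
	qed
	have "reg (id_blinfun - T) (sin be) 1 B" unfolding reg_def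
	proof (intro allI impI)
		fix z assume z: "z \<notin> sto (sin be) 1" "z ~= 0"
		have "1 - z \<notin> spectrum (graph_of T)" using out[OF z al(1) be(1)] T by (auto simp: ritt_type_def)
		then have r: "1 - z \<in> resolvent_set (graph_of T)" by (simp add: spectrum_def)
		then have "z \<in> resolvent_set (graph_of (id_blinfun - T))" using resolvent_set_reflect[of "1 - z" T] by simp
		moreover have "norm (res (id_blinfun - T) z) \<le> B / cmod z" using B(2)[of "1 - z"] out[OF z, of be0] be0 al z
			by (simp add: resolvent_reflect[OF r] norm_scaleC field_simps)
		ultimately show "z \<in> resolvent_set (graph_of (id_blinfun - T)) \<and> norm (res (id_blinfun - T) z) \<le> B / cmod z"
			by simp
	qed
	then show ?thesis ..
qed

text \<open>Outside the sector the sectorial estimate applies. Inside the sector but outside the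
  Stolz domain |z| exceeds rh cos nu \<ge> 3, whereas \<open>sto s 1\<close> lies in |z| \<le> 2, so
  the bound \<open>M1\<close> takes over. The constant does not depend on rh.\<close>

lemma reg_of_sectorial:
	assumes A: "sectorial om (graph_of A)" and nu: "om < nu" "nu < pi / 2" and reg: "reg A s 1 M1" "s < 1"
	shows "\<exists>rh0>0. \<exists>M. \<forall>rh\<ge>rh0. reg A (sin nu) rh M"
proof -
	obtain nu0 where nu0: "om < nu0" "nu0 < nu" using dense nu(1) by blast
	have om: "0 < om" using A by (simp add: sectorial_def)
	have c: "0 < cos nu" using nu om by (intro cos_gt_zero) auto
	have "bounded ((%z. z *\<^sub>C res A z) ` (- closure (sector nu0)))" using A nu0 nu unfolding sectorial_def by auto
	then obtain B where B: "0 \<le> B" "\<And>z. z \<in> - closure (sector nu0) ==> norm (z *\<^sub>C res A z) \<le> B"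
		using bounded_image_norm by blast
	have "reg A (sin nu) rh (max B M1)" if rh: "rh \<ge> 3 / cos nu" for rh unfolding reg_def
	proof (intro allI impI)
		fix z assume z: "z \<notin> sto (sin nu) rh" "z ~= 0"
		show "z \<in> resolvent_set (graph_of A) \<and> norm (res A z) \<le> max B M1 / cmod z"
		proof (cases "z \<in> sector nu")
			case True
			then have "rh * cos nu < cmod z" using sector_eq_Union_sto(2)[of nu z rh] z om nu by force
			moreover have "3 \<le> rh * cos nu" using rh c by (simp add: field_simps)
			ultimately have "2 < cmod z" by linarith
			then have "z \<notin> sto s 1" using stc_bounds(3)[of z s 1] sto_subset_stc[of s 1] reg(2) by auto
			then have "z \<in> resolvent_set (graph_of A) \<and> norm (res A z) \<le> M1 / cmod z"
				using regD[OF reg(1) _ z(2)] by blast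
			moreover have "M1 / cmod z \<le> max B M1 / cmod z" by (intro divide_right_mono) auto
			ultimately show ?thesis by linarith
		next
			case False
			have out: "z \<notin> closure (sector de)" if "0 < de" "de < nu" for de
				using closure_sector_subset[OF that _ _ z(2)] False nu pi_gt_zero by auto
			have "z \<in> resolvent_set (graph_of A)" using out[OF om nu(1)] A by (auto simp: sectorial_def spectrum_def)
			moreover have "cmod z * norm (res A z) \<le> max B M1"
				using B(2)[of z] out[of nu0] nu0 om by (simp add: norm_scaleC)
			ultimately show ?thesis using z(2) by (simp add: field_simps)
		qed
	qed
	then show ?thesis using c by (intro exI[of _ "3 / cos nu"]) auto
qed

lemma closed_densely_defined_graph_of:
	assumes "complex_linear S"
	shows "closed_densely_defined (graph_of S)"
proof -
	have mem: "(x, y) \<in> graph_of S \<longleftrightarrow> y = S x" for x y by (auto simp: graph_of_def)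
	have "closed {p. snd p = S (fst p)}" by (intro closed_Collect_eq continuous_intros)
	moreover have "{p. snd p = S (fst p)} = graph_of S" by (auto simp: graph_of_def)
	moreover have "linear_operator (graph_of S)"
		using assms unfolding linear_operator_def single_valued_def mem complex_linear_def
		by (simp add: blinfun.add_right blinfun.zero_right)
	moreover have "Domain (graph_of S) = UNIV" by (auto simp: Domain_iff mem)
	ultimately show ?thesis unfolding closed_densely_defined_def by simp
qed

lemma sectorial_of_ritt:
	assumes T: "ritt_type al T"
	shows "sectorial al (graph_of (id_blinfun - T))" unfolding sectorial_def
proof (intro conjI allI impI)
	have al: "0 < al" "al < pi / 2" using T by (auto simp: ritt_type_def)
	then show "0 < al" "al < pi" by auto
	show "closed_densely_defined (graph_of (id_blinfun - T))"
		using T by (intro closed_densely_defined_graph_of complex_linear_diff) (auto simp: ritt_type_def)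
	show "spectrum (graph_of (id_blinfun - T)) \<subseteq> closure (sector al)"
	proof
		fix z assume "z \<in> spectrum (graph_of (id_blinfun - T))"
		then have "1 - z \<in> spectrum (graph_of T)"
			using resolvent_set_reflect[of "1 - z" T] by (simp add: spectrum_def)
		then have "1 - z \<in> closure (stolz al)" using T by (auto simp: ritt_type_def)
		then have "1 - (1 - z) \<in> (%w. 1 - w) ` closure (stolz al)" by (rule imageI)
		also have "... \<subseteq> closure (sector al)"
		proof (rule image_closure_subset)
			have "1 - w \<in> sector al" if "w \<in> stolz al" for w
				using stolz_iff[OF al, of w] that sto_subset_sector[OF al, of 1] by auto
			then show "(%w. 1 - w) ` stolz al \<subseteq> closure (sector al)" using closure_subset by blast
		qed (auto intro!: continuous_intros)
		finally show "z \<in> closure (sector al)" by simp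
	qed
	fix nu assume nu: "al < nu \<and> nu < pi"
	\<comment> \<open>\<open>nu\<close> may exceed pi / 2, beyond which there are no Stolz domains; the
	  estimate of a smaller angle covers the complement of the larger sector.\<close>
	obtain nu' where nu': "al < nu'" "nu' < pi / 2" "nu' \<le> nu" using dense[of al "min nu (pi / 2)"] nu al by auto
	obtain M where M: "reg (id_blinfun - T) (sin nu') 1 M" using reg_of_ritt[OF T nu'(1,2)] ..
	have M0: "0 \<le> M" using reg_nonneg[OF M] sin_less_one nu' al by force
	have "norm (z *\<^sub>C res (id_blinfun - T) z) \<le> M" if z: "z \<notin> closure (sector nu)" for z
	proof (cases "z = 0")
		case False
		have "z \<notin> sector nu'" using z closure_subset[of "sector nu"] sector_mono[OF nu'(3)] by blast
		then have "z \<notin> sto (sin nu') 1" using sto_subset_sector[of nu' 1] nu' al by auto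
		then have "norm (res (id_blinfun - T) z) \<le> M / cmod z" using regD(2)[OF M] False by blast
		then show ?thesis using False by (simp add: norm_scaleC field_simps)
	qed (simp add: M0)
	then show "bounded ((%z. z *\<^sub>C res (id_blinfun - T) z) ` (- closure (sector nu)))"
		unfolding bounded_iff by auto
qed

lemma compose_reflect_commute:
	assumes "S o\<^sub>L T = T o\<^sub>L S"
	shows "(id_blinfun - S) o\<^sub>L (id_blinfun - T) = (id_blinfun - T) o\<^sub>L (id_blinfun - S)"
	by (simp add: compose_diff_left compose_diff_right assms)

section \<open>Splitting the Stolz contour\<close>

definition cut :: "real set => contour => contour" where
	"cut J c = (params c \<inter> J, dens c, pnt c)"

lemma cut_simps [simp]:
	"params (cut J c) = params c \<inter> J" "dens (cut J c) = dens c" "pnt (cut J c) = pnt c" by (simp_all add: cut_def)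

lemma locus_cut: "locus (cut J c) \<subseteq> locus c" by (auto simp: locus_def)

lemma contour_cut:
	assumes c: "contour c" and J: "open J"
	shows "contour (cut J c)"
proof -
	have "(%t. cmod (dens c t) * wt s (pnt c t)) integrable_on params c \<inter> J" if "s > 0" for s
	proof -
		have "(%t. cmod (dens c t) * wt s (pnt c t)) absolutely_integrable_on params c"
			using c that by (intro nonnegative_absolutely_integrable_1) (auto simp: contour_def wt_nonneg)
		then have "(%t. cmod (dens c t) * wt s (pnt c t)) absolutely_integrable_on params c \<inter> J"
			by (rule set_integrable_subset) (use c J in \<open>auto simp: contour_def intro!: borel_open open_Int\<close>)
		then show ?thesis by (rule set_lebesgue_integral_eq_integral(1))
	qed
	moreover have "0 \<notin> locus (cut J c)" using c locus_cut[of J c] by (auto simp: contour_def)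
	ultimately show ?thesis using c J unfolding contour_def cut_simps by (auto intro: continuous_on_subset)
qed

lemma integrand_on_subset:
	"integrand_on s C c F ==> locus c' \<subseteq> locus c ==> integrand_on s C c' F"
	unfolding integrand_on_def by (auto intro: continuous_on_subset)

lemma cint_cut:
	assumes c: "contour c" and J: "open J1" "open J2" "J1 \<inter> J2 = {}" "params c \<subseteq> J1 \<union> J2"
		and s: "s > 0" and F: "integrand_on s C c F"
	shows "cint c F = cint (cut J1 c) F + cint (cut J2 c) F"
proof -
	let ?v = "%t. dens c t *\<^sub>C F (pnt c t)"
	have i: "?v integrable_on params c \<inter> J" if "open J" for J
		using integrand_on_lift(4)[OF contour_cut[OF c that] s integrand_on_subset[OF F locus_cut]] by simp
	have "params c = (params c \<inter> J1) \<union> (params c \<inter> J2)" using J by blast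
	then have "integral (params c) ?v = integral ((params c \<inter> J1) \<union> (params c \<inter> J2)) ?v" by simp
	also have "... = integral (params c \<inter> J1) ?v + integral (params c \<inter> J2) ?v"
	proof (rule Henstock_Kurzweil_Integration.integral_Un[OF i i])
		have "(params c \<inter> J1) \<inter> (params c \<inter> J2) = {}" using J(3) by blast
		then show "negligible ((params c \<inter> J1) \<inter> (params c \<inter> J2))" by simp
	qed (use J in auto)
	finally show ?thesis by (simp add: cint_def)
qed

text \<open>No continuity of \<open>F\<close> is needed: a non-integrable function has integral \<open>0\<close>.\<close>

lemma norm_cint_le_of_bound:
	assumes c: "contour c" and s: "s > 0" and C: "0 \<le> C" and le: "\<And>z. z \<in> locus c ==> norm (F z) \<le> C * wt s z"
	shows "norm (cint c F) \<le> C * mass s c"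
proof (cases "(%t. dens c t *\<^sub>C F (pnt c t)) integrable_on params c")
	case True
	have "norm (cint c F) \<le> integral (params c) (%t. C * (cmod (dens c t) * wt s (pnt c t)))" unfolding cint_def
	proof (rule integral_norm_bound_integral[OF True])
		show "(%t. C * (cmod (dens c t) * wt s (pnt c t))) integrable_on params c"
			using c s by (intro integrable_on_mult_right) (auto simp: contour_def)
		fix t assume "t \<in> params c"
		then have "norm (F (pnt c t)) \<le> C * wt s (pnt c t)" by (intro le pnt_locus)
		then have "cmod (dens c t) * norm (F (pnt c t)) \<le> cmod (dens c t) * (C * wt s (pnt c t))"
			by (intro mult_left_mono) auto
		then show "norm (dens c t *\<^sub>C F (pnt c t)) \<le> C * (cmod (dens c t) * wt s (pnt c t))"
			by (simp add: norm_scaleC mult_ac)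
	qed
	then show ?thesis by (simp add: mass_def)
next
	case False
	then show ?thesis using C mass_nonneg by (simp add: cint_def not_integrable_integral)
qed

definition rays :: "real => contour" where
	"rays be = cut ({..<1/2} \<union> {3/4<..}) (bcont be 1)"

definition carc :: "real => contour" where
	"carc be = cut {1/2<..<3/4} (bcont be 1)"

lemma locus_rays_subset: "locus (rays be) \<subseteq> locus (bcont be 1)"
	and locus_arc_subset: "locus (carc be) \<subseteq> locus (bcont be 1)" unfolding rays_def carc_def by (rule locus_cut)+

lemma contour_rays: "0 < be ==> be < pi / 2 ==> contour (rays be)"
	and contour_arc: "0 < be ==> be < pi / 2 ==> contour (carc be)"
	unfolding rays_def carc_def by (intro contour_cut contour_bcont open_Un; simp)+

lemma cint_rays_arc:
	assumes "0 < be" "be < pi / 2" "s > 0" "integrand_on s C (bcont be 1) F"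
	shows "cint (bcont be 1) F = cint (rays be) F + cint (carc be) F" unfolding rays_def carc_def
	by (rule cint_cut[OF contour_bcont _ _ _ _ assms(3,4)]) (use assms in \<open>auto simp: bdom_def\<close>)

text \<open>The segments lie on the boundary rays of the sector of angle \<open>be\<close>, so they
  avoid the Stolz domains of all sizes. This lets \<open>z\<close> range over a whole sector in
  kernel integrals over the segments.\<close>

lemma locus_rays:
	assumes be: "0 < be" "be < pi / 2" and z: "z \<in> locus (rays be)"
	shows "z \<notin> sto (sin be) rh" "z ~= 0" "cmod z \<le> 2" "z \<in> stc (sin be) 1"
proof -
	have l: "z \<in> locus (bcont be 1)" using z locus_rays_subset by blast
	then show "z ~= 0" "cmod z \<le> 2" "z \<in> stc (sin be) 1" using locus_bcont[OF be, of 1 z] by auto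
	have c: "0 < cos be" using be by (intro cos_gt_zero) auto
	obtain t where t: "t \<in> bdom" "t < 1/2 \<or> 3/4 < t" "z = bpath be t" using z by (auto simp: locus_def rays_def)
	have t01: "0 < t" "t < 1" using t(1) bdom_subset by auto
	have "\<exists>r\<ge>0. z = of_real r * cis (- be) \<or> z = of_real r * cis be"
	proof (cases "t < 1/2")
		case True
		then have "z = of_real (2 * t * cos be) * cis (- be)" using t bpath_eq(1)[of t be] by simp
		moreover have "0 \<le> 2 * t * cos be" using t01 c by simp
		ultimately show ?thesis by blast
	next
		case False
		then have "z = of_real (4 * (1 - t) * cos be) * cis be" using t bpath_eq(3)[of t be] by simp
		moreover have "0 \<le> 4 * (1 - t) * cos be" using t01 c by simp
		ultimately show ?thesis by blast
	qed
	then obtain r where r: "r \<ge> 0" "z = of_real r * cis (- be) \<or> z = of_real r * cis be" by blast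
	have "Re z = cos be * cmod z" using r by (auto simp: norm_mult)
	then show "z \<notin> sto (sin be) rh" using sto_subset_sector[OF be] sector_iff[of be z] be by auto
qed

lemma locus_arc:
	assumes be: "0 < be" "be < pi / 2" and z: "z \<in> locus (carc be)"
	shows "1 - sin be \<le> cmod z" "cmod z \<le> 2" "z \<notin> sto (sin be) 1" "z ~= 0" "z \<in> stc (sin be) 1"
proof -
	have l: "z \<in> locus (bcont be 1)" using z locus_arc_subset by blast
	then show "cmod z \<le> 2" "z \<notin> sto (sin be) 1" "z ~= 0" "z \<in> stc (sin be) 1" using locus_bcont[OF be, of 1 z] by auto
	obtain t where t: "1/2 < t" "t < 3/4" "z = bpath be t" using z by (auto simp: locus_def carc_def)
	show "1 - sin be \<le> cmod z"
		using norm_triangle_ineq2[of 1 "of_real (sin be) * cis (bangle be t)"] t be sin_ge_zero[of be]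
		by (simp add: bpath_eq(2) norm_mult)
qed

section \<open>Transporting functions from a Stolz domain to a sector\<close>

text \<open>The part of the reproducing integral that comes from the two segments. Without the arc
  the point z is no longer confined to the Stolz domain, and the result is defined on a full sector
  of smaller angle.\<close>

definition hop :: "real => (complex => complex) => complex => complex" where
	"hop be F z = 1 / (2 * pi * \<i>) * cint (rays be) (%mu. F mu * ker mu z)"

lemma cmod_two_pi_i: "cmod (1 / (2 * pi * \<i>)) = 1 / (2 * pi)" by (simp add: norm_divide norm_mult)

lemma integrand_on_powrI:
	fixes F :: "complex => 'b::complex_banach"
	assumes "continuous_on (locus c) F" "0 < si" "0 \<le> C"
		and le: "\<And>mu. mu \<in> locus c ==> cmod mu \<le> 2 \<and> norm (F mu) \<le> C * cmod mu powr (si - 1)"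
	shows "integrand_on si (C * (1 + 2 powr (2 * si))) c F"
proof -
	have "norm (F mu) \<le> C * (1 + 2 powr (2 * si)) * wt si mu" if "mu \<in> locus c" for mu
	proof -
		have "norm (F mu) \<le> C * cmod mu powr (si - 1)" using le[OF that] by simp
		also have "... \<le> C * ((1 + 2 powr (2 * si)) * wt si mu)"
			using le[OF that] assms(2,3) by (intro mult_left_mono powr_le_wt) auto
		finally show ?thesis by (simp add: mult_ac)
	qed
	then show ?thesis unfolding integrand_on_def using assms(1) by blast
qed

text \<open>The factor 5 is 1 + 2^2: for |mu| \<le> 2 the weight with s = 1 is at least 1/5.\<close>

lemma norm_cint_le_of_bounded:
	fixes F :: "complex => 'b::complex_banach"
	assumes c: "contour c" and B: "0 \<le> B" and le: "\<And>mu. mu \<in> locus c ==> cmod mu \<le> 2 \<and> norm (F mu) \<le> B"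
	shows "norm (cint c F) \<le> 5 * B * mass 1 c"
proof (rule norm_cint_le_of_bound[OF c])
	fix mu assume mu: "mu \<in> locus c"
	have "mu ~= 0" using c mu by (auto simp: contour_def)
	then have "1 \<le> 5 * wt 1 mu" using powr_le_wt[of mu 2 1] le[OF mu] by simp
	then have "B * 1 \<le> B * (5 * wt 1 mu)" using B by (rule mult_left_mono)
	then show "norm (F mu) \<le> 5 * B * wt 1 mu" using le[OF mu] by simp
qed (use B in auto)

text \<open>For \<open>ta\<close> at most 1/2 the power |z|^(2 ta) is at most |1 + z|, so the factor
  1 / |1 + z| of the kernel provides the decay at infinity that the class demands.\<close>

lemma W_half:
	assumes "0 < ta" "ta \<le> 1/2" "0 \<le> Re z"
	shows "cmod z powr ta / cmod (1 + z) \<le> 2 * W ta z"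
proof -
	have "cmod z powr (2 * ta) \<le> cmod (1 + z)"
	proof (cases "cmod z \<le> 1")
		case True
		then have "cmod z powr (2 * ta) \<le> 1" using assms by (intro powr_le1) auto
		then show ?thesis using norm_one_plus_ge(1)[OF assms(3)] by linarith
	next
		case False
		then have "cmod z powr (2 * ta) \<le> cmod z powr 1" using assms by (intro powr_mono) auto
		then show ?thesis using norm_one_plus_ge(2)[OF assms(3)] False by simp
	qed
	then have le: "1 + cmod z powr (2 * ta) \<le> 2 * cmod (1 + z)" using norm_one_plus_ge(1)[OF assms(3)] by linarith
	have "2 * cmod z powr ta / (2 * cmod (1 + z)) \<le> 2 * cmod z powr ta / (1 + cmod z powr (2 * ta))"
	proof (rule divide_left_mono[OF le])
		have "0 < 1 + cmod z powr (2 * ta)" by (simp add: add_pos_nonneg)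
		moreover from this le have "0 < 2 * cmod (1 + z)" by linarith
		ultimately show "0 < 2 * cmod (1 + z) * (1 + cmod z powr (2 * ta))" by (rule mult_pos_pos[rotated])
	qed simp
	then show ?thesis by (simp add: W_eq)
qed

context
	fixes th be ga :: real
	assumes th: "0 < th" "th < be" and ga: "be < ga" "ga < pi / 2"
begin

text \<open>The constant \<open>ka\<close> of \<open>separated\<close> for the sines of the two
  angles.\<close>

definition sep_const :: real where
	"sep_const = (sin be - sin th) / (2 + (sin be - sin th))"

lemma angles: "0 < be" "be < pi / 2" "sin th < sin be" "sin be < sin ga" "sin ga < 1" "0 < cos th"
	using th ga by (auto intro!: sin_monotone_2pi sin_less_one cos_gt_zero)

lemma rays_separated:
	assumes "z \<in> sector th" "mu \<in> locus (rays be)"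
	shows "0 < sep_const" "sep_const * cmod z \<le> cmod (mu - z)" "sep_const * cmod mu \<le> cmod (mu - z)"
		"0 < Re z" "z ~= 0"
proof -
	obtain v where v: "0 < v" "cmod (z - of_real v) < v * sin th"
		using sector_eq_Union_sto(1)[of th z] assms th ga by auto
	then have z: "z \<in> stc (sin th) v" by (auto simp: stc_def intro!: exI[of _ v])
	show "0 < sep_const" "sep_const * cmod z \<le> cmod (mu - z)" "sep_const * cmod mu \<le> cmod (mu - z)"
		using separated[OF z locus_rays(1)[OF angles(1,2) assms(2), of v]] angles unfolding sep_const_def by auto
	show "0 < Re z" "z ~= 0" using stc_bounds[OF z] angles by auto
qed

lemma continuous_on_ker:
	assumes "z \<in> sector th"
	shows "continuous_on (locus (rays be)) (%mu. ker mu z)"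
proof -
	have "1 + z ~= 0" if "mu \<in> locus (rays be)" for mu
		using norm_one_plus_ge(1)[of z] rays_separated(4)[OF assms that] by auto
	moreover have "mu - z ~= 0" if "mu \<in> locus (rays be)" for mu
		using rays_separated[OF assms that] by (auto simp: mult_le_0_iff)
	ultimately show ?thesis
		unfolding ker_def using locus_rays(2)[OF angles(1,2)] by (auto intro!: continuous_intros)
qed

text \<open>6 = 3 * 2, where 3 bounds 1 + |mu| and 2 comes from \<open>W_half\<close>; the last
  factor turns a power of |mu| into the weight.\<close>

definition hop_const :: "real => real" where
	"hop_const ta = 6 / sep_const * (1 + 2 powr (2 * ta))"

lemma hop_const_nonneg: "0 \<le> hop_const ta" using angles by (simp add: hop_const_def sep_const_def)

text \<open>Of the power |mu|^(2 ta) granted by the decay of \<open>F\<close>, half pays for the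
  decay |z|^ta of the kernel, and the rest leaves the integrable singularity |mu|^(ta - 1).\<close>

lemma hop_integrand:
	assumes s: "0 < s" and ta: "ta = min s 1 / 2" and F: "continuous_on (locus (rays be)) F" and C: "0 \<le> C"
		and le: "\<And>mu. mu \<in> locus (rays be) ==> cmod (F mu) \<le> C * W s mu" and z: "z \<in> sector th"
	shows "integrand_on ta (hop_const ta * C * W ta z) (rays be) (%mu. F mu * ker mu z)"
proof -
	have ta': "0 < ta" "ta \<le> 1/2" "2 * ta \<le> s" using s ta by auto
	have ka: "0 < sep_const" using angles by (simp add: sep_const_def)
	have "norm (F mu * ker mu z) \<le> hop_const ta * C * W ta z * wt ta mu" if mu: "mu \<in> locus (rays be)" for mu
	proof -
		note r = rays_separated[OF z mu] and l = locus_rays[OF angles(1,2) mu]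
		have "W s mu \<le> cmod mu powr (2 * ta)" using W_antimono[of "2 * ta" s mu] W_le_powr[of mu "2 * ta"] ta' by auto
		then have Fmu: "cmod (F mu) \<le> C * cmod mu powr (2 * ta)"
			using order_trans[OF le[OF mu] mult_left_mono[OF _ C]] by blast
		have "cmod (ker mu z) \<le> (1 + cmod mu) / sep_const * (cmod mu powr (- ta - 1) * (cmod z powr ta / cmod (1 + z)))"
			using r l ta' by (intro norm_ker_le) auto
		also have "... \<le> 3 / sep_const * (cmod mu powr (- ta - 1) * (2 * W ta z))"
			using l(3) ka W_half[of ta z] ta' r(4) by (intro mult_mono divide_right_mono mult_left_mono) auto
		finally have k: "cmod (ker mu z) \<le> 3 / sep_const * (cmod mu powr (- ta - 1) * (2 * W ta z))" .
		have "norm (F mu * ker mu z) \<le> (C * cmod mu powr (2 * ta)) * (3 / sep_const * (cmod mu powr (- ta - 1) * (2 * W ta z)))"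
			unfolding norm_mult using Fmu k C by (intro mult_mono) auto
		also have "... = 6 / sep_const * C * W ta z * (cmod mu powr (2 * ta) * cmod mu powr (- ta - 1))" by simp
		also have "cmod mu powr (2 * ta) * cmod mu powr (- ta - 1) = cmod mu powr (ta - 1)" by (simp flip: powr_add)
		also have "6 / sep_const * C * W ta z * cmod mu powr (ta - 1)
				\<le> 6 / sep_const * C * W ta z * ((1 + 2 powr (2 * ta)) * wt ta mu)"
			using powr_le_wt[OF l(3), of ta] ta' ka C wt_nonneg[of ta z] by (intro mult_left_mono mult_nonneg_nonneg) auto
		finally show ?thesis by (simp add: hop_const_def mult_ac)
	qed
	then show ?thesis
		unfolding integrand_on_def using F continuous_on_ker[OF z] by (auto intro: continuous_on_mult)
qed

lemma hop_decay:
	assumes s: "0 < s" and ta: "ta = min s 1 / 2" and F: "continuous_on (locus (rays be)) F" and C: "0 \<le> C"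
		and le: "\<And>mu. mu \<in> locus (rays be) ==> cmod (F mu) \<le> C * W s mu" and z: "z \<in> sector th"
	shows "cmod (hop be F z) \<le> hop_const ta * mass ta (rays be) * C * W ta z"
proof -
	let ?c = "cint (rays be) (%mu. F mu * ker mu z)"
	have "norm ?c \<le> hop_const ta * C * W ta z * mass ta (rays be)"
		using s ta by (intro norm_cint_le[OF contour_rays[OF angles(1,2)] _ hop_integrand[OF assms]]) auto
	also have "... = hop_const ta * mass ta (rays be) * C * W ta z" by (simp only: mult_ac)
	finally have c: "norm ?c \<le> hop_const ta * mass ta (rays be) * C * W ta z" .
	have "norm ?c * 1 \<le> norm ?c * (2 * pi)" using pi_ge_two by (intro mult_left_mono) auto
	then have "norm ?c / (2 * pi) \<le> norm ?c" by (simp add: divide_le_eq)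
	then have "cmod (hop be F z) \<le> norm ?c" unfolding hop_def norm_mult cmod_two_pi_i by simp
	then show ?thesis using c by (rule order_trans)
qed

lemma holomorphic_on_hop:
	assumes s: "0 < s" and F: "continuous_on (locus (rays be)) F" and C: "0 \<le> C"
		and le: "\<And>mu. mu \<in> locus (rays be) ==> cmod (F mu) \<le> C * W s mu"
	shows "hop be F holomorphic_on sector th"
proof -
	define ta where "ta = min s 1 / 2"
	have "(%z. cint (rays be) (%mu. F mu * ker mu z)) holomorphic_on sector th"
	proof (rule holomorphic_on_cint[OF contour_rays[OF angles(1,2)]])
		show "0 < ta" using s by (simp add: ta_def)
		show "open (sector th)" using th ga by (intro open_sector) auto
		fix mu assume mu: "mu \<in> locus (rays be)"
		have "1 + z ~= 0" if "z \<in> sector th" for z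
			using norm_one_plus_ge(1)[of z] rays_separated(4)[OF that mu] by auto
		moreover have "mu - z ~= 0" if "z \<in> sector th" for z
			using rays_separated[OF that mu] by (auto simp: mult_le_0_iff)
		ultimately show "(%z. F mu * ker mu z) holomorphic_on sector th"
			unfolding ker_def using locus_rays(2)[OF angles(1,2) mu] by (auto intro!: holomorphic_intros)
	next
		fix z assume z: "z \<in> sector th"
		have w: "hop_const ta * C * W ta z * wt ta mu \<le> hop_const ta * C * wt ta mu" for mu
			using W_le_1[of z ta] hop_const_nonneg C wt_nonneg[of ta mu]
			by (intro mult_right_mono) (auto intro!: mult_left_le)
		have "integrand_on ta (hop_const ta * C * W ta z) (rays be) (%mu. F mu * ker mu z)"
			by (rule hop_integrand[OF s ta_def F C le z])
		then show "integrand_on ta (hop_const ta * C) (rays be) (%mu. F mu * ker mu z)"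
			unfolding integrand_on_def using order_trans[OF _ w] by blast
	qed
	then show ?thesis unfolding hop_def[abs_def] by (intro holomorphic_intros)
qed

text \<open>Holomorphy in the variables that are not transformed, which enter only as parameters of
  the integrand.\<close>

lemma holomorphic_on_hop_param:
	assumes U: "open U" and s: "0 < s" and C: "0 \<le> C" and F: "\<And>w. w \<in> U ==> continuous_on (locus (rays be)) (F w)"
		and le: "\<And>w mu. w \<in> U ==> mu \<in> locus (rays be) ==> cmod (F w mu) \<le> C * W s mu"
		and holo: "\<And>mu. mu \<in> locus (rays be) ==> (%w. F w mu) holomorphic_on U" and z: "z \<in> sector th"
	shows "(%w. hop be (F w) z) holomorphic_on U"
proof -
	define ta where "ta = min s 1 / 2"
	have "(%w. cint (rays be) (%mu. F w mu * ker mu z)) holomorphic_on U"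
	proof (rule holomorphic_on_cint[OF contour_rays[OF angles(1,2)] _ U])
		show "0 < ta" using s by (simp add: ta_def)
		show "(%w. F w mu * ker mu z) holomorphic_on U" if "mu \<in> locus (rays be)" for mu
			by (intro holomorphic_on_mult holomorphic_on_const holo that)
		show "integrand_on ta (hop_const ta * C * W ta z) (rays be) (%mu. F w mu * ker mu z)" if "w \<in> U" for w
			by (rule hop_integrand[OF s ta_def F[OF that] C le[OF that] z])
	qed
	then show ?thesis unfolding hop_def by (intro holomorphic_intros)
qed

text \<open>The crucial estimate: \<open>K\<close> depends on the angles only, while
  \<open>s\<close> and \<open>C\<close> merely ensure convergence. The bound |f| \<le> B does not
  make the integrand integrable at the vertex, so Cauchy's theorem is used to move the singular
  contributions to the arc, differently for small and for other z.\<close>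

lemma hop_bound:
	"\<exists>K\<ge>0. \<forall>f s C B z. f holomorphic_on sto (sin ga) 1 --> 0 < s --> 0 \<le> C -->
		(\<forall>mu\<in>sto (sin ga) 1. cmod (f mu) \<le> C * W s mu \<and> cmod (f mu) \<le> B) --> z \<in> sector th -->
		cmod (hop be f z) \<le> K * B"
proof -
	define k where "k = 1 - sin be"
	\<comment> \<open>|z| < cos th puts a point of the sector into the Stolz domain of size 1, where
	  f(z) makes sense; |z| < k / 2 keeps z at distance at least k / 2 from the arc, whose points have
	  modulus at least k.\<close>
	define r where "r = min (cos th) (k / 2)"
	let ?m1 = "mass 1 (rays be)" and ?m2 = "mass 1 (carc be)" and ?ka = sep_const
	have k: "0 < k" using angles by (simp add: k_def)
	have r: "0 < r" using angles k by (simp add: r_def)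
	have ka: "0 < ?ka" using angles by (simp add: sep_const_def)
	have m: "0 \<le> ?m1" "0 \<le> ?m2" by (rule mass_nonneg)+
	define K where "K = 1 + 15 * ?m2 / k + 5 * ?m1 / (?ka * r)"
	have K0: "0 \<le> 15 * ?m2 / k" "0 \<le> 5 * ?m1 / (?ka * r)" "5 * ?m2 / k \<le> 15 * ?m2 / k"
		using k r ka m by (auto intro: divide_right_mono)
	have pi1: "x / (2 * pi) \<le> x" if "0 \<le> x" for x :: real
	proof -
		have "x * 1 \<le> x * (2 * pi)" using that pi_ge_two by (intro mult_left_mono) auto
		then show ?thesis by (simp add: divide_le_eq)
	qed
	show ?thesis
	proof (intro exI[of _ K] conjI allI impI)
		show "0 \<le> K" using K0 by (simp add: K_def)
		fix f :: "complex => complex" and s C B z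
		assume f: "f holomorphic_on sto (sin ga) 1" and s: "0 < s" and C: "0 \<le> C"
			and fb: "\<forall>mu\<in>sto (sin ga) 1. cmod (f mu) \<le> C * W s mu \<and> cmod (f mu) \<le> B" and z: "z \<in> sector th"
		define si where "si = min s 1"
		have si: "0 < si" "si \<le> 1" using s by (auto simp: si_def)
		have sub: "stc (sin be) 1 \<subseteq> sto (sin ga) 1" using angles by (intro stc_subset_sto) auto
		have fC: "cmod (f mu) \<le> C * cmod mu powr si" if "mu \<in> sto (sin ga) 1" for mu
		proof -
			have "W s mu \<le> cmod mu powr si" using W_antimono[of si s mu] W_le_powr[of mu si] s by (auto simp: si_def)
			then show ?thesis using fb that C mult_left_mono order_trans by blast
		qed
		have B: "0 \<le> B" using fb of_real_in_sto[of 1 1 "sin ga"] angles th sin_gt_zero[of be] norm_ge_zero order_trans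
			by (metis less_trans order_refl pi_half_less_two sin_gt_zero_02 zero_less_one)
		have lb: "mu \<in> sto (sin ga) 1" "mu ~= 0" "cmod mu \<le> 2" "mu \<notin> sto (sin be) 1" if "mu \<in> locus (bcont be 1)" for mu
			using locus_bcont[OF angles(1,2) _ that] sub by auto
		have cf: "continuous_on V f" if "V \<subseteq> locus (bcont be 1)" for V
			using holomorphic_on_imp_continuous_on[OF f] continuous_on_subset that lb(1) by blast
		have fdiv: "cmod (f mu / x) \<le> C / q * cmod mu powr (si - 1)"
			if "mu \<in> locus (bcont be 1)" "0 < q" "q * cmod mu \<le> cmod x" for mu x q
		proof -
			have "cmod (f mu / x) \<le> (C * cmod mu powr si) / (q * cmod mu)"
				unfolding norm_divide using that lb(2)[OF that(1)] fC[OF lb(1)[OF that(1)]] C by (intro frac_le) auto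
			also have "... = C / q * cmod mu powr (si - 1)" using lb(2)[OF that(1)] by (simp add: powr_diff)
			finally show ?thesis .
		qed
		have arcz: "k \<le> cmod mu" if "mu \<in> locus (carc be)" for mu using locus_arc(1)[OF angles(1,2) that] by (simp add: k_def)
		obtain v where v: "0 < v" "cmod (z - of_real v) < v * sin th"
			using sector_eq_Union_sto(1)[of th z] z th ga by auto
		then have zv: "z \<in> stc (sin th) v" by (auto simp: stc_def intro!: exI[of _ v])
		have Rz: "0 < Re z" "z ~= 0" using stc_bounds[OF zv] angles by auto
		have z1: "1 \<le> cmod (1 + z)" "1 + z ~= 0" using norm_one_plus_ge(1)[of z] Rz by auto
		have div: "cmod (f mu / x) \<le> B / q" if "mu \<in> locus (bcont be 1)" "0 < q" "q \<le> cmod x" for mu x q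
			unfolding norm_divide using fb lb(1)[OF that(1)] that B by (intro frac_le) auto
		show "cmod (hop be f z) \<le> K * B"
		proof (cases "cmod z < r")
			case True
			have zs: "z \<in> sto (sin th) 1" using sector_eq_Union_sto(2)[of th z 1] z True th ga by (simp add: r_def)
			then have zb: "z \<in> sto (sin be) 1" using sto_mono[of "sin th" "sin be" 1 1] angles by auto
			have sp: "?ka * cmod mu \<le> cmod (mu - z)" "mu - z ~= 0" if mu: "mu \<in> locus (bcont be 1)" for mu
			proof -
				show "?ka * cmod mu \<le> cmod (mu - z)"
					using separated(3)[of z "sin th" 1 mu "sin be"] zs sto_subset_stc lb(4)[OF mu] angles unfolding sep_const_def by auto
				then show "mu - z ~= 0" using ka lb(2)[OF mu] by (auto simp: mult_le_0_iff)
			qed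
			let ?F = "%mu. f mu / (mu - z) + - (f mu / (mu * (1 + z)))"
			have Feq: "f mu * ker mu z = ?F mu" for mu by (simp add: ker_def algebra_simps)
			have i: "integrand_on si ((C / ?ka + C / 1) * (1 + 2 powr (2 * si))) (bcont be 1) (%mu. f mu * ker mu z)"
			proof (rule integrand_on_powrI[OF _ si(1)])
				show "continuous_on (locus (bcont be 1)) (%mu. f mu * ker mu z)"
					unfolding Feq using sp(2) lb(2) z1(2) by (intro continuous_intros cf) auto
				fix mu assume mu: "mu \<in> locus (bcont be 1)"
				have "cmod mu * 1 \<le> cmod mu * cmod (1 + z)" by (intro mult_left_mono z1(1)) auto
				then have "cmod (f mu / (mu * (1 + z))) \<le> C / 1 * cmod mu powr (si - 1)"
					by (intro fdiv[OF mu]) (auto simp: norm_mult)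
				moreover have "cmod (f mu / (mu - z)) \<le> C / ?ka * cmod mu powr (si - 1)" by (rule fdiv[OF mu ka sp(1)[OF mu]])
				moreover have "cmod (?F mu) \<le> cmod (f mu / (mu - z)) + cmod (- (f mu / (mu * (1 + z))))"
					by (rule norm_triangle_ineq)
				ultimately show "cmod mu \<le> 2 \<and> norm (f mu * ker mu z) \<le> (C / ?ka + C / 1) * cmod mu powr (si - 1)"
					unfolding Feq distrib_right norm_minus_cancel using lb(3)[OF mu] by linarith
			qed (use C ka in auto)
			have "2 * pi * \<i> * f z = cint (bcont be 1) (%mu. f mu * ker mu z)"
				by (rule cint_ker_reproduces[OF angles(1,2) _ angles(4,5) f si C fC zb, symmetric]) (use sub in auto)
			also have "... = cint (rays be) (%mu. f mu * ker mu z) + cint (carc be) (%mu. f mu * ker mu z)"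
				by (rule cint_rays_arc[OF angles(1,2) si(1) i])
			\<comment> \<open>The full contour reproduces f(z), so the segments give f(z) minus the arc, and
			  on the arc the kernel is bounded.\<close>
			finally have h: "hop be f z = f z - 1 / (2 * pi * \<i>) * cint (carc be) (%mu. f mu * ker mu z)"
				unfolding hop_def by (simp add: field_simps)
			have "cmod (cint (carc be) (%mu. f mu * ker mu z)) \<le> 5 * (3 * B / k) * ?m2"
			proof (rule norm_cint_le_of_bounded[OF contour_arc[OF angles(1,2)]])
				fix mu assume mu: "mu \<in> locus (carc be)"
				then have l: "mu \<in> locus (bcont be 1)" using locus_arc_subset by blast
				have "k * 1 \<le> cmod mu * cmod (1 + z)" using arcz[OF mu] z1(1) k by (intro mult_mono) auto
				then have b1: "cmod (f mu / (mu * (1 + z))) \<le> B / k" by (intro div[OF l k]) (simp add: norm_mult)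
				have "k / 2 \<le> cmod (mu - z)" using arcz[OF mu] True norm_triangle_ineq2[of mu z] by (simp add: r_def)
				then have b2: "cmod (f mu / (mu - z)) \<le> B / (k / 2)" using k by (intro div[OF l]) auto
				have "cmod (?F mu) \<le> cmod (f mu / (mu - z)) + cmod (- (f mu / (mu * (1 + z))))" by (rule norm_triangle_ineq)
				also have "... \<le> B / (k / 2) + B / k" unfolding norm_minus_cancel by (rule add_mono[OF b2 b1])
				also have "... = 3 * B / k" using k by (simp add: field_simps)
				finally show "cmod mu \<le> 2 \<and> norm (f mu * ker mu z) \<le> 3 * B / k" unfolding Feq using lb(3)[OF l] by blast
			qed (use B k in auto)
			then have a: "cmod (cint (carc be) (%mu. f mu * ker mu z)) / (2 * pi) \<le> 15 * ?m2 / k * B"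
				using pi1[of "cmod (cint (carc be) (%mu. f mu * ker mu z))"] by (simp add: mult_ac)
			have "cmod (hop be f z) \<le> cmod (f z) + cmod (1 / (2 * pi * \<i>) * cint (carc be) (%mu. f mu * ker mu z))"
				unfolding h by (rule norm_triangle_ineq4)
			also have "... = cmod (f z) + cmod (cint (carc be) (%mu. f mu * ker mu z)) / (2 * pi)"
				unfolding norm_mult cmod_two_pi_i by simp
			also have "... \<le> B + 15 * ?m2 / k * B"
				using a fb zb sto_subset_stc[of "sin be" 1] sub by (intro add_mono) auto
			also have "... \<le> K * B" using mult_right_mono[OF K0(2) B] by (simp add: K_def distrib_right)
			finally show ?thesis .
		next
			case False
			let ?G = "%mu. f mu / (mu - z)" and ?H = "%mu. f mu / mu"
			have lr: "mu \<in> locus (bcont be 1)" if "mu \<in> locus (rays be)" for mu using that locus_rays_subset by blast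
			have G: "integrand_on si (C / ?ka * (1 + 2 powr (2 * si))) (rays be) ?G"
			proof (rule integrand_on_powrI[OF _ si(1)])
				have "mu - z ~= 0" if "mu \<in> locus (rays be)" for mu
					using rays_separated[OF z that] by (auto simp: mult_le_0_iff)
				then show "continuous_on (locus (rays be)) ?G" by (intro continuous_intros cf locus_rays_subset) auto
				show "cmod mu \<le> 2 \<and> norm (f mu / (mu - z)) \<le> C / ?ka * cmod mu powr (si - 1)" if "mu \<in> locus (rays be)" for mu
					using fdiv[OF lr[OF that] ka rays_separated(3)[OF z that]] lb(3)[OF lr[OF that]] by simp
			qed (use C ka in auto)
			have H: "integrand_on si (C / 1 * (1 + 2 powr (2 * si))) (bcont be 1) ?H"
			proof (rule integrand_on_powrI[OF _ si(1)])
				show "continuous_on (locus (bcont be 1)) ?H" using lb(2) by (intro continuous_intros cf) auto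
				show "cmod mu \<le> 2 \<and> norm (f mu / mu) \<le> C / 1 * cmod mu powr (si - 1)" if "mu \<in> locus (bcont be 1)" for mu
					using fdiv[OF that, of 1] lb(3)[OF that] by simp
			qed (use C in auto)
			\<comment> \<open>The quotient f(mu) / mu is holomorphic inside and integrable at the vertex.
			  Hence its integral over the segments, for which B alone gives no bound, is minus the one over
			  the arc.\<close>
			have "cint (bcont be 1) ?H = 0"
			proof (rule cint_bcont_eq_0[OF angles(1,2) _ angles(4) _ si C])
				show "?H holomorphic_on sto (sin ga) 1"
					using f stc_bounds(2)[of _ "sin ga" 1] sto_subset_stc[of "sin ga" 1] angles
					by (intro holomorphic_intros) auto
				fix mu assume mu: "mu \<in> stc (sin be) 1"
				then have "mu ~= 0" using stc_bounds(2)[of mu "sin be" 1] angles by auto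
				then show "cmod (f mu / mu) \<le> C * cmod mu powr (si - 1)"
					using fC[of mu] mu sub by (auto simp: norm_divide powr_diff divide_right_mono)
			qed simp
			then have rH: "cint (rays be) ?H = - cint (carc be) ?H"
				using cint_rays_arc[OF angles(1,2) si(1) H] by (simp add: eq_neg_iff_add_eq_0)
			note Hr = integrand_on_subset[OF H locus_rays_subset]
			let ?a = "- (1 / (1 + z))"
			have "cint (rays be) (%mu. f mu * ker mu z) = cint (rays be) (%mu. ?G mu + ?a *\<^sub>C ?H mu)"
				by (rule cint_cong) (simp add: ker_def algebra_simps)
			also have "... = cint (rays be) ?G + cint (rays be) (%mu. ?a *\<^sub>C ?H mu)"
				by (rule cint_add[OF contour_rays[OF angles(1,2)] si(1) G integrand_on_linear[OF Hr bounded_linear_scaleC]])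
			also have "cint (rays be) (%mu. ?a *\<^sub>C ?H mu) = ?a *\<^sub>C cint (rays be) ?H"
				by (rule cint_scaleC[OF contour_rays[OF angles(1,2)] si(1) Hr])
			finally have e: "cint (rays be) (%mu. f mu * ker mu z) = cint (rays be) ?G + 1 / (1 + z) * cint (carc be) ?H"
				unfolding rH by simp
			have "cmod (cint (rays be) ?G) \<le> 5 * (B / (?ka * r)) * ?m1"
			proof (rule norm_cint_le_of_bounded[OF contour_rays[OF angles(1,2)]])
				fix mu assume mu: "mu \<in> locus (rays be)"
				have "?ka * r \<le> ?ka * cmod z" using False ka by (intro mult_left_mono) auto
				then have "?ka * r \<le> cmod (mu - z)" using rays_separated(2)[OF z mu] by linarith
				then show "cmod mu \<le> 2 \<and> norm (f mu / (mu - z)) \<le> B / (?ka * r)"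
					using div[OF lr[OF mu]] lb(3)[OF lr[OF mu]] ka r by simp
			qed (use B ka r in auto)
			moreover have "cmod (cint (carc be) ?H) \<le> 5 * (B / k) * ?m2"
			proof (rule norm_cint_le_of_bounded[OF contour_arc[OF angles(1,2)]])
				fix mu assume mu: "mu \<in> locus (carc be)"
				then have l: "mu \<in> locus (bcont be 1)" using locus_arc_subset by blast
				show "cmod mu \<le> 2 \<and> norm (f mu / mu) \<le> B / k" using div[OF l k arcz[OF mu]] lb(3)[OF l] by simp
			qed (use B k in auto)
			moreover have "cmod (1 / (1 + z) * cint (carc be) ?H) \<le> 1 * cmod (cint (carc be) ?H)"
				unfolding norm_mult using z1 by (intro mult_right_mono) (auto simp: norm_divide)
			moreover have "cmod (cint (rays be) ?G + 1 / (1 + z) * cint (carc be) ?H)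
					\<le> cmod (cint (rays be) ?G) + cmod (1 / (1 + z) * cint (carc be) ?H)" by (rule norm_triangle_ineq)
			ultimately have "cmod (cint (rays be) (%mu. f mu * ker mu z)) \<le> (5 * ?m1 / (?ka * r) + 5 * ?m2 / k) * B"
				unfolding e by (simp add: algebra_simps)
			also have "... \<le> K * B" using K0 B by (intro mult_right_mono) (auto simp: K_def)
			finally have "cmod (cint (rays be) (%mu. f mu * ker mu z)) \<le> K * B" .
			then show ?thesis using pi1[of "cmod (cint (rays be) (%mu. f mu * ker mu z))"]
				unfolding hop_def norm_mult cmod_two_pi_i by simp
		qed
	qed
qed

text \<open>The segment part of the Stolz calculus is the sectorial calculus applied to
  \<open>hop be f\<close>. The sector boundary is first replaced by a bounded Stolz contour, over
  which the exchange of integrations is available.\<close>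

lemma cint_rays_qop:
	fixes A :: "'a::complex_banach \<Rightarrow>\<^sub>L 'a"
	assumes A: "complex_linear A" and nu: "0 < nu" "nu < th"
		and rh0: "0 < rh0" and reg: "\<And>rh. rh \<ge> rh0 ==> reg A (sin nu) rh M"
		and f: "continuous_on (locus (rays be)) f" and s: "0 < s" and C: "0 \<le> C"
		and le: "\<And>mu. mu \<in> locus (rays be) ==> cmod (f mu) \<le> C * W s mu"
	shows "cint (rays be) (%mu. f mu *\<^sub>C qop A mu) = cint (scont nu) (%z. hop be f z *\<^sub>C res A z)"
proof -
	define ta where "ta = min s 1 / 2"
	have ta: "0 < ta" using s by (simp add: ta_def)
	have nu2: "nu < pi / 2" "nu < be" "sin nu < sin be" using nu th ga by (auto intro!: sin_monotone_2pi)
	define D where "D = hop_const ta * mass ta (rays be)"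
	have hd: "cmod (hop be f z) \<le> (D * C) * W ta z" if "z \<in> sector th" for z
		unfolding D_def by (rule hop_decay[OF s ta_def f C le that])
	have hh: "hop be f holomorphic_on sector th" by (rule holomorphic_on_hop[OF s f C le])
	have DC: "0 \<le> D * C" using C hop_const_nonneg mass_nonneg by (simp add: D_def)
	have "cint (scont nu) (%z. hop be f z *\<^sub>C res A z) = cint (bcont nu rh0) (%z. hop be f z *\<^sub>C res A z)"
		by (rule cint_scont[OF A nu _ rh0 reg nu rh0 reg[OF order_refl] hh ta DC hd]) (use th ga in auto)
	moreover have "(2 * pi * \<i>) *\<^sub>C cint (bcont nu rh0) (%z. hop be f z *\<^sub>C res A z)
			= cint (bcont nu rh0) (%z. (2 * pi * \<i>) *\<^sub>C (hop be f z *\<^sub>C res A z))"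
	proof (rule cint_scaleC[symmetric, OF contour_bcont[OF nu(1) nu2(1) rh0] ta integrand_on_kern[OF kern_bcont_res[OF nu(1) nu2(1) rh0 reg[OF order_refl]]]])
		have l: "locus (bcont nu rh0) \<subseteq> sector th"
			using bcont_locus_sector[OF nu _ rh0 order_refl] sto_subset_sector[of th rh0] th ga by auto
		then show "continuous_on (locus (bcont nu rh0)) (hop be f)"
			by (rule continuous_on_subset[OF holomorphic_on_imp_continuous_on[OF hh]])
		show "cmod (hop be f z) \<le> (D * C) * W ta z" if "z \<in> locus (bcont nu rh0)" for z using hd l that by blast
	qed
	moreover have "... = cint (bcont nu rh0) (%z. cint (rays be) (%mu. f mu * ker mu z) *\<^sub>C res A z)"
		by (simp add: hop_def scaleC_scaleC)
	moreover have "... = (2 * pi * \<i>) *\<^sub>C cint (rays be) (%mu. f mu *\<^sub>C qop A mu)"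
	proof (rule cint_exchange[OF A nu(1) nu2(1) rh0 reg[OF order_refl] nu2(3) _ contour_rays[OF angles(1,2)] _ _ f _ _ _ C])
		show "cmod (f mu) \<le> C * cmod mu powr min s 1" if "mu \<in> locus (rays be)" for mu
		proof -
			have "W s mu \<le> cmod mu powr min s 1" using W_antimono[of "min s 1" s mu] W_le_powr[of mu "min s 1"] s by auto
			then show ?thesis using le[OF that] C mult_left_mono order_trans by blast
		qed
		show "locus (rays be) \<inter> sto (sin be) rh0 = {}" using locus_rays(1)[OF angles(1,2)] by blast
		show "cmod mu \<le> 2" if "mu \<in> locus (rays be)" for mu using locus_rays(3)[OF angles(1,2) that] .
	qed (use s in auto)
	ultimately have "(2 * pi * \<i>) *\<^sub>C cint (rays be) (%mu. f mu *\<^sub>C qop A mu)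
			= (2 * pi * \<i>) *\<^sub>C cint (scont nu) (%z. hop be f z *\<^sub>C res A z)" by simp
	then have "(1 / (2 * pi * \<i>)) *\<^sub>C (2 * pi * \<i>) *\<^sub>C cint (rays be) (%mu. f mu *\<^sub>C qop A mu)
			= (1 / (2 * pi * \<i>)) *\<^sub>C (2 * pi * \<i>) *\<^sub>C cint (scont nu) (%z. hop be f z *\<^sub>C res A z)" by (rule arg_cong)
	then show ?thesis by (simp add: scaleC_scaleC)
qed

end

section \<open>Functional calculi over products of contours\<close>

type_synonym 'a kernel = "contour \<times> (complex => ('a \<Rightarrow>\<^sub>L 'a))"

primrec kprod :: "(complex => ('a::complex_banach \<Rightarrow>\<^sub>L 'a)) list => complex list => ('a \<Rightarrow>\<^sub>L 'a)" where
	"kprod [] zs = id_blinfun"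
| "kprod (K # Ks) zs = K (hd zs) o\<^sub>L kprod Ks (tl zs)"

text \<open>Each variable carries its own contour and its own operator kernel, so that sectorial and
  Stolz variables can be mixed. The normalizing power of 1 / (2 pi i) is left out.\<close>

definition calc :: "'a::complex_banach kernel list => (complex list => complex) => ('a \<Rightarrow>\<^sub>L 'a)" where
	"calc vs f = iter (map fst vs) (%zs. f zs *\<^sub>C kprod (map snd vs) zs)"

abbreviation Ws :: "real => complex list => real" where
	"Ws s zs \<equiv> prod_list (map (W s) zs)"

definition fits :: "complex set => 'a::complex_banach kernel => bool" where
	"fits D v \<longleftrightarrow> open D \<and> locus (fst v) \<subseteq> D \<and> (\<exists>M. kern M (fst v) (snd v))"

text \<open>The decay of the class of the sector is used on every kind of domain. On Stolz domains,
  which are bounded, it is equivalent to decay by a power at the vertex.\<close>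

definition decays :: "real => real => complex set list => (complex list => complex) => bool" where
	"decays s C Ds f \<longleftrightarrow> sep_holo f Ds \<and> 0 < s \<and> 0 \<le> C \<and> (\<forall>zs\<in>listset Ds. cmod (f zs) \<le> C * Ws s zs)"

lemma Ws_nonneg: "0 \<le> Ws s zs" by (induction zs) (auto simp: wt_nonneg)

lemma Ws_le_1: "Ws s zs \<le> 1"
	by (induction zs) (auto intro!: mult_le_one W_le_1 Ws_nonneg simp: wt_nonneg simp del: prod_list.Cons
			simp: prod_list.Cons)

lemma Ws_antimono: "0 < s' ==> s' \<le> s ==> Ws s zs \<le> Ws s' zs"
	by (induction zs) (auto intro!: mult_mono[OF W_antimono] Ws_nonneg simp: wt_nonneg)

lemma Ws_mid: "Ws s (xs @ z # ys) = Ws s xs * Ws s ys * W s z" by simp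

lemma Ws_le_nth:
	assumes "k < length zs" shows "Ws s zs \<le> W s (zs ! k)"
proof -
	have "Ws s zs = Ws s (take k zs) * Ws s (drop (Suc k) zs) * W s (zs ! k)"
		using Ws_mid[of s "take k zs" "zs ! k" "drop (Suc k) zs"] id_take_nth_drop[OF assms] by simp
	also have "... \<le> 1 * 1 * W s (zs ! k)" by (intro mult_right_mono mult_mono Ws_le_1 Ws_nonneg W_nonneg) auto
	finally show ?thesis by simp
qed

lemma list_lim_Cons_iff:
	assumes "list_lim X (z # zs)"
	shows "(%n. hd (X n)) \<longlonglongrightarrow> z" "list_lim (%n. tl (X n)) zs"
proof -
	have l: "length (X n) = Suc (length zs)" for n using assms by (simp add: list_lim_def)
	have t: "tl (X n) ! i = X n ! Suc i" if "i < length zs" for n i using l[of n] that by (simp add: nth_tl)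
	have "hd (X n) = X n ! 0" for n using l[of n] by (intro hd_conv_nth) auto
	moreover have "(%n. X n ! 0) \<longlonglongrightarrow> (z # zs) ! 0" using assms unfolding list_lim_def by blast
	ultimately show "(%n. hd (X n)) \<longlonglongrightarrow> z" by simp
	have "(%n. X n ! Suc i) \<longlonglongrightarrow> zs ! i" if "i < length zs" for i using assms that unfolding list_lim_def by force
	then show "list_lim (%n. tl (X n)) zs" using l t by (simp add: list_lim_def)
qed

lemma kprod_append:
	"length xs = length Ks1 ==> kprod (Ks1 @ Ks2) (xs @ ys) = kprod Ks1 xs o\<^sub>L kprod Ks2 ys"
proof (induction Ks1 arbitrary: xs)
	case (Cons K Ks1)
	then show ?case by (cases xs) (auto simp: compose_assoc)
qed simp

lemma kprod_bound:
	assumes "\<forall>v\<in>set vs. \<exists>M. kern M (fst v) (snd v)"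
	shows "\<exists>M\<ge>0. seqcont (loci (map fst vs)) (kprod (map snd vs)) \<and>
		(\<forall>zs\<in>loci (map fst vs). complex_linear (kprod (map snd vs) zs) \<and>
			 norm (kprod (map snd vs) zs) \<le> M * prod_list (map (%z. 1 / cmod z) zs))" using assms
proof (induction vs)
	case Nil
	show ?case by (intro exI[of _ 1]) (auto simp: seqcont_def norm_id_blinfun_le)
next
	case (Cons v vs)
	obtain c K where v: "v = (c, K)" by (cases v)
	obtain M where M: "kern M c K" using Cons.prems v by auto
	then have M0: "0 \<le> M" by (simp add: kern_def)
	obtain N where N: "0 \<le> N" "seqcont (loci (map fst vs)) (kprod (map snd vs))"
		"\<And>zs. zs \<in> loci (map fst vs) ==> complex_linear (kprod (map snd vs) zs) \<and>
			 norm (kprod (map snd vs) zs) \<le> N * prod_list (map (%z. 1 / cmod z) zs)" using Cons by auto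
	have "seqcont (loci (map fst (v # vs))) (kprod (map snd (v # vs)))" unfolding seqcont_def
	proof (intro allI impI)
		fix X zs assume X: "\<forall>n. X n \<in> loci (map fst (v # vs))" "zs \<in> loci (map fst (v # vs))" "list_lim X zs"
		obtain z zs' where zs: "zs = z # zs'" "z \<in> locus c" "zs' \<in> loci (map fst vs)"
			using X(2) v by (auto elim: listset_ConsE)
		have Xn: "hd (X n) \<in> locus c" "tl (X n) \<in> loci (map fst vs)" for n
			using X(1)[rule_format, of n] v by (auto elim!: listset_ConsE)
		note l = list_lim_Cons_iff[OF X(3)[unfolded zs(1)]]
		have "(%n. K (hd (X n))) \<longlonglongrightarrow> K z"
			using M Xn(1) by (intro continuous_on_tendsto_compose[OF _ l(1) zs(2)]) (auto simp: kern_def)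
		moreover have "(%n. kprod (map snd vs) (tl (X n))) \<longlonglongrightarrow> kprod (map snd vs) zs'"
			by (rule seqcontD[OF N(2) Xn(2) zs(3) l(2)])
		ultimately show "(%n. kprod (map snd (v # vs)) (X n)) \<longlonglongrightarrow> kprod (map snd (v # vs)) zs"
			by (simp add: v zs(1) tendsto_compose_blinfun)
	qed
	moreover have "complex_linear (kprod (map snd (v # vs)) zs) \<and>
			norm (kprod (map snd (v # vs)) zs) \<le> M * N * prod_list (map (%z. 1 / cmod z) zs)"
		if "zs \<in> loci (map fst (v # vs))" for zs
	proof -
		have "zs \<in> listset (locus c # map locus (map fst vs))" using that v by simp
		then obtain z zs' where zs: "zs = z # zs'" "z \<in> locus c" "zs' \<in> loci (map fst vs)" by (rule listset_ConsE)
		have K: "complex_linear (K z)" "norm (K z) \<le> M / cmod z" using M zs(2) by (auto simp: kern_def)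
		show ?thesis using compose_bound[OF K(2) conjunct2[OF N(3)[OF zs(3)]]] N(3)[OF zs(3)] K(1)
			by (simp add: v zs(1) complex_linear_compose mult_ac)
	qed
	moreover have "0 \<le> M * N" using M0 N(1) by simp
	ultimately show ?case by (intro exI[of _ "M * N"] conjI ballI) blast+
qed

lemma fits_loci_subset:
	assumes "list_all2 fits Ds vs" shows "loci (map fst vs) \<subseteq> listset Ds"
proof (rule listset_mono)
	show "list_all2 (\<subseteq>) (map locus (map fst vs)) Ds" using assms by (simp add: list_all2_conv_all_nth fits_def)
qed

lemma fits_set:
	assumes "list_all2 fits Ds vs"
	shows "\<forall>v\<in>set vs. \<exists>M. kern M (fst v) (snd v)" "\<forall>c\<in>set (map fst vs). contour c" "\<forall>D\<in>set Ds. open D"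
proof -
	have *: "fits (Ds ! i) (vs ! i)" if "i < length vs" for i
		using assms that by (simp add: list_all2_conv_all_nth)
	then show k: "\<forall>v\<in>set vs. \<exists>M. kern M (fst v) (snd v)" by (metis in_set_conv_nth fits_def)
	then show "\<forall>c\<in>set (map fst vs). contour c" by (auto simp: kern_def)
	show "\<forall>D\<in>set Ds. open D" using * assms by (auto simp: in_set_conv_nth fits_def list_all2_lengthD)
qed

lemma seqcont_subset: "seqcont S F ==> S' \<subseteq> S ==> seqcont S' F" unfolding seqcont_def by blast

lemma integrand_calc:
	assumes fits: "list_all2 fits Ds vs" and f: "decays s C Ds f"
	shows "\<exists>C'\<ge>0. integrand s C' (map fst vs) (%zs. f zs *\<^sub>C kprod (map snd vs) zs)"
proof -
	obtain M where M: "0 \<le> M" "seqcont (loci (map fst vs)) (kprod (map snd vs))"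
		"\<And>zs. zs \<in> loci (map fst vs) ==> norm (kprod (map snd vs) zs) \<le> M * prod_list (map (%z. 1 / cmod z) zs)"
		using kprod_bound[OF fits_set(1)[OF fits]] by auto
	have C: "0 \<le> C" and fC: "\<And>zs. zs \<in> listset Ds ==> cmod (f zs) \<le> C * Ws s zs"
		and sf: "sep_holo f Ds" using f by (auto simp: decays_def)
	have "cmod (f zs) \<le> C" if "zs \<in> listset Ds" for zs
		using fC[OF that] mult_left_mono[OF Ws_le_1 C, of s zs] by simp
	then have "seqcont (listset Ds) f" by (rule seqcont_of_sep_holo[OF fits_set(3)[OF fits] sf])
	then have sc: "seqcont (loci (map fst vs)) f" using seqcont_subset fits_loci_subset[OF fits] by blast
	have "integrand s (C * M) (map fst vs) (%zs. f zs *\<^sub>C kprod (map snd vs) zs)" unfolding integrand_def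
	proof (intro conjI ballI)
		show "seqcont (loci (map fst vs)) (%zs. f zs *\<^sub>C kprod (map snd vs) zs)"
			using sc M(2) unfolding seqcont_def by (auto intro!: tendsto_scaleC)
		fix zs assume zs: "zs \<in> loci (map fst vs)"
		have "0 \<notin> set zs" by (rule zero_notin_loci[OF fits_set(2)[OF fits] zs])
		then have e: "Ws s zs * prod_list (map (%z. 1 / cmod z) zs) = wts s zs"
			by (induction zs) (auto simp: field_simps)
		have "norm (f zs *\<^sub>C kprod (map snd vs) zs)
				\<le> (C * Ws s zs) * (M * prod_list (map (%z. 1 / cmod z) zs))"
			unfolding norm_scaleC using fC zs fits_loci_subset[OF fits] M(3)[OF zs] C Ws_nonneg
			by (intro mult_mono) auto
		also have "... = C * M * (Ws s zs * prod_list (map (%z. 1 / cmod z) zs))" by (simp only: mult_ac)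
		finally show "norm (f zs *\<^sub>C kprod (map snd vs) zs) \<le> C * M * wts s zs" unfolding e .
	qed
	then show ?thesis using C M(1) by (intro exI[of _ "C * M"]) auto
qed

lemma decays_slice:
	assumes f: "decays s C (Ds1 @ D # Ds2) f" and xs: "xs \<in> listset Ds1" and ys: "ys \<in> listset Ds2"
	shows "(%z. f (xs @ z # ys)) holomorphic_on D"
		and "\<And>z. z \<in> D ==> cmod (f (xs @ z # ys)) \<le> (C * Ws s xs * Ws s ys) * W s z" and "0 \<le> C * Ws s xs * Ws s ys"
proof -
	show "(%z. f (xs @ z # ys)) holomorphic_on D" using f sep_holo_slice[OF _ xs ys] by (simp add: decays_def)
	show "cmod (f (xs @ z # ys)) \<le> (C * Ws s xs * Ws s ys) * W s z" if "z \<in> D" for z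
	proof -
		have "xs @ z # ys \<in> listset (Ds1 @ D # Ds2)" using xs ys that by (intro append_in_listset) auto
		then have "cmod (f (xs @ z # ys)) \<le> C * Ws s (xs @ z # ys)" using f unfolding decays_def by blast
		then show ?thesis by (simp only: Ws_mid mult.assoc)
	qed
	show "0 \<le> C * Ws s xs * Ws s ys" using f Ws_nonneg by (simp add: decays_def)
qed

lemma fits_mid:
	assumes "list_all2 fits (Ds1 @ D # Ds2) (vs1 @ v # vs2)" "length Ds1 = length vs1"
	shows "list_all2 fits Ds1 vs1" "fits D v" "list_all2 fits Ds2 vs2"
	using assms by (auto simp: list_all2_append)

text \<open>The factors to the left and to the right do not depend on the variable z and leave the
  integral, the left one by complex linearity. Equalities of one-variable integrals can then be used
  in the middle of a product.\<close>

lemma cint_slice: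
	assumes fits: "list_all2 fits (Ds1 @ D # Ds2) (vs1 @ (c, K) # vs2)" "length Ds1 = length vs1"
		and f: "decays s C (Ds1 @ D # Ds2) f" and xs: "xs \<in> loci (map fst vs1)" and ys: "ys \<in> loci (map fst vs2)"
	shows "cint c (%z. f (xs @ z # ys) *\<^sub>C kprod (map snd (vs1 @ (c, K) # vs2)) (xs @ z # ys))
		= kprod (map snd vs1) xs o\<^sub>L (cint c (%z. f (xs @ z # ys) *\<^sub>C K z) o\<^sub>L kprod (map snd vs2) ys)"
proof -
	note fm = fits_mid[OF fits]
	let ?P = "kprod (map snd vs1) xs" and ?Q = "kprod (map snd vs2) ys"
	have len: "length xs = length (map snd vs1)" using length_listset[OF xs] by simp
	have P: "complex_linear ?P" using kprod_bound[OF fits_set(1)[OF fm(1)]] xs by auto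
	have xs': "xs \<in> listset Ds1" and ys': "ys \<in> listset Ds2"
		using xs ys fits_loci_subset[OF fm(1)] fits_loci_subset[OF fm(3)] by auto
	note sl = decays_slice[OF f xs' ys']
	have s: "0 < s" using f by (simp add: decays_def)
	obtain M where M: "kern M c K" and lc: "locus c \<subseteq> D" using fm(2) by (auto simp: fits_def)
	have cc: "contour c" using M by (simp add: kern_def)
	have i: "integrand_on s (C * Ws s xs * Ws s ys * M) c (%z. f (xs @ z # ys) *\<^sub>C K z)"
		using lc by (intro integrand_on_kern[OF M] sl(2) continuous_on_subset[OF holomorphic_on_imp_continuous_on[OF sl(1)]]) auto
	have "cint c (%z. f (xs @ z # ys) *\<^sub>C kprod (map snd (vs1 @ (c, K) # vs2)) (xs @ z # ys))
		= cint c (%z. ?P o\<^sub>L ((f (xs @ z # ys) *\<^sub>C K z) o\<^sub>L ?Q))"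
		using kprod_append[OF len, of "K # map snd vs2" "_ # ys"] P
		by (simp add: compose_scaleC_left compose_scaleC_right)
	also have "... = ?P o\<^sub>L cint c (%z. (f (xs @ z # ys) *\<^sub>C K z) o\<^sub>L ?Q)"
		by (rule cint_compose_left[OF cc s integrand_on_linear[OF i bounded_linear_compose_right] P])
	also have "cint c (%z. (f (xs @ z # ys) *\<^sub>C K z) o\<^sub>L ?Q) = cint c (%z. f (xs @ z # ys) *\<^sub>C K z) o\<^sub>L ?Q"
		by (rule cint_compose_right[OF cc s i])
	finally show ?thesis .
qed

lemma calc_replace_at:
	assumes fits: "list_all2 fits (Ds1 @ D # Ds2) (vs1 @ (c, K) # vs2)"
			"list_all2 fits (Ds1 @ D' # Ds2) (vs1 @ (c', K') # vs2)" and len: "length Ds1 = length vs1"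
		and f: "decays s C (Ds1 @ D # Ds2) f" and g: "decays s' C' (Ds1 @ D' # Ds2) g"
		and eq: "\<And>xs ys. xs \<in> listset Ds1 ==> ys \<in> listset Ds2 ==>
			cint c (%z. f (xs @ z # ys) *\<^sub>C K z) = cint c' (%z. g (xs @ z # ys) *\<^sub>C K' z)"
	shows "calc (vs1 @ (c, K) # vs2) f = calc (vs1 @ (c', K') # vs2) g"
proof -
	obtain B where B: "integrand s B (map fst (vs1 @ (c, K) # vs2)) (%zs. f zs *\<^sub>C kprod (map snd (vs1 @ (c, K) # vs2)) zs)"
		using integrand_calc[OF fits(1) f] by blast
	obtain B' where B': "integrand s' B' (map fst (vs1 @ (c', K') # vs2)) (%zs. g zs *\<^sub>C kprod (map snd (vs1 @ (c', K') # vs2)) zs)"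
		using integrand_calc[OF fits(2) g] by blast
	have s: "0 < s" "0 < s'" using f g by (auto simp: decays_def)
	note fm = fits_mid[OF fits(1) len]
	have "iter (map fst vs1 @ c # map fst vs2) (%zs. f zs *\<^sub>C kprod (map snd (vs1 @ (c, K) # vs2)) zs)
		= iter (map fst vs1 @ c' # map fst vs2) (%zs. g zs *\<^sub>C kprod (map snd (vs1 @ (c', K') # vs2)) zs)"
	proof (rule iter_replace_at[OF _ _ s])
		show "\<forall>d\<in>set (map fst vs1 @ c # map fst vs2). contour d" "contour c'"
			using fits_set(2)[OF fits(1)] fits_set(2)[OF fits(2)] by auto
		show "integrand s B (map fst vs1 @ c # map fst vs2) (%zs. f zs *\<^sub>C kprod (map snd (vs1 @ (c, K) # vs2)) zs)"
			using B by simp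
		show "integrand s' B' (map fst vs1 @ c' # map fst vs2) (%zs. g zs *\<^sub>C kprod (map snd (vs1 @ (c', K') # vs2)) zs)"
			using B' by simp
		fix xs ys assume xs: "xs \<in> loci (map fst vs1)" and ys: "ys \<in> loci (map fst vs2)"
		show "cint c (%z. f (xs @ z # ys) *\<^sub>C kprod (map snd (vs1 @ (c, K) # vs2)) (xs @ z # ys))
			= cint c' (%z. g (xs @ z # ys) *\<^sub>C kprod (map snd (vs1 @ (c', K') # vs2)) (xs @ z # ys))"
			unfolding cint_slice[OF fits(1) len f xs ys] cint_slice[OF fits(2) len g xs ys]
			using eq[of xs ys] xs ys fits_loci_subset[OF fm(1)] fits_loci_subset[OF fm(3)] by (simp add: subset_iff)
	qed
	then show ?thesis by (simp add: calc_def)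
qed

section \<open>Exchanging and splitting the kernels of a product calculus\<close>

definition interchangeable :: "complex set => 'a::complex_banach kernel => 'a kernel => bool" where
	"interchangeable D v v' \<longleftrightarrow> (\<forall>h s C. h holomorphic_on D --> 0 < s --> 0 \<le> C --> (\<forall>z\<in>D. cmod (h z) \<le> C * W s z) -->
		 cint (fst v) (%z. h z *\<^sub>C snd v z) = cint (fst v') (%z. h z *\<^sub>C snd v' z))"

text \<open>The prefix \<open>us\<close> takes up the kernels already exchanged, and each induction
  step moves one variable from \<open>ts\<close> to it.\<close>

lemma calc_interchange_suffix:
	assumes "\<forall>(D, v, v')\<in>set ts. fits D v \<and> fits D v' \<and> interchangeable D v v'"
		and "list_all2 fits Ds us" and "decays s C (Ds @ map fst ts) f"
	shows "calc (us @ map (fst \<circ> snd) ts) f = calc (us @ map (snd \<circ> snd) ts) f" using assms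
proof (induction ts arbitrary: us Ds)
	case (Cons t ts)
	obtain D c K v' where t: "t = (D, (c, K), v')" by (metis prod_cases3 surj_pair)
	have tt: "fits D (c, K)" "fits D v'" "interchangeable D (c, K) v'" using Cons.prems(1) t by auto
	have ft: "list_all2 fits (map fst ts) (map (fst \<circ> snd) ts)"
		using Cons.prems(1) by (auto simp: list_all2_map1 list_all2_map2 intro!: list.rel_refl_strong)
	have len: "length Ds = length us" using Cons.prems(2) by (rule list_all2_lengthD)
	have d: "decays s C (Ds @ D # map fst ts) f" using Cons.prems(3) t by simp
	have "calc (us @ (c, K) # map (fst \<circ> snd) ts) f = calc (us @ (fst v', snd v') # map (fst \<circ> snd) ts) f"
	proof (rule calc_replace_at[OF _ _ len d d])
		show "list_all2 fits (Ds @ D # map fst ts) (us @ (c, K) # map (fst \<circ> snd) ts)"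
			"list_all2 fits (Ds @ D # map fst ts) (us @ (fst v', snd v') # map (fst \<circ> snd) ts)"
			using Cons.prems(2) ft tt by (auto intro!: list_all2_appendI)
		fix xs ys assume xs: "xs \<in> listset Ds" and ys: "ys \<in> listset (map fst ts)"
		have "0 < s" using d by (simp add: decays_def)
		then show "cint c (%z. f (xs @ z # ys) *\<^sub>C K z) = cint (fst v') (%z. f (xs @ z # ys) *\<^sub>C snd v' z)"
			using tt(3)[unfolded interchangeable_def, rule_format, OF decays_slice(1)[OF d xs ys] _ decays_slice(3)[OF d xs ys] decays_slice(2)[OF d xs ys]]
			by simp
	qed
	also have "... = calc ((us @ [v']) @ map (fst \<circ> snd) ts) f" by simp
	also have "... = calc ((us @ [v']) @ map (snd \<circ> snd) ts) f"
		using Cons.prems tt(2) t by (intro Cons.IH[of "Ds @ [D]"]) (auto intro!: list_all2_appendI)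
	finally have e: "calc (us @ (c, K) # map (fst \<circ> snd) ts) f = calc (us @ v' # map (snd \<circ> snd) ts) f" by simp
	have "map (fst \<circ> snd) (t # ts) = (c, K) # map (fst \<circ> snd) ts"
		"map (snd \<circ> snd) (t # ts) = v' # map (snd \<circ> snd) ts" by (simp_all add: t)
	then show ?case using e by (simp only:)
qed simp

lemma calc_interchange:
	assumes "\<forall>(D, v, v')\<in>set ts. fits D v \<and> fits D v' \<and> interchangeable D v v'" and "decays s C (map fst ts) f"
	shows "calc (map (fst \<circ> snd) ts) f = calc (map (snd \<circ> snd) ts) f"
	using calc_interchange_suffix[OF assms(1), of "[]" "[]"] assms(2) by simp

lemma calc_rays_arc:
	assumes be: "0 < be" "be < pi / 2" and fits: "list_all2 fits (Ds1 @ D # Ds2) (vs1 @ (bcont be 1, K) # vs2)"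
		and f: "decays s C (Ds1 @ D # Ds2) f"
	shows "calc (vs1 @ (bcont be 1, K) # vs2) f = calc (vs1 @ (rays be, K) # vs2) f + calc (vs1 @ (carc be, K) # vs2) f"
proof -
	obtain B where B: "integrand s B (map fst (vs1 @ (bcont be 1, K) # vs2)) (%zs. f zs *\<^sub>C kprod (map snd (vs1 @ (bcont be 1, K) # vs2)) zs)"
		using integrand_calc[OF fits f] by blast
	have s: "0 < s" using f by (auto simp: decays_def)
	let ?F = "%zs. f zs *\<^sub>C kprod (map snd (vs1 @ (bcont be 1, K) # vs2)) zs"
	have "iter (map fst vs1 @ bcont be 1 # map fst vs2) ?F
		= iter (map fst vs1 @ rays be # map fst vs2) ?F + iter (map fst vs1 @ carc be # map fst vs2) ?F"
	proof (rule iter_split_at[OF _ contour_rays[OF be] contour_arc[OF be] s _ locus_rays_subset locus_arc_subset cint_rays_arc[OF be s]])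
		show "\<forall>d\<in>set (map fst vs1 @ bcont be 1 # map fst vs2). contour d" using fits_set(2)[OF fits] by simp
		show "integrand s B (map fst vs1 @ bcont be 1 # map fst vs2) ?F" using B by simp
	qed
	then show ?thesis by (simp add: calc_def)
qed

lemma kprod_commute:
	assumes "\<And>v z. v \<in> set vs ==> z \<in> locus (fst v) ==> snd v z o\<^sub>L U = U o\<^sub>L snd v z" and "zs \<in> loci (map fst vs)"
	shows "kprod (map snd vs) zs o\<^sub>L U = U o\<^sub>L kprod (map snd vs) zs" using assms
proof (induction vs arbitrary: zs)
	case (Cons v vs)
	obtain z zs' where zs: "zs = z # zs'" "z \<in> locus (fst v)" "zs' \<in> loci (map fst vs)"
		using Cons.prems(2) by (auto elim: listset_ConsE)
	have "kprod (map snd vs) zs' o\<^sub>L U = U o\<^sub>L kprod (map snd vs) zs'"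
		using Cons.prems(1) zs(3) by (intro Cons.IH) auto
	moreover have "snd v z o\<^sub>L U = U o\<^sub>L snd v z" using Cons.prems(1) zs(2) by simp
	ultimately show ?case unfolding zs(1) by (simp add: compose_assoc) (simp flip: compose_assoc)
qed simp

text \<open>Freezing a variable keeps the constant, because its own decay factor is at most
  1.\<close>

lemma decays_insert:
	assumes f: "decays s C (Ds1 @ D # Ds2) f" and mu: "mu \<in> D"
	shows "decays s C (Ds1 @ Ds2) (%zs. f (take (length Ds1) zs @ mu # drop (length Ds1) zs))"
proof -
	let ?g = "%zs. f (take (length Ds1) zs @ mu # drop (length Ds1) zs)"
	have g: "?g (xs @ ys) = f (xs @ mu # ys)" if "length xs = length Ds1" for xs ys using that by simp
	have sf: "sep_holo f (Ds1 @ D # Ds2)" and C: "0 \<le> C" using f by (auto simp: decays_def)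
	have "sep_holo ?g (Ds1 @ Ds2)" unfolding sep_holo_def
	proof (intro allI impI)
		fix As E Bs xs ys assume e: "Ds1 @ Ds2 = As @ E # Bs" and xs: "xs \<in> listset As" and ys: "ys \<in> listset Bs"
		have "(\<exists>us. Ds1 = As @ E # us \<and> Bs = us @ Ds2) \<or> (\<exists>us. As = Ds1 @ us \<and> Ds2 = us @ E # Bs)"
			using e unfolding append_eq_append_conv2 Cons_eq_append_conv append_eq_Cons_conv by auto
		then show "(%z. ?g (xs @ z # ys)) holomorphic_on E"
		proof (elim disjE exE conjE)
			fix us assume u: "Ds1 = As @ E # us" "Bs = us @ Ds2"
			then obtain y1 y2 where y: "ys = y1 @ y2" "y1 \<in> listset us" "y2 \<in> listset Ds2"
				using ys by (auto elim: listset_appendE)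
			have "?g (xs @ z # ys) = f (xs @ z # (y1 @ mu # y2))" for z
				using g[of "xs @ z # y1" y2] length_listset[OF xs] length_listset[OF y(2)] u(1) y(1) by simp
			moreover have "(%z. f (xs @ z # (y1 @ mu # y2))) holomorphic_on E"
				using sf u(1) y mu xs by (intro sep_holo_slice[of f As E "us @ D # Ds2"] append_in_listset) auto
			ultimately show ?thesis by simp
		next
			fix us assume u: "As = Ds1 @ us" "Ds2 = us @ E # Bs"
			then obtain x1 x2 where x: "xs = x1 @ x2" "x1 \<in> listset Ds1" "x2 \<in> listset us"
				using xs by (auto elim: listset_appendE)
			have "?g (xs @ z # ys) = f ((x1 @ mu # x2) @ z # ys)" for z
				using g[of x1 "x2 @ z # ys"] length_listset[OF x(2)] x(1) by simp
			moreover have "(%z. f ((x1 @ mu # x2) @ z # ys)) holomorphic_on E"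
				using sf u(2) x mu ys by (intro sep_holo_slice[of f "Ds1 @ D # us" E Bs] append_in_listset) auto
			ultimately show ?thesis by simp
		qed
	qed
	moreover have "cmod (?g zs) \<le> C * Ws s zs" if zs: "zs \<in> listset (Ds1 @ Ds2)" for zs
	proof -
		obtain xs ys where x: "zs = xs @ ys" "xs \<in> listset Ds1" "ys \<in> listset Ds2" using zs by (rule listset_appendE)
		have "cmod (?g zs) = cmod (f (xs @ mu # ys))" using x length_listset[OF x(2)] by simp
		also have "... \<le> (C * Ws s xs * Ws s ys) * W s mu" by (rule decays_slice(2)[OF f x(2,3) mu])
		also have "... \<le> (C * Ws s xs * Ws s ys) * 1" by (intro mult_left_mono W_le_1 decays_slice(3)[OF f x(2,3)])
		finally show ?thesis using x(1) by simp
	qed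
	ultimately show ?thesis using f by (simp add: decays_def)
qed

lemma norm_calc_pull:
	assumes fits: "list_all2 fits (Ds1 @ D # Ds2) (vs1 @ (c, K) # vs2)" "length Ds1 = length vs1"
		and f: "decays s C (Ds1 @ D # Ds2) f"
		and comm: "\<And>v z mu. v \<in> set vs1 ==> z \<in> locus (fst v) ==> mu \<in> locus c ==> snd v z o\<^sub>L K mu = K mu o\<^sub>L snd v z"
		and M: "0 \<le> M" "\<And>mu. mu \<in> locus c ==> cmod mu \<le> 2 \<and> norm (K mu) \<le> M" and R: "0 \<le> R" "\<And>mu. mu \<in> locus c ==>
			norm (calc (vs1 @ vs2) (%zs. f (take (length Ds1) zs @ mu # drop (length Ds1) zs))) \<le> R"
	shows "norm (calc (vs1 @ (c, K) # vs2) f) \<le> 5 * (M * R) * mass 1 c"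
proof -
	note fm = fits_mid[OF fits]
	let ?cs1 = "map fst vs1" and ?cs2 = "map fst vs2" and ?k = "length Ds1"
	let ?F = "%zs. f zs *\<^sub>C kprod (map snd (vs1 @ (c, K) # vs2)) zs"
	let ?f = "%mu zs. f (take ?k zs @ mu # drop ?k zs)"
	obtain B where B: "integrand s B (map fst (vs1 @ (c, K) # vs2)) ?F"
		using integrand_calc[OF fits(1) f] by blast
	have s: "0 < s" using f by (auto simp: decays_def)
	have cs: "\<forall>d\<in>set (?cs1 @ c # ?cs2). contour d" using fits_set(2)[OF fits(1)] by simp
	have f12: "list_all2 fits (Ds1 @ Ds2) (vs1 @ vs2)" using fm(1,3) by (rule list_all2_appendI)
	have inner: "iter ?cs1 (%xs. iter ?cs2 (%ys. ?F (xs @ mu # ys))) = K mu o\<^sub>L calc (vs1 @ vs2) (?f mu)"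
		if mu: "mu \<in> locus c" for mu
	proof -
		have muD: "mu \<in> D" and lin: "complex_linear (K mu)" using fm(2) mu by (auto simp: fits_def kern_def)
		obtain B' where B': "integrand s B' (map fst (vs1 @ vs2)) (%zs. ?f mu zs *\<^sub>C kprod (map snd (vs1 @ vs2)) zs)"
			using integrand_calc[OF f12 decays_insert[OF f muD]] by blast
		have "iter ?cs1 (%xs. iter ?cs2 (%ys. ?F (xs @ mu # ys)))
				= iter ?cs1 (%xs. iter ?cs2 (%ys. K mu o\<^sub>L (?f mu (xs @ ys) *\<^sub>C kprod (map snd (vs1 @ vs2)) (xs @ ys))))"
		proof (intro iter_cong)
			fix xs ys assume xs: "xs \<in> loci ?cs1" and ys: "ys \<in> loci ?cs2"
			have len: "length xs = length vs1" using length_listset[OF xs] by simp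
			have "kprod (map snd (vs1 @ (c, K) # vs2)) (xs @ mu # ys)
					= kprod (map snd vs1) xs o\<^sub>L (K mu o\<^sub>L kprod (map snd vs2) ys)"
				using kprod_append[of xs "map snd vs1" "K # map snd vs2" "mu # ys"] len by simp
			also have "... = (K mu o\<^sub>L kprod (map snd vs1) xs) o\<^sub>L kprod (map snd vs2) ys"
				using kprod_commute[OF comm[OF _ _ mu] xs] by (simp flip: compose_assoc)
			also have "... = K mu o\<^sub>L kprod (map snd (vs1 @ vs2)) (xs @ ys)"
				using kprod_append[of xs "map snd vs1" "map snd vs2" ys] len by (simp add: compose_assoc)
			finally show "?F (xs @ mu # ys) = K mu o\<^sub>L (?f mu (xs @ ys) *\<^sub>C kprod (map snd (vs1 @ vs2)) (xs @ ys))"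
				using len fits(2) by (simp add: compose_scaleC_right[OF lin])
		qed
		also have "... = iter (map fst (vs1 @ vs2)) (%zs. K mu o\<^sub>L (?f mu zs *\<^sub>C kprod (map snd (vs1 @ vs2)) zs))"
			by (simp add: iterated_integral_append)
		also have "... = K mu o\<^sub>L calc (vs1 @ vs2) (?f mu)" unfolding calc_def
			by (rule iter_linear[OF fits_set(2)[OF f12] s B' bounded_linear_compose_left compose_scaleC_right[OF lin]])
		finally show ?thesis .
	qed
	have "calc (vs1 @ (c, K) # vs2) f = iter (?cs1 @ c # ?cs2) ?F" by (simp add: calc_def)
	also have "... = cint c (%mu. iter ?cs1 (%xs. iter ?cs2 (%ys. ?F (xs @ mu # ys))))"
		by (rule iter_pull_front[OF cs s]) (use B in simp)
	also have "... = cint c (%mu. K mu o\<^sub>L calc (vs1 @ vs2) (?f mu))" by (rule cint_cong) (rule inner)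
	also have "norm ... \<le> 5 * (M * R) * mass 1 c"
		using cs M R by (intro norm_cint_le_of_bounded) (auto intro!: compose_bound)
	finally show ?thesis .
qed

section \<open>Transforming one coordinate of a function of several variables\<close>

lemma sep_holo_update:
	assumes "sep_holo f Ds" "i < length Ds" "length zs = length Ds"
		and "\<And>j. j < length Ds ==> j ~= i ==> zs ! j \<in> Ds ! j"
	shows "(%z. f (zs[i := z])) holomorphic_on Ds ! i"
proof -
	have "take i zs \<in> listset (take i Ds)" "drop (Suc i) zs \<in> listset (drop (Suc i) Ds)"
		using assms by (auto simp: in_listset_iff list_all2_conv_all_nth)
	then have "(%z. f (take i zs @ z # drop (Suc i) zs)) holomorphic_on Ds ! i"
		using assms(1,2) by (intro sep_holo_slice) (auto simp: id_take_nth_drop[symmetric])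
	then show ?thesis using assms(2,3) by (simp add: upd_conv_take_nth_drop)
qed

text \<open>The index form of separate holomorphy. The entry at position i is left arbitrary, since
  it is overwritten by the update.\<close>

lemma sep_holoI:
	assumes "\<And>i zs. i < length Ds ==> length zs = length Ds ==>
		(\<And>j. j < length Ds ==> j ~= i ==> zs ! j \<in> Ds ! j) ==> (%z. f (zs[i := z])) holomorphic_on Ds ! i"
	shows "sep_holo f Ds" unfolding sep_holo_def
proof (intro allI impI)
	fix As D Bs xs ys assume D: "Ds = As @ D # Bs" and xs: "xs \<in> listset As" and ys: "ys \<in> listset Bs"
	have l: "length xs = length As" "length ys = length Bs" using length_listset xs ys by auto
	have "(%z. f ((xs @ 0 # ys)[length As := z])) holomorphic_on Ds ! length As"
	proof (rule assms)
		fix j assume j: "j < length Ds" "j ~= length As"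
		show "(xs @ 0 # ys) ! j \<in> Ds ! j"
			using j xs ys l by (auto simp: D nth_append nth_Cons' in_listset_iff list_all2_conv_all_nth)
	qed (use D l in auto)
	then show "(%z. f (xs @ z # ys)) holomorphic_on D"
		using nth_append_length[of As D Bs] l(1) by (simp add: D list_update_append)
qed

definition hop_at :: "real => nat => (complex list => complex) => complex list => complex" where
	"hop_at be k f zs = hop be (%mu. f (zs[k := mu])) (zs ! k)"

lemma hop_at_mid: "length xs = k ==> hop_at be k f (xs @ z # ys) = hop be (%mu. f (xs @ mu # ys)) z"
	by (auto simp: hop_at_def)

lemma locus_rays_sto:
	assumes "0 < be" "be < ga" "ga < pi / 2"
	shows "locus (rays be) \<subseteq> sto (sin ga) 1" "locus (carc be) \<subseteq> sto (sin ga) 1"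
	using bcont_locus_sector[OF assms, of 1 1] order_trans[OF locus_rays_subset] order_trans[OF locus_arc_subset]
	by simp_all

text \<open>In coordinate k holomorphy and decay are those of \<open>hop\<close>; in the other
  coordinates the function enters as a parameter. All exponents are lowered to the common
  \<open>ta\<close>.\<close>

lemma decays_hop_at:
	assumes th: "0 < th" "th < be" and ga: "be < ga" "ga < pi / 2" and op: "\<forall>D\<in>set (Ds1 @ Ds2). open D"
		and f: "decays s C (Ds1 @ sto (sin ga) 1 # Ds2) f"
	shows "\<exists>ta C'. decays ta C' (Ds1 @ sector th # Ds2) (hop_at be (length Ds1) f)"
proof -
	define ta where "ta = min s 1 / 2"
	let ?k = "length Ds1" and ?D = "sto (sin ga) 1"
	let ?Ds = "Ds1 @ ?D # Ds2" and ?Es = "Ds1 @ sector th # Ds2"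
	have sf: "sep_holo f ?Ds" and s: "0 < s" and C: "0 \<le> C"
		and fb: "\<And>zs. zs \<in> listset ?Ds ==> cmod (f zs) \<le> C * Ws s zs" using f by (auto simp: decays_def)
	have ta: "0 < ta" "ta \<le> s" using s by (auto simp: ta_def)
	have lr: "locus (rays be) \<subseteq> ?D" using locus_rays_sto(1) th ga by auto
	define K where "K = hop_const th be ta * mass ta (rays be)"
	have K: "0 \<le> K" using hop_const_nonneg[OF th ga] mass_nonneg by (simp add: K_def)
	have nth: "?Ds ! j = ?Es ! j" if "j ~= ?k" for j using that by (simp add: nth_append nth_Cons')
	have slice: "(%mu. f (zs[?k := mu])) holomorphic_on ?D"
			"\<And>mu. mu \<in> ?D ==> cmod (f (zs[?k := mu])) \<le> C * W s mu"
		if zs: "length zs = length ?Es" "\<And>j. j < length ?Es ==> j ~= ?k ==> zs ! j \<in> ?Es ! j" for zs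
	proof -
		have j: "zs ! j \<in> ?Ds ! j" if "j < length ?Ds" "j ~= ?k" for j
			using zs(2)[of j] that nth[of j] by (metis length_append length_Cons)
		show "(%mu. f (zs[?k := mu])) holomorphic_on ?D" using sep_holo_update[OF sf _ _ j, of ?k] zs(1) by simp
		fix mu assume mu: "mu \<in> ?D"
		have "zs[?k := mu] ! j \<in> ?Ds ! j" if "j < length ?Ds" for j
			using j[OF that] mu that zs(1) by (cases "j = ?k") auto
		then have "zs[?k := mu] \<in> listset ?Ds" unfolding in_listset_iff list_all2_conv_all_nth using zs(1) by simp
		then have "cmod (f (zs[?k := mu])) \<le> C * Ws s (zs[?k := mu])" by (rule fb)
		also have "... \<le> C * W s mu" using Ws_le_nth[of ?k "zs[?k := mu]" s] zs(1) C by (intro mult_left_mono) auto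
		finally show "cmod (f (zs[?k := mu])) \<le> C * W s mu" .
	qed
	have "sep_holo (hop_at be ?k f) ?Es"
	proof (rule sep_holoI)
		fix i zs assume i: "i < length ?Es" and zs: "length zs = length ?Es"
			"\<And>j. j < length ?Es ==> j ~= i ==> zs ! j \<in> ?Es ! j"
		show "(%z. hop_at be ?k f (zs[i := z])) holomorphic_on ?Es ! i"
		proof (cases "i = ?k")
			case True
			have sl: "(%mu. f (zs[?k := mu])) holomorphic_on ?D"
				"\<And>mu. mu \<in> ?D ==> cmod (f (zs[?k := mu])) \<le> C * W s mu" using slice[of zs] zs True by auto
			have "hop be (%mu. f (zs[?k := mu])) holomorphic_on sector th"
				using sl lr by (intro holomorphic_on_hop[OF th ga s _ C] continuous_on_subset[OF holomorphic_on_imp_continuous_on lr]) auto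
			then show ?thesis using i zs(1) by (simp add: hop_at_def True)
		next
			case False
			have "open (?Es ! i)" using False op i by (auto simp: nth_append nth_Cons' all_set_conv_all_nth)
			moreover have "(zs[i := w])[?k := mu] = (zs[?k := mu])[i := w]" for w mu
				using False by (simp add: list_update_swap)
			moreover have "(%w. hop be (%mu. f ((zs[i := w])[?k := mu])) (zs ! ?k)) holomorphic_on ?Es ! i"
			proof (rule holomorphic_on_hop_param[OF th ga \<open>open (?Es ! i)\<close> s C])
				show "zs ! ?k \<in> sector th" using zs(2)[of ?k] False by simp
				fix w assume w: "w \<in> ?Es ! i"
				have "zs[i := w] ! j \<in> ?Es ! j" if "j < length ?Es" for j using zs w that by (cases "j = i") auto
				then have sl: "(%mu. f ((zs[i := w])[?k := mu])) holomorphic_on ?D"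
					"\<And>mu. mu \<in> ?D ==> cmod (f ((zs[i := w])[?k := mu])) \<le> C * W s mu" using slice[of "zs[i := w]"] zs(1) by auto
				show "continuous_on (locus (rays be)) (%mu. f ((zs[i := w])[?k := mu]))"
					by (rule continuous_on_subset[OF holomorphic_on_imp_continuous_on[OF sl(1)] lr])
				show "cmod (f ((zs[i := w])[?k := mu])) \<le> C * W s mu" if "mu \<in> locus (rays be)" for mu
					using sl(2) lr that by blast
			next
				fix mu assume mu: "mu \<in> locus (rays be)"
				have "zs[?k := mu] ! j \<in> ?Ds ! j" if "j < length ?Ds" "j ~= i" for j
					using zs(2)[of j] nth[of j] that mu lr zs(1) by (cases "j = ?k") auto
				then have "(%w. f ((zs[?k := mu])[i := w])) holomorphic_on ?Ds ! i"
					using i zs(1) by (intro sep_holo_update[OF sf]) auto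
				then show "(%w. f ((zs[i := w])[?k := mu])) holomorphic_on ?Es ! i"
					using False nth[OF False] by (simp add: list_update_swap)
			qed
			ultimately show ?thesis using False by (simp add: hop_at_def)
		qed
	qed
	moreover have "cmod (hop_at be ?k f zs) \<le> (K * C) * Ws ta zs" if zs: "zs \<in> listset ?Es" for zs
	proof -
		obtain xs zs' where 1: "zs = xs @ zs'" "xs \<in> listset Ds1" "zs' \<in> listset (sector th # Ds2)"
			using zs by (rule listset_appendE)
		from 1(3) obtain z ys where 2: "zs' = z # ys" "z \<in> sector th" "ys \<in> listset Ds2" by (rule listset_ConsE)
		note sl = decays_slice[OF f 1(2) 2(3)]
		have "cmod (hop be (%mu. f (xs @ mu # ys)) z) \<le> K * (C * Ws s xs * Ws s ys) * W ta z"
			unfolding K_def using sl(2) lr 2(2)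
			by (intro hop_decay[OF th ga s ta_def] sl(3) continuous_on_subset[OF holomorphic_on_imp_continuous_on[OF sl(1)] lr]) auto
		also have "... \<le> K * (C * Ws ta xs * Ws ta ys) * W ta z"
			using K C ta by (intro mult_right_mono mult_left_mono mult_mono Ws_antimono Ws_nonneg W_nonneg mult_nonneg_nonneg) auto
		also have "... = (K * C) * Ws ta (xs @ z # ys)" by simp
		finally show ?thesis using 1(1) 2(1) hop_at_mid[of xs ?k be f z ys] length_listset[OF 1(2)] by simp
	qed
	ultimately have "decays ta (K * C) ?Es (hop_at be ?k f)" using ta K C by (simp add: decays_def)
	then show ?thesis by blast
qed

lemma hop_at_bound:
	assumes th: "0 < th" "th < be" and ga: "be < ga" "ga < pi / 2"
	shows "\<exists>K\<ge>0. \<forall>f s C Ds1 Ds2 B zs. decays s C (Ds1 @ sto (sin ga) 1 # Ds2) f -->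
		(\<forall>zs\<in>listset (Ds1 @ sto (sin ga) 1 # Ds2). cmod (f zs) \<le> B) -->
		zs \<in> listset (Ds1 @ sector th # Ds2) --> cmod (hop_at be (length Ds1) f zs) \<le> K * B"
proof -
	obtain K where K: "0 \<le> K" "\<And>f s C B z. f holomorphic_on sto (sin ga) 1 ==> 0 < s ==> 0 \<le> C ==>
		\<forall>mu\<in>sto (sin ga) 1. cmod (f mu) \<le> C * W s mu \<and> cmod (f mu) \<le> B ==> z \<in> sector th ==>
		cmod (hop be f z) \<le> K * B" using hop_bound[OF assms] by (elim exE conjE) (rule that; blast)
	show ?thesis
	proof (intro exI[of _ K] conjI K(1) allI impI)
		fix f s C Ds1 Ds2 B zs
		assume f: "decays s C (Ds1 @ sto (sin ga) 1 # Ds2) f"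
			and B: "\<forall>zs\<in>listset (Ds1 @ sto (sin ga) 1 # Ds2). cmod (f zs) \<le> B"
			and zs: "zs \<in> listset (Ds1 @ sector th # Ds2)"
		obtain xs zs' where 1: "zs = xs @ zs'" "xs \<in> listset Ds1" "zs' \<in> listset (sector th # Ds2)"
			using zs by (rule listset_appendE)
		from 1(3) obtain z ys where 2: "zs' = z # ys" "z \<in> sector th" "ys \<in> listset Ds2" by (rule listset_ConsE)
		note sl = decays_slice[OF f 1(2) 2(3)]
		have "cmod (f (xs @ mu # ys)) \<le> B" if "mu \<in> sto (sin ga) 1" for mu
			using B append_in_listset[OF 1(2), of "mu # ys"] that 2(3) by auto
		then have "cmod (hop be (%mu. f (xs @ mu # ys)) z) \<le> K * B"
			using f sl(2) by (intro K(2)[OF sl(1) _ sl(3) _ 2(2), of s]) (simp_all add: decays_def)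
		then show "cmod (hop_at be (length Ds1) f zs) \<le> K * B"
			using 1(1) 2(1) hop_at_mid[of xs "length Ds1" be f z ys] length_listset[OF 1(2)] by simp
	qed
qed

lemma kern_subset: "kern M c K ==> contour c' ==> locus c' \<subseteq> locus c ==> kern M c' K"
	unfolding kern_def by (auto intro: continuous_on_subset)

lemma compose_commute_add:
	"S o\<^sub>L U = U o\<^sub>L S ==> T o\<^sub>L U = U o\<^sub>L T ==> (S + T) o\<^sub>L U = U o\<^sub>L (S + T)"
	by (simp add: compose_add_left compose_add_right)

lemma compose_commute_scaleC:
	"complex_linear U ==> S o\<^sub>L U = U o\<^sub>L S ==> (c *\<^sub>C S) o\<^sub>L U = U o\<^sub>L (c *\<^sub>C S)"
	by (simp add: compose_scaleC_left compose_scaleC_right)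

lemma qop_commute:
	assumes A: "complex_linear A" "complex_linear B" "A o\<^sub>L B = B o\<^sub>L A"
		and r: "z \<in> resolvent_set (graph_of A)" "- 1 \<in> resolvent_set (graph_of A)"
			"mu \<in> resolvent_set (graph_of B)" "- 1 \<in> resolvent_set (graph_of B)"
	shows "qop A z o\<^sub>L qop B mu = qop B mu o\<^sub>L qop A z"
proof -
	have l: "complex_linear (res B mu)" "complex_linear (res B (- 1))" "complex_linear (qop B mu)"
		unfolding qop_def by (intro complex_linear_add complex_linear_scaleC complex_linear_resolvent r)+
	have *: "qop B mu o\<^sub>L res A w = res A w o\<^sub>L qop B mu" if w: "w \<in> resolvent_set (graph_of A)" for w
		unfolding qop_def using resolvents_commute[OF w _ A(3,1)] r complex_linear_resolvent[OF w]
		by (intro compose_commute_add compose_commute_scaleC) auto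
	show ?thesis unfolding qop_def[of A] using *[OF r(1)] *[OF r(2)] l(3)
		by (intro compose_commute_add compose_commute_scaleC) auto
qed

section \<open>From sectorial calculi to Stolz contours\<close>

context
	fixes I :: "nat set" and A :: "nat => ('a::complex_banach \<Rightarrow>\<^sub>L 'a)" and nu th be ga rh0 M N :: "nat => real"
	assumes lin: "\<And>i. i \<in> I ==> complex_linear (A i)"
		and ang: "\<And>i. i \<in> I ==> 0 < nu i \<and> nu i < th i \<and> th i < be i \<and> be i < ga i \<and> ga i < pi / 2"
		and reg_sec: "\<And>i rh. i \<in> I ==> rh \<ge> rh0 i ==> reg (A i) (sin (nu i)) rh (M i)" "\<And>i. i \<in> I ==> 0 < rh0 i"
		and reg_sto: "\<And>i. i \<in> I ==> reg (A i) (sin (be i)) 1 (N i)"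
		and comm: "\<And>i j. i \<in> I ==> j \<in> I ==> A i o\<^sub>L A j = A j o\<^sub>L A i" and base: "\<And>js. set js \<subseteq> I ==> sorted_wrt (<) js ==>
			\<exists>C\<ge>0. \<forall>f s C0 B. decays s C0 (map (%i. sector (th i)) js) f --> 0 \<le> B -->
				(\<forall>zs\<in>listset (map (%i. sector (th i)) js). cmod (f zs) \<le> B) -->
				norm (calc (map (%i. (scont (nu i), res (A i))) js) f) \<le> C * B"
begin

abbreviation (input) "X i \<equiv> (bcont (be i) 1, qop (A i))"
abbreviation (input) "Y i \<equiv> (scont (nu i), res (A i))"
abbreviation (input) "S i \<equiv> sto (sin (ga i)) 1"
abbreviation (input) "E i \<equiv> sector (th i)"

lemma kern_X: "i \<in> I ==> kern (2 * N i) (bcont (be i) 1) (qop (A i))"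
	using ang[of i] locus_bcont(2)[of "be i" 1] sin_less_one[of "be i"]
	by (intro kern_qop[OF contour_bcont reg_sto]) auto

lemma fits_X:
	assumes "i \<in> I" shows "fits (S i) (X i)" "fits (S i) (rays (be i), qop (A i))"
proof -
	have b: "0 < be i" "be i < ga i" "ga i < pi / 2" "be i < pi / 2" using ang[OF assms] by auto
	show "fits (S i) (X i)"
		using kern_X[OF assms] bcont_locus_sector[OF b(1-3), of 1 1] open_sto by (auto simp: fits_def)
	show "fits (S i) (rays (be i), qop (A i))"
		using kern_subset[OF kern_X[OF assms] contour_rays[OF b(1,4)] locus_rays_subset] locus_rays_sto(1)[OF b(1-3)] open_sto
		by (auto simp: fits_def)
qed

lemma fits_Y:
	assumes "i \<in> I" shows "fits (E i) (Y i)"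
proof -
	have b: "0 < nu i" "nu i < pi / 2" "nu i < th i" "th i < pi / 2" "0 < th i" "th i \<le> pi" using ang[OF assms] by auto
	show ?thesis
		using kern_scont_res[OF b(1,2) reg_sec(1)[OF assms order_refl]] locus_scont(4)[OF _ b(1-4)] open_sector[OF b(5,6)]
		by (auto simp: fits_def)
qed

text \<open>The variables in \<open>as\<close> are of Stolz type, those in \<open>bs\<close>
  sectorial, and \<open>C\<close> may depend neither on the decay exponent nor on \<open>C0\<close>.
  The last Stolz variable is removed first, so that it joins the front of \<open>bs\<close> and the
  order of indices is preserved; with no Stolz variable left the assumption on sectorial calculi
  applies.\<close>

lemma norm_calc_mixed_le:
	assumes "set (as @ bs) \<subseteq> I" "sorted_wrt (<) (as @ bs)"
	shows "\<exists>C\<ge>0. \<forall>f s C0 B. decays s C0 (map (%i. S i) as @ map (%i. E i) bs) f --> 0 \<le> B -->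
		(\<forall>zs\<in>listset (map (%i. S i) as @ map (%i. E i) bs). cmod (f zs) \<le> B) -->
		norm (calc (map (%i. X i) as @ map (%i. Y i) bs) f) \<le> C * B" using assms
proof (induction as arbitrary: bs rule: rev_induct)
	case Nil
	then show ?case using base[of bs] by simp
next
	case (snoc i as)
	have i: "i \<in> I" using snoc.prems by simp
	have b: "0 < th i" "th i < be i" "be i < ga i" "ga i < pi / 2" "0 < be i" "be i < pi / 2" "0 < nu i" "nu i < th i"
		using ang[OF i] by auto
	let ?S = "map (%i. S i) as" and ?E = "map (%i. E i) bs" and ?X = "map (%i. X i) as" and ?Y = "map (%i. Y i) bs"
	have "set (as @ i # bs) \<subseteq> I" "sorted_wrt (<) (as @ i # bs)" using snoc.prems by simp_all
	\<comment> \<open>The case of the segments: variable i has become sectorial, so the number of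
	  variables stays the same.\<close>
	from snoc.IH[OF this] obtain C1 where C1: "0 \<le> C1"
		"\<And>f s C0 B. decays s C0 (?S @ E i # ?E) f ==> 0 \<le> B ==>
			\<forall>zs\<in>listset (?S @ E i # ?E). cmod (f zs) \<le> B ==> norm (calc (?X @ Y i # ?Y) f) \<le> C1 * B"
		unfolding list.map by (elim exE conjE) (rule that; blast)
	have "set (as @ bs) \<subseteq> I" "sorted_wrt (<) (as @ bs)" using snoc.prems by (auto simp: sorted_wrt_append)
	\<comment> \<open>The case of the arc: variable i is frozen and disappears, which is why the
	  calculi of all subtuples are required.\<close>
	from snoc.IH[OF this] obtain C2 where C2: "0 \<le> C2"
		"\<And>f s C0 B. decays s C0 (?S @ ?E) f ==> 0 \<le> B ==>
			\<forall>zs\<in>listset (?S @ ?E). cmod (f zs) \<le> B ==> norm (calc (?X @ ?Y) f) \<le> C2 * B"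
		by (elim exE conjE) (rule that; blast)
	obtain K where K: "0 \<le> K" "\<And>f s C Ds1 Ds2 B zs. decays s C (Ds1 @ S i # Ds2) f ==>
		\<forall>zs\<in>listset (Ds1 @ S i # Ds2). cmod (f zs) \<le> B ==>
		zs \<in> listset (Ds1 @ E i # Ds2) ==> cmod (hop_at (be i) (length Ds1) f zs) \<le> K * B"
		using hop_at_bound[OF b(1-4)] by (elim exE conjE) (rule that; blast)
	\<comment> \<open>A bound for \<open>qop\<close> along the arc, where |mu| is at least 1 - sin
	  be.\<close>
	define L where "L = 2 * N i / (1 - sin (be i))"
	have k: "0 < 1 - sin (be i)" using sin_less_one b by simp
	have N: "0 \<le> N i" using reg_nonneg[OF reg_sto[OF i]] k by simp
	have L: "0 \<le> L" using k N by (simp add: L_def)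
	have fitsX: "list_all2 fits ?S ?X" and fitsY: "list_all2 fits ?E ?Y"
		using snoc.prems fits_X(1) fits_Y by (auto simp: list_all2_map1 list_all2_map2 intro!: list.rel_refl_strong)
	have len: "length ?S = length ?X" "length ?S = length as" by simp_all
	have arc_sub: "locus (carc (be i)) \<subseteq> S i" by (rule locus_rays_sto(2)[OF b(5,3,4)])
	have fits_arc: "fits (S i) (carc (be i), qop (A i))"
		using kern_subset[OF kern_X[OF i] contour_arc[OF b(5,6)] locus_arc_subset] arc_sub open_sto by (auto simp: fits_def)
	have r1: "- 1 \<in> resolvent_set (graph_of (A j))" if "j \<in> I" for j
		using regD(1)[OF reg_sto[OF that] minus_one_notin_sto] sin_less_one[of "be j"] ang[OF that] by simp
	have r: "z \<in> resolvent_set (graph_of (A j))" if "j \<in> I" "z \<in> locus (bcont (be j) 1)" for j z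
		using regD(1)[OF reg_sto[OF that(1)]] locus_bcont(2,3)[OF _ _ _ that(2)] ang[OF that(1)] by simp
	show ?case
	proof (intro exI[of _ "C1 * K + 5 * (L * C2) * mass 1 (carc (be i))"] conjI allI impI)
		show "0 \<le> C1 * K + 5 * (L * C2) * mass 1 (carc (be i))" using C1(1) C2(1) K(1) L mass_nonneg by simp
		fix f s C0 B
		assume "decays s C0 (map (%i. S i) (as @ [i]) @ ?E) f" and B: "0 \<le> B"
			and "\<forall>zs\<in>listset (map (%i. S i) (as @ [i]) @ ?E). cmod (f zs) \<le> B"
		then have f: "decays s C0 (?S @ S i # ?E) f" and fB: "\<forall>zs\<in>listset (?S @ S i # ?E). cmod (f zs) \<le> B" by simp_all
		have s: "0 < s" using f by (simp add: decays_def)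
		have op: "\<forall>D\<in>set (?S @ ?E). open D" using fits_set(3)[OF list_all2_appendI[OF fitsX fitsY]] .
		obtain ta C' where h: "decays ta C' (?S @ E i # ?E) (hop_at (be i) (length ?S) f)"
			using decays_hop_at[OF b(1-4) op f] by blast
		have e1: "calc (?X @ (rays (be i), qop (A i)) # ?Y) f = calc (?X @ (scont (nu i), res (A i)) # ?Y) (hop_at (be i) (length ?S) f)"
		proof (rule calc_replace_at[OF _ _ len(1) f h])
			show "list_all2 fits (?S @ S i # ?E) (?X @ (rays (be i), qop (A i)) # ?Y)"
				"list_all2 fits (?S @ E i # ?E) (?X @ (scont (nu i), res (A i)) # ?Y)"
				using fitsX fitsY fits_X(2)[OF i] fits_Y[OF i] by (auto intro!: list_all2_appendI)
			fix xs ys assume xs: "xs \<in> listset ?S" and ys: "ys \<in> listset ?E"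
			have lx: "length xs = length ?S" using length_listset[OF xs] .
			note sl = decays_slice[OF f xs ys]
			have lr: "locus (rays (be i)) \<subseteq> S i" by (rule locus_rays_sto(1)[OF b(5,3,4)])
			have "cint (rays (be i)) (%z. f (xs @ z # ys) *\<^sub>C qop (A i) z)
				= cint (scont (nu i)) (%z. hop (be i) (%mu. f (xs @ mu # ys)) z *\<^sub>C res (A i) z)" using sl(2) lr
				by (intro cint_rays_qop[OF b(1-4) lin[OF i] b(7,8) reg_sec(2)[OF i] reg_sec(1)[OF i] _ s sl(3)]
						continuous_on_subset[OF holomorphic_on_imp_continuous_on[OF sl(1)] lr]) auto
			then show "cint (rays (be i)) (%z. f (xs @ z # ys) *\<^sub>C qop (A i) z)
				= cint (scont (nu i)) (%z. hop_at (be i) (length ?S) f (xs @ z # ys) *\<^sub>C res (A i) z)"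
				by (simp only: hop_at_mid[OF lx])
		qed
		have n1: "norm (calc (?X @ (scont (nu i), res (A i)) # ?Y) (hop_at (be i) (length ?S) f)) \<le> C1 * (K * B)"
			using K(2)[OF f fB] K(1) B by (intro C1(2)[OF h]) auto
		have n2: "norm (calc (?X @ (carc (be i), qop (A i)) # ?Y) f) \<le> 5 * (L * (C2 * B)) * mass 1 (carc (be i))"
		proof (rule norm_calc_pull[OF _ len(1) f])
			show "list_all2 fits (?S @ S i # ?E) (?X @ (carc (be i), qop (A i)) # ?Y)"
				using fitsX fitsY fits_arc by (auto intro!: list_all2_appendI)
			show "snd v z o\<^sub>L qop (A i) mu = qop (A i) mu o\<^sub>L snd v z"
				if v: "v \<in> set ?X" "z \<in> locus (fst v)" "mu \<in> locus (carc (be i))" for v z mu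
			proof -
				obtain j where j: "j \<in> I" "v = X j" using v(1) snoc.prems(1) by auto
				have mu: "mu \<in> locus (bcont (be i) 1)" using v(3) locus_arc_subset by blast
				show ?thesis
					using v(2) qop_commute[OF lin[OF j(1)] lin[OF i] comm[OF j(1) i] r[OF j(1)] r1[OF j(1)] r[OF i mu] r1[OF i]]
					by (simp add: j(2))
			qed
			show "cmod mu \<le> 2 \<and> norm (qop (A i) mu) \<le> L" if "mu \<in> locus (carc (be i))" for mu
			proof -
				note la = locus_arc[OF b(5,6) that]
				have "norm (qop (A i) mu) \<le> 2 * N i / cmod mu" using norm_qop_le[OF reg_sto[OF i] _ la(3,4)] k by simp
				also have "... \<le> L" unfolding L_def using la(1) k N by (intro divide_left_mono mult_pos_pos) auto
				finally show ?thesis using la(2) by simp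
			qed
			show "norm (calc (?X @ ?Y) (%zs. f (take (length ?S) zs @ mu # drop (length ?S) zs))) \<le> C2 * B"
				if "mu \<in> locus (carc (be i))" for mu
			proof (rule C2(2)[OF decays_insert[OF f] B])
				show mu: "mu \<in> S i" using that arc_sub by blast
				show "\<forall>zs\<in>listset (?S @ ?E). cmod (f (take (length ?S) zs @ mu # drop (length ?S) zs)) \<le> B"
				proof
					fix zs assume "zs \<in> listset (?S @ ?E)"
					then obtain xs ys where x: "zs = xs @ ys" "xs \<in> listset ?S" "ys \<in> listset ?E" by (rule listset_appendE)
					have "xs @ mu # ys \<in> listset (?S @ S i # ?E)" using x mu by (intro append_in_listset) auto
					then show "cmod (f (take (length ?S) zs @ mu # drop (length ?S) zs)) \<le> B"
						using fB x(1) length_listset[OF x(2)] by simp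
				qed
			qed
		qed (use L C2(1) B in auto)
		have e2: "calc (?X @ (bcont (be i) 1, qop (A i)) # ?Y) f
				= calc (?X @ (rays (be i), qop (A i)) # ?Y) f + calc (?X @ (carc (be i), qop (A i)) # ?Y) f"
			using fitsX fitsY fits_X(1)[OF i] by (intro calc_rays_arc[OF b(5,6) _ f]) (auto intro!: list_all2_appendI)
		have "norm (calc (?X @ X i # ?Y) f) \<le> C1 * (K * B) + 5 * (L * (C2 * B)) * mass 1 (carc (be i))"
			unfolding e2 e1 by (rule norm_triangle_mono[OF n1 n2])
		also have "... = (C1 * K + 5 * (L * C2) * mass 1 (carc (be i))) * B" by (simp add: algebra_simps)
		finally show "norm (calc (map (%i. X i) (as @ [i]) @ ?Y) f) \<le> (C1 * K + 5 * (L * C2) * mass 1 (carc (be i))) * B"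
			by simp
	qed
qed

end

section \<open>Comparison of the function classes and of the calculi\<close>

abbreviation reflect :: "complex list => complex list" where
	"reflect zs \<equiv> map (%z. 1 - z) zs"

abbreviation (input) maps_into :: "complex set => complex set => bool" where
	"maps_into D' D \<equiv> \<forall>z\<in>D'. 1 - z \<in> D"

lemma reflect_in_listset:
	"zs \<in> listset Ds' ==> list_all2 (%D' D. maps_into D' D) Ds' Ds ==> reflect zs \<in> listset Ds"
	unfolding in_listset_iff list_all2_conv_all_nth by simp

lemma sep_holo_reflect:
	assumes f: "sep_holo f Ds" and D: "list_all2 (%D' D. maps_into D' D) Ds' Ds"
	shows "sep_holo (%zs. f (reflect zs)) Ds'"
proof (rule sep_holoI)
	fix i zs assume i: "i < length Ds'" and zs: "length zs = length Ds'"
		"\<And>j. j < length Ds' ==> j ~= i ==> zs ! j \<in> Ds' ! j"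
	have len: "length Ds' = length Ds" and nth: "\<And>j. j < length Ds ==> maps_into (Ds' ! j) (Ds ! j)"
		using D by (auto simp: list_all2_conv_all_nth)
	have h: "(%z. f ((reflect zs)[i := z])) holomorphic_on Ds ! i"
		using i zs len nth by (intro sep_holo_update[OF f]) auto
	have "((%z. f ((reflect zs)[i := z])) \<circ> (%z. 1 - z)) holomorphic_on Ds' ! i"
		using nth[of i] i len by (intro holomorphic_on_compose_gen[OF _ h] holomorphic_intros) auto
	then show "(%z. f (reflect (zs[i := z]))) holomorphic_on Ds' ! i" by (simp add: o_def map_update)
qed

lemma maps_into_stolz:
	assumes "\<forall>ga\<in>set gas. 0 < ga \<and> ga < pi / 2"
	shows "list_all2 (%D' D. maps_into D' D) (map (%ga. sto (sin ga) 1) gas) (map stolz gas)"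
		and "list_all2 (%D' D. maps_into D' D) (map stolz gas) (map sector gas)"
proof -
	have "maps_into (sto (sin ga) 1) (stolz ga)" "maps_into (stolz ga) (sector ga)" if "ga \<in> set gas" for ga
		using assms that stolz_iff[of ga] sto_subset_sector[of ga 1] by auto
	then show "list_all2 (%D' D. maps_into D' D) (map (%ga. sto (sin ga) 1) gas) (map stolz gas)"
		"list_all2 (%D' D. maps_into D' D) (map stolz gas) (map sector gas)"
		by (auto simp: list_all2_map1 list_all2_map2 intro!: list.rel_refl_strong)
qed

lemma listset_nonempty: "\<forall>D\<in>set Ds. D ~= {} ==> listset Ds ~= {}"
proof (induction Ds)
	case (Cons D Ds)
	then obtain z zs where "z \<in> D" "zs \<in> listset Ds" by auto
	then have "z # zs \<in> listset (D # Ds)" by simp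
	then show ?case by blast
qed simp

lemma stolz_nonempty: "0 < ga ==> ga < pi / 2 ==> stolz ga ~= {}"
	using stolz_iff[of ga 0] of_real_in_sto[of 1 1 "sin ga"] sin_gt_zero[of ga] by auto

lemma sector_nonempty: "0 < th ==> sector th ~= {}" by (auto simp: sector_def intro!: exI[of _ 1])

lemma norm_le_sup_norm:
	assumes "bounded (f ` U)" "x \<in> U" shows "cmod (f x) \<le> sup_norm U f"
proof -
	obtain B where "\<forall>y\<in>f ` U. norm y \<le> B" using assms(1) bounded_iff by blast
	then have "bdd_above ((%x. cmod (f x)) ` U)" by (intro bdd_aboveI[of _ B]) auto
	then show ?thesis unfolding sup_norm_def by (rule cSUP_upper[OF assms(2)])
qed

lemma sup_norm_le: "U ~= {} ==> (\<And>x. x \<in> U ==> cmod (f x) \<le> B) ==> sup_norm U f \<le> B"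
	unfolding sup_norm_def by (rule cSUP_least)

lemma decays_of_H0_sector:
	assumes "f \<in> H0_sector ths"
	shows "\<exists>s C. decays s C (map sector ths) f" "bounded (f ` listset (map sector ths))"
proof -
	show "bounded (f ` listset (map sector ths))" using assms by (simp add: H0_sector_def)
	obtain C s where "0 < C" "0 < s" "\<forall>zs\<in>listset (map sector ths).
				cmod (f zs) \<le> C * (\<Prod>z\<leftarrow>zs. cmod z powr s / (1 + cmod z powr (2 * s)))"
		using assms unfolding H0_sector_def by blast
	moreover have "sep_holo f (map sector ths)"
		using assms by (intro sep_holo_of_multi_holomorphic) (simp add: H0_sector_def)
	ultimately have "decays s C (map sector ths) f" unfolding decays_def W_eq by simp
	then show "\<exists>s C. decays s C (map sector ths) f" by blast
qed

lemma H0_sector_of_decays: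
	assumes f: "decays s C (map sector ths) f" and ths: "\<forall>th\<in>set ths. 0 < th \<and> th < pi"
	shows "f \<in> H0_sector ths"
proof -
	have C: "0 \<le> C" "0 < s" and fC: "\<And>zs. zs \<in> listset (map sector ths) ==> cmod (f zs) \<le> C * Ws s zs"
		using f by (auto simp: decays_def)
	have fb: "cmod (f zs) \<le> C" if "zs \<in> listset (map sector ths)" for zs
		using fC[OF that] mult_left_mono[OF Ws_le_1 C(1), of s zs] by simp
	have 1: "multi_holomorphic_on f (listset (map sector ths))"
		using f ths by (intro multi_holomorphic_of_sep_holo[OF _ _ fb]) (auto simp: decays_def intro!: open_sector)
	have 2: "bounded (f ` listset (map sector ths))" using fb by (auto simp: bounded_iff)
	have "cmod (f zs) \<le> (C + 1) * Ws s zs" if "zs \<in> listset (map sector ths)" for zs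
		using fC[OF that] Ws_nonneg[of s zs] by (simp add: distrib_right)
	then have 3: "\<exists>C'>0. \<exists>s'>0. \<forall>zs\<in>listset (map sector ths). cmod (f zs) \<le> C' * Ws s' zs"
		using C by - (rule exI[of _ "C + 1"], rule conjI, simp, rule exI[of _ s], blast)
	show ?thesis using 1 2 3 unfolding H0_sector_def W_eq mem_Collect_eq by (intro conjI)
qed

text \<open>The change of variable carries the Stolz domain into the sector of the same angle, and
  the sector weight is at most the power |z|^s.\<close>

lemma H0_stolz_of_decays:
	assumes f: "decays s C (map sector gas) f" and gas: "\<forall>ga\<in>set gas. 0 < ga \<and> ga < pi / 2"
	shows "(%zs. f (reflect zs)) \<in> H0_stolz gas"
proof -
	note m = maps_into_stolz(2)[OF gas]
	have C: "0 \<le> C" "0 < s" and sf: "sep_holo f (map sector gas)"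
		and fC: "\<And>zs. zs \<in> listset (map sector gas) ==> cmod (f zs) \<le> C * Ws s zs" using f by (auto simp: decays_def)
	have fC': "cmod (f (reflect zs)) \<le> C * Ws s (reflect zs)" if "zs \<in> listset (map stolz gas)" for zs
		by (rule fC[OF reflect_in_listset[OF that m]])
	have fb: "cmod (f (reflect zs)) \<le> C" if "zs \<in> listset (map stolz gas)" for zs
		using fC'[OF that] mult_left_mono[OF Ws_le_1 C(1), of s "reflect zs"] by simp
	have 1: "multi_holomorphic_on (%zs. f (reflect zs)) (listset (map stolz gas))"
		by (rule multi_holomorphic_of_sep_holo[OF _ sep_holo_reflect[OF sf m] fb]) (auto simp: stolz_def)
	have 2: "bounded ((%zs. f (reflect zs)) ` listset (map stolz gas))" using fb by (auto simp: bounded_iff)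
	have "cmod (f (reflect zs)) \<le> (C + 1) * (\<Prod>z\<leftarrow>zs. cmod (1 - z) powr s)"
		if "zs \<in> listset (map stolz gas)" for zs
	proof -
		have w: "Ws s (reflect zs) \<le> (\<Prod>z\<leftarrow>zs. cmod (1 - z) powr s)"
			by (induction zs) (auto intro!: mult_mono W_le_powr Ws_nonneg[of s "reflect _", unfolded map_map o_def] simp: o_def)
		have "0 \<le> (\<Prod>z\<leftarrow>zs. cmod (1 - z) powr s)" by (induction zs) auto
		then show ?thesis using order_trans[OF fC'[OF that] mult_left_mono[OF w C(1)]] by (simp add: distrib_right)
	qed
	then have 3: "\<exists>c>0. \<exists>s'>0. \<forall>zs\<in>listset (map stolz gas). cmod (f (reflect zs)) \<le> c * (\<Prod>z\<leftarrow>zs. cmod (1 - z) powr s')"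
		using C by - (rule exI[of _ "C + 1"], rule conjI, simp, rule exI[of _ s], blast)
	show ?thesis using 1 2 3 unfolding H0_stolz_def mem_Collect_eq by (intro conjI)
qed

text \<open>Conversely |z| \<le> 2 on the Stolz domain, so each power costs only the factor q = 1 +
  2^(2s) when it is replaced by the sector weight.\<close>

lemma decays_of_H0_stolz:
	assumes ph: "ph \<in> H0_stolz gas" and gas: "\<forall>ga\<in>set gas. 0 < ga \<and> ga < pi / 2"
	shows "\<exists>s C. decays s C (map (%ga. sto (sin ga) 1) gas) (%zs. ph (reflect zs))"
		"bounded (ph ` listset (map stolz gas))"
proof -
	note m = maps_into_stolz(1)[OF gas]
	show "bounded (ph ` listset (map stolz gas))" using ph by (simp add: H0_stolz_def)
	obtain c s where c: "0 < c" "0 < s"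
		and le: "\<And>zs. zs \<in> listset (map stolz gas) ==> cmod (ph zs) \<le> c * (\<Prod>z\<leftarrow>zs. cmod (1 - z) powr s)"
		using ph unfolding H0_stolz_def by blast
	have sh: "sep_holo (%zs. ph (reflect zs)) (map (%ga. sto (sin ga) 1) gas)"
		using ph by (intro sep_holo_reflect[OF sep_holo_of_multi_holomorphic m]) (simp add: H0_stolz_def)
	define q where "q = 1 + 2 powr (2 * s)"
	have q: "0 \<le> q" by (simp add: q_def)
	have "cmod (ph (reflect zs)) \<le> (c * q ^ length gas) * Ws s zs" if zs: "zs \<in> listset (map (%ga. sto (sin ga) 1) gas)" for zs
	proof -
		have "list_all2 (%z ga. z \<in> sto (sin ga) 1) zs gas" using zs by (simp add: in_listset_iff list_all2_map2)
		then have "(\<Prod>z\<leftarrow>zs. cmod z powr s) \<le> q ^ length gas * Ws s zs" using gas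
		proof (induction rule: list_all2_induct)
			case (Cons z zs ga gas)
			have z: "cmod z \<le> 2" "z ~= 0"
				using stc_bounds(2,3)[of z "sin ga" 1] sto_subset_stc Cons.hyps(1) Cons.prems sin_less_one[of ga] by auto
			have "cmod z powr s = cmod z * cmod z powr (s - 1)" using z by (simp add: powr_diff)
			also have "... \<le> cmod z * (q * wt s z)" unfolding q_def by (intro mult_left_mono powr_le_wt z c) simp
			finally have "cmod z powr s \<le> q * W s z" by (simp add: mult_ac)
			moreover have "0 \<le> (\<Prod>z\<leftarrow>zs. cmod z powr s)" by (induction zs) auto
			ultimately have "cmod z powr s * (\<Prod>z\<leftarrow>zs. cmod z powr s) \<le> (q * W s z) * (q ^ length gas * Ws s zs)"
				using Cons.IH Cons.prems q wt_nonneg[of s z] by (intro mult_mono) auto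
			then show ?case by (simp add: mult_ac)
		qed simp
		then have "c * (\<Prod>z\<leftarrow>zs. cmod z powr s) \<le> c * (q ^ length gas * Ws s zs)"
			using c by (intro mult_left_mono) auto
		then show ?thesis using le[OF reflect_in_listset[OF zs m]] by (simp add: o_def mult_ac)
	qed
	then have "decays s (c * q ^ length gas) (map (%ga. sto (sin ga) 1) gas) (%zs. ph (reflect zs))"
		using sh c q by (simp add: decays_def)
	then show "\<exists>s C. decays s C (map (%ga. sto (sin ga) 1) gas) (%zs. ph (reflect zs))" by blast
qed

section \<open>The two functional calculi in terms of contours and kernels\<close>

lemma path_integral_stolz_boundary:
	fixes F :: "complex => 'b::complex_banach"
	shows "path_integral {0..1} (stolz_boundary be) F = cint (bcont be 1) (%z. - F (1 - z))"
proof -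
	let ?g = "%t. vector_derivative (stolz_boundary be) (at t within {0..1}) *\<^sub>C F (stolz_boundary be t)"
	have s: "stolz_boundary be t = 1 - bpath be t" for t by (simp add: bpath_def)
	have d: "vector_derivative (stolz_boundary be) (at t within {0..1}) = - bderiv be t" if "t \<in> bdom" for t
	proof (rule vector_derivative_at_within_ivl)
		have "((%t. 1 - bpath be t) has_vector_derivative (0 - bderiv be t)) (at t)"
			by (intro has_vector_derivative_diff bpath_has_derivative that has_vector_derivative_const)
		then show "(stolz_boundary be has_vector_derivative - bderiv be t) (at t)" unfolding bpath_def by simp
	qed (use that bdom_subset in auto)
	have "path_integral {0..1} (stolz_boundary be) F = integral bdom ?g"
		unfolding path_integral_def by (rule integral_spike_set[OF bdom_negligible])
	also have "... = cint (bcont be 1) (%z. - F (1 - z))" unfolding cint_def bcont_simps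
		by (rule integral_cong) (simp add: d s scaleC_minus_left scaleC_minus_right)
	finally show ?thesis .
qed

lemma iter_minus: "iter cs (%zs. - F zs) = - iter cs F"
	by (induction cs arbitrary: F) (simp_all add: cint_def scaleC_minus_right)

text \<open>Each change of variable contributes a factor -1. The hypothesis carries the same signs,
  because every reflected resolvent contributes one as well, and they cancel.\<close>

lemma iterated_integral_stolz:
	fixes F :: "complex list => 'b::complex_banach"
	assumes "\<And>zs. zs \<in> loci (map (%be. bcont be 1) bes) ==> F (reflect zs) = (- 1) ^ length bes *\<^sub>C H zs"
	shows "iterated_integral (map (%be. path_integral {0..1} (stolz_boundary be)) bes) F
		= iter (map (%be. bcont be 1) bes) H" using assms
proof (induction bes arbitrary: F H)
	case Nil
	then show ?case by simp
next
	case (Cons be bes)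
	let ?L = "map (%be. path_integral {0..1} (stolz_boundary be)) bes" and ?cs = "map (%be. bcont be 1) bes"
	have "iterated_integral ?L (%zs. F ((1 - z) # zs)) = iter ?cs (%zs. - H (z # zs))"
		if z: "z \<in> locus (bcont be 1)" for z
	proof (rule Cons.IH)
		fix zs assume "zs \<in> loci ?cs"
		then have "F (reflect (z # zs)) = (- 1) ^ length (be # bes) *\<^sub>C H (z # zs)" using z by (intro Cons.prems) simp
		then show "F ((1 - z) # reflect zs) = (- 1) ^ length bes *\<^sub>C - H (z # zs)"
			by (simp add: scaleC_minus_left scaleC_minus_right)
	qed
	then have e: "cint (bcont be 1) (%z. - iterated_integral ?L (%zs. F ((1 - z) # zs)))
			= cint (bcont be 1) (%z. iter ?cs (%zs. H (z # zs)))"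
		by (intro cint_cong) (simp only: iter_minus minus_minus)
	have "iterated_integral (map (%be. path_integral {0..1} (stolz_boundary be)) (be # bes)) F
			= path_integral {0..1} (stolz_boundary be) (%w. iterated_integral ?L (%zs. F (w # zs)))" by simp
	also have "... = cint (bcont be 1) (%z. - iterated_integral ?L (%zs. F ((1 - z) # zs)))"
		by (rule path_integral_stolz_boundary)
	finally show ?case unfolding e by simp
qed

lemma resolvent_product_eq:
	"length zs = length Ss ==> resolvent_product zs (map graph_of Ss) = kprod (map (%S. res S) Ss) zs"
	by (induction zs Ss rule: list_induct2) (simp_all add: resolvent_product_def)

lemma resolvent_product_reflect:
	assumes "list_all2 (%z T. 1 - z \<in> resolvent_set (graph_of T)) zs Ts"
	shows "resolvent_product (reflect zs) (map graph_of Ts)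
		= (- 1) ^ length Ts *\<^sub>C kprod (map (%T. res (id_blinfun - T)) Ts) zs" using assms
proof (induction rule: list_all2_induct)
	case (Cons z zs T Ts)
	have z: "resolvent (1 - z) (graph_of T) = - res (id_blinfun - T) z"
		using resolvent_reflect[OF Cons.hyps(1)] by simp
	have "complex_linear (resolvent (1 - z) (graph_of T))" by (rule complex_linear_resolvent[OF Cons.hyps(1)])
	then have l: "complex_linear (- res (id_blinfun - T) z)" unfolding z .
	have "resolvent_product (reflect (z # zs)) (map graph_of (T # Ts))
			= resolvent (1 - z) (graph_of T) o\<^sub>L resolvent_product (reflect zs) (map graph_of Ts)"
		by (simp add: resolvent_product_def)
	also have "... = (- 1) ^ length Ts *\<^sub>C ((- res (id_blinfun - T) z) o\<^sub>L kprod (map (%T. res (id_blinfun - T)) Ts) zs)"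
		unfolding Cons.IH z by (rule compose_scaleC_right[OF l])
	finally show ?case by (simp add: compose_minus_left scaleC_minus_left scaleC_minus_right)
qed (simp add: resolvent_product_def)

lemma map2_pair:
	assumes "length xs = length ys"
	shows "map fst (map2 (%x y. (b x, r y)) xs ys) = map b xs" "map snd (map2 (%x y. (b x, r y)) xs ys) = map r ys"
	using assms by (induction xs ys rule: list_induct2) simp_all

lemma ritt_calculus_eq:
	assumes "list_all2 (%be T. be < pi / 2 \<and> (\<exists>al<be. ritt_type al T)) bes Ts"
	shows "ritt_calculus bes Ts ph = (1 / (2 * of_real pi * \<i>)) ^ length Ts *\<^sub>C
		calc (map2 (%be T. (bcont be 1, res (id_blinfun - T))) bes Ts) (%zs. ph (reflect zs))"
proof -
	have len: "length bes = length Ts" using assms by (rule list_all2_lengthD)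
	have "iterated_integral (map (%be. path_integral {0..1} (stolz_boundary be)) bes)
			(%zs. ph zs *\<^sub>C resolvent_product zs (map graph_of Ts))
		= iter (map (%be. bcont be 1) bes) (%zs. ph (reflect zs) *\<^sub>C kprod (map (%T. res (id_blinfun - T)) Ts) zs)"
	proof (rule iterated_integral_stolz)
		fix zs assume zs: "zs \<in> loci (map (%be. bcont be 1) bes)"
		have "1 - zs ! i \<in> resolvent_set (graph_of (Ts ! i))" if i: "i < length Ts" for i
		proof -
			obtain al where al: "al < bes ! i" "bes ! i < pi / 2" "ritt_type al (Ts ! i)"
				using assms i by (auto simp: list_all2_conv_all_nth)
			have p: "0 < bes ! i" using al by (auto simp: ritt_type_def)
			obtain M where M: "reg (id_blinfun - Ts ! i) (sin (bes ! i)) 1 M" using reg_of_ritt[OF al(3,1,2)] ..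
			have l: "zs ! i \<in> locus (bcont (bes ! i) 1)"
				using zs i len by (auto simp: in_listset_iff list_all2_conv_all_nth)
			have "zs ! i \<in> resolvent_set (graph_of (id_blinfun - Ts ! i))"
				by (rule regD(1)[OF M locus_bcont(2,3)[OF p al(2) zero_less_one l]])
			then show ?thesis using resolvent_set_reflect[of "1 - zs ! i" "Ts ! i"] by simp
		qed
		then have "list_all2 (%z T. 1 - z \<in> resolvent_set (graph_of T)) zs Ts"
			using length_listset[OF zs] len by (simp add: list_all2_conv_all_nth)
		from resolvent_product_reflect[OF this]
		show "ph (reflect zs) *\<^sub>C resolvent_product (reflect zs) (map graph_of Ts)
			= (- 1) ^ length bes *\<^sub>C (ph (reflect zs) *\<^sub>C kprod (map (%T. res (id_blinfun - T)) Ts) zs)"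
			by (simp add: scaleC_scaleC mult.commute len)
	qed
	then show ?thesis unfolding ritt_calculus_def calc_def map2_pair[OF len] by simp
qed

lemma sectorial_calculus_eq:
	assumes len: "length nus = length Ss"
	shows "sectorial_calculus nus (map graph_of Ss) f = (1 / (2 * of_real pi * \<i>)) ^ length Ss *\<^sub>C
		calc (map2 (%nu S. (scont nu, res S)) nus Ss) f"
proof -
	have "map (%nu. path_integral UNIV (sector_boundary nu)) nus
			= (map cint (map scont nus) :: ((complex => ('a \<Rightarrow>\<^sub>L 'a)) => ('a \<Rightarrow>\<^sub>L 'a)) list)"
		by (simp add: fun_eq_iff path_integral_sector_boundary)
	then have "iterated_integral (map (%nu. path_integral UNIV (sector_boundary nu)) nus)
			(%zs. f zs *\<^sub>C resolvent_product zs (map graph_of Ss))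
		= iter (map scont nus) (%zs. f zs *\<^sub>C resolvent_product zs (map graph_of Ss))" by (simp only:)
	also have "... = iter (map scont nus) (%zs. f zs *\<^sub>C kprod (map (%S. res S) Ss) zs)"
	proof (rule iter_cong)
		fix zs assume "zs \<in> loci (map scont nus)"
		then have "length zs = length Ss" using length_listset len by fastforce
		then show "f zs *\<^sub>C resolvent_product zs (map graph_of Ss) = f zs *\<^sub>C kprod (map (%S. res S) Ss) zs"
			by (simp only: resolvent_product_eq)
	qed
	finally show ?thesis unfolding sectorial_calculus_def calc_def map2_pair[OF len] by simp
qed

text \<open>The type \<open>om\<close> may be smaller than the Ritt type \<open>al\<close>: the
  resolvent bound along the sector boundary comes from sectoriality for large Stolz domains, the one
  along the Stolz contour from the Ritt condition.\<close>

lemma interchangeable_sector: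
	assumes T: "ritt_type al T" and be: "al < be" "be < ga" "ga < pi / 2"
		and om: "sectorial om (graph_of (id_blinfun - T))" "om < nu" "nu < ga"
	shows "fits (sector ga) (scont nu, res (id_blinfun - T))"
		and "fits (sector ga) (bcont be 1, res (id_blinfun - T))"
		and "interchangeable (sector ga) (scont nu, res (id_blinfun - T)) (bcont be 1, res (id_blinfun - T))"
proof -
	let ?A = "id_blinfun - T"
	have p: "0 < be" "be < pi / 2" "0 < nu" "nu < pi / 2" "0 < ga" "ga \<le> pi" using T be om by (auto simp: ritt_type_def sectorial_def)
	have lin: "complex_linear ?A" using T by (intro complex_linear_diff) (auto simp: ritt_type_def)
	obtain M where M: "reg ?A (sin be) 1 M" using reg_of_ritt[OF T be(1) p(2)] ..
	obtain rh0 M' where rh0: "0 < rh0" "\<And>rh. rh \<ge> rh0 ==> reg ?A (sin nu) rh M'"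
		using reg_of_sectorial[OF om(1,2) p(4) M sin_less_one[OF p(1,2)]] by blast
	show "fits (sector ga) (scont nu, res ?A)"
		using kern_scont_res[OF p(3,4) rh0(2)[OF order_refl]] locus_scont(4)[OF _ p(3,4) om(3) be(3)] open_sector[OF p(5,6)]
		by (auto simp: fits_def)
	have "locus (bcont be 1) \<subseteq> sector ga"
		using bcont_locus_sector[OF p(1) be(2,3), of 1 1] sto_subset_sector[OF p(5) be(3), of 1] by auto
	then show "fits (sector ga) (bcont be 1, res ?A)"
		using kern_bcont_res[OF p(1,2) _ M] open_sector[OF p(5,6)] by (auto simp: fits_def)
	show "interchangeable (sector ga) (scont nu, res ?A) (bcont be 1, res ?A)"
		unfolding interchangeable_def fst_conv snd_conv
		by (intro allI impI; rule cint_scont[OF lin p(3) om(3) be(3) rh0 p(1) be(2) zero_less_one M]; blast)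
qed

text \<open>Relates an arbitrary admissible angle \<open>be'\<close>, possibly with another type
  \<open>al'\<close>, to the fixed angle \<open>be\<close> and the kernel
  \<open>qop\<close>.\<close>

lemma interchangeable_stolz:
	assumes T: "ritt_type al T" and be: "al < be" "be < ga" "ga < pi / 2"
		and T': "ritt_type al' T" and be': "al' < be'" "be' < ga"
	shows "fits (sto (sin ga) 1) (bcont be' 1, res (id_blinfun - T))"
		and "fits (sto (sin ga) 1) (bcont be 1, qop (id_blinfun - T))"
		and "interchangeable (sto (sin ga) 1) (bcont be' 1, res (id_blinfun - T)) (bcont be 1, qop (id_blinfun - T))"
proof -
	let ?A = "id_blinfun - T"
	have p: "0 < be" "be < pi / 2" "0 < be'" "be' < pi / 2" "0 < al" "0 < ga" using T T' be be' by (auto simp: ritt_type_def)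
	have lin: "complex_linear ?A" using T by (intro complex_linear_diff) (auto simp: ritt_type_def)
	\<comment> \<open>The passage from the resolvent to \<open>qop\<close> goes to a strictly larger
	  angle; so \<open>be'\<close> is first exchanged for some \<open>be1\<close> below
	  \<open>be\<close>.\<close>
	obtain be1 where be1: "al < be1" "be1 < be" using dense be(1) by blast
	obtain M1 where M1: "reg ?A (sin be1) 1 M1" using reg_of_ritt[OF T be1(1)] be1 p by auto
	obtain M where M: "reg ?A (sin be) 1 M" using reg_of_ritt[OF T be(1) p(2)] ..
	obtain M' where M': "reg ?A (sin be') 1 M'" using reg_of_ritt[OF T' be'(1) p(4)] ..
	show "fits (sto (sin ga) 1) (bcont be' 1, res ?A)"
		using kern_bcont_res[OF p(3,4) _ M'] bcont_locus_sector[OF p(3) be'(2) be(3), of 1 1] open_sto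
		by (auto simp: fits_def)
	have "kern (2 * M) (bcont be 1) (qop ?A)"
		using locus_bcont(2)[OF p(1,2), of 1] sin_less_one[OF p(1,2)] contour_bcont[OF p(1,2), of 1]
		by (intro kern_qop[OF _ M]) auto
	then show "fits (sto (sin ga) 1) (bcont be 1, qop ?A)"
		using bcont_locus_sector[OF p(1) be(2,3), of 1 1] open_sto by (auto simp: fits_def)
	show "interchangeable (sto (sin ga) 1) (bcont be' 1, res ?A) (bcont be 1, qop ?A)"
		unfolding interchangeable_def fst_conv snd_conv
	proof (intro allI impI)
		fix h :: "complex => complex" and s C
		assume h: "h holomorphic_on sto (sin ga) 1" and s: "0 < s" and C: "0 \<le> C"
			and le: "\<forall>z\<in>sto (sin ga) 1. cmod (h z) \<le> C * W s z"
		have le1: "cmod (h z) \<le> C * cmod z powr min s 1" if "z \<in> sto (sin ga) 1" for z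
		proof -
			have "W s z \<le> cmod z powr min s 1" using W_antimono[of "min s 1" s z] W_le_powr[of z "min s 1"] s by auto
			then show ?thesis using le that C mult_left_mono order_trans by blast
		qed
		have sn: "sin be < sin ga" "sin ga < 1" using p be by (auto intro!: sin_monotone_2pi sin_less_one)
		have "cint (bcont be' 1) (%z. h z *\<^sub>C res ?A z) = cint (bcont be1 1) (%z. h z *\<^sub>C res ?A z)"
			by (rule bcont_independent[OF lin _ _ _ _ _ _ _ _ _ M' M1 h _ _ C le1]) (use p be be' be1 s in auto)
		also have "... = cint (bcont be 1) (%mu. h mu *\<^sub>C qop ?A mu)"
			by (rule cint_contour_change[OF lin _ _ _ _ _ M1 sn h _ _ C le1])
				(use p be be1 s stc_subset_sto[OF sn(1), of 1 1] in auto)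
		finally show "cint (bcont be' 1) (%z. h z *\<^sub>C res ?A z) = cint (bcont be 1) (%mu. h mu *\<^sub>C qop ?A mu)" .
	qed
qed

lemma norm_two_pi_i_power_le:
	fixes x :: "'b::complex_normed_vector"
	shows "norm ((1 / (2 * of_real pi * \<i>)) ^ m *\<^sub>C x) \<le> norm x"
proof -
	have "cmod (1 / (2 * of_real pi * \<i>)) \<le> 1" using pi_ge_two by (simp add: norm_divide norm_mult)
	then have "cmod ((1 / (2 * of_real pi * \<i>)) ^ m) \<le> 1" unfolding norm_power by (intro power_le_one) auto
	then have "cmod ((1 / (2 * of_real pi * \<i>)) ^ m) * norm x \<le> 1 * norm x" by (rule mult_right_mono) simp
	then show ?thesis by (simp add: norm_scaleC)
qed

lemma two_pi_i_power_inverse: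
	fixes x :: "'b::complex_normed_vector"
	shows "x = (2 * of_real pi * \<i>) ^ m *\<^sub>C (1 / (2 * of_real pi * \<i>)) ^ m *\<^sub>C x"
proof -
	have "(2 * of_real pi * \<i>) * (1 / (2 * of_real pi * \<i>)) = 1" by simp
	then show ?thesis unfolding scaleC_scaleC power_mult_distrib[symmetric] by simp
qed

section \<open>The two implications\<close>

lemma commuting_resolvents_of_commuting:
	assumes "\<forall>i\<in>set js. ritt (T i)" "\<forall>i\<in>set js. \<forall>j\<in>set js. T i o\<^sub>L T j = T j o\<^sub>L T i"
	shows "commuting_resolvents (map (%i. graph_of (id_blinfun - T i)) js)"
proof -
	have "resolvent z (graph_of (id_blinfun - T i)) o\<^sub>L resolvent w (graph_of (id_blinfun - T j))
			= resolvent w (graph_of (id_blinfun - T j)) o\<^sub>L resolvent z (graph_of (id_blinfun - T i))"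
		if "i \<in> set js" "j \<in> set js" "z \<in> resolvent_set (graph_of (id_blinfun - T i))"
			"w \<in> resolvent_set (graph_of (id_blinfun - T j))" for i j z w using assms that
		by (intro resolvents_commute compose_reflect_commute complex_linear_diff) (auto simp: ritt_def ritt_type_def)
	then show ?thesis unfolding commuting_resolvents_def by auto
qed

text \<open>After the exchange of contours the sectorial calculus of f is the Ritt calculus of its
  restriction, reflected to the Stolz domains. The supremum over the smaller set is at most the one
  over the sectors.\<close>

lemma sectorial_calculus_of_ritt_calculus:
	fixes T :: "nat => ('a::complex_banach \<Rightarrow>\<^sub>L 'a)"
	assumes ga: "\<forall>i\<in>set js. 0 < ga i \<and> ga i < pi / 2"
		and T: "\<forall>i\<in>set js. ritt (T i)" "\<forall>i\<in>set js. \<forall>j\<in>set js. T i o\<^sub>L T j = T j o\<^sub>L T i"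
		and bc: "ritt_joint_bounded_calculus (map ga js) (map T js)"
	shows "sectorial_joint_bounded_calculus (map ga js) (map (%i. graph_of (id_blinfun - T i)) js)"
proof -
	let ?A = "%i. id_blinfun - T i"
	have "\<forall>i\<in>set js. \<exists>al<ga i. ritt_type al (T i)"
		using bc unfolding ritt_joint_bounded_calculus_def by (auto simp: list_all2_conv_all_nth in_set_conv_nth)
	then obtain al where al: "\<And>i. i \<in> set js ==> al i < ga i \<and> ritt_type (al i) (T i)" by metis
	\<comment> \<open>One admissible angle for the Ritt calculus; all admissible sectorial angles are
	  compared with it.\<close>
	define be where "be i = (al i + ga i) / 2" for i
	have be: "al i < be i" "be i < ga i" if "i \<in> set js" for i using al[OF that] by (auto simp: be_def)
	obtain C where C: "C > 0" "\<And>ph bes. ph \<in> H0_stolz (map ga js) ==> list_all2 (<) bes (map ga js) ==>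
			list_all2 (%be T. \<exists>al<be. ritt_type al T) bes (map T js) ==>
			norm (ritt_calculus bes (map T js) ph) \<le> C * sup_norm (listset (map stolz (map ga js))) ph"
		using bc unfolding ritt_joint_bounded_calculus_def by blast
	have gas: "\<forall>ga\<in>set (map ga js). 0 < ga \<and> ga < pi / 2" using ga by auto
	have gr: "map (%i. graph_of (?A i)) js = map graph_of (map ?A js)" by simp
	have bound: "norm (sectorial_calculus nus (map (%i. graph_of (?A i)) js) f)
			\<le> C * sup_norm (listset (map sector (map ga js))) f"
		if f: "f \<in> H0_sector (map ga js)" and nus: "list_all2 (<) nus (map ga js)"
			and sec: "list_all2 (%nu A. \<exists>om<nu. sectorial om A) nus (map (%i. graph_of (?A i)) js)" for f nus
	proof -
		let ?ph = "%zs. f (reflect zs)"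
		obtain s C0 where d: "decays s C0 (map sector (map ga js)) f" using decays_of_H0_sector(1)[OF f] by blast
		have len: "length nus = length js" using list_all2_lengthD[OF nus] by simp
		define ts where "ts = map2 (%nu i. (sector (ga i), (scont nu, res (?A i)), (bcont (be i) 1, res (?A i)))) nus js"
		have ts: "map fst ts = map sector (map ga js)"
			"map (fst \<circ> snd) ts = map2 (%nu S. (scont nu, res S)) nus (map ?A js)"
			"map (snd \<circ> snd) ts = map2 (%be T. (bcont be 1, res (id_blinfun - T))) (map be js) (map T js)"
			using len unfolding ts_def by (induction nus js rule: list_induct2) simp_all
		have "calc (map (fst \<circ> snd) ts) f = calc (map (snd \<circ> snd) ts) f"
		proof (rule calc_interchange)
			show "decays s C0 (map fst ts) f" using d by (simp only: ts)
			show "\<forall>(D, v, v')\<in>set ts. fits D v \<and> fits D v' \<and> interchangeable D v v'"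
			proof (clarsimp simp: ts_def set_zip simp del: fst_conv snd_conv)
				fix k assume k: "k < length nus" "k < length js"
				then have i: "js ! k \<in> set js" by simp
				have "nus ! k < ga (js ! k)" using list_all2_nthD[OF nus, of k] k by simp
				moreover obtain om where "om < nus ! k" "sectorial om (graph_of (?A (js ! k)))"
					using list_all2_nthD[OF sec, of k] k by auto
				ultimately show "fits (sector (ga (js ! k))) (scont (nus ! k), res (?A (js ! k))) \<and>
						fits (sector (ga (js ! k))) (bcont (be (js ! k)) 1, res (?A (js ! k))) \<and>
						interchangeable (sector (ga (js ! k))) (scont (nus ! k), res (?A (js ! k))) (bcont (be (js ! k)) 1, res (?A (js ! k)))"
					using interchangeable_sector[of "al (js ! k)" "T (js ! k)" "be (js ! k)" "ga (js ! k)" om "nus ! k"]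
						al[OF i] be[OF i] ga i by auto
			qed
		qed
		then have "sectorial_calculus nus (map (%i. graph_of (?A i)) js) f = ritt_calculus (map be js) (map T js) ?ph"
		proof -
			have l: "list_all2 (%be T. be < pi / 2 \<and> (\<exists>al<be. ritt_type al T)) (map be js) (map T js)"
				using al be ga by (force simp: list_all2_map1 list_all2_map2 intro!: list.rel_refl_strong)
			assume "calc (map (fst \<circ> snd) ts) f = calc (map (snd \<circ> snd) ts) f"
			moreover have "(%zs. f (reflect (reflect zs))) = f" by (simp add: o_def)
			ultimately show ?thesis
				unfolding gr ritt_calculus_eq[OF l] using sectorial_calculus_eq[of nus "map ?A js" f] len by (simp only: ts length_map)
		qed
		also have "norm ... \<le> C * sup_norm (listset (map stolz (map ga js))) ?ph"
			using al be by (intro C(2) H0_stolz_of_decays[OF d gas])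
				(force simp: list_all2_map1 list_all2_map2 intro!: list.rel_refl_strong)+
		also have "... \<le> C * sup_norm (listset (map sector (map ga js))) f"
		proof (intro mult_left_mono sup_norm_le)
			show "listset (map stolz (map ga js)) ~= {}" using ga stolz_nonempty by (intro listset_nonempty) auto
			show "cmod (f (reflect zs)) \<le> sup_norm (listset (map sector (map ga js))) f"
				if "zs \<in> listset (map stolz (map ga js))" for zs
				by (rule norm_le_sup_norm[OF decays_of_H0_sector(2)[OF f] reflect_in_listset[OF that maps_into_stolz(2)[OF gas]]])
		qed (use C in simp)
		finally show ?thesis .
	qed
	have "list_all2 (%th A. th < pi \<and> (\<exists>om<th. sectorial om A)) (map ga js) (map (%i. graph_of (?A i)) js)"
	proof -
		have "ga i < pi \<and> (\<exists>om<ga i. sectorial om (graph_of (?A i)))" if "i \<in> set js" for i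
			using ga that al[OF that] sectorial_of_ritt[of "al i" "T i"] pi_gt_zero by auto
		then show ?thesis by (auto simp: list_all2_map1 list_all2_map2 intro!: list.rel_refl_strong)
	qed
	then show ?thesis unfolding sectorial_joint_bounded_calculus_def
		using commuting_resolvents_of_commuting[OF T] C(1) bound by blast
qed

text \<open>Removes the normalizing factor from the hypothesis and adds the empty tuple, which the
  induction on Stolz variables reaches; there the calculus is \<open>f []\<close> times the
  identity.\<close>

lemma norm_calc_sector_le:
	fixes T :: "nat => ('a::complex_banach \<Rightarrow>\<^sub>L 'a)"
	assumes th: "\<forall>i\<in>set js. 0 < th i \<and> th i < pi"
		and nu: "\<forall>i\<in>set js. nu i < th i \<and> (\<exists>om<nu i. sectorial om (graph_of (id_blinfun - T i)))"
		and bc: "js ~= [] ==> sectorial_joint_bounded_calculus (map th js) (map (%i. graph_of (id_blinfun - T i)) js)"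
	shows "\<exists>C\<ge>0. \<forall>f s C0 B. decays s C0 (map (%i. sector (th i)) js) f --> 0 \<le> B -->
		(\<forall>zs\<in>listset (map (%i. sector (th i)) js). cmod (f zs) \<le> B) -->
		norm (calc (map (%i. (scont (nu i), res (id_blinfun - T i))) js) f) \<le> C * B"
proof (cases "js = []")
	case True
	have "norm (f [] *\<^sub>C (id_blinfun :: 'a \<Rightarrow>\<^sub>L 'a)) \<le> 1 * B" if "cmod (f []) \<le> B" for f :: "complex list => complex" and B
		unfolding norm_scaleC using that norm_id_blinfun_le order_trans[OF norm_ge_zero that]
			mult_mono[OF that norm_id_blinfun_le] by simp
	then show ?thesis unfolding True by (intro exI[of _ 1]) (simp add: calc_def)
next
	case False
	let ?A = "%i. id_blinfun - T i"
	obtain C where C: "C > 0" "\<And>f nus. f \<in> H0_sector (map th js) ==> list_all2 (<) nus (map th js) ==>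
			list_all2 (%nu A. \<exists>om<nu. sectorial om A) nus (map (%i. graph_of (?A i)) js) ==>
			norm (sectorial_calculus nus (map (%i. graph_of (?A i)) js) f) \<le> C * sup_norm (listset (map sector (map th js))) f"
		using bc[OF False] unfolding sectorial_joint_bounded_calculus_def by blast
	let ?c = "cmod (2 * of_real pi * \<i>) ^ length js"
	have m: "map (%i. sector (th i)) js = map sector (map th js)" by simp
	have gr: "map (%i. graph_of (?A i)) js = map graph_of (map ?A js)" by simp
	have "norm (calc (map (%i. (scont (nu i), res (?A i))) js) f) \<le> ?c * C * B"
		if d: "decays s C0 (map sector (map th js)) f" and B: "\<forall>zs\<in>listset (map sector (map th js)). cmod (f zs) \<le> B" for f s C0 B
	proof -
		have sc: "sectorial_calculus (map nu js) (map (%i. graph_of (?A i)) js) f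
				= (1 / (2 * of_real pi * \<i>)) ^ length js *\<^sub>C calc (map (%i. (scont (nu i), res (?A i))) js) f"
			unfolding gr using sectorial_calculus_eq[of "map nu js" "map ?A js" f] by (simp only: map2_map_map length_map)
		have "norm (sectorial_calculus (map nu js) (map (%i. graph_of (?A i)) js) f)
				\<le> C * sup_norm (listset (map sector (map th js))) f" using th nu by (intro C(2) H0_sector_of_decays[OF d])
				(auto simp: list_all2_map1 list_all2_map2 intro!: list.rel_refl_strong)
		also have "... \<le> C * B"
			using C(1) B th sector_nonempty by (intro mult_left_mono sup_norm_le listset_nonempty) auto
		finally have le: "norm (sectorial_calculus (map nu js) (map (%i. graph_of (?A i)) js) f) \<le> C * B" .
		have "norm (calc (map (%i. (scont (nu i), res (?A i))) js) f)
				= norm ((2 * of_real pi * \<i>) ^ length js *\<^sub>C sectorial_calculus (map nu js) (map (%i. graph_of (?A i)) js) f)"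
			unfolding sc by (subst two_pi_i_power_inverse[of _ "length js"]) (rule refl)
		also have "... = ?c * norm (sectorial_calculus (map nu js) (map (%i. graph_of (?A i)) js) f)"
			by (simp only: norm_scaleC norm_power)
		also have "... \<le> ?c * (C * B)" using le by (rule mult_left_mono) simp
		finally show ?thesis by (simp only: mult.assoc)
	qed
	then show ?thesis unfolding m using C(1) by (intro exI[of _ "?c * C"]) auto
qed

lemma ritt_calculus_of_sectorial_calculus:
	fixes T :: "nat => ('a::complex_banach \<Rightarrow>\<^sub>L 'a)"
	assumes T: "\<forall>i\<in>I. ritt (T i)" "\<forall>i\<in>I. \<forall>j\<in>I. T i o\<^sub>L T j = T j o\<^sub>L T i" and th: "\<forall>i\<in>I. 0 < th i \<and> th i < pi / 2"
		and bc: "\<And>js. js ~= [] ==> set js \<subseteq> I ==> sorted_wrt (<) js ==>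
			sectorial_joint_bounded_calculus (map th js) (map (%i. graph_of (id_blinfun - T i)) js)"
	shows "\<exists>ga. (\<forall>i\<in>I. 0 < ga i \<and> ga i < pi / 2) \<and>
		(\<forall>js. set js \<subseteq> I \<and> sorted_wrt (<) js --> ritt_joint_bounded_calculus (map ga js) (map T js))"
proof -
	let ?A = "%i. id_blinfun - T i"
	have "\<forall>i\<in>I. \<exists>al. ritt_type al (T i)" using T(1) by (simp add: ritt_def)
	then obtain al where al: "\<And>i. i \<in> I ==> ritt_type (al i) (T i)" by metis
	have "\<forall>i\<in>I. \<exists>om. om < th i \<and> sectorial om (graph_of (?A i))"
	proof
		fix i assume "i \<in> I"
		then show "\<exists>om. om < th i \<and> sectorial om (graph_of (?A i))"
			using bc[of "[i]"] by (auto simp: sectorial_joint_bounded_calculus_def)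
	qed
	then obtain om where om: "\<And>i. i \<in> I ==> om i < th i \<and> sectorial (om i) (graph_of (?A i))" by metis
	define nu where "nu i = (om i + th i) / 2" for i
	\<comment> \<open>Midpoints, so that \<open>be\<close> and \<open>ga\<close> exceed both the
	  sectorial angle \<open>th\<close>, as the transport of functions demands, and the Ritt type
	  \<open>al\<close>, as the resolvent estimates demand, while staying below pi / 2.\<close>
	define ga where "ga i = (max (th i) (al i) + pi / 2) / 2" for i
	define be where "be i = (max (th i) (al i) + ga i) / 2" for i
	have ang: "0 < om i" "om i < nu i" "nu i < th i" "th i < be i" "al i < be i" "be i < ga i" "ga i < pi / 2" "0 < al i"
		if "i \<in> I" for i
	proof -
		have *: "0 < al i" "al i < pi / 2" "0 < om i" "om i < th i" "th i < pi / 2"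
			using al[OF that] om[OF that] th that by (auto simp: ritt_type_def sectorial_def)
		have "th i \<le> max (th i) (al i)" "al i \<le> max (th i) (al i)" "max (th i) (al i) < pi / 2" using * by auto
		with * show "0 < om i" "om i < nu i" "nu i < th i" "th i < be i" "al i < be i" "be i < ga i" "ga i < pi / 2" "0 < al i"
			unfolding nu_def be_def ga_def by argo+
	qed
	have "\<forall>i\<in>I. \<exists>N. reg (?A i) (sin (be i)) 1 N" using reg_of_ritt[OF al] ang by (meson less_trans)
	then obtain N where N: "\<And>i. i \<in> I ==> reg (?A i) (sin (be i)) 1 (N i)" by metis
	have "\<forall>i\<in>I. \<exists>rh0 M. 0 < rh0 \<and> (\<forall>rh\<ge>rh0. reg (?A i) (sin (nu i)) rh M)"
	proof
		fix i assume i: "i \<in> I"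
		have "nu i < pi / 2" "sin (be i) < 1" using ang[OF i] by (auto intro!: sin_less_one)
		then show "\<exists>rh0 M. 0 < rh0 \<and> (\<forall>rh\<ge>rh0. reg (?A i) (sin (nu i)) rh M)"
			using reg_of_sectorial[of "om i" "?A i" "nu i" "sin (be i)" "N i"] om[OF i] ang(2)[OF i] N[OF i] by blast
	qed
	then obtain rh0 M where rh0: "\<And>i. i \<in> I ==> 0 < rh0 i"
			"\<And>i rh. i \<in> I ==> rh \<ge> rh0 i ==> reg (?A i) (sin (nu i)) rh (M i)" by metis
	have "ritt_joint_bounded_calculus (map ga js) (map T js)" if js: "set js \<subseteq> I" "sorted_wrt (<) js" for js
	proof -
		let ?S = "%i. sto (sin (ga i)) 1"
		have gas: "\<forall>ga\<in>set (map ga js). 0 < ga \<and> ga < pi / 2" using ang js(1) by force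
		have "\<exists>C\<ge>0. \<forall>f s C0 B. decays s C0 (map ?S js @ map (%i. sector (th i)) []) f --> 0 \<le> B -->
			(\<forall>zs\<in>listset (map ?S js @ map (%i. sector (th i)) []). cmod (f zs) \<le> B) -->
			norm (calc (map (%i. (bcont (be i) 1, qop (?A i))) js @ map (%i. (scont (nu i), res (?A i))) []) f) \<le> C * B"
		proof (rule norm_calc_mixed_le[where I = I and M = M and N = N and ?rh0.0 = rh0])
			show "complex_linear (?A i)" if "i \<in> I" for i
				using al[OF that] by (intro complex_linear_diff) (auto simp: ritt_type_def)
			show "0 < nu i \<and> nu i < th i \<and> th i < be i \<and> be i < ga i \<and> ga i < pi / 2" if "i \<in> I" for i
				using ang[OF that] by auto
			show "?A i o\<^sub>L ?A j = ?A j o\<^sub>L ?A i" if "i \<in> I" "j \<in> I" for i j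
				using T(2) that by (intro compose_reflect_commute) auto
			show "\<exists>C\<ge>0. \<forall>f s C0 B. decays s C0 (map (%i. sector (th i)) js) f --> 0 \<le> B -->
					(\<forall>zs\<in>listset (map (%i. sector (th i)) js). cmod (f zs) \<le> B) -->
					norm (calc (map (%i. (scont (nu i), res (?A i))) js) f) \<le> C * B"
				if "set js \<subseteq> I" "sorted_wrt (<) js" for js
				by (rule norm_calc_sector_le[OF _ _ bc]) (use that th om ang pi_gt_zero in \<open>force+\<close>)
		qed (use N rh0 js in auto)
		then obtain C where C: "0 \<le> C" "\<And>f s C0 B. decays s C0 (map ?S js) f ==> 0 \<le> B ==>
			\<forall>zs\<in>listset (map ?S js). cmod (f zs) \<le> B ==> norm (calc (map (%i. (bcont (be i) 1, qop (?A i))) js) f) \<le> C * B"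
			unfolding list.map append_Nil2 by (elim exE conjE) (rule that; blast)
		\<comment> \<open>C + 1 replaces \<open>C\<close> because the calculus asks for a strictly
		  positive constant. The angles \<open>bes\<close> are arbitrary; they are exchanged for the fixed
		  angles \<open>be i\<close> with kernels \<open>qop\<close>, for which \<open>C\<close> is
		  valid.\<close>
		have bound: "norm (ritt_calculus bes (map T js) ph) \<le> (C + 1) * sup_norm (listset (map stolz (map ga js))) ph"
			if ph: "ph \<in> H0_stolz (map ga js)" and bes: "list_all2 (<) bes (map ga js)"
				and rt: "list_all2 (%be T. \<exists>al<be. ritt_type al T) bes (map T js)" for ph bes
		proof -
			let ?f = "%zs. ph (reflect zs)" and ?B = "sup_norm (listset (map stolz (map ga js))) ph"
			have m: "map (%ga. sto (sin ga) 1) (map ga js) = map ?S js" by simp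
			obtain s C0 where d: "decays s C0 (map ?S js) ?f"
				using decays_of_H0_stolz(1)[OF ph gas] unfolding m by blast
			have len: "length bes = length js" using list_all2_lengthD[OF bes] by simp
			define ts where "ts = map2 (%be' i. (?S i, (bcont be' 1, res (?A i)), (bcont (be i) 1, qop (?A i)))) bes js"
			have ts: "map fst ts = map ?S js"
				"map (fst \<circ> snd) ts = map2 (%be T. (bcont be 1, res (id_blinfun - T))) bes (map T js)"
				"map (snd \<circ> snd) ts = map (%i. (bcont (be i) 1, qop (?A i))) js"
				using len unfolding ts_def by (induction bes js rule: list_induct2) simp_all
			have e: "calc (map (fst \<circ> snd) ts) ?f = calc (map (snd \<circ> snd) ts) ?f"
			proof (rule calc_interchange)
				show "decays s C0 (map fst ts) ?f" using d by (simp only: ts)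
				show "\<forall>(D, v, v')\<in>set ts. fits D v \<and> fits D v' \<and> interchangeable D v v'"
				proof (clarsimp simp: ts_def set_zip simp del: fst_conv snd_conv)
					fix k assume k: "k < length bes" "k < length js"
					then have i: "js ! k \<in> I" using js(1) nth_mem by blast
					have "bes ! k < ga (js ! k)" using list_all2_nthD[OF bes, of k] k by simp
					moreover obtain al' where "al' < bes ! k" "ritt_type al' (T (js ! k))"
						using list_all2_nthD[OF rt, of k] k by auto
					ultimately show "fits (?S (js ! k)) (bcont (bes ! k) 1, res (?A (js ! k))) \<and>
							fits (?S (js ! k)) (bcont (be (js ! k)) 1, qop (?A (js ! k))) \<and>
							interchangeable (?S (js ! k)) (bcont (bes ! k) 1, res (?A (js ! k))) (bcont (be (js ! k)) 1, qop (?A (js ! k)))"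
						using interchangeable_stolz[of "al (js ! k)" "T (js ! k)" "be (js ! k)" "ga (js ! k)" al' "bes ! k"]
							al[OF i] ang[OF i] by blast
				qed
			qed
			have l: "list_all2 (%be T. be < pi / 2 \<and> (\<exists>al<be. ritt_type al T)) bes (map T js)"
				unfolding list_all2_conv_all_nth
			proof (intro conjI allI impI)
				fix k assume k: "k < length bes"
				have "bes ! k < ga (js ! k)" using list_all2_nthD[OF bes, of k] k len by simp
				moreover have "ga (js ! k) < pi / 2" using k len js(1) nth_mem ang(7) by force
				ultimately show "bes ! k < pi / 2" by linarith
				show "\<exists>al<bes ! k. ritt_type al (map T js ! k)" using list_all2_nthD[OF rt, of k] k len by simp
			qed (simp add: len)
			have ub: "cmod (ph zs) \<le> ?B" if "zs \<in> listset (map stolz (map ga js))" for zs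
				by (rule norm_le_sup_norm[OF decays_of_H0_stolz(2)[OF ph gas] that])
			obtain z0 where "z0 \<in> listset (map stolz (map ga js))"
				using listset_nonempty[of "map stolz (map ga js)"] gas stolz_nonempty by auto
			then have B: "0 \<le> ?B" using ub norm_ge_zero order_trans by blast
			have "norm (ritt_calculus bes (map T js) ph) \<le> norm (calc (map (%i. (bcont (be i) 1, qop (?A i))) js) ?f)"
				unfolding ritt_calculus_eq[OF l] using e norm_two_pi_i_power_le by (simp only: ts)
			also have "... \<le> C * ?B"
			proof (rule C(2)[OF d B])
				show "\<forall>zs\<in>listset (map ?S js). cmod (ph (reflect zs)) \<le> ?B"
					using ub reflect_in_listset maps_into_stolz(1)[OF gas] unfolding m by blast
			qed
			also have "... \<le> (C + 1) * ?B" using B by (simp add: distrib_right)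
			finally show ?thesis .
		qed
		have "commuting (map T js)" using T(2) js(1) by (auto simp: commuting_def)
		moreover have "list_all2 (%ga T. ga < pi / 2 \<and> (\<exists>al<ga. ritt_type al T)) (map ga js) (map T js)"
		proof -
			have "ga i < pi / 2 \<and> (\<exists>al<ga i. ritt_type al (T i))" if "i \<in> set js" for i
				using ang[of i] al[of i] js(1) that by (meson less_trans subsetD)
			then show ?thesis by (auto simp: list_all2_map1 list_all2_map2 intro!: list.rel_refl_strong)
		qed
		moreover have "0 < C + 1" using C(1) by simp
		ultimately show ?thesis unfolding ritt_joint_bounded_calculus_def using bound by blast
	qed
	moreover have "\<forall>i\<in>I. 0 < ga i \<and> ga i < pi / 2" using ang by force
	ultimately show ?thesis by blast
qed

theorem theorem2p5:
  fixes T :: "nat \<Rightarrow> ('a::complex_banach \<Rightarrow>\<^sub>L 'a)" and n :: nat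
  assumes "\<forall>i\<in>{1..n}. ritt (T i)"
    and "\<forall>i\<in>{1..n}. \<forall>j\<in>{1..n}. T i o\<^sub>L T j = T j o\<^sub>L T i"
  shows "(\<exists>\<gamma>. (\<forall>i\<in>{1..n}. 0 < \<gamma> i \<and> \<gamma> i < pi / 2) \<and>
            (\<forall>js. js \<noteq> [] \<and> set js \<subseteq> {1..n} \<and> sorted_wrt (<) js \<longrightarrow>
               ritt_joint_bounded_calculus (map \<gamma> js) (map T js))) \<longleftrightarrow>
         (\<exists>\<theta>. (\<forall>i\<in>{1..n}. 0 < \<theta> i \<and> \<theta> i < pi / 2) \<and>
            (\<forall>js. js \<noteq> [] \<and> set js \<subseteq> {1..n} \<and> sorted_wrt (<) js \<longrightarrow>
               sectorial_joint_bounded_calculus (map \<theta> js)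
                 (map (\<lambda>i. graph_of (id_blinfun - T i)) js)))"
proof (rule iffI; elim exE conjE)
  fix \<gamma> :: "nat \<Rightarrow> real"
  assume \<gamma>: "\<forall>i\<in>{1..n}. 0 < \<gamma> i \<and> \<gamma> i < pi / 2"
    and bc: "\<forall>js. js \<noteq> [] \<and> set js \<subseteq> {1..n} \<and> sorted_wrt (<) js \<longrightarrow>
      ritt_joint_bounded_calculus (map \<gamma> js) (map T js)"
  have "sectorial_joint_bounded_calculus (map \<gamma> js) (map (\<lambda>i. graph_of (id_blinfun - T i)) js)"
    if "js \<noteq> [] \<and> set js \<subseteq> {1..n} \<and> sorted_wrt (<) js" for js
    using that \<gamma> assms by (intro sectorial_calculus_of_ritt_calculus bc[rule_format]) blast+
  then show "\<exists>\<theta>. (\<forall>i\<in>{1..n}. 0 < \<theta> i \<and> \<theta> i < pi / 2) \<and>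
      (\<forall>js. js \<noteq> [] \<and> set js \<subseteq> {1..n} \<and> sorted_wrt (<) js \<longrightarrow>
        sectorial_joint_bounded_calculus (map \<theta> js) (map (\<lambda>i. graph_of (id_blinfun - T i)) js))"
    using \<gamma> by blast
next
  fix \<theta> :: "nat \<Rightarrow> real"
  assume \<theta>: "\<forall>i\<in>{1..n}. 0 < \<theta> i \<and> \<theta> i < pi / 2"
    and bc: "\<forall>js. js \<noteq> [] \<and> set js \<subseteq> {1..n} \<and> sorted_wrt (<) js \<longrightarrow>
      sectorial_joint_bounded_calculus (map \<theta> js) (map (\<lambda>i. graph_of (id_blinfun - T i)) js)"
  show "\<exists>\<gamma>. (\<forall>i\<in>{1..n}. 0 < \<gamma> i \<and> \<gamma> i < pi / 2) \<and>
      (\<forall>js. js \<noteq> [] \<and> set js \<subseteq> {1..n} \<and> sorted_wrt (<) js \<longrightarrow>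
        ritt_joint_bounded_calculus (map \<gamma> js) (map T js))"
    using ritt_calculus_of_sectorial_calculus[OF assms \<theta> bc[rule_format, OF conjI, OF _ conjI]] by blast
qed

end
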